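(* Let $m\in\mathbb N$, $0<\delta_0<1$, $A>0$ and $0<\delta<\sqrt{\delta_0/(2-\delta_0)}$. For $t_1,t_2\in\mathbb C$ with $2|t_2|<1$ let $K_n$ be the normalized reproducing kernel and $R_n^{(m)}$ the $m$-point correlation function for the potential $V(z)=|z|^2-2\,\mathrm{Re}(t_1z+t_2z^2)$. Put $\theta_{n,t_2}(z_0,a,b)=\sqrt n\,\mathrm{Im}\left((\overline a-\overline b)(z_0-2\overline{t_2}\,\overline{z_0})\right)+\mathrm{Im}\left(\overline ab+t_2(a^2-b^2)\right)$. In each line below, $\sup_{t}$ denotes the supremum over all $t_1\in\mathbb C$ and all $t_2\in\mathbb C$ with $0\le2|t_2|\le1-\delta_0$. Then, for the kernel, $$\lim_{n\to\infty}\sup_{t}\sup_{\substack{z_0\in E_{1,t_1,t_2,-\delta} \\ a,b\in\overline B_A(0)}}\left|\tfrac1nK_n\left(z_0+\tfrac a{\sqrt n},z_0+\tfrac b{\sqrt n}\right)-\tfrac1\pi e^{i\theta_{n,t_2}(z_0-v,a,b)}e^{-\frac{|a-b|^2}2}\right|=0,$$ $$\lim_{n\to\infty}\sup_{t}\sup_{\substack{z_0\in\mathbb C\setminus E_{1,t_1,t_2,+\delta} \\ a,b\in\overline B_A(0)}}\left|\tfrac1nK_n\left(z_0+\tfrac a{\sqrt n},z_0+\tfrac b{\sqrt n}\right)\right|=0,$$ $$\lim_{n\to\infty}\sup_{t}\sup_{\substack{z_0\in\partial E_{1,t_1,t_2} \\ a,b\in\overline B_A(0)}}\left|\tfrac1nK_n\left(z_0+\tfrac{ae^{i\psi(z_0)}}{\sqrt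 n},z_0+\tfrac{be^{i\psi(z_0)}}{\sqrt n}\right)-e^{i\theta_{n,t_2}(z_0-v,ae^{i\psi(z_0)},be^{i\psi(z_0)})}e^{-\frac{|a-b|^2}2}\,\tfrac1{2\pi}\mathrm{erfc}\left(\tfrac{\overline a+b}{\sqrt2}\right)\right|=0,$$ and, for the correlation functions, $$\lim_{n\to\infty}\sup_{t}\sup_{\substack{z_0\in E_{1,t_1,t_2,-\delta} \\ a_1,\dots,a_m\in\overline B_A(0)}}\left|\tfrac1{n^m}R_n^{(m)}\left(z_0+\tfrac{a_1}{\sqrt n},\dots,z_0+\tfrac{a_m}{\sqrt n}\right)-\det\left(\tfrac1\pi e^{-\frac12|a_k-a_l|^2+i\,\mathrm{Im}(\overline{a_k}a_l)}\right)_{k,l=1}^m\right|=0,$$ $$\lim_{n\to\infty}\sup_{t}\sup_{\substack{z_0\in\mathbb C\setminus E_{1,t_1,t_2,+\delta} \\ a_1,\dots,a_m\in\overline B_A(0)}}\left|\tfrac1{n^m}R_n^{(m)}\left(z_0+\tfrac{a_1}{\sqrt n},\dots,z_0+\tfrac{a_m}{\sqrt n}\right)\right|=0,$$ $$\lim_{n\to\infty}\sup_{t}\sup_{\substack{z_0\in\partial E_{1,t_1,t_2} \\ a_1,\dots,a_m\in\overline B_A(0)}}\left|\tfrac1{n^m}R_n^{(m)}\left(z_0+\tfrac{a_1e^{i\psi(z_0)}}{\sqrt n},\dots,z_0+\tfrac{a_me^{i\psi(z_0)}}{\sqrt n}\right)-\det\left(\tfrac1{2\pi}\mathrm{erfc}\left(\tfrac{\overline{a_k}+a_l}{\sqrt2}\right)e^{-\frac12|a_k-a_l|^2+i\,\mathrm{Im}(\overline{a_k}a_l)}\right)_{k,l=1}^m\right|=0.$$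 Here, for $z_0\in\partial E_{1,t_1,t_2}$: if $t_2\ne0$, let $\phi\in(-\pi,\pi]$ be such that $\sqrt{t_2/|t_2|}\,(z_0-v)=a_{1,t_2}\cos\phi+i\,b_{1,t_2}\sin\phi$; then $\psi(z_0)=-\frac{\arg t_2}2+\arctan\left(\frac{1+2|t_2|}{1-2|t_2|}\tan\phi\right)$ if $\phi\in(-\frac\pi2,\frac\pi2)$, $\psi(z_0)=-\frac{\arg t_2}2+\arctan\left(\frac{1+2|t_2|}{1-2|t_2|}\tan\phi\right)+\mathrm{sign}(\phi)\pi$ if $\phi\notin[-\frac\pi2,\frac\pi2]$, and $\psi(z_0)=-\frac{\arg t_2}2+\phi$ if $\phi=\pm\frac\pi2$. If $t_2=0$, $\psi(z_0)=\phi$ where $z_0-v=e^{i\phi}$.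
   Context: For $n\in\mathbb N$ and a potential $V:\mathbb C\to\mathbb R$, let $(p_{k,n})_{k\ge0}$ be the polynomials with $\deg p_{k,n}=k$ and positive leading coefficient satisfying $\int_{\mathbb C}\overline{p_{k,n}(z)}p_{l,n}(z)e^{-nV(z)}\,d^2z=\delta_{kl}$ ($d^2z$ is Lebesgue measure). The normalized reproducing kernel is $K_n(w,z)=e^{-\frac n2(V(w)+V(z))}\sum_{k=0}^{n-1}\overline{p_{k,n}(w)}\,p_{k,n}(z)$, and for $1\le m\le n$ the $m$-point correlation function is $R_n^{(m)}(z_1,\dots,z_m)=\det(K_n(z_k,z_l))_{k,l=1}^m$. For $t_1,t_2\in\mathbb C$, $2|t_2|<1$ put $v=v(t_1,t_2)=\frac{\overline{t_1}+2t_1\overline{t_2}}{1-4|t_2|^2}$, $a_{1,t_2}=\sqrt{\frac{1+2|t_2|}{1-2|t_2|}}$, $b_{1,t_2}=\sqrt{\frac{1-2|t_2|}{1+2|t_2|}}$. If $t_2\neq0$: $\partial E_{1,t_1,t_2}=\left\{z\in\mathbb C:\frac{(\mathrm{Re}(\sqrt{t_2}(z-v)))^2}{a_{1,t_2}^2}+\frac{(\mathrm{Im}(\sqrt{t_2}(z-v)))^2}{b_{1,t_2}^2}=|t_2|\right\}$ and $E_{1,t_1,t_2,\pm\delta}=\left\{z\in\mathbb C:\frac{(\mathrm{Re}(\sqrt{t_2}(z-v)))^2}{(a_{1,t_2}\pm\delta)^2}+\frac{(\mathrm{Im}(\sqrt{t_2}(z-v)))^2}{(b_{1,t_2}\pm\delta)^2}<|t_2|\right\}$.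 If $t_2=0$: $\partial E_{1,t_1,0}=\{z:|z-v|=1\}$ and $E_{1,t_1,0,\pm\delta}=\{z:|z-v|^2<(1\pm\delta)^2\}$. $\arg$ takes values in $(-\pi,\pi]$, square roots are principal, $\overline B_A(0)$ is the closed disc of radius $A$ around $0$, and $\mathrm{erfc}(z)=\frac{2}{\sqrt\pi}\int_z^\infty e^{-w^2}dw$ (entire function). *)

theory Defs
  imports
    "HOL-Analysis.Analysis"
    "HOL-Computational_Algebra.Polynomial"
    "Jordan_Normal_Form.Determinant"
begin

definition is_orthonormal_polys ::
    "(complex \<Rightarrow> real) \<Rightarrow> nat \<Rightarrow> (nat \<Rightarrow> complex poly) \<Rightarrow> bool" where
  "is_orthonormal_polys V n p \<longleftrightarrow>
     (\<forall>k. degree (p k) = k \<and> (\<exists>c::real. c > 0 \<and> lead_coeff (p k) = of_real c)) \<and>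
     (\<forall>k l. has_bochner_integral lborel
        (\<lambda>z. cnj (poly (p k) z) * poly (p l) z * of_real (exp (- (real n * V z))))
        (if k = l then 1 else 0))"

text \<open>The family is uniquely determined whenever it exists; for the potentials considered
  here it exists for every \<open>n \<ge> 1\<close>.\<close>

definition orthonormal_polys :: "(complex \<Rightarrow> real) \<Rightarrow> nat \<Rightarrow> nat \<Rightarrow> complex poly" where
  "orthonormal_polys V n = (THE p. is_orthonormal_polys V n p)"

definition repr_kernel :: "(complex \<Rightarrow> real) \<Rightarrow> nat \<Rightarrow> complex \<Rightarrow> complex \<Rightarrow> complex" where
  "repr_kernel V n w z =
     of_real (exp (- (real n / 2) * (V w + V z))) *
     (\<Sum>k<n. cnj (poly (orthonormal_polys V n k) w) * poly (orthonormal_polys V n k) z)"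

text \<open>A tuple \<open>(z\<^sub>1, \<dots>, z\<^sub>m)\<close> is a function of which only the values at \<open>0, \<dots>, m - 1\<close> are used.\<close>

definition corr_fun ::
    "(complex \<Rightarrow> real) \<Rightarrow> nat \<Rightarrow> nat \<Rightarrow> (nat \<Rightarrow> complex) \<Rightarrow> complex" where
  "corr_fun V n m z =
     Determinant.det (Matrix.mat m m (\<lambda>(k, l). repr_kernel V n (z k) (z l)))"

definition ell_potential :: "complex \<Rightarrow> complex \<Rightarrow> complex \<Rightarrow> real" where
  "ell_potential t1 t2 z = (cmod z)\<^sup>2 - 2 * Re (t1 * z + t2 * z\<^sup>2)"

definition ell_center :: "complex \<Rightarrow> complex \<Rightarrow> complex" where
  "ell_center t1 t2 = (cnj t1 + 2 * t1 * cnj t2) / of_real (1 - 4 * (cmod t2)\<^sup>2)"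

definition ell_a :: "complex \<Rightarrow> real" where
  "ell_a t2 = sqrt ((1 + 2 * cmod t2) / (1 - 2 * cmod t2))"

definition ell_b :: "complex \<Rightarrow> real" where
  "ell_b t2 = sqrt ((1 - 2 * cmod t2) / (1 + 2 * cmod t2))"

definition ell_boundary :: "complex \<Rightarrow> complex \<Rightarrow> complex set" where
  "ell_boundary t1 t2 =
     (if t2 = 0 then {z. cmod (z - ell_center t1 t2) = 1}
      else {z. (Re (csqrt t2 * (z - ell_center t1 t2)))\<^sup>2 / (ell_a t2)\<^sup>2
             + (Im (csqrt t2 * (z - ell_center t1 t2)))\<^sup>2 / (ell_b t2)\<^sup>2 = cmod t2})"

text \<open>The shift \<open>s\<close> is signed: \<open>s = \<delta>\<close> gives \<open>E\<^sub>+\<^sub>\<delta>\<close> and \<open>s = - \<delta>\<close> gives \<open>E\<^sub>-\<^sub>\<delta>\<close>.\<close>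

definition ell_shifted :: "complex \<Rightarrow> complex \<Rightarrow> real \<Rightarrow> complex set" where
  "ell_shifted t1 t2 s =
     (if t2 = 0 then {z. (cmod (z - ell_center t1 t2))\<^sup>2 < (1 + s)\<^sup>2}
      else {z. (Re (csqrt t2 * (z - ell_center t1 t2)))\<^sup>2 / (ell_a t2 + s)\<^sup>2
             + (Im (csqrt t2 * (z - ell_center t1 t2)))\<^sup>2 / (ell_b t2 + s)\<^sup>2 < cmod t2})"

text \<open>\<open>2 / \<surd>\<pi> \<integral>\<^sub>z\<^sup>\<infinity> e\<^bsup>-w\<^sup>2\<^esup> dw\<close>, integrated along the horizontal ray \<open>w = z + x\<close>, \<open>x \<ge> 0\<close>.\<close>

definition erfc :: "complex \<Rightarrow> complex" where
  "erfc z = of_real (2 / sqrt pi) * (LBINT x:{0..}. exp (- (z + complex_of_real x)\<^sup>2))"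

definition theta :: "nat \<Rightarrow> complex \<Rightarrow> complex \<Rightarrow> complex \<Rightarrow> complex \<Rightarrow> real" where
  "theta n t2 z0 a b =
     sqrt (real n) * Im ((cnj a - cnj b) * (z0 - 2 * cnj t2 * cnj z0))
     + Im (cnj a * b + t2 * (a\<^sup>2 - b\<^sup>2))"

text \<open>The parameter \<open>\<phi>\<close> of a boundary point. For \<open>t\<^sub>2 = 0\<close> it is normalised to \<open>(-\<pi>, \<pi>]\<close> as
  well; only \<open>e\<^bsup>i\<phi>\<^esup>\<close> is used in that case.\<close>

definition ell_phi :: "complex \<Rightarrow> complex \<Rightarrow> complex \<Rightarrow> real" where
  "ell_phi t1 t2 z0 =
     (if t2 = 0
      then (THE \<phi>. - pi < \<phi> \<and> \<phi> \<le> pi \<and> z0 - ell_center t1 t2 = cis \<phi>)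
      else (THE \<phi>. - pi < \<phi> \<and> \<phi> \<le> pi \<and>
              csqrt (t2 / of_real (cmod t2)) * (z0 - ell_center t1 t2)
                = of_real (ell_a t2 * cos \<phi>) + \<i> * of_real (ell_b t2 * sin \<phi>)))"

definition ell_psi :: "complex \<Rightarrow> complex \<Rightarrow> complex \<Rightarrow> real" where
  "ell_psi t1 t2 z0 =
     (let \<phi> = ell_phi t1 t2 z0;
          \<alpha> = arctan ((1 + 2 * cmod t2) / (1 - 2 * cmod t2) * tan \<phi>)
      in if t2 = 0 then \<phi>
         else if - (pi / 2) < \<phi> \<and> \<phi> < pi / 2 then - (Arg t2 / 2) + \<alpha>
         else if \<phi> < - (pi / 2) \<or> pi / 2 < \<phi> then - (Arg t2 / 2) + \<alpha> + sgn \<phi> * pi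
         else - (Arg t2 / 2) + \<phi>)"

definition admissible :: "real \<Rightarrow> (complex \<times> complex) set" where
  "admissible \<delta>0 = {(t1, t2). 0 \<le> 2 * cmod t2 \<and> 2 * cmod t2 \<le> 1 - \<delta>0}"

end

theory Submission
  imports Defs "HOL-Probability.Probability" "HOL-Complex_Analysis.Complex_Analysis"
begin

text \<open>
  An affine change of variables turns the orthonormal polynomials into scaled Hermite
  polynomials, so that up to a phase and a Gaussian factor \<open>K\<^sub>n\<close> is a partial sum of Mehler's
  series, multiplied by the reciprocal of the full sum (\<open>nkern\<close>). On the diagonal this normalised
  partial sum (\<open>ndens\<close>) is \<open>P (N < n)\<close> for a random variable \<open>N\<close> whose generating function is known
  explicitly by Mehler's formula. Chernoff bounds show that it is exponentially close to 1 inside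
  and to 0 outside the ellipse, and the Cauchy--Schwarz inequality carries both estimates over to
  the off-diagonal kernel. At a boundary point \<open>N\<close> obeys a central limit theorem, which gives
  the \<open>erfc\<close> limit for \<open>a = b\<close>; since the normalised kernel is holomorphic in \<open>cnj a\<close> and \<open>b\<close> and
  locally bounded, Vitali's theorem extends it to all \<open>a\<close> and \<open>b\<close>.
  Every limit is proved along arbitrary sequences of parameters, which amounts to uniformity.
  The phases are coboundaries up to the term \<open>Im (cnj a * b)\<close> and cancel in the determinants.
\<close>

section \<open>Mehler's formula\<close>

text \<open>The parameter \<open>t1\<close> enters only through a translation and
  \<open>arg t2\<close> only through a rotation, so the analysis has a single real parameter \<tau>
  = \<open>2 * cmod t2\<close>, confined to \<open>[0, 1 - \<delta>0]\<close>. Neither \<tau> nor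
  the angle of a boundary point has to converge along a sequence, so all constants must be
  independent of them. For \<tau> > 0 the polynomial \<open>herm \<tau> k\<close> is
  \<open>\<tau>^(k/2) * He_k (x / sqrt \<tau>)\<close>; its recurrence still makes sense at \<tau> =
  0, where it gives monomials, and the circular case needs no analysis of its own. The obstacle at
  the boundary is that an off-diagonal partial sum is not a probability. In the coordinates
  \<open>x = (cnj a + b) / 2\<close> and \<open>y = (b - cnj a) / (2 * \<i>)\<close>, both real
  exactly when \<open>a = b\<close>, the limit depends on \<open>x\<close> alone and is determined
  by its values at real points. A displacement along the normal shifts the mean of \<open>N\<close>
  by twice its standard deviation times the displacement, whatever \<tau> and the position; this is
  why the limit is universal. The bound on \<delta> is the smallest minor semi-axis that occurs,
  which keeps the shrunken ellipses nondegenerate.\<close>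

fun herm :: "real \<Rightarrow> nat \<Rightarrow> complex \<Rightarrow> complex" where
  "herm \<tau> 0 x = 1"
| "herm \<tau> (Suc 0) x = x"
| "herm \<tau> (Suc (Suc k)) x = x * herm \<tau> (Suc k) x - of_real (\<tau> * real (Suc k)) * herm \<tau> k x"

text \<open>At \<open>k = 0\<close> the index \<open>k - 1\<close> is truncated to 0, harmlessly,
  because its coefficient vanishes; so one rule covers both recursive equations.\<close>

lemma herm_Suc: "herm \<tau> (Suc k) x = x * herm \<tau> k x - of_real (\<tau> * real k) * herm \<tau> (k - 1) x"
  by (cases k) auto

declare herm.simps(3) [simp del]

lemma herm_cnj: "herm \<tau> k (cnj x) = cnj (herm \<tau> k x)"
proof (induction k rule: less_induct)
  case (less k)
  then show ?case by (cases k) (auto simp: herm_Suc)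
qed

text \<open>An Appell sequence: differentiating the recurrence for
  \<open>herm \<tau> (Suc j)\<close> and inserting the derivatives of the two lower polynomials
  reproduces \<open>j\<close> times the recurrence for \<open>herm \<tau> j\<close>, plus one more
  copy of \<open>herm \<tau> j\<close> from the factor \<open>x\<close>.\<close>

lemma DERIV_herm:
  "(herm \<tau> k has_field_derivative of_nat k * herm \<tau> (k - 1) x) (at x)"
proof (induction k rule: less_induct)
  case (less k)
  show ?case
  proof (cases k)
    case 0
    have "herm \<tau> 0 = (\<lambda>x. 1)" by (rule ext) simp
    then show ?thesis using 0 by simp
  next
    case (Suc j)
    have eq: "herm \<tau> (Suc j) = (\<lambda>x. x * herm \<tau> j x - of_real (\<tau> * real j) * herm \<tau> (j - 1) x)"
      by (rule ext) (rule herm_Suc)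
    have d1: "(herm \<tau> j has_field_derivative of_nat j * herm \<tau> (j - 1) x) (at x)"
      using less Suc by simp
    show ?thesis
    proof (cases j)
      case 0
      then show ?thesis unfolding Suc eq using d1 by (auto intro!: derivative_eq_intros)
    next
      case (Suc i)
      have d2: "(herm \<tau> i has_field_derivative of_nat i * herm \<tau> (i - 1) x) (at x)"
        using less \<open>k = Suc j\<close> Suc by simp
      have F: "herm \<tau> (Suc i) x = x * herm \<tau> i x - of_real (\<tau> * real i) * herm \<tau> (i - 1) x"
        by (rule herm_Suc)
      have e: "of_nat (Suc j) * herm \<tau> j x = 1 * herm \<tau> j x + of_nat j * herm \<tau> (j - 1) x * x
          - of_real (\<tau> * real j) * (of_nat i * herm \<tau> (i - 1) x)"
        unfolding Suc F by (simp add: algebra_simps)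
      show ?thesis unfolding \<open>k = Suc j\<close> eq using d1 d2 e Suc
        by (auto intro!: derivative_eq_intros simp: algebra_simps)
    qed
  qed
qed

lemma holomorphic_herm [holomorphic_intros]:
  "f holomorphic_on S \<Longrightarrow> (\<lambda>x. herm \<tau> k (f x)) holomorphic_on S"
proof -
  have "herm \<tau> k holomorphic_on UNIV"
    unfolding holomorphic_on_def field_differentiable_def using DERIV_herm by auto
  then show "f holomorphic_on S \<Longrightarrow> (\<lambda>x. herm \<tau> k (f x)) holomorphic_on S"
    using holomorphic_on_compose_gen[of f S "herm \<tau> k" UNIV] by (simp add: o_def)
qed

text \<open>The recurrence multiplies by \<open>x\<close> and by \<open>\<tau> * k\<close>. Measured
  against \<open>\<rho>^k * sqrt (fact k)\<close>, the first factor costs about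
  \<open>R / sqrt k\<close>, which decays, and the second about \<tau>. Any
  \<open>\<rho>\<^sup>2 > \<tau>\<close> therefore wins from some index on, and the finitely many
  earlier values go into the constant.\<close>

lemma herm_bound:
  assumes "0 \<le> \<tau>" "\<tau> < \<rho>\<^sup>2" "0 < \<rho>" "0 \<le> R"
  obtains C where "0 < C" "\<And>k x. cmod x \<le> R \<Longrightarrow> cmod (herm \<tau> k x) \<le> C * \<rho> ^ k * sqrt (fact k)"
proof -
  have "\<exists>B>0. \<forall>k<N. \<forall>x. cmod x \<le> R \<longrightarrow> cmod (herm \<tau> k x) \<le> B" for N
  proof (induction N)
    case 0
    then show ?case by (intro exI[of _ 1]) auto
  next
    case (Suc N)
    then obtain B where B: "B > 0" "\<forall>k<N. \<forall>x. cmod x \<le> R \<longrightarrow> cmod (herm \<tau> k x) \<le> B" by blast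
    have "\<exists>B'>0. \<forall>x. cmod x \<le> R \<longrightarrow> cmod (herm \<tau> N x) \<le> B'"
    proof (cases N)
      case 0
      then show ?thesis by (intro exI[of _ 1]) auto
    next
      case (Suc j)
      have "cmod (herm \<tau> N x) \<le> R * B + \<tau> * real j * B" if "cmod x \<le> R" for x
      proof -
        have "cmod (herm \<tau> N x) \<le> cmod x * cmod (herm \<tau> j x) + \<tau> * real j * cmod (herm \<tau> (j - 1) x)"
          unfolding Suc herm_Suc using assms(1)
          by (intro order_trans[OF norm_triangle_ineq4]) (simp add: norm_mult)
        also have "\<dots> \<le> R * B + \<tau> * real j * B"
          using B that Suc assms by (intro add_mono mult_mono) auto
        finally show ?thesis .
      qed
      moreover have "0 \<le> R * B + \<tau> * real j * B" using assms B by auto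
      ultimately show ?thesis by (intro exI[of _ "R * B + \<tau> * real j * B + 1"]) (auto intro: add_increasing2 order_trans)
    qed
    then obtain B' where B': "B' > 0" "\<forall>x. cmod x \<le> R \<longrightarrow> cmod (herm \<tau> N x) \<le> B'" by blast
    show ?case
      by (intro exI[of _ "max B B'"]) (use B B' in \<open>auto simp: less_Suc_eq le_max_iff_disj\<close>)
  qed
  note bounded = this
  \<comment> \<open>Solves \<open>\<eta> * \<rho> + \<tau> = \<rho>\<^sup>2\<close>: \<eta> is the
    part of the growth rate that \<tau> leaves for the factor \<open>x\<close>.\<close>
  define \<eta> where "\<eta> = (\<rho>\<^sup>2 - \<tau>) / \<rho>"
  have \<eta>: "\<eta> > 0" using assms by (simp add: \<eta>_def)
  obtain N where N: "real N > (R / \<eta>)\<^sup>2" using reals_Archimedean2 by blast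
  obtain B where B: "B > 0" "\<forall>k<N+2. \<forall>x. cmod x \<le> R \<longrightarrow> cmod (herm \<tau> k x) \<le> B"
    using bounded[of "N+2"] by blast
  \<comment> \<open>The sum of the inverse powers makes \<open>C * \<rho> ^ k\<close> at least
    \<open>B\<close> for every starting index \<open>k < N + 2\<close>, also when \<rho> <
    1.\<close>
  define C where "C = B * (\<Sum>k<N+2. inverse (\<rho> ^ k))"
  have C: "C > 0" unfolding C_def using B assms by (intro mult_pos_pos sum_pos) auto
  have main: "cmod (herm \<tau> k x) \<le> C * \<rho> ^ k * sqrt (fact k)" if x: "cmod x \<le> R" for k x
  proof (induction k rule: less_induct)
    case (less k)
    show ?case
    proof (cases "k < N + 2")
      case True
      have "inverse (\<rho> ^ k) \<le> (\<Sum>k<N+2. inverse (\<rho> ^ k))"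
        using True assms by (intro member_le_sum) auto
      then have "1 \<le> (\<Sum>k<N+2. inverse (\<rho> ^ k)) * \<rho> ^ k"
        using assms by (simp add: field_simps)
      then have "B * 1 \<le> B * ((\<Sum>k<N+2. inverse (\<rho> ^ k)) * \<rho> ^ k)"
        using B by (intro mult_left_mono) auto
      then have "B \<le> C * \<rho> ^ k" unfolding C_def by (simp add: mult.assoc)
      moreover have "C * \<rho> ^ k * 1 \<le> C * \<rho> ^ k * sqrt (fact k)"
        using C assms by (intro mult_left_mono) (auto simp: fact_ge_1)
      ultimately show ?thesis using B True x by force
    next
      case False
      then obtain j where k: "k = Suc (Suc j)" by (metis Suc_diff_Suc add_2_eq_Suc' not_less_eq zero_less_Suc Suc_pred add_gr_0 le_add2 less_Suc_eq_le linorder_not_less numeral_2_eq_2 old.nat.exhaust)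
      have jN: "N \<le> j" using False k by simp
      have "(R / \<eta>)\<^sup>2 \<le> real (j+2)" using N jN by linarith
      then have "R / \<eta> \<le> sqrt (real (j + 2))" by (rule real_le_rsqrt)
      then have Rb: "R \<le> \<eta> * sqrt (real (j + 2))" using \<eta> by (simp add: field_simps)
      have f1: "sqrt (fact (Suc j)) * sqrt (real (j+2)) = sqrt (fact k)"
        unfolding k real_sqrt_mult[symmetric] by (simp add: algebra_simps)
      have f2: "real (Suc j) * sqrt (fact j) \<le> sqrt (fact k)"
      proof -
        have "(real (Suc j) * sqrt (fact j))\<^sup>2 = real (Suc j) * real (Suc j) * fact j"
          by (simp add: power_mult_distrib power2_eq_square)
        also have "\<dots> \<le> real (Suc (Suc j)) * real (Suc j) * fact j"
          by (intro mult_right_mono) auto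
        also have "\<dots> = fact k" by (simp add: k algebra_simps)
        finally show ?thesis by (rule real_le_rsqrt)
      qed
      have "cmod (herm \<tau> k x) \<le> cmod x * cmod (herm \<tau> (Suc j) x) + \<tau> * real (Suc j) * cmod (herm \<tau> j x)"
        unfolding k herm.simps(3) using assms(1)
        by (intro order_trans[OF norm_triangle_ineq4]) (simp add: norm_mult del: of_nat_Suc)
      also have "\<dots> \<le> R * (C * \<rho> ^ Suc j * sqrt (fact (Suc j))) + \<tau> * real (Suc j) * (C * \<rho> ^ j * sqrt (fact j))"
        using less k x assms C by (intro add_mono mult_mono mult_nonneg_nonneg) (auto simp del: fact_Suc power_Suc)
      also have "\<dots> \<le> (\<eta> * sqrt (real (j + 2))) * (C * \<rho> ^ Suc j * sqrt (fact (Suc j))) + \<tau> * real (Suc j) * (C * \<rho> ^ j * sqrt (fact j))"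
        using Rb C assms by (intro add_right_mono mult_right_mono) auto
      also have "\<dots> = \<eta> * (C * \<rho> ^ Suc j) * (sqrt (fact (Suc j)) * sqrt (real (j + 2))) + \<tau> * (C * \<rho> ^ j) * (real (Suc j) * sqrt (fact j))"
        by (simp only: mult_ac)
      also have "\<dots> \<le> \<eta> * (C * \<rho> ^ Suc j) * sqrt (fact k) + \<tau> * (C * \<rho> ^ j) * sqrt (fact k)"
        unfolding f1 using f2 C assms by (intro add_left_mono mult_left_mono) auto
      also have "\<dots> = C * \<rho> ^ j * sqrt (fact k) * (\<eta> * \<rho> + \<tau>)" by (simp add: algebra_simps)
      also have "\<eta> * \<rho> + \<tau> = \<rho>\<^sup>2" using assms by (simp add: \<eta>_def)
      finally show ?thesis by (simp add: k power2_eq_square mult_ac)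
    qed
  qed
  show ?thesis using that[OF C main] .
qed

section \<open>The differential equation satisfied by the partial sums of Mehler's series\<close>

definition mehler_sum :: "real \<Rightarrow> complex \<Rightarrow> nat \<Rightarrow> complex \<Rightarrow> complex \<Rightarrow> complex" where
  "mehler_sum \<tau> s n Y X = (\<Sum>k<n. s ^ k * herm \<tau> k Y * herm \<tau> k X / fact k)"

definition mehler_deriv :: "real \<Rightarrow> complex \<Rightarrow> nat \<Rightarrow> complex \<Rightarrow> complex \<Rightarrow> complex" where
  "mehler_deriv \<tau> s n Y X = (\<Sum>k<n. s ^ k * herm \<tau> k Y * (of_nat k * herm \<tau> (k - 1) X) / fact k)"

text \<open>The boundary term by which a partial sum of Mehler's series fails to satisfy the
  differential equation in \<open>X\<close> of the closed form \<open>exp (mehler_exp \<tau> s Y X)\<close>.\<close>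

definition mehler_rem :: "real \<Rightarrow> complex \<Rightarrow> nat \<Rightarrow> complex \<Rightarrow> complex \<Rightarrow> complex" where
  "mehler_rem \<tau> s n Y X = s ^ n * herm \<tau> n Y * (of_nat n * herm \<tau> (n - 1) X) / fact n"

lemma mehler_sum_commute: "mehler_sum \<tau> s n Y X = mehler_sum \<tau> s n X Y"
  by (simp add: mehler_sum_def mult_ac)

lemma DERIV_mehler_sum:
  "(mehler_sum \<tau> s n Y has_field_derivative mehler_deriv \<tau> s n Y X) (at X)"
proof -
  have "mehler_sum \<tau> s n Y = (\<lambda>X. \<Sum>k<n. s ^ k * herm \<tau> k Y * herm \<tau> k X / fact k)"
    by (rule ext) (simp add: mehler_sum_def)
  then show ?thesis unfolding mehler_deriv_def
    by (auto simp only: intro!: DERIV_sum DERIV_cdivide DERIV_cmult DERIV_herm)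
qed

text \<open>The recurrence in \<open>Y\<close> rewrites the term of index \<open>k + 1\<close> of
  the \<open>X\<close>-derivative through the terms of index \<open>k\<close>. The sums then
  telescope, and only the first term beyond the cut-off survives.\<close>

lemma mehler_deriv_add:
  "mehler_deriv \<tau> s n Y X + of_real \<tau> * s * mehler_deriv \<tau> s n X Y
     = s * Y * mehler_sum \<tau> s n Y X - mehler_rem \<tau> s n Y X"
proof (induction n)
  case 0
  then show ?case by (simp add: mehler_deriv_def mehler_sum_def mehler_rem_def)
next
  case (Suc n)
  have a: "mehler_deriv \<tau> s (Suc n) Y X = mehler_deriv \<tau> s n Y X + mehler_rem \<tau> s n Y X" for Y X
    by (simp add: mehler_deriv_def mehler_rem_def)
  have b: "mehler_sum \<tau> s (Suc n) Y X = mehler_sum \<tau> s n Y X + s ^ n * herm \<tau> n Y * herm \<tau> n X / fact n"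
    by (simp add: mehler_sum_def)
  have "mehler_rem \<tau> s (Suc n) Y X = s ^ Suc n * herm \<tau> (Suc n) Y * herm \<tau> n X / fact n"
    by (simp add: mehler_rem_def divide_simps del: of_nat_Suc)
  also have "\<dots> = s * Y * (s ^ n * herm \<tau> n Y * herm \<tau> n X / fact n) - of_real \<tau> * s * mehler_rem \<tau> s n X Y"
    unfolding herm_Suc mehler_rem_def by (simp add: field_simps)
  finally have c: "mehler_rem \<tau> s (Suc n) Y X = \<dots>" .
  show ?case unfolding a b c using Suc by (simp add: algebra_simps)
qed

text \<open>\<open>mehler_deriv_add\<close> for \<open>(Y, X)\<close> and for \<open>(X, Y)\<close>
  is a linear system for the two partial derivatives with determinant
  \<open>1 - (s * \<tau>)\<^sup>2\<close>; this solves it for the derivative in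
  \<open>X\<close>.\<close>

lemma mehler_deriv_eq:
  "(1 - (s * of_real \<tau>)\<^sup>2) * mehler_deriv \<tau> s n Y X
     = (s * Y - s\<^sup>2 * of_real \<tau> * X) * mehler_sum \<tau> s n Y X
       - mehler_rem \<tau> s n Y X + of_real \<tau> * s * mehler_rem \<tau> s n X Y"
proof -
  note 1 = mehler_deriv_add[of \<tau> s n Y X]
  note 2 = mehler_deriv_add[of \<tau> s n X Y, unfolded mehler_sum_commute[of \<tau> s n X Y]]
  from 2 have e: "mehler_deriv \<tau> s n X Y = s * X * mehler_sum \<tau> s n Y X - mehler_rem \<tau> s n X Y
      - of_real \<tau> * s * mehler_deriv \<tau> s n Y X"
    by (simp add: algebra_simps)
  show ?thesis using 1 unfolding e by (simp add: algebra_simps power2_eq_square)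
qed

text \<open>By \<open>herm_bound\<close> with \<open>\<rho>\<^sup>2 = q\<close> slightly above
  \<tau>, the factorials cancel and the boundary term is at most a multiple of
  \<open>n * (cmod s * q)^n\<close>. The strict inequality \<open>cmod s * \<tau> < 1\<close> leaves
  room for such a \<open>q\<close>.\<close>

lemma mehler_rem_small:
  assumes "0 \<le> \<tau>" "cmod s * \<tau> < 1" "0 \<le> R"
  obtains e where "e \<longlonglongrightarrow> 0"
    "\<And>n X Y. cmod X \<le> R \<Longrightarrow> cmod Y \<le> R \<Longrightarrow> cmod (mehler_rem \<tau> s n Y X) \<le> e n"
proof -
  obtain q where q: "\<tau> < q" "cmod s * q < 1"
  proof (cases "s = 0")
    case True
    then show ?thesis using that[of "\<tau> + 1"] by simp
  next
    case False
    then have "\<tau> < 1 / cmod s" using assms by (simp add: field_simps)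
    then obtain q where "\<tau> < q" "q < 1 / cmod s" using dense by blast
    then show ?thesis using that[of q] False by (simp add: field_simps)
  qed
  define \<rho> where "\<rho> = sqrt q"
  have \<rho>: "0 < \<rho>" "\<rho>\<^sup>2 = q" using q assms by (auto simp: \<rho>_def)
  obtain C where C: "0 < C" "\<And>k x. cmod x \<le> R \<Longrightarrow> cmod (herm \<tau> k x) \<le> C * \<rho> ^ k * sqrt (fact k)"
    using herm_bound[of \<tau> \<rho> R] assms q \<rho> by auto
  define e where "e n = C\<^sup>2 / \<rho> * (real n * (cmod s * q) ^ n)" for n
  have "(\<lambda>n. C\<^sup>2 / \<rho> * (real n * (cmod s * q) ^ n)) \<longlonglongrightarrow> C\<^sup>2 / \<rho> * 0"
    using q assms by (intro tendsto_mult tendsto_const powser_times_n_limit_0)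
      (auto simp: abs_mult)
  then have "e \<longlonglongrightarrow> 0" unfolding e_def by simp
  moreover have "cmod (mehler_rem \<tau> s n Y X) \<le> e n" if "cmod X \<le> R" "cmod Y \<le> R" for n X Y
  proof (cases n)
    case 0
    then show ?thesis by (simp add: mehler_rem_def e_def)
  next
    case (Suc j)
    have f: "sqrt (fact n) * sqrt (fact j) \<le> fact n"
    proof -
      have "sqrt (fact n) * sqrt (fact j) \<le> sqrt (fact n) * sqrt (fact n)"
        unfolding Suc by (intro mult_left_mono real_sqrt_le_mono fact_mono) auto
      then show ?thesis by simp
    qed
    have "cmod (mehler_rem \<tau> s n Y X) = cmod s ^ n * cmod (herm \<tau> n Y) * (real n * cmod (herm \<tau> j X)) / fact n"
      by (simp add: mehler_rem_def norm_mult norm_divide norm_power Suc del: of_nat_Suc)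
    also have "\<dots> \<le> cmod s ^ n * (C * \<rho> ^ n * sqrt (fact n)) * (real n * (C * \<rho> ^ j * sqrt (fact j))) / fact n"
      using C that \<rho> by (intro divide_right_mono mult_mono mult_nonneg_nonneg) auto
    also have "\<dots> = C\<^sup>2 * real n * cmod s ^ n * \<rho> ^ n * \<rho> ^ j * ((sqrt (fact n) * sqrt (fact j)) / fact n)"
      by (simp add: power2_eq_square)
    also have "\<dots> \<le> C\<^sup>2 * real n * cmod s ^ n * \<rho> ^ n * \<rho> ^ j * 1"
      using C \<rho> f by (intro mult_left_mono) auto
    also have "\<dots> = e n"
      using \<rho>(1) unfolding e_def \<rho>(2)[symmetric]
      by (simp add: power_mult_distrib Suc power2_eq_square field_simps)
    finally show ?thesis .
  qed
  ultimately show ?thesis using that by blast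
qed

definition mehler_exp :: "real \<Rightarrow> complex \<Rightarrow> complex \<Rightarrow> complex \<Rightarrow> complex" where
  "mehler_exp \<tau> s Y X = (s * Y * X - s\<^sup>2 * of_real \<tau> * (X\<^sup>2 + Y\<^sup>2) / 2) / (1 - (s * of_real \<tau>)\<^sup>2)"

lemma mehler_exp_commute: "mehler_exp \<tau> s Y X = mehler_exp \<tau> s X Y"
  by (simp add: mehler_exp_def algebra_simps)

lemma one_minus_sq_nonzero:
  assumes "0 \<le> \<tau>" "cmod s * \<tau> < 1"
  shows "1 - (s * of_real \<tau>)\<^sup>2 \<noteq> 0"
proof
  assume "1 - (s * of_real \<tau>)\<^sup>2 = 0"
  then have "cmod ((s * of_real \<tau>)\<^sup>2) = 1" by (metis norm_one right_minus_eq)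
  then have "(cmod s * \<tau>)\<^sup>2 = 1" using assms by (simp add: norm_mult norm_power)
  moreover have "(cmod s * \<tau>)\<^sup>2 < 1\<^sup>2" using assms by (intro power_strict_mono) auto
  ultimately show False by simp
qed

text \<open>By \<open>mehler_deriv_eq\<close> the factor \<open>exp (- mehler_exp)\<close> cancels
  everything in the \<open>X\<close>-derivative of the product except the two boundary terms. The
  derivative thus tends to 0 uniformly on discs: the product becomes constant in \<open>X\<close>
  before the series is known to converge.\<close>

lemma mehler_step:
  assumes "0 \<le> \<tau>" "cmod s * \<tau> < 1"
  shows "(\<lambda>n. mehler_sum \<tau> s n Y X * exp (- mehler_exp \<tau> s Y X)
            - mehler_sum \<tau> s n Y 0 * exp (- mehler_exp \<tau> s Y 0)) \<longlonglongrightarrow> 0"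
proof -
  define R where "R = max (cmod X) (cmod Y)"
  define D where "D = 1 - (s * of_real \<tau>)\<^sup>2"
  have D: "D \<noteq> 0" using one_minus_sq_nonzero[OF assms] by (simp add: D_def)
  have R: "0 \<le> R" by (simp add: R_def le_max_iff_disj)
  obtain e where e: "e \<longlonglongrightarrow> 0"
    "\<And>n X Y. cmod X \<le> R \<Longrightarrow> cmod Y \<le> R \<Longrightarrow> cmod (mehler_rem \<tau> s n Y X) \<le> e n"
    using mehler_rem_small[OF assms R] by blast
  have "compact (cball (0::complex) R)" by simp
  moreover have "continuous_on (cball 0 R) (\<lambda>X. exp (- mehler_exp \<tau> s Y X))"
    unfolding mehler_exp_def D_def[symmetric] using D by (intro continuous_intros) auto
  ultimately have "bounded ((\<lambda>X. exp (- mehler_exp \<tau> s Y X)) ` cball 0 R)"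
    using compact_continuous_image compact_imp_bounded by blast
  then obtain B where B: "B > 0" "\<And>X. cmod X \<le> R \<Longrightarrow> cmod (exp (- mehler_exp \<tau> s Y X)) \<le> B"
    unfolding bounded_pos by auto
  define \<Phi> where "\<Phi> n X = mehler_sum \<tau> s n Y X * exp (- mehler_exp \<tau> s Y X)" for n X
  have der: "(\<Phi> n has_field_derivative
      exp (- mehler_exp \<tau> s Y X) * (of_real \<tau> * s * mehler_rem \<tau> s n X Y - mehler_rem \<tau> s n Y X) / D) (at X)" for n X
  proof -
    have "(mehler_exp \<tau> s Y has_field_derivative (s * Y - s\<^sup>2 * of_real \<tau> * X) / D) (at X)"
      unfolding mehler_exp_def[abs_def] D_def[symmetric] using D
      by (auto intro!: derivative_eq_intros simp: field_simps)
    then have "(\<Phi> n has_field_derivative mehler_deriv \<tau> s n Y X * exp (- mehler_exp \<tau> s Y X)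
        + (exp (- mehler_exp \<tau> s Y X) * - ((s * Y - s\<^sup>2 * of_real \<tau> * X) / D)) * mehler_sum \<tau> s n Y X) (at X)"
      unfolding \<Phi>_def by (intro DERIV_mult DERIV_mehler_sum DERIV_fun_exp DERIV_minus)
    moreover have "mehler_deriv \<tau> s n Y X * exp (- mehler_exp \<tau> s Y X)
        + (exp (- mehler_exp \<tau> s Y X) * - ((s * Y - s\<^sup>2 * of_real \<tau> * X) / D)) * mehler_sum \<tau> s n Y X
       = exp (- mehler_exp \<tau> s Y X) * (of_real \<tau> * s * mehler_rem \<tau> s n X Y - mehler_rem \<tau> s n Y X) / D"
    proof -
      have "D * mehler_deriv \<tau> s n Y X
         = (s * Y - s\<^sup>2 * of_real \<tau> * X) * mehler_sum \<tau> s n Y X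
       - mehler_rem \<tau> s n Y X + of_real \<tau> * s * mehler_rem \<tau> s n X Y"
        unfolding D_def by (rule mehler_deriv_eq)
      then have deq: "of_real \<tau> * s * mehler_rem \<tau> s n X Y - mehler_rem \<tau> s n Y X
          = D * mehler_deriv \<tau> s n Y X - (s * Y - s\<^sup>2 * of_real \<tau> * X) * mehler_sum \<tau> s n Y X"
        by simp
      have "exp (- mehler_exp \<tau> s Y X) * (of_real \<tau> * s * mehler_rem \<tau> s n X Y - mehler_rem \<tau> s n Y X) / D
          = exp (- mehler_exp \<tau> s Y X) * (D * mehler_deriv \<tau> s n Y X - (s * Y - s\<^sup>2 * of_real \<tau> * X) * mehler_sum \<tau> s n Y X) / D"
        by (simp only: deq)
      also have "\<dots> = mehler_deriv \<tau> s n Y X * exp (- mehler_exp \<tau> s Y X)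
        + (exp (- mehler_exp \<tau> s Y X) * - ((s * Y - s\<^sup>2 * of_real \<tau> * X) / D)) * mehler_sum \<tau> s n Y X"
        using D by (simp add: field_simps)
      finally show ?thesis ..
    qed
    ultimately show ?thesis by simp
  qed
  have bd: "cmod (\<Phi> n X - \<Phi> n 0) \<le> (B * ((\<tau> * cmod s + 1) * e n) / cmod D) * R" for n
  proof -
    have "cmod (\<Phi> n X - \<Phi> n 0) \<le> (B * ((\<tau> * cmod s + 1) * e n) / cmod D) * cmod (X - 0)"
    proof (rule field_differentiable_bound[of "cball 0 R"])
      fix Z :: complex assume "Z \<in> cball 0 R"
      then have Z: "cmod Z \<le> R" by simp
      show "(\<Phi> n has_field_derivative
      exp (- mehler_exp \<tau> s Y Z) * (of_real \<tau> * s * mehler_rem \<tau> s n Z Y - mehler_rem \<tau> s n Y Z) / D) (at Z within cball 0 R)"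
        using der has_field_derivative_at_within by blast
      have "cmod (of_real \<tau> * s * mehler_rem \<tau> s n Z Y - mehler_rem \<tau> s n Y Z) \<le> \<tau> * cmod s * e n + e n"
        by (intro order_trans[OF norm_triangle_ineq4] add_mono)
          (use assms e(2)[of Z Y n] e(2)[of Y Z n] Z in \<open>auto simp: R_def norm_mult mult_left_mono\<close>)
      then show "cmod (exp (- mehler_exp \<tau> s Y Z) * (of_real \<tau> * s * mehler_rem \<tau> s n Z Y - mehler_rem \<tau> s n Y Z) / D)
          \<le> B * ((\<tau> * cmod s + 1) * e n) / cmod D"
        unfolding norm_divide norm_mult[of "exp _"] using B Z
        by (intro divide_right_mono mult_mono) (auto simp: algebra_simps)
    qed (auto simp: R_def le_max_iff_disj)
    also have "\<dots> \<le> (B * ((\<tau> * cmod s + 1) * e n) / cmod D) * R"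
    proof (rule mult_left_mono)
      have "0 \<le> e n" using order_trans[OF norm_ge_zero e(2)[of 0 0 n]] R by simp
      then show "0 \<le> B * ((\<tau> * cmod s + 1) * e n) / cmod D" using B assms by auto
    qed (simp add: R_def)
    finally show ?thesis .
  qed
  have "(\<lambda>n. (B * ((\<tau> * cmod s + 1) * e n) / cmod D) * R) \<longlonglongrightarrow> (B * ((\<tau> * cmod s + 1) * 0) / cmod D) * R"
    using e(1) D by (intro tendsto_intros) auto
  then have "(\<lambda>n. (B * ((\<tau> * cmod s + 1) * e n) / cmod D) * R) \<longlonglongrightarrow> 0" by simp
  then have "(\<lambda>n. \<Phi> n X - \<Phi> n 0) \<longlonglongrightarrow> 0"
    by (rule Lim_null_comparison[rotated]) (use bd in auto)
  then show ?thesis by (simp add: \<Phi>_def)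
qed

section \<open>The value of the series at the origin, and its sum\<close>

lemma herm_at_0: "herm \<tau> (2 * j) 0 = (of_real (- \<tau>)) ^ j * (\<Prod>i<j. of_nat (2 * i + 1))"
  "herm \<tau> (Suc (2 * j)) 0 = 0"
  by (induction j) (auto simp: herm.simps(3) algebra_simps)

text \<open>With \<open>p\<close> the product of the first \<open>j\<close> odd numbers, this is the
  identity \<open>p\<^sup>2 / fact (2 * j) = (- 1)^j * ((- 1 / 2) gchoose j)\<close>, proved by
  comparing consecutive terms.\<close>

lemma mehler_origin_term:
  "s ^ (2 * j) * herm \<tau> (2 * j) 0 * herm \<tau> (2 * j) 0 / fact (2 * j)
    = ((- 1 / 2) gchoose j) * (- ((s * of_real \<tau>)\<^sup>2)) ^ j"
proof (induction j)
  case 0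
  then show ?case by simp
next
  case (Suc j)
  have h: "herm \<tau> (2 * Suc j) 0 = - of_real \<tau> * (2 * of_nat j + 1) * herm \<tau> (2 * j) 0"
    by (simp add: herm.simps(3) algebra_simps)
  have g: "((- 1 / 2 :: complex) gchoose Suc j) = ((- 1 / 2) gchoose j) * ((- 1/2 - of_nat j) / of_nat (Suc j))"
    using gbinomial_absorb_comp[of "-1/2 :: complex" j] gbinomial_absorption[of j "-1/2 :: complex"]
    by (simp add: field_simps del: of_nat_Suc)
  have f: "fact (2 * Suc j) = (2 * of_nat j + 2) * (2 * of_nat j + 1) * (fact (2 * j) :: complex)"
    by (simp add: algebra_simps)
  have nz: "(2 * of_nat j + 1 :: complex) \<noteq> 0" "(2 * of_nat j + 2 :: complex) \<noteq> 0"
    by (metis of_nat_1 of_nat_Suc of_nat_mult of_nat_numeral of_nat_eq_0_iff add.commute nat.distinct(1) Suc_eq_plus1,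
        metis of_nat_mult of_nat_numeral of_nat_add of_nat_eq_0_iff add_eq_0_iff_both_eq_0 zero_neq_numeral)
  have "s ^ (2 * Suc j) * herm \<tau> (2 * Suc j) 0 * herm \<tau> (2 * Suc j) 0 / fact (2 * Suc j)
     = (s ^ (2 * j) * herm \<tau> (2 * j) 0 * herm \<tau> (2 * j) 0 / fact (2 * j)) * ((s * of_real \<tau>)\<^sup>2 * ((2 * of_nat j + 1) / (2 * of_nat j + 2)))"
  proof -
    have ring: "S * s\<^sup>2 * (- t * c * H) * (- t * c * H) / (d * c * F) = (S * H * H / F) * ((s * t)\<^sup>2 * (c / d))"
      if "c \<noteq> 0" "d \<noteq> 0" "F \<noteq> 0" for S t c d H F :: complex
      using that by (simp add: field_simps power2_eq_square)
    have "s ^ (2 * Suc j) = s ^ (2 * j) * s\<^sup>2" by (simp add: power2_eq_square)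
    show ?thesis unfolding h f \<open>s ^ (2 * Suc j) = _\<close> by (rule ring[OF nz fact_nonzero])
  qed
  also have "\<dots> = ((- 1 / 2) gchoose j) * (- ((s * of_real \<tau>)\<^sup>2)) ^ j * ((s * of_real \<tau>)\<^sup>2 * ((2 * of_nat j + 1) / (2 * of_nat j + 2)))"
    unfolding Suc ..
  also have "((2 * of_nat j + 1) / (2 * of_nat j + 2) :: complex) = - ((- 1/2 - of_nat j) / of_nat (Suc j))"
    using nz by (simp add: divide_simps) (simp add: algebra_simps)
  finally show ?case unfolding g by simp
qed

text \<open>Odd indices contribute nothing and the even ones form the binomial series for the
  exponent \<open>- 1 / 2\<close>. This also shows that the principal branch of the square root is
  the right one.\<close>

lemma mehler_origin:
  assumes "0 \<le> \<tau>" "cmod s * \<tau> < 1"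
  shows "(\<lambda>k. s ^ k * herm \<tau> k 0 * herm \<tau> k 0 / fact k) sums (1 - (s * of_real \<tau>)\<^sup>2) powr (- 1 / 2)"
proof -
  let ?f = "\<lambda>k. s ^ k * herm \<tau> k 0 * herm \<tau> k 0 / fact k"
  have "cmod (- ((s * of_real \<tau>)\<^sup>2)) < 1"
  proof -
    have "(cmod s * \<tau>)\<^sup>2 < 1\<^sup>2" using assms by (intro power_strict_mono) auto
    then show ?thesis using assms by (simp add: norm_mult norm_power)
  qed
  from gen_binomial_complex[OF this, of "- 1/2"]
  have "(\<lambda>j. ?f (2 * j)) sums (1 - (s * of_real \<tau>)\<^sup>2) powr (- 1 / 2)"
    unfolding mehler_origin_term by simp
  moreover have "strict_mono (\<lambda>j::nat. 2 * j)" by (simp add: strict_mono_def)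
  moreover have "?f k = 0" if "k \<notin> range (\<lambda>j. 2 * j)" for k
  proof -
    have "odd k" using that by (auto elim: evenE)
    then obtain j where "k = Suc (2 * j)" by (auto elim: oddE)
    then show ?thesis by (simp add: herm_at_0)
  qed
  ultimately show ?thesis using sums_mono_reindex[of "\<lambda>j. 2 * j" ?f] by blast
qed

text \<open>\<open>mehler_step\<close> moves only the second argument. It is applied once from
  \<open>(0, 0)\<close> to \<open>(0, Y)\<close> and, after exchanging the arguments by symmetry,
  once from \<open>(Y, 0)\<close> to \<open>(Y, X)\<close>.\<close>

theorem mehler:
  assumes "0 \<le> \<tau>" "cmod s * \<tau> < 1"
  shows "(\<lambda>k. s ^ k * herm \<tau> k Y * herm \<tau> k X / fact k) sums
    ((1 - (s * of_real \<tau>)\<^sup>2) powr (- 1 / 2) * exp (mehler_exp \<tau> s Y X))"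
proof -
  let ?P = "(1 - (s * of_real \<tau>)\<^sup>2) powr (- 1 / 2)"
  have 0: "(\<lambda>n. mehler_sum \<tau> s n 0 0) \<longlonglongrightarrow> ?P"
    using mehler_origin[OF assms] unfolding sums_def mehler_sum_def .
  have e0: "mehler_exp \<tau> s 0 0 = 0" by (simp add: mehler_exp_def)
  have 1: "(\<lambda>n. mehler_sum \<tau> s n 0 Y * exp (- mehler_exp \<tau> s 0 Y)) \<longlonglongrightarrow> ?P"
    using tendsto_add[OF mehler_step[OF assms, of 0 Y] 0] by (simp add: e0)
  have "(\<lambda>n. mehler_sum \<tau> s n Y X * exp (- mehler_exp \<tau> s Y X)) \<longlonglongrightarrow> ?P"
    using tendsto_add[OF mehler_step[OF assms, of Y X] 1]
    by (simp add: mehler_sum_commute[of \<tau> s _ Y 0] mehler_exp_commute[of \<tau> s Y 0])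
  then have "(\<lambda>n. mehler_sum \<tau> s n Y X * exp (- mehler_exp \<tau> s Y X) * exp (mehler_exp \<tau> s Y X)) \<longlonglongrightarrow> ?P * exp (mehler_exp \<tau> s Y X)"
    by (intro tendsto_intros)
  then have "(\<lambda>n. mehler_sum \<tau> s n Y X) \<longlonglongrightarrow> ?P * exp (mehler_exp \<tau> s Y X)"
    by (simp add: mult.assoc exp_minus)
  then show ?thesis unfolding sums_def mehler_sum_def .
qed

section \<open>The normalised partial sums\<close>

definition nkern :: "real \<Rightarrow> nat \<Rightarrow> complex \<Rightarrow> complex \<Rightarrow> complex" where
  "nkern \<tau> n Y X = of_real (sqrt (1 - \<tau>\<^sup>2)) * exp (- mehler_exp \<tau> 1 Y X) * mehler_sum \<tau> 1 n Y X"

text \<open>Mehler's exponent at \<open>s = 1\<close> on the diagonal. In the coordinates of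
  \<open>ell_coord\<close> it is \<open>n\<close> times the potential minus its value at the
  centre.\<close>

definition ell_weight :: "real \<Rightarrow> complex \<Rightarrow> real" where
  "ell_weight \<tau> X = ((cmod X)\<^sup>2 - \<tau> * Re (X\<^sup>2)) / (1 - \<tau>\<^sup>2)"

definition ndens :: "real \<Rightarrow> nat \<Rightarrow> complex \<Rightarrow> real" where
  "ndens \<tau> n X = sqrt (1 - \<tau>\<^sup>2) * exp (- ell_weight \<tau> X) * (\<Sum>k<n. (cmod (herm \<tau> k X))\<^sup>2 / fact k)"

definition ell_gen :: "real \<Rightarrow> real \<Rightarrow> complex \<Rightarrow> real" where
  "ell_gen \<tau> s X = s * (Re X)\<^sup>2 / (1 + s * \<tau>) + s * (Im X)\<^sup>2 / (1 - s * \<tau>)"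

text \<open>The derivative of \<open>ell_gen \<tau> s X\<close> in \<open>s\<close> at
  \<open>s = 1\<close>, that is the mean of \<open>N\<close> up to a term bounded in terms of
  \<tau>. The equation \<open>ellq = n\<close> is the boundary ellipse in rescaled
  coordinates.\<close>

definition ellq :: "real \<Rightarrow> complex \<Rightarrow> real" where
  "ellq \<tau> X = (Re X)\<^sup>2 / (1 + \<tau>)\<^sup>2 + (Im X)\<^sup>2 / (1 - \<tau>)\<^sup>2"

lemma sq_less_one:
  assumes "0 \<le> \<tau>" "\<tau> < (1::real)"
  shows "\<tau>\<^sup>2 < 1" "0 < 1 - \<tau>\<^sup>2"
  using power_strict_mono[of \<tau> 1 2] assms by auto

lemma holomorphic_nkern [holomorphic_intros]:
  assumes "0 \<le> \<tau>" "\<tau> < 1" "f holomorphic_on S" "g holomorphic_on S"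
  shows "(\<lambda>x. nkern \<tau> n (f x) (g x)) holomorphic_on S"
  using one_minus_sq_nonzero[of \<tau> 1] assms
  unfolding nkern_def mehler_exp_def mehler_sum_def by (auto intro!: holomorphic_intros)

lemma nkern_tendsto_1:
  assumes "0 \<le> \<tau>" "\<tau> < 1"
  shows "(\<lambda>n. nkern \<tau> n Y X) \<longlonglongrightarrow> 1"
proof -
  define D where "D = 1 - \<tau>\<^sup>2"
  have D: "D > 0" using sq_less_one[OF assms] by (simp add: D_def)
  have "(\<lambda>n. mehler_sum \<tau> 1 n Y X) \<longlonglongrightarrow> (1 - (1 * of_real \<tau>)\<^sup>2) powr (- 1 / 2) * exp (mehler_exp \<tau> 1 Y X)"
    using mehler[of \<tau> 1 Y X] assms unfolding sums_def mehler_sum_def by simp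
  then have "(\<lambda>n. nkern \<tau> n Y X) \<longlonglongrightarrow> of_real (sqrt (1 - \<tau>\<^sup>2)) * exp (- mehler_exp \<tau> 1 Y X) *
     ((1 - (1 * of_real \<tau>)\<^sup>2) powr (- 1 / 2) * exp (mehler_exp \<tau> 1 Y X))"
    unfolding nkern_def by (intro tendsto_intros)
  also have "(1 - (1 * of_real \<tau>)\<^sup>2) powr (- 1 / 2) = complex_of_real (D powr (- 1 / 2))"
    using powr_of_real[of D "- 1 / 2"] D by (simp add: D_def)
  also have "D powr (- 1 / 2) = inverse (sqrt D)"
    using D powr_minus[of D "1/2"] by (simp add: powr_half_sqrt)
  also have "of_real (sqrt (1 - \<tau>\<^sup>2)) * exp (- mehler_exp \<tau> 1 Y X) *
     (complex_of_real (inverse (sqrt D)) * exp (mehler_exp \<tau> 1 Y X))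
     = of_real (sqrt D * inverse (sqrt D)) * (exp (- mehler_exp \<tau> 1 Y X) * exp (mehler_exp \<tau> 1 Y X))"
    unfolding D_def of_real_mult by (simp only: mult_ac)
  also have "\<dots> = 1"
    using D by (simp add: exp_minus)
  finally show ?thesis .
qed

lemma mehler_exp_diag:
  assumes "0 \<le> \<tau>" "0 \<le> s" "s * \<tau> < 1"
  shows "mehler_exp \<tau> (of_real s) (cnj X) X = of_real (ell_gen \<tau> s X)"
proof -
  have st: "0 \<le> s * \<tau>" using assms by simp
  have "of_real s * cnj X * X - (of_real s)\<^sup>2 * of_real \<tau> * (X\<^sup>2 + (cnj X)\<^sup>2) / 2
     = of_real (s * ((Re X)\<^sup>2 + (Im X)\<^sup>2) - s\<^sup>2 * \<tau> * ((Re X)\<^sup>2 - (Im X)\<^sup>2))"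
    by (simp add: complex_eq_iff power2_eq_square field_simps)
  also have "s * ((Re X)\<^sup>2 + (Im X)\<^sup>2) - s\<^sup>2 * \<tau> * ((Re X)\<^sup>2 - (Im X)\<^sup>2)
     = s * (Re X)\<^sup>2 * (1 - s * \<tau>) + s * (Im X)\<^sup>2 * (1 + s * \<tau>)"
    by (simp add: power2_eq_square algebra_simps)
  finally have 1: "of_real s * cnj X * X - (of_real s)\<^sup>2 * of_real \<tau> * (X\<^sup>2 + (cnj X)\<^sup>2) / 2 = of_real \<dots>" .
  have 2: "(s * (Re X)\<^sup>2 * (1 - s * \<tau>) + s * (Im X)\<^sup>2 * (1 + s * \<tau>)) / (1 - (s * \<tau>)\<^sup>2) = ell_gen \<tau> s X"
  proof -
    have "1 - (s * \<tau>)\<^sup>2 = (1 + s * \<tau>) * (1 - s * \<tau>)" by (simp add: power2_eq_square algebra_simps)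
    moreover have "1 + s * \<tau> \<noteq> 0" "1 - s * \<tau> \<noteq> 0" using assms st by linarith+
    ultimately show ?thesis unfolding ell_gen_def by (simp add: add_divide_distrib)
  qed
  show ?thesis unfolding mehler_exp_def 1 2[symmetric] by simp
qed

lemma ell_gen_1:
  assumes "0 \<le> \<tau>" "\<tau> < 1"
  shows "ell_gen \<tau> 1 X = ell_weight \<tau> X"
proof -
  have "1 - \<tau>\<^sup>2 = (1 + \<tau>) * (1 - \<tau>)" by (simp add: power2_eq_square algebra_simps)
  moreover have "1 + \<tau> \<noteq> 0" "1 - \<tau> \<noteq> 0" using assms by linarith+
  moreover have "(cmod X)\<^sup>2 - \<tau> * Re (X\<^sup>2) = (Re X)\<^sup>2 * (1 - \<tau>) + (Im X)\<^sup>2 * (1 + \<tau>)"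
    by (simp add: cmod_power2 Re_power2 algebra_simps)
  ultimately show ?thesis unfolding ell_weight_def ell_gen_def
    by (simp add: add_divide_distrib)
qed

lemma cmod_herm_sq: "herm \<tau> k (cnj X) * herm \<tau> k X = of_real ((cmod (herm \<tau> k X))\<^sup>2)"
  by (simp add: herm_cnj complex_norm_square mult.commute del: of_real_power)

lemma nkern_diag:
  assumes "0 \<le> \<tau>" "\<tau> < 1"
  shows "nkern \<tau> n (cnj X) X = of_real (ndens \<tau> n X)"
proof -
  have "mehler_exp \<tau> 1 (cnj X) X = of_real (ell_weight \<tau> X)"
    using mehler_exp_diag[of \<tau> 1 X] ell_gen_1[of \<tau> X] assms by simp
  moreover have "mehler_sum \<tau> 1 n (cnj X) X = of_real (\<Sum>k<n. (cmod (herm \<tau> k X))\<^sup>2 / fact k)"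
    by (simp add: mehler_sum_def cmod_herm_sq del: of_real_power)
  ultimately show ?thesis unfolding nkern_def ndens_def
    by (simp add: exp_of_real[symmetric] del: of_real_sum)
qed

lemma ndens_tendsto_1:
  assumes "0 \<le> \<tau>" "\<tau> < 1"
  shows "(\<lambda>n. ndens \<tau> n X) \<longlonglongrightarrow> 1"
proof -
  have "(\<lambda>n. complex_of_real (ndens \<tau> n X)) \<longlonglongrightarrow> of_real 1"
    using nkern_tendsto_1[OF assms, of "cnj X" X] unfolding nkern_diag[OF assms] by simp
  then show ?thesis by (simp only: tendsto_of_real_iff)
qed

lemma ndens_mono:
  assumes "0 \<le> \<tau>" "\<tau> < 1" "n \<le> N"
  shows "ndens \<tau> n X \<le> ndens \<tau> N X"
  unfolding ndens_def using sq_less_one[of \<tau>] assms by (intro mult_left_mono sum_mono2) auto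

lemma ndens_range:
  assumes "0 \<le> \<tau>" "\<tau> < 1"
  shows "0 \<le> ndens \<tau> n X" "ndens \<tau> n X \<le> 1"
proof -
  show "0 \<le> ndens \<tau> n X"
    unfolding ndens_def using sq_less_one[of \<tau>] assms by (intro mult_nonneg_nonneg sum_nonneg) auto
  show "ndens \<tau> n X \<le> 1"
    by (rule LIMSEQ_le_const[OF ndens_tendsto_1[OF assms]]) (use ndens_mono[OF assms] in blast)
qed

text \<open>By polarisation of the quadratic form \<open>ell_weight\<close>. The term in
  \<open>X - Y\<close> measures by how much the normalising factor of \<open>nkern\<close> exceeds
  the geometric mean of the two diagonal ones; every off-diagonal bound has to pay for it.\<close>

lemma Re_mehler_exp:
  assumes "0 \<le> \<tau>" "\<tau> < 1"
  shows "Re (mehler_exp \<tau> 1 (cnj Y) X)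
     = (ell_weight \<tau> X + ell_weight \<tau> Y) / 2 - (cmod (X - Y))\<^sup>2 / (2 * (1 - \<tau>\<^sup>2))"
proof -
  define D where "D = 1 - \<tau>\<^sup>2"
  have D: "D > 0" using sq_less_one[OF assms] by (simp add: D_def)
  have "mehler_exp \<tau> 1 (cnj Y) X = (cnj Y * X - of_real \<tau> * (X\<^sup>2 + (cnj Y)\<^sup>2) / 2) / of_real D"
    by (simp add: mehler_exp_def D_def)
  then have "Re (mehler_exp \<tau> 1 (cnj Y) X) = Re (cnj Y * X - of_real \<tau> * (X\<^sup>2 + (cnj Y)\<^sup>2) / 2) / D"
    by (simp only: Re_divide_of_real)
  also have "Re (cnj Y * X - of_real \<tau> * (X\<^sup>2 + (cnj Y)\<^sup>2) / 2)
    = ((cmod X)\<^sup>2 - \<tau> * Re (X\<^sup>2) + ((cmod Y)\<^sup>2 - \<tau> * Re (Y\<^sup>2)) - (cmod (X - Y))\<^sup>2) / 2"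
    unfolding cmod_power2 by (simp add: power2_eq_square field_simps)
  finally show ?thesis unfolding ell_weight_def D_def[symmetric]
    by (simp add: add_divide_distrib diff_divide_distrib)
qed

text \<open>Stated for blocks of consecutive indices so that one inequality serves two purposes:
  \<open>n = 0\<close> bounds the kernel by the two densities, and \<open>N\<close> tending to
  infinity bounds its distance from 1 by the two tails. The Gaussian on the left is the excess
  computed in \<open>Re_mehler_exp\<close>.\<close>

lemma nkern_cauchy_schwarz:
  assumes \<tau>: "0 \<le> \<tau>" "\<tau> < 1" and "n \<le> N"
  shows "exp (- (cmod (X - Y))\<^sup>2 / (2 * (1 - \<tau>\<^sup>2))) * cmod (nkern \<tau> N (cnj Y) X - nkern \<tau> n (cnj Y) X)
    \<le> sqrt ((ndens \<tau> N Y - ndens \<tau> n Y) * (ndens \<tau> N X - ndens \<tau> n X))"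
proof -
  define D where "D = 1 - \<tau>\<^sup>2"
  have D: "D > 0" using sq_less_one[OF \<tau>] by (simp add: D_def)
  define u where "u X k = cmod (herm \<tau> k X) / sqrt (fact k)" for X k
  have diff: "(\<Sum>k<N. f k) - (\<Sum>k<n. f k) = (\<Sum>k\<in>{n..<N}. f k)" for f :: "nat \<Rightarrow> 'a::ab_group_add"
    using sum_diff_nat_ivl[of 0 n N f] assms by (simp add: lessThan_atLeast0)
  have dd: "ndens \<tau> N Z - ndens \<tau> n Z = sqrt D * exp (- ell_weight \<tau> Z) * (\<Sum>k\<in>{n..<N}. (u Z k)\<^sup>2)" for Z
    unfolding ndens_def D_def[symmetric] right_diff_distrib[symmetric] diff
    by (simp add: u_def power_divide)
  have "nkern \<tau> N (cnj Y) X - nkern \<tau> n (cnj Y) X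
     = of_real (sqrt D) * exp (- mehler_exp \<tau> 1 (cnj Y) X) * (\<Sum>k\<in>{n..<N}. herm \<tau> k (cnj Y) * herm \<tau> k X / fact k)"
    unfolding nkern_def mehler_sum_def D_def[symmetric] right_diff_distrib[symmetric] diff by simp
  then have "cmod (nkern \<tau> N (cnj Y) X - nkern \<tau> n (cnj Y) X)
     = sqrt D * exp (- Re (mehler_exp \<tau> 1 (cnj Y) X)) * cmod (\<Sum>k\<in>{n..<N}. herm \<tau> k (cnj Y) * herm \<tau> k X / fact k)"
    using D by (simp add: norm_mult)
  also have "\<dots> \<le> sqrt D * exp (- Re (mehler_exp \<tau> 1 (cnj Y) X)) * (\<Sum>k\<in>{n..<N}. u Y k * u X k)"
    using D by (intro mult_left_mono sum_norm_le)
      (auto simp: u_def norm_mult norm_divide herm_cnj)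
  also have "(\<Sum>k\<in>{n..<N}. u Y k * u X k) \<le> sqrt ((\<Sum>k\<in>{n..<N}. (u Y k)\<^sup>2) * (\<Sum>k\<in>{n..<N}. (u X k)\<^sup>2))"
    by (intro real_le_rsqrt Cauchy_Schwarz_ineq_sum)
  finally have le: "cmod (nkern \<tau> N (cnj Y) X - nkern \<tau> n (cnj Y) X)
     \<le> sqrt D * exp (- Re (mehler_exp \<tau> 1 (cnj Y) X)) * sqrt ((\<Sum>k\<in>{n..<N}. (u Y k)\<^sup>2) * (\<Sum>k\<in>{n..<N}. (u X k)\<^sup>2))"
    using D by (simp add: mult_left_mono)
  have ex: "exp (- (cmod (X - Y))\<^sup>2 / (2 * D)) * exp (- Re (mehler_exp \<tau> 1 (cnj Y) X))
     = sqrt (exp (- ell_weight \<tau> Y) * exp (- ell_weight \<tau> X))"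
  proof -
    have "sqrt (exp u) = exp (u / 2)" for u :: real
      by (rule real_sqrt_unique) (simp_all add: power2_eq_square flip: exp_add)
    then have "sqrt (exp (- ell_weight \<tau> Y) * exp (- ell_weight \<tau> X)) = exp ((- ell_weight \<tau> Y + - ell_weight \<tau> X) / 2)"
      unfolding exp_add[symmetric] .
    also have "\<dots> = exp (- (cmod (X - Y))\<^sup>2 / (2 * D) + - Re (mehler_exp \<tau> 1 (cnj Y) X))"
      unfolding Re_mehler_exp[OF \<tau>] D_def[symmetric] by (simp add: add_divide_distrib diff_divide_distrib)
    finally show ?thesis unfolding exp_add ..
  qed
  have "exp (- (cmod (X - Y))\<^sup>2 / (2 * D)) * cmod (nkern \<tau> N (cnj Y) X - nkern \<tau> n (cnj Y) X)
    \<le> exp (- (cmod (X - Y))\<^sup>2 / (2 * D)) * (sqrt D * exp (- Re (mehler_exp \<tau> 1 (cnj Y) X)) * sqrt ((\<Sum>k\<in>{n..<N}. (u Y k)\<^sup>2) * (\<Sum>k\<in>{n..<N}. (u X k)\<^sup>2)))"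
    using le by (intro mult_left_mono) auto
  also have "\<dots> = (exp (- (cmod (X - Y))\<^sup>2 / (2 * D)) * exp (- Re (mehler_exp \<tau> 1 (cnj Y) X))) * (sqrt D * sqrt ((\<Sum>k\<in>{n..<N}. (u Y k)\<^sup>2) * (\<Sum>k\<in>{n..<N}. (u X k)\<^sup>2)))"
    by (simp only: mult_ac)
  also have "\<dots> = sqrt ((ndens \<tau> N Y - ndens \<tau> n Y) * (ndens \<tau> N X - ndens \<tau> n X))"
  proof -
    have sD: "sqrt D * sqrt D = D" using D by simp
    have prod: "(sqrt D * a * b) * (sqrt D * c * d) = (a * c) * (D * (b * d))" for a b c d
    proof -
      have "(sqrt D * a * b) * (sqrt D * c * d) = (a * c) * ((sqrt D * sqrt D) * (b * d))"
        by (simp only: mult_ac)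
      then show ?thesis unfolding sD .
    qed
    have "sqrt ((ndens \<tau> N Y - ndens \<tau> n Y) * (ndens \<tau> N X - ndens \<tau> n X))
      = sqrt ((exp (- ell_weight \<tau> Y) * exp (- ell_weight \<tau> X)) * (D * ((\<Sum>k\<in>{n..<N}. (u Y k)\<^sup>2) * (\<Sum>k\<in>{n..<N}. (u X k)\<^sup>2))))"
      unfolding dd by (rule arg_cong[OF prod])
    then show ?thesis unfolding ex real_sqrt_mult by simp
  qed
  finally show ?thesis unfolding D_def .
qed

lemma nkern_bound:
  assumes \<tau>: "0 \<le> \<tau>" "\<tau> < 1"
  shows "exp (- (cmod (X - Y))\<^sup>2 / (2 * (1 - \<tau>\<^sup>2))) * cmod (nkern \<tau> n (cnj Y) X) \<le> sqrt (ndens \<tau> n Y * ndens \<tau> n X)"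
proof -
  have "nkern \<tau> 0 (cnj Y) X = 0" "ndens \<tau> 0 Z = 0" for Z
    by (simp_all add: nkern_def ndens_def mehler_sum_def)
  then show ?thesis using nkern_cauchy_schwarz[OF \<tau>, of 0 n X Y] by simp
qed

lemma one_minus_nkern_bound:
  assumes \<tau>: "0 \<le> \<tau>" "\<tau> < 1"
  shows "exp (- (cmod (X - Y))\<^sup>2 / (2 * (1 - \<tau>\<^sup>2))) * cmod (nkern \<tau> n (cnj Y) X - 1)
     \<le> sqrt ((1 - ndens \<tau> n Y) * (1 - ndens \<tau> n X))"
proof -
  have "exp (- (cmod (X - Y))\<^sup>2 / (2 * (1 - \<tau>\<^sup>2))) * cmod (1 - nkern \<tau> n (cnj Y) X)
     \<le> sqrt ((1 - ndens \<tau> n Y) * (1 - ndens \<tau> n X))"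
  proof (rule LIMSEQ_le)
    show "(\<lambda>N. exp (- (cmod (X - Y))\<^sup>2 / (2 * (1 - \<tau>\<^sup>2))) * cmod (nkern \<tau> N (cnj Y) X - nkern \<tau> n (cnj Y) X))
        \<longlonglongrightarrow> exp (- (cmod (X - Y))\<^sup>2 / (2 * (1 - \<tau>\<^sup>2))) * cmod (1 - nkern \<tau> n (cnj Y) X)"
      by (intro tendsto_intros nkern_tendsto_1 \<tau>)
    show "(\<lambda>N. sqrt ((ndens \<tau> N Y - ndens \<tau> n Y) * (ndens \<tau> N X - ndens \<tau> n X)))
        \<longlonglongrightarrow> sqrt ((1 - ndens \<tau> n Y) * (1 - ndens \<tau> n X))"
      by (intro tendsto_intros ndens_tendsto_1 \<tau>)
  qed (use nkern_cauchy_schwarz[OF \<tau>] in blast)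
  then show ?thesis by (simp add: norm_minus_commute)
qed

section \<open>Chernoff bounds from the generating function\<close>

lemma gen_sums:
  assumes "0 \<le> \<tau>" "0 \<le> s" "s * \<tau> < 1"
  shows "(\<lambda>k. s ^ k * ((cmod (herm \<tau> k X))\<^sup>2 / fact k)) sums (exp (ell_gen \<tau> s X) / sqrt (1 - (s * \<tau>)\<^sup>2))"
proof -
  have st: "0 < 1 - (s * \<tau>)\<^sup>2" using sq_less_one[of "s * \<tau>"] assms by simp
  have "(\<lambda>k. of_real s ^ k * herm \<tau> k (cnj X) * herm \<tau> k X / fact k) sums
    ((1 - (of_real s * of_real \<tau>)\<^sup>2) powr (- 1 / 2) * exp (mehler_exp \<tau> (of_real s) (cnj X) X))"
    using mehler[of \<tau> "of_real s"] assms by simp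
  moreover have "of_real s ^ k * herm \<tau> k (cnj X) * herm \<tau> k X / fact k = of_real (s ^ k * ((cmod (herm \<tau> k X))\<^sup>2 / fact k))" for k
    by (simp add: mult.assoc cmod_herm_sq del: of_real_power) simp
  moreover have "(1 - (complex_of_real s * of_real \<tau>)\<^sup>2) powr (- 1 / 2) = of_real ((1 - (s * \<tau>)\<^sup>2) powr (- 1 / 2))"
    using powr_of_real[of "1 - (s * \<tau>)\<^sup>2" "- 1 / 2"] st by simp
  moreover have "(1 - (s * \<tau>)\<^sup>2) powr (- 1 / 2) = inverse (sqrt (1 - (s * \<tau>)\<^sup>2))"
    using st powr_minus[of "1 - (s * \<tau>)\<^sup>2" "1/2"] by (simp add: powr_half_sqrt)
  moreover have "exp (mehler_exp \<tau> (of_real s) (cnj X) X) = of_real (exp (ell_gen \<tau> s X))"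
    using mehler_exp_diag[OF assms] by (simp add: exp_of_real)
  moreover have "exp (ell_gen \<tau> s X) / sqrt (1 - (s * \<tau>)\<^sup>2) = inverse (sqrt (1 - (s * \<tau>)\<^sup>2)) * exp (ell_gen \<tau> s X)"
    by (simp add: field_simps)
  ultimately have "(\<lambda>k. complex_of_real (s ^ k * ((cmod (herm \<tau> k X))\<^sup>2 / fact k))) sums
     of_real (exp (ell_gen \<tau> s X) / sqrt (1 - (s * \<tau>)\<^sup>2))"
    by (simp only: of_real_mult)
  then show ?thesis by (simp only: sums_of_real_iff)
qed

lemma gen_sums_1:
  assumes "0 \<le> \<tau>" "\<tau> < 1"
  shows "(\<lambda>k. (cmod (herm \<tau> k X))\<^sup>2 / fact k) sums (exp (ell_weight \<tau> X) / sqrt (1 - \<tau>\<^sup>2))"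
  using gen_sums[of \<tau> 1 X] assms by (simp add: ell_gen_1)

lemma sqrt_ratio_le_1:
  assumes "0 \<le> (\<tau>::real)" "\<tau> < 1" "0 < s" "s \<le> 1"
  shows "sqrt (1 - \<tau>\<^sup>2) / sqrt (1 - (s * \<tau>)\<^sup>2) \<le> 1"
proof -
  have "(s * \<tau>)\<^sup>2 \<le> \<tau>\<^sup>2" using assms by (intro power_mono) (auto simp: mult_left_le_one_le)
  then have "sqrt (1 - \<tau>\<^sup>2) \<le> sqrt (1 - (s * \<tau>)\<^sup>2)" by simp
  moreover have "0 < sqrt (1 - \<tau>\<^sup>2)" using sq_less_one[of \<tau>] assms by simp
  ultimately show ?thesis by (simp add: divide_le_eq_1)
qed

text \<open>For \<open>s \<le> 1\<close> every term with \<open>k < n\<close> satisfies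
  \<open>1 \<le> s^k / s^n\<close>, so the partial sum is at most \<open>1 / s^n\<close> times the
  generating function.\<close>

lemma ndens_upper:
  assumes \<tau>: "0 \<le> \<tau>" "\<tau> < 1" and s: "0 < s" "s \<le> 1"
  shows "ndens \<tau> n X \<le> inverse s ^ n * exp (ell_gen \<tau> s X - ell_gen \<tau> 1 X)"
proof -
  have st: "s * \<tau> < 1" using \<tau> s by (meson le_less_trans mult_left_le_one_le less_imp_le)
  define a where "a k = (cmod (herm \<tau> k X))\<^sup>2 / fact k" for k
  have a0: "a k \<ge> 0" for k by (simp add: a_def)
  have sums: "(\<lambda>k. s ^ k * a k) sums (exp (ell_gen \<tau> s X) / sqrt (1 - (s * \<tau>)\<^sup>2))"
    unfolding a_def using gen_sums[of \<tau> s X] \<tau> s st by simp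
  have "(\<Sum>k<n. a k) \<le> (\<Sum>k<n. inverse s ^ n * (s ^ k * a k))"
  proof (rule sum_mono)
    fix k assume "k \<in> {..<n}"
    then have "s ^ n \<le> s ^ k" using s by (intro power_decreasing) auto
    then have "1 \<le> inverse s ^ n * s ^ k" using s by (simp add: field_simps)
    then have "1 * a k \<le> (inverse s ^ n * s ^ k) * a k" using a0 by (intro mult_right_mono) auto
    then show "a k \<le> inverse s ^ n * (s ^ k * a k)" by (simp add: mult.assoc)
  qed
  also have "\<dots> = inverse s ^ n * (\<Sum>k<n. s ^ k * a k)" by (simp add: sum_distrib_left)
  also have "\<dots> \<le> inverse s ^ n * (exp (ell_gen \<tau> s X) / sqrt (1 - (s * \<tau>)\<^sup>2))"
    using s a0 sum_le_suminf[OF sums_summable[OF sums], of "{..<n}"] sums_unique[OF sums]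
    by (intro mult_left_mono) auto
  finally have "ndens \<tau> n X \<le> sqrt (1 - \<tau>\<^sup>2) * exp (- ell_gen \<tau> 1 X) * (inverse s ^ n * (exp (ell_gen \<tau> s X) / sqrt (1 - (s * \<tau>)\<^sup>2)))"
    unfolding ndens_def a_def ell_gen_1[OF \<tau>] using sq_less_one[OF \<tau>]
    by (intro mult_left_mono) auto
  also have "\<dots> = inverse s ^ n * exp (ell_gen \<tau> s X - ell_gen \<tau> 1 X) * (sqrt (1 - \<tau>\<^sup>2) / sqrt (1 - (s * \<tau>)\<^sup>2))"
    by (simp add: exp_diff exp_minus field_simps)
  also have "\<dots> \<le> inverse s ^ n * exp (ell_gen \<tau> s X - ell_gen \<tau> 1 X) * 1"
    using sqrt_ratio_le_1[OF \<tau> s] s by (intro mult_left_mono) auto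
  finally show ?thesis by simp
qed

text \<open>The same device for the upper tail \<open>k \<ge> n\<close> with
  \<open>s \<ge> 1\<close>. Mehler's formula reaches beyond 1 as long as
  \<open>s * \<tau> < 1\<close>; there the square root in the denominator may be small and has to be
  kept.\<close>

lemma ndens_lower:
  assumes \<tau>: "0 \<le> \<tau>" "\<tau> < 1" and s: "1 \<le> s" "s * \<tau> < 1"
  shows "1 - ndens \<tau> n X \<le> inverse s ^ n * exp (ell_gen \<tau> s X - ell_gen \<tau> 1 X) / sqrt (1 - (s * \<tau>)\<^sup>2)"
proof -
  define a where "a k = (cmod (herm \<tau> k X))\<^sup>2 / fact k" for k
  have a0: "a k \<ge> 0" for k by (simp add: a_def)
  have sums: "(\<lambda>k. s ^ k * a k) sums (exp (ell_gen \<tau> s X) / sqrt (1 - (s * \<tau>)\<^sup>2))"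
    unfolding a_def using gen_sums[of \<tau> s X] \<tau> s by simp
  have st0: "0 < 1 - (s * \<tau>)\<^sup>2" using sq_less_one[of "s * \<tau>"] assms by simp
  have diff: "ndens \<tau> N X - ndens \<tau> n X \<le> inverse s ^ n * exp (ell_gen \<tau> s X - ell_gen \<tau> 1 X) / sqrt (1 - (s * \<tau>)\<^sup>2)"
    if "n \<le> N" for N
  proof -
    have "(\<Sum>k<N. a k) - (\<Sum>k<n. a k) = (\<Sum>k\<in>{n..<N}. a k)"
      using sum_diff_nat_ivl[of 0 n N a] that by (simp add: lessThan_atLeast0)
    also have "\<dots> \<le> (\<Sum>k\<in>{n..<N}. inverse s ^ n * (s ^ k * a k))"
    proof (rule sum_mono)
      fix k assume "k \<in> {n..<N}"
      then have "s ^ n \<le> s ^ k" using s by (intro power_increasing) auto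
      then have "1 \<le> inverse s ^ n * s ^ k" using s by (simp add: field_simps)
      then have "1 * a k \<le> (inverse s ^ n * s ^ k) * a k" using a0 by (intro mult_right_mono) auto
      then show "a k \<le> inverse s ^ n * (s ^ k * a k)" by (simp add: mult.assoc)
    qed
    also have "\<dots> = inverse s ^ n * (\<Sum>k\<in>{n..<N}. s ^ k * a k)" by (simp add: sum_distrib_left)
    also have "\<dots> \<le> inverse s ^ n * (exp (ell_gen \<tau> s X) / sqrt (1 - (s * \<tau>)\<^sup>2))"
      using s a0 sum_le_suminf[OF sums_summable[OF sums], of "{n..<N}"] sums_unique[OF sums]
      by (intro mult_left_mono) auto
    finally have le: "(\<Sum>k<N. a k) - (\<Sum>k<n. a k) \<le> \<dots>" .
    have "ndens \<tau> N X - ndens \<tau> n X = sqrt (1 - \<tau>\<^sup>2) * exp (- ell_gen \<tau> 1 X) * ((\<Sum>k<N. a k) - (\<Sum>k<n. a k))"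
      unfolding ndens_def a_def ell_gen_1[OF \<tau>] by (simp add: algebra_simps)
    also have "\<dots> \<le> sqrt (1 - \<tau>\<^sup>2) * exp (- ell_gen \<tau> 1 X) * (inverse s ^ n * (exp (ell_gen \<tau> s X) / sqrt (1 - (s * \<tau>)\<^sup>2)))"
      using le sq_less_one[OF \<tau>] by (intro mult_left_mono) auto
    also have "\<dots> = (inverse s ^ n * exp (ell_gen \<tau> s X - ell_gen \<tau> 1 X) / sqrt (1 - (s * \<tau>)\<^sup>2)) * sqrt (1 - \<tau>\<^sup>2)"
      by (simp add: exp_diff exp_minus field_simps)
    also have "\<dots> \<le> (inverse s ^ n * exp (ell_gen \<tau> s X - ell_gen \<tau> 1 X) / sqrt (1 - (s * \<tau>)\<^sup>2)) * 1"
      using s st0 by (intro mult_left_mono) auto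
    finally show ?thesis by simp
  qed
  have "(\<lambda>N. ndens \<tau> N X - ndens \<tau> n X) \<longlonglongrightarrow> 1 - ndens \<tau> n X"
    by (intro tendsto_intros ndens_tendsto_1 \<tau>)
  then show ?thesis by (rule LIMSEQ_le_const2) (use diff in blast)
qed

lemma ell_gen_diff:
  assumes "0 \<le> \<tau>" "\<tau> < 1" "0 \<le> s" "s * \<tau> < 1"
  shows "ell_gen \<tau> s X - ell_gen \<tau> 1 X
    = (s - 1) * ((Re X)\<^sup>2 / ((1 + s * \<tau>) * (1 + \<tau>)) + (Im X)\<^sup>2 / ((1 - s * \<tau>) * (1 - \<tau>)))"
proof -
  have "0 \<le> s * \<tau>" using assms by simp
  then have nz: "1 + s * \<tau> \<noteq> 0" "1 + \<tau> \<noteq> 0" "1 - s * \<tau> \<noteq> 0" "1 - \<tau> \<noteq> 0" using assms by linarith+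
  have 1: "s * a / (1 + s * \<tau>) - a / (1 + \<tau>) = (s - 1) * (a / ((1 + s * \<tau>) * (1 + \<tau>)))" for a
    using nz by (simp add: field_simps)
  have 2: "s * a / (1 - s * \<tau>) - a / (1 - \<tau>) = (s - 1) * (a / ((1 - s * \<tau>) * (1 - \<tau>)))" for a
    using nz by (simp add: field_simps)
  show ?thesis unfolding ell_gen_def using 1[of "(Re X)\<^sup>2"] 2[of "(Im X)\<^sup>2"] by (simp add: algebra_simps)
qed

lemma ellq_nonneg: "0 \<le> ellq \<tau> X"
  by (simp add: ellq_def)

text \<open>Compares \<open>ell_gen\<close> with its tangent at \<open>s = 1\<close>, whose slope is
  \<open>ellq\<close>. The correction factor is exact along the imaginary axis and generous along
  the real one, so a single factor serves both.\<close>

lemma ell_gen_diff_upper: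
  assumes \<tau>: "0 \<le> \<tau>" "\<tau> < 1" and s: "1 \<le> s" "s * \<tau> < 1"
  shows "ell_gen \<tau> s X - ell_gen \<tau> 1 X \<le> (s - 1) * (ellq \<tau> X * ((1 - \<tau>) / (1 - s * \<tau>)))"
proof -
  have "\<tau> * 1 \<le> \<tau> * s" using \<tau> s by (intro mult_left_mono) auto
  then have m: "\<tau> \<le> s * \<tau>" by (simp add: mult.commute)
  have r: "1 \<le> (1 - \<tau>) / (1 - s * \<tau>)" using m s by (simp add: le_divide_eq)
  have "(Re X)\<^sup>2 / ((1 + s * \<tau>) * (1 + \<tau>)) \<le> (Re X)\<^sup>2 / ((1 + \<tau>) * (1 + \<tau>))"
    using m \<tau> s by (intro divide_left_mono mult_right_mono mult_pos_pos) auto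
  also have "\<dots> \<le> (Re X)\<^sup>2 / ((1 + \<tau>) * (1 + \<tau>)) * ((1 - \<tau>) / (1 - s * \<tau>))"
    using mult_left_mono[OF r, of "(Re X)\<^sup>2 / ((1 + \<tau>) * (1 + \<tau>))"] \<tau> by simp
  finally have 1: "(Re X)\<^sup>2 / ((1 + s * \<tau>) * (1 + \<tau>)) \<le> (Re X)\<^sup>2 / (1 + \<tau>)\<^sup>2 * ((1 - \<tau>) / (1 - s * \<tau>))"
    by (simp add: power2_eq_square)
  have 2: "(Im X)\<^sup>2 / ((1 - s * \<tau>) * (1 - \<tau>)) = (Im X)\<^sup>2 / (1 - \<tau>)\<^sup>2 * ((1 - \<tau>) / (1 - s * \<tau>))"
    using \<tau> s by (simp add: power2_eq_square)
  show ?thesis unfolding ell_gen_diff[OF \<tau> _ s(2), of X, OF order_trans[OF zero_le_one s(1)]] ellq_def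
    unfolding distrib_right[of _ _ "(1 - \<tau>) / (1 - s * \<tau>)"]
    using add_mono[OF 1 eq_refl[OF 2]] s by (intro mult_left_mono) auto
qed

text \<open>The tangent comparison on the other side. The factor is now at most 1: it is still exact
  in the imaginary direction and weakens the contribution of the real one.\<close>

lemma ell_gen_diff_lower:
  assumes \<tau>: "0 \<le> \<tau>" "\<tau> < 1" and s: "0 \<le> s" "s \<le> 1"
  shows "ell_gen \<tau> s X - ell_gen \<tau> 1 X \<le> - (1 - s) * (ellq \<tau> X * ((1 - \<tau>) / (1 - s * \<tau>)))"
proof -
  have "s * \<tau> \<le> 1 * \<tau>" using \<tau> s by (intro mult_right_mono) auto
  then have m: "s * \<tau> \<le> \<tau>" "s * \<tau> < 1" "0 \<le> s * \<tau>" using \<tau> s by auto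
  have r: "(1 - \<tau>) / (1 - s * \<tau>) \<le> 1" using m by (simp add: divide_le_eq)
  have "(Re X)\<^sup>2 / (1 + \<tau>)\<^sup>2 * ((1 - \<tau>) / (1 - s * \<tau>)) \<le> (Re X)\<^sup>2 / (1 + \<tau>)\<^sup>2"
    using mult_left_mono[OF r, of "(Re X)\<^sup>2 / (1 + \<tau>)\<^sup>2"] by simp
  also have "\<dots> \<le> (Re X)\<^sup>2 / ((1 + s * \<tau>) * (1 + \<tau>))"
    unfolding power2_eq_square[of "1 + \<tau>"]
    using m \<tau> s by (intro divide_left_mono mult_right_mono mult_pos_pos) (auto intro: add_pos_nonneg)
  finally have 1: "(Re X)\<^sup>2 / (1 + \<tau>)\<^sup>2 * ((1 - \<tau>) / (1 - s * \<tau>)) \<le> (Re X)\<^sup>2 / ((1 + s * \<tau>) * (1 + \<tau>))" .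
  have 2: "(Im X)\<^sup>2 / ((1 - s * \<tau>) * (1 - \<tau>)) = (Im X)\<^sup>2 / (1 - \<tau>)\<^sup>2 * ((1 - \<tau>) / (1 - s * \<tau>))"
    using \<tau> s by (simp add: power2_eq_square)
  have flip: "(s - 1) * z \<le> - (1 - s) * w" if "(1 - s) * w \<le> (1 - s) * z" for w z
    using that by (simp add: algebra_simps)
  show ?thesis unfolding ell_gen_diff[OF \<tau> s(1) m(2)]
  proof (rule flip)
    show "(1 - s) * (ellq \<tau> X * ((1 - \<tau>) / (1 - s * \<tau>)))
     \<le> (1 - s) * ((Re X)\<^sup>2 / ((1 + s * \<tau>) * (1 + \<tau>)) + (Im X)\<^sup>2 / ((1 - s * \<tau>) * (1 - \<tau>)))"
    unfolding ellq_def distrib_right[of _ _ "(1 - \<tau>) / (1 - s * \<tau>)"]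
    using add_mono[OF 1 eq_refl[OF 2[symmetric]]] s by (intro mult_left_mono) auto
  qed
qed

text \<open>Chernoff with \<open>s = 1 + e\<close> for one small \<open>e\<close> that depends only
  on \<delta> and \<open>q\<close>. The leading part \<open>ellq\<close> of the mean stays a fixed
  fraction below the threshold \<open>n\<close>, so the first-order gain beats the second-order loss
  uniformly in \<tau> and \<open>X\<close>.\<close>

lemma ndens_interior:
  assumes \<delta>: "0 < \<delta>" "\<delta> \<le> 1" and q: "0 \<le> q" "q < 1"
  obtains C r where "0 < C" "0 < r" "r < 1"
    "\<And>\<tau> n X. 0 \<le> \<tau> \<Longrightarrow> \<tau> \<le> 1 - \<delta> \<Longrightarrow> ellq \<tau> X \<le> real n * q \<Longrightarrow> 1 - ndens \<tau> n X \<le> C * r ^ n"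
proof -
  \<comment> \<open>Chosen so that \<open>e * (1 + 1 / \<delta>)\<close> is half of the gap
    \<open>1 - q\<close>. Then \<open>q * (1 + e) < 1 - e / \<delta>\<close>, where
    \<open>e / \<delta>\<close> bounds the relative decrease from \<open>1 - \<tau>\<close> to
    \<open>1 - s * \<tau>\<close>.\<close>
  define e where "e = (1 - q) / (2 * (1 + 1 / \<delta>))"
  have e0: "0 < e" using \<delta> q by (simp add: e_def add_pos_pos)
  have pos: "1 + 1 / \<delta> > 0" using \<delta> by (simp add: add_pos_pos)
  have half: "2 * (a / (2 * b)) * b = a" if "b > 0" for a b :: real using that by simp
  have e2: "2 * e * (1 + 1 / \<delta>) = 1 - q" unfolding e_def by (rule half[OF pos])
  have ed: "e \<le> \<delta> / 2"
  proof -
    have "2 * (e / \<delta>) \<le> 1" using e2 e0 q by (simp add: algebra_simps)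
    then show ?thesis using \<delta> by (simp add: field_simps)
  qed
  \<comment> \<open>The ratio of the geometric Chernoff bound at \<open>s = 1 + e\<close>; it lies
    below 1 because \<open>ln (1 + e) \<ge> e / (1 + e)\<close>.\<close>
  define r where "r = exp (e * (q / (1 - e / \<delta>))) / (1 + e)"
  have edl: "e / \<delta> < 1" using ed \<delta> e0 by (simp add: field_simps)
  have r1: "r < 1"
  proof -
    have "q * (1 + e) < 1 - e / \<delta>"
    proof -
      have "q * e \<le> 1 * e" using q e0 by (intro mult_right_mono) auto
      moreover have "e * (1 + 1 / \<delta>) < 1 - q" using e2 q by linarith
      ultimately show ?thesis by (simp add: algebra_simps)
    qed
    then have "q / (1 - e / \<delta>) < 1 / (1 + e)" using edl e0 by (simp add: field_simps)
    then have "e * (q / (1 - e / \<delta>)) < e * (1 / (1 + e))" using e0 by (intro mult_strict_left_mono)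
    also have "\<dots> \<le> ln (1 + e)"
      using ln_add_one_self_le_self2[of "- e / (1 + e)"] e0
      by (simp add: field_simps ln_div)
    finally have "exp (e * (q / (1 - e / \<delta>))) < exp (ln (1 + e))" by (simp only: exp_less_cancel_iff)
    then have "exp (e * (q / (1 - e / \<delta>))) < 1 + e" using e0 by simp
    then show ?thesis unfolding r_def using e0 by simp
  qed
  have main: "1 - ndens \<tau> n X \<le> (1 / sqrt (\<delta> / 2)) * r ^ n"
    if \<tau>: "0 \<le> \<tau>" "\<tau> \<le> 1 - \<delta>" and Q: "ellq \<tau> X \<le> real n * q" for \<tau> n X
  proof -
    define s where "s = 1 + e"
    have \<tau>1: "\<tau> < 1" using \<tau> \<delta> by linarith
    have "e * \<tau> \<le> e * 1" using e0 \<tau>1 by (intro mult_left_mono) auto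
    then have "1 - s * \<tau> \<ge> (1 - \<tau>) - e" by (simp add: s_def algebra_simps)
    moreover have "(1 - \<tau>) * (e / \<delta>) \<ge> e"
    proof -
      have "\<delta> * (e / \<delta>) \<le> (1 - \<tau>) * (e / \<delta>)" using \<tau> e0 \<delta> by (intro mult_right_mono) auto
      then show ?thesis using \<delta> by simp
    qed
    ultimately have s1: "1 - s * \<tau> \<ge> (1 - \<tau>) - e" "1 - s * \<tau> \<ge> (1 - \<tau>) * (1 - e / \<delta>)"
      by (auto simp: algebra_simps)
    have s2: "1 - s * \<tau> \<ge> \<delta> / 2" using s1(1) ed \<tau> by linarith
    then have s3: "s * \<tau> < 1" using \<delta> by linarith
    have ss: "1 \<le> s" using e0 by (simp add: s_def)
    have ratio: "(1 - \<tau>) / (1 - s * \<tau>) \<le> 1 / (1 - e / \<delta>)"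
      using s1(2) s3 edl by (simp add: field_simps)
    have "ellq \<tau> X * ((1 - \<tau>) / (1 - s * \<tau>)) \<le> (real n * q) * (1 / (1 - e / \<delta>))"
      using Q ratio \<tau>1 s3 q by (intro mult_mono) auto
    then have "e * (ellq \<tau> X * ((1 - \<tau>) / (1 - s * \<tau>))) \<le> e * ((real n * q) * (1 / (1 - e / \<delta>)))"
      using e0 by (intro mult_left_mono) auto
    then have g: "ell_gen \<tau> s X - ell_gen \<tau> 1 X \<le> real n * (e * (q / (1 - e / \<delta>)))"
      using ell_gen_diff_upper[OF \<tau>(1) \<tau>1 ss s3, of X] by (simp add: s_def mult_ac)
    have "0 \<le> s * \<tau>" using ss \<tau> by simp
    then have "(s * \<tau>)\<^sup>2 \<le> s * \<tau>" using s3 by (simp add: power2_eq_square mult_left_le_one_le)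
    then have p: "\<delta> / 2 \<le> 1 - (s * \<tau>)\<^sup>2" using s2 by linarith
    have "1 - ndens \<tau> n X \<le> inverse s ^ n * exp (ell_gen \<tau> s X - ell_gen \<tau> 1 X) / sqrt (1 - (s * \<tau>)\<^sup>2)"
      by (rule ndens_lower[OF \<tau>(1) \<tau>1 ss s3])
    also have "\<dots> \<le> inverse s ^ n * exp (real n * (e * (q / (1 - e / \<delta>)))) / sqrt (\<delta> / 2)"
      using g p ss \<delta> by (intro frac_le mult_left_mono mult_nonneg_nonneg) auto
    also have "\<dots> = (1 / sqrt (\<delta> / 2)) * r ^ n"
      unfolding exp_of_nat_mult r_def by (simp add: s_def power_divide field_simps)
    finally show ?thesis .
  qed
  have "0 < r" unfolding r_def using e0 by simp
  then show ?thesis using that[of "1 / sqrt (\<delta> / 2)" r] main r1 \<delta> by simp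
qed

text \<open>The mirror image with \<open>s = 1 - e\<close>, based on
  \<open>- ln (1 - e) \<le> e / (1 - e)\<close>. There is no constant in front of
  \<open>r^n\<close>, since for \<open>s \<le> 1\<close> the ratio of the square roots is at most
  1.\<close>

lemma ndens_exterior:
  assumes \<delta>: "0 < \<delta>" "\<delta> \<le> 1" and q: "1 < q"
  obtains r where "0 < r" "r < 1"
    "\<And>\<tau> n X. 0 \<le> \<tau> \<Longrightarrow> \<tau> \<le> 1 - \<delta> \<Longrightarrow> real n * q \<le> ellq \<tau> X \<Longrightarrow> ndens \<tau> n X \<le> r ^ n"
proof -
  \<comment> \<open>Then \<open>1 + e / \<delta> < q * (1 - e)\<close>, which makes the ratio
    \<open>r\<close> smaller than 1; here \<delta> enters through
    \<open>1 - s * \<tau> \<le> (1 - \<tau>) * (1 + e / \<delta>)\<close>.\<close>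
  define e where "e = (q - 1) / (2 * (q + 1 / \<delta>))"
  have pos: "q + 1 / \<delta> > 0" using \<delta> q by (simp add: add_pos_pos)
  have e0: "0 < e" using \<delta> q pos by (simp add: e_def)
  have half: "2 * (a / (2 * b)) * b = a" if "b > 0" for a b :: real using that by simp
  have e2: "2 * e * (q + 1 / \<delta>) = q - 1" unfolding e_def by (rule half[OF pos])
  have e1: "e < 1"
  proof -
    have "e * q \<le> e * (q + 1 / \<delta>)" using e0 \<delta> by (intro mult_left_mono) auto
    also have "\<dots> < 1 * q" using e2 q by linarith
    finally show ?thesis using q by simp
  qed
  define r where "r = exp (- (e * (q / (1 + e / \<delta>)))) / (1 - e)"
  have edp: "1 + e / \<delta> > 0" using \<delta> e0 by (simp add: add_pos_pos)
  have r1: "r < 1"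
  proof -
    have "1 + e / \<delta> < q * (1 - e)"
    proof -
      have "e * (q + 1 / \<delta>) < q - 1" using e2 q by linarith
      then show ?thesis by (simp add: algebra_simps)
    qed
    then have "1 / (1 - e) < q / (1 + e / \<delta>)" using edp e1 by (simp add: field_simps)
    then have "e * (1 / (1 - e)) < e * (q / (1 + e / \<delta>))" using e0 by (intro mult_strict_left_mono)
    moreover have "- ln (1 - e) \<le> e * (1 / (1 - e))"
      using ln_add_one_self_le_self2[of "e / (1 - e)"] e0 e1
      by (simp add: field_simps ln_div)
    ultimately have "- (e * (q / (1 + e / \<delta>))) < ln (1 - e)" by linarith
    then have "exp (- (e * (q / (1 + e / \<delta>)))) < exp (ln (1 - e))" by (simp only: exp_less_cancel_iff)
    then have "exp (- (e * (q / (1 + e / \<delta>)))) < 1 - e" using e1 by simp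
    then show ?thesis unfolding r_def using e1 by simp
  qed
  have main: "ndens \<tau> n X \<le> r ^ n"
    if \<tau>: "0 \<le> \<tau>" "\<tau> \<le> 1 - \<delta>" and Q: "real n * q \<le> ellq \<tau> X" for \<tau> n X
  proof -
    define s where "s = 1 - e"
    have \<tau>1: "\<tau> < 1" using \<tau> \<delta> by linarith
    have ss: "0 < s" "s \<le> 1" using e0 e1 by (auto simp: s_def)
    have "s * \<tau> \<le> 1 * \<tau>" using ss \<tau> by (intro mult_right_mono) auto
    then have s3: "1 - s * \<tau> > 0" using \<tau>1 by simp
    have "e * \<tau> \<le> (1 - \<tau>) * (e / \<delta>)"
    proof -
      have "e * \<tau> \<le> e * 1" using e0 \<tau>1 by (intro mult_left_mono) auto
      also have "\<dots> = \<delta> * (e / \<delta>)" using \<delta> by simp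
      also have "\<dots> \<le> (1 - \<tau>) * (e / \<delta>)" using \<tau> e0 \<delta> by (intro mult_right_mono) auto
      finally show ?thesis .
    qed
    then have sb: "1 - s * \<tau> \<le> (1 - \<tau>) * (1 + e / \<delta>)" by (simp add: s_def algebra_simps)
    have ratio: "1 / (1 + e / \<delta>) \<le> (1 - \<tau>) / (1 - s * \<tau>)"
    proof -
      have "1 / b \<le> a / c" if "c \<le> a * b" "0 < b" "0 < c" for a b c :: real
        using that by (simp add: field_simps)
      from this[OF sb edp s3] show ?thesis .
    qed
    have "(real n * q) * (1 / (1 + e / \<delta>)) \<le> ellq \<tau> X * ((1 - \<tau>) / (1 - s * \<tau>))"
      using Q ratio edp q ellq_nonneg by (intro mult_mono) auto
    then have "e * ((real n * q) * (1 / (1 + e / \<delta>))) \<le> e * (ellq \<tau> X * ((1 - \<tau>) / (1 - s * \<tau>)))"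
      using e0 by (intro mult_left_mono) auto
    then have g: "ell_gen \<tau> s X - ell_gen \<tau> 1 X \<le> real n * (- (e * (q / (1 + e / \<delta>))))"
      using ell_gen_diff_lower[OF \<tau>(1) \<tau>1 less_imp_le[OF ss(1)] ss(2), of X] by (simp add: s_def mult_ac)
    have "ndens \<tau> n X \<le> inverse s ^ n * exp (ell_gen \<tau> s X - ell_gen \<tau> 1 X)"
      by (rule ndens_upper[OF \<tau>(1) \<tau>1 ss])
    also have "\<dots> \<le> inverse s ^ n * exp (real n * (- (e * (q / (1 + e / \<delta>)))))"
      using g ss by (intro mult_left_mono) auto
    also have "\<dots> = r ^ n"
      unfolding exp_of_nat_mult r_def by (simp add: s_def power_divide field_simps)
    finally show ?thesis .
  qed
  have "0 < r" unfolding r_def using e1 by simp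
  then show ?thesis using that[of r] main r1 by simp
qed

section \<open>Gaussian integrals\<close>

lemma measurable_Complex [measurable]:
  "(\<lambda>(x, y). Complex x y) \<in> borel_measurable (lborel \<Otimes>\<^sub>M lborel)"
  unfolding borel_measurable_complex_iff by (simp add: case_prod_beta)

text \<open>Both measures agree on boxes, which determines Lebesgue measure. The product form opens
  the way to Tonelli's theorem for integrals over the plane.\<close>

lemma lborel_complex: "lborel = distr (lborel \<Otimes>\<^sub>M lborel) borel (\<lambda>(x, y). Complex x y)"
proof (rule lborel_eqI)
  fix l u :: complex
  assume b: "\<And>b. b \<in> Basis \<Longrightarrow> l \<bullet> b \<le> u \<bullet> b"
  have le: "Re l \<le> Re u" "Im l \<le> Im u"
    using b[of 1] b[of \<i>] by (auto simp: Basis_complex_def)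
  have "(\<lambda>(x, y). Complex x y) -` box l u \<inter> space (lborel \<Otimes>\<^sub>M lborel) = {Re l<..<Re u} \<times> {Im l<..<Im u}"
    by (auto simp: space_pair_measure in_box_complex_iff)
  then have "emeasure (distr (lborel \<Otimes>\<^sub>M lborel) borel (\<lambda>(x, y). Complex x y)) (box l u)
      = emeasure (lborel \<Otimes>\<^sub>M lborel) ({Re l<..<Re u} \<times> {Im l<..<Im u})"
    by (subst emeasure_distr) auto
  also have "\<dots> = ennreal (Re u - Re l) * ennreal (Im u - Im l)"
    using le by (subst lborel.emeasure_pair_measure_Times) auto
  also have "\<dots> = (\<Prod>b\<in>Basis. (u - l) \<bullet> b)"
    using le by (simp add: Basis_complex_def ennreal_mult inner_diff_left)
  finally show "emeasure (distr (lborel \<Otimes>\<^sub>M lborel) borel (\<lambda>(x, y). Complex x y)) (box l u)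
      = (\<Prod>b\<in>Basis. (u - l) \<bullet> b)" .
qed simp

lemma nn_integral_gauss:
  assumes "0 < a"
  shows "(\<integral>\<^sup>+x. ennreal (exp (- (a * (x - m)\<^sup>2))) \<partial>lborel) = ennreal (sqrt (pi / a))"
proof -
  define \<sigma> where "\<sigma> = sqrt (1 / (2 * a))"
  have \<sigma>2: "\<sigma>\<^sup>2 = 1 / (2 * a)" using assms by (simp add: \<sigma>_def)
  have e: "exp (- (a * (x - m)\<^sup>2)) = sqrt (pi / a) * normal_density m \<sigma> x" for x
    using assms unfolding normal_density_def \<sigma>2 by (simp add: real_sqrt_divide mult.commute)
  have "(\<integral>\<^sup>+x. ennreal (normal_density m \<sigma> x) \<partial>lborel) = ennreal 1"
    using assms by (subst nn_integral_eq_integral) (auto simp: \<sigma>_def)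
  then show ?thesis
    unfolding e using assms by (simp add: ennreal_mult' nn_integral_cmult)
qed

lemma nn_integral_gauss_complex:
  assumes "0 < C" "0 < A * C - B\<^sup>2"
  shows "(\<integral>\<^sup>+z. ennreal (exp (- (A * (Re z)\<^sup>2 + 2 * B * (Re z * Im z) + C * (Im z)\<^sup>2))) \<partial>lborel)
    = ennreal (pi / sqrt (A * C - B\<^sup>2))"
proof -
  let ?f = "\<lambda>z. ennreal (exp (- (A * (Re z)\<^sup>2 + 2 * B * (Re z * Im z) + C * (Im z)\<^sup>2)))"
  \<comment> \<open>The coefficient left for \<open>Re z\<close> after completing the square in
    \<open>Im z\<close>, that is the Schur complement of \<open>C\<close>.\<close>
  define D where "D = (A * C - B\<^sup>2) / C"
  have D: "0 < D" using assms by (simp add: D_def)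
  have split: "?f (Complex x y) = ennreal (exp (- (D * (x - 0)\<^sup>2))) * ennreal (exp (- (C * (y - (- B / C * x))\<^sup>2)))" for x y
  proof -
    have "A * x\<^sup>2 + 2 * B * (x * y) + C * y\<^sup>2 = D * (x - 0)\<^sup>2 + C * (y - (- B / C * x))\<^sup>2"
      using assms by (simp add: D_def power2_eq_square field_simps)
    then show ?thesis by (simp add: ennreal_mult[symmetric] exp_add[symmetric])
  qed
  have "(\<integral>\<^sup>+z. ?f z \<partial>lborel) = (\<integral>\<^sup>+p. ?f (case p of (x, y) \<Rightarrow> Complex x y) \<partial>(lborel \<Otimes>\<^sub>M lborel))"
    by (subst lborel_complex, subst nn_integral_distr) auto
  also have "\<dots> = (\<integral>\<^sup>+p. (case p of (x, y) \<Rightarrow> ?f (Complex x y)) \<partial>(lborel \<Otimes>\<^sub>M lborel))"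
    by (intro nn_integral_cong) auto
  also have "\<dots> = (\<integral>\<^sup>+x. (\<integral>\<^sup>+y. ?f (Complex x y) \<partial>lborel) \<partial>lborel)"
    by (subst lborel.nn_integral_fst[symmetric]) auto
  also have "\<dots> = (\<integral>\<^sup>+x. ennreal (exp (- (D * (x - 0)\<^sup>2))) * ennreal (sqrt (pi / C)) \<partial>lborel)"
    unfolding split
  proof (rule nn_integral_cong)
    fix x
    show "(\<integral>\<^sup>+y. ennreal (exp (- (D * (x - 0)\<^sup>2))) * ennreal (exp (- (C * (y - (- B / C * x))\<^sup>2))) \<partial>lborel)
        = ennreal (exp (- (D * (x - 0)\<^sup>2))) * ennreal (sqrt (pi / C))"
      unfolding nn_integral_gauss[OF assms(1), of "- B / C * x", symmetric]
      by (rule nn_integral_cmult) measurable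
  qed
  also have "\<dots> = ennreal (sqrt (pi / D)) * ennreal (sqrt (pi / C))"
    by (subst nn_integral_multc) (use nn_integral_gauss[OF D, of 0] in auto)
  also have "\<dots> = ennreal (sqrt (pi / D * (pi / C)))"
    using assms D by (simp only: real_sqrt_mult) (simp add: ennreal_mult)
  also have "pi / D * (pi / C) = pi\<^sup>2 / (A * C - B\<^sup>2)"
    using assms by (simp add: D_def power2_eq_square)
  also have "sqrt \<dots> = pi / sqrt (A * C - B\<^sup>2)"
    by (simp add: real_sqrt_divide)
  finally show ?thesis .
qed

lemma integrable_gauss_complex:
  assumes "0 < \<eta>"
  shows "integrable lborel (\<lambda>z::complex. exp (- (\<eta> * (cmod z)\<^sup>2)))"
proof (rule integrableI_nonneg)
  have "(\<integral>\<^sup>+z. ennreal (exp (- (\<eta> * (cmod z)\<^sup>2))) \<partial>lborel)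
     = (\<integral>\<^sup>+z. ennreal (exp (- (\<eta> * (Re z)\<^sup>2 + 2 * 0 * (Re z * Im z) + \<eta> * (Im z)\<^sup>2))) \<partial>lborel)"
    by (simp add: cmod_power2 algebra_simps)
  also have "\<dots> = ennreal (pi / sqrt (\<eta> * \<eta> - 0\<^sup>2))"
    by (rule nn_integral_gauss_complex) (use assms in auto)
  finally show "(\<integral>\<^sup>+z. ennreal (exp (- (\<eta> * (cmod z)\<^sup>2))) \<partial>lborel) < \<infinity>" by simp
qed auto

section \<open>Integration by parts on the plane\<close>

lemma lborel_translate:
  fixes f :: "complex \<Rightarrow> 'b::{banach, second_countable_topology}"
  assumes "integrable lborel f"
  shows "integrable lborel (\<lambda>z. f (z + c))" "(\<integral>z. f (z + c) \<partial>lborel) = (\<integral>z. f z \<partial>lborel)"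
proof -
  have [measurable]: "f \<in> borel_measurable borel" using assms by auto
  have "integrable (distr lborel borel ((+) c)) f" unfolding lborel_distr_plus by fact
  then show "integrable lborel (\<lambda>z. f (z + c))"
    by (subst (asm) integrable_distr_eq) (auto simp: add.commute)
  have "(\<integral>z. f z \<partial>lborel) = (\<integral>z. f z \<partial>(distr lborel borel ((+) c)))" unfolding lborel_distr_plus ..
  also have "\<dots> = (\<integral>z. f (c + z) \<partial>lborel)" by (subst integral_distr) auto
  finally show "(\<integral>z. f (z + c) \<partial>lborel) = (\<integral>z. f z \<partial>lborel)" by (simp add: add.commute)
qed

text \<open>By translation invariance \<open>F (z + d) - F z\<close> integrates to 0. Written as the
  integral of \<open>F'\<close> along the segment from \<open>z\<close> to \<open>z + d\<close>,
  Fubini's theorem and translation invariance turn the same quantity into the integral of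
  \<open>F'\<close>.\<close>

lemma integral_directional_derivative:
  fixes F F' :: "complex \<Rightarrow> complex" and d :: complex
  assumes der: "\<And>z. ((\<lambda>t::real. F (z + of_real t * d)) has_vector_derivative F' z) (at 0)"
    and cont: "continuous_on UNIV F'"
    and int: "integrable lborel F" "integrable lborel F'"
  shows "(\<integral>z. F' z \<partial>lborel) = 0"
proof -
  have der': "((\<lambda>t::real. F (z + of_real t * d)) has_vector_derivative F' (z + of_real t * d)) (at t)" for z t
  proof -
    have "((\<lambda>s. F ((z + of_real t * d) + of_real s * d)) has_vector_derivative F' (z + of_real t * d)) (at (t - t))"
      using der[of "z + of_real t * d"] by simp
    then have "(((\<lambda>s. F ((z + of_real t * d) + of_real s * d)) \<circ> (\<lambda>s. s - t)) has_vector_derivative 1 *\<^sub>R F' (z + of_real t * d)) (at t)"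
      by (intro vector_diff_chain_at) (auto intro!: derivative_eq_intros)
    moreover have "(\<lambda>s. F ((z + of_real t * d) + of_real s * d)) \<circ> (\<lambda>s. s - t) = (\<lambda>t::real. F (z + of_real t * d))"
      by (rule ext) (simp add: algebra_simps)
    ultimately show ?thesis by simp
  qed
  have cm: "continuous_on S (\<lambda>x. F' (g x))" if "continuous_on S g" for S and g :: "'x::topological_space \<Rightarrow> complex"
    using continuous_on_compose2[OF cont that] by simp
  let ?g = "\<lambda>t z. indicator {0..1::real} t *\<^sub>R F' (z + of_real t * d)"
  have m: "(\<lambda>(t, z). ?g t z) \<in> borel_measurable (lborel \<Otimes>\<^sub>M lborel)"
  proof -
    have "(\<lambda>p::real \<times> complex. F' (snd p + of_real (fst p) * d)) \<in> borel_measurable borel"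
      by (intro borel_measurable_continuous_onI cm continuous_intros)
    then have "(\<lambda>p. F' (snd p + of_real (fst p) * d)) \<in> borel_measurable (lborel \<Otimes>\<^sub>M lborel)"
      by (simp add: lborel_prod)
    then show ?thesis by (simp add: case_prod_beta)
  qed
  have pint: "integrable (lborel \<Otimes>\<^sub>M lborel) (\<lambda>(t, z). ?g t z)"
  proof (rule lborel_pair.Fubini_integrable[OF m])
    have "integrable lborel (\<lambda>z. norm (F' z))" using int by simp
    from lborel_translate(2)[OF this]
    have "(\<integral>z. norm (case (t, z) of (t, z) \<Rightarrow> ?g t z) \<partial>lborel) = indicator {0..1} t *\<^sub>R (\<integral>z. norm (F' z) \<partial>lborel)" for t
      by (simp add: indicator_def)
    note e = this
    show "integrable lborel (\<lambda>t. \<integral>z. norm (case (t, z) of (t, z) \<Rightarrow> ?g t z) \<partial>lborel)"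
      unfolding e by simp
    show "AE t in lborel. integrable lborel (\<lambda>z. case (t, z) of (t, z) \<Rightarrow> ?g t z)"
      using lborel_translate(1)[OF int(2)] by auto
  qed
  have inner: "(\<integral>t. ?g t z \<partial>lborel) = F (z + d) - F z" for z
  proof -
    have "(\<integral>t. ?g t z \<partial>lborel) = F (z + of_real 1 * d) - F (z + of_real 0 * d)"
    proof (rule integral_FTC_atLeastAtMost)
      show "continuous_on {0..1} (\<lambda>t. F' (z + complex_of_real t * d))"
        by (intro cm continuous_intros)
    qed (auto intro: has_vector_derivative_at_within der')
    then show ?thesis by simp
  qed
  have "(\<integral>z. F' z \<partial>lborel) = (\<integral>t. indicator {0..1::real} t *\<^sub>R (\<integral>z. F' z \<partial>lborel) \<partial>lborel)"
    by (subst integral_scaleR_left) auto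
  also have "\<dots> = (\<integral>t. (\<integral>z. ?g t z \<partial>lborel) \<partial>lborel)"
    by (simp add: lborel_translate(2)[OF int(2)])
  also have "\<dots> = (\<integral>z. (\<integral>t. ?g t z \<partial>lborel) \<partial>lborel)"
    using lborel_pair.Fubini_integral[OF pint] by simp
  also have "\<dots> = (\<integral>z. F (z + d) - F z \<partial>lborel)" unfolding inner ..
  also have "\<dots> = 0"
    using int lborel_translate[OF int(1), of d] by simp
  finally show ?thesis .
qed

text \<open>Growth below every Gaussian. Quantifying over all \<epsilon> makes the class closed
  under products (split \<epsilon> in half), and whatever the decay rate of the weight, such a
  function is integrable against it.\<close>

definition subgauss :: "(complex \<Rightarrow> complex) \<Rightarrow> bool" where
  "subgauss h \<longleftrightarrow> continuous_on UNIV h \<and> (\<forall>\<epsilon>>0. \<exists>C. \<forall>z. cmod (h z) \<le> C * exp (\<epsilon> * (cmod z)\<^sup>2))"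

lemma subgauss_const [intro]: "subgauss (\<lambda>z. c)"
  unfolding subgauss_def
proof (intro conjI allI impI)
  fix \<epsilon> :: real assume "\<epsilon> > 0"
  then have "cmod c * 1 \<le> cmod c * exp (\<epsilon> * (cmod z)\<^sup>2)" for z by (intro mult_left_mono) auto
  then show "\<exists>C. \<forall>z. cmod c \<le> C * exp (\<epsilon> * (cmod z)\<^sup>2)" by auto
qed auto

lemma subgauss_id [intro]: "subgauss (\<lambda>z. z)"
  unfolding subgauss_def
proof (intro conjI allI impI)
  fix \<epsilon> :: real assume e: "\<epsilon> > 0"
  show "\<exists>C. \<forall>z. cmod z \<le> C * exp (\<epsilon> * (cmod z)\<^sup>2)"
  proof (intro exI allI)
    fix z
    have "0 \<le> (cmod z - 1)\<^sup>2" by simp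
    then have "2 * cmod z \<le> 1 + (cmod z)\<^sup>2" by (simp add: power2_diff)
    then have "cmod z \<le> 1 + (cmod z)\<^sup>2" using norm_ge_zero[of z] by linarith
    moreover have "\<epsilon> * (cmod z)\<^sup>2 \<le> exp (\<epsilon> * (cmod z)\<^sup>2)"
      using exp_ge_add_one_self[of "\<epsilon> * (cmod z)\<^sup>2"] by linarith
    then have "(cmod z)\<^sup>2 \<le> 1 / \<epsilon> * exp (\<epsilon> * (cmod z)\<^sup>2)" using e by (simp add: field_simps)
    moreover have "1 \<le> exp (\<epsilon> * (cmod z)\<^sup>2)" using e by simp
    ultimately show "cmod z \<le> (1 + 1 / \<epsilon>) * exp (\<epsilon> * (cmod z)\<^sup>2)" unfolding distrib_right by linarith
  qed
qed auto

lemma subgauss_add [intro]: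
  assumes "subgauss f" "subgauss g" shows "subgauss (\<lambda>z. f z + g z)"
  unfolding subgauss_def
proof (intro conjI allI impI)
  show "continuous_on UNIV (\<lambda>z. f z + g z)" using assms by (auto simp: subgauss_def intro: continuous_intros)
  fix \<epsilon> :: real assume "\<epsilon> > 0"
  then obtain C D where "\<And>z. cmod (f z) \<le> C * exp (\<epsilon> * (cmod z)\<^sup>2)" "\<And>z. cmod (g z) \<le> D * exp (\<epsilon> * (cmod z)\<^sup>2)"
    using assms unfolding subgauss_def by blast
  then have "cmod (f z + g z) \<le> (C + D) * exp (\<epsilon> * (cmod z)\<^sup>2)" for z
    unfolding distrib_right by (intro order_trans[OF norm_triangle_ineq] add_mono)
  then show "\<exists>C. \<forall>z. cmod (f z + g z) \<le> C * exp (\<epsilon> * (cmod z)\<^sup>2)" by blast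
qed

lemma subgauss_mult [intro]:
  assumes "subgauss f" "subgauss g" shows "subgauss (\<lambda>z. f z * g z)"
  unfolding subgauss_def
proof (intro conjI allI impI)
  show "continuous_on UNIV (\<lambda>z. f z * g z)" using assms by (auto simp: subgauss_def intro: continuous_intros)
  fix \<epsilon> :: real assume "\<epsilon> > 0"
  then have "\<epsilon> / 2 > 0" by simp
  then obtain C D where b: "\<And>z. cmod (f z) \<le> C * exp (\<epsilon> / 2 * (cmod z)\<^sup>2)" "\<And>z. cmod (g z) \<le> D * exp (\<epsilon> / 2 * (cmod z)\<^sup>2)"
    using assms unfolding subgauss_def by blast
  have "cmod (f z * g z) \<le> (C * D) * exp (\<epsilon> * (cmod z)\<^sup>2)" for z
  proof -
    have "cmod (f z * g z) \<le> (C * exp (\<epsilon> / 2 * (cmod z)\<^sup>2)) * (D * exp (\<epsilon> / 2 * (cmod z)\<^sup>2))"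
      unfolding norm_mult using b order_trans[OF norm_ge_zero b(1)] by (intro mult_mono) auto
    also have "\<dots> = (C * D) * (exp (\<epsilon> / 2 * (cmod z)\<^sup>2 + \<epsilon> / 2 * (cmod z)\<^sup>2))"
      unfolding exp_add by simp
    finally show ?thesis by simp
  qed
  then show "\<exists>C. \<forall>z. cmod (f z * g z) \<le> C * exp (\<epsilon> * (cmod z)\<^sup>2)" by blast
qed

lemma subgauss_cnj [intro]: "subgauss f \<Longrightarrow> subgauss (\<lambda>z. cnj (f z))"
  unfolding subgauss_def by (auto intro: continuous_intros)

lemma subgauss_poly [intro]: "subgauss (poly p)"
proof (induction p)
  case 0
  have "poly 0 = (\<lambda>z::complex. 0)" by (rule ext) simp
  then show ?case by (simp only: subgauss_const)
next
  case (pCons a p)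
  have "poly (pCons a p) = (\<lambda>z. a + z * poly p z)" by (rule ext) simp
  then show ?case using pCons by (simp only:) (intro subgauss_add subgauss_mult subgauss_const subgauss_id)
qed

section \<open>The weight, its inner product and the raising operator\<close>

definition ew :: "nat \<Rightarrow> complex \<Rightarrow> complex \<Rightarrow> complex \<Rightarrow> real" where
  "ew n t1 t2 z = exp (- (real n * ell_potential t1 t2 z))"

lemma continuous_ew: "continuous_on UNIV (ew n t1 t2)"
  unfolding ew_def[abs_def] ell_potential_def by (intro continuous_intros)

text \<open>The quadratic part of the potential is at least
  \<open>(1 - 2 * cmod t2) * (cmod z)\<^sup>2\<close>. One half of it absorbs the linear term by
  completing a square, the other half remains as decay.\<close>

lemma ew_bound:
  assumes n: "n \<ge> 1" and t: "2 * cmod t2 < 1"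
  obtains \<eta> C where "\<eta> > 0" "\<And>z. ew n t1 t2 z \<le> C * exp (- (\<eta> * (cmod z)\<^sup>2))"
proof -
  define p where "p = 1 - 2 * cmod t2"
  have p: "p > 0" using t by (simp add: p_def)
  have "ew n t1 t2 z \<le> exp (real n * (2 * (cmod t1)\<^sup>2 / p)) * exp (- ((real n * p / 2) * (cmod z)\<^sup>2))" for z
  proof -
    have "Re (t1 * z + t2 * z\<^sup>2) \<le> cmod (t1 * z + t2 * z\<^sup>2)" by (rule complex_Re_le_cmod)
    also have "\<dots> \<le> cmod t1 * cmod z + cmod t2 * (cmod z)\<^sup>2"
      by (intro order_trans[OF norm_triangle_ineq]) (simp add: norm_mult norm_power)
    finally have 1: "ell_potential t1 t2 z \<ge> p * (cmod z)\<^sup>2 - 2 * cmod t1 * cmod z"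
      unfolding ell_potential_def p_def by (simp add: algebra_simps)
    have "0 \<le> (p * cmod z - 2 * cmod t1)\<^sup>2 / (2 * p)" using p by simp
    also have "\<dots> = p / 2 * (cmod z)\<^sup>2 - 2 * cmod t1 * cmod z + 2 * (cmod t1)\<^sup>2 / p"
      using p by (simp add: power2_eq_square field_simps)
    finally have "2 * cmod t1 * cmod z \<le> p / 2 * (cmod z)\<^sup>2 + 2 * (cmod t1)\<^sup>2 / p" by linarith
    with 1 have "ell_potential t1 t2 z \<ge> p / 2 * (cmod z)\<^sup>2 - 2 * (cmod t1)\<^sup>2 / p" by (simp add: algebra_simps)
    then have "real n * (p / 2 * (cmod z)\<^sup>2 - 2 * (cmod t1)\<^sup>2 / p) \<le> real n * ell_potential t1 t2 z"
      by (intro mult_left_mono) auto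
    then show ?thesis unfolding ew_def exp_add[symmetric] by (simp add: algebra_simps)
  qed
  then show ?thesis using that[of "real n * p / 2"] n p by auto
qed

lemma integrable_subgauss:
  assumes n: "n \<ge> 1" and t: "2 * cmod t2 < 1" and h: "subgauss h"
  shows "integrable lborel (\<lambda>z. h z * of_real (ew n t1 t2 z))"
proof -
  obtain \<eta> C where e: "\<eta> > 0" "\<And>z. ew n t1 t2 z \<le> C * exp (- (\<eta> * (cmod z)\<^sup>2))"
    using ew_bound[OF n t] by blast
  have "\<eta> / 2 > 0" using e by simp
  then obtain D where D: "\<And>z. cmod (h z) \<le> D * exp (\<eta> / 2 * (cmod z)\<^sup>2)"
    using h unfolding subgauss_def by blast
  show ?thesis
  proof (rule Bochner_Integration.integrable_bound)
    show "integrable lborel (\<lambda>z::complex. (C * D) * exp (- (\<eta> / 2 * (cmod z)\<^sup>2)))"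
      using integrable_gauss_complex[of "\<eta> / 2"] e by simp
    show "(\<lambda>z. h z * complex_of_real (ew n t1 t2 z)) \<in> borel_measurable lborel"
      using h continuous_ew unfolding subgauss_def
      by (auto intro!: borel_measurable_continuous_onI continuous_intros)
    show "AE z in lborel. norm (h z * complex_of_real (ew n t1 t2 z)) \<le> norm ((C * D) * exp (- (\<eta> / 2 * (cmod z)\<^sup>2)))"
    proof (rule AE_I2)
      fix z
      have w0: "0 \<le> ew n t1 t2 z" by (simp add: ew_def)
      have "norm (h z * complex_of_real (ew n t1 t2 z)) = cmod (h z) * ew n t1 t2 z"
        using w0 by (simp add: norm_mult)
      also have "\<dots> \<le> (D * exp (\<eta> / 2 * (cmod z)\<^sup>2)) * (C * exp (- (\<eta> * (cmod z)\<^sup>2)))"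
        using D[of z] e(2)[of z] w0 order_trans[OF norm_ge_zero D] by (intro mult_mono) auto
      also have "\<dots> = (C * D) * exp (\<eta> / 2 * (cmod z)\<^sup>2 + - (\<eta> * (cmod z)\<^sup>2))"
        unfolding exp_add by simp
      also have "\<eta> / 2 * (cmod z)\<^sup>2 + - (\<eta> * (cmod z)\<^sup>2) = - (\<eta> / 2 * (cmod z)\<^sup>2)" by simp
      also have "(C * D) * exp (- (\<eta> / 2 * (cmod z)\<^sup>2)) \<le> norm ((C * D) * exp (- (\<eta> / 2 * (cmod z)\<^sup>2)))"
        by simp
      finally show "norm (h z * complex_of_real (ew n t1 t2 z)) \<le> norm ((C * D) * exp (- (\<eta> / 2 * (cmod z)\<^sup>2)))" .
    qed
  qed
qed

definition pip :: "nat \<Rightarrow> complex \<Rightarrow> complex \<Rightarrow> complex poly \<Rightarrow> complex poly \<Rightarrow> complex" where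
  "pip n t1 t2 f g = (\<integral>z. cnj (poly f z) * poly g z * of_real (ew n t1 t2 z) \<partial>lborel)"

lemma pip_integrable:
  assumes "n \<ge> 1" "2 * cmod t2 < 1"
  shows "integrable lborel (\<lambda>z. cnj (poly f z) * poly g z * of_real (ew n t1 t2 z))"
  by (intro integrable_subgauss[OF assms] subgauss_mult subgauss_cnj subgauss_poly)

text \<open>The Wirtinger derivative of the potential with respect to \<open>z\<close>.\<close>

definition pot_deriv :: "complex \<Rightarrow> complex \<Rightarrow> complex \<Rightarrow> complex" where
  "pot_deriv t1 t2 z = cnj z - t1 - 2 * t2 * z"

lemma ew_directional_derivative:
  "((\<lambda>t::real. ew n t1 t2 (z + of_real t * d)) has_real_derivative
     - (2 * real n * Re (d * pot_deriv t1 t2 z)) * ew n t1 t2 z) (at 0)"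
proof -
  have expand: "ell_potential t1 t2 (z + of_real t * d) = ell_potential t1 t2 z + t * (2 * Re (d * pot_deriv t1 t2 z))
      + t\<^sup>2 * ((cmod d)\<^sup>2 - 2 * Re (t2 * d\<^sup>2))" for t
    unfolding ell_potential_def pot_deriv_def cmod_power2
    by (simp add: power2_eq_square algebra_simps)
  have "ew n t1 t2 z = exp (- (real n * (ell_potential t1 t2 z + 0 * (2 * Re (d * pot_deriv t1 t2 z))
      + 0\<^sup>2 * ((cmod d)\<^sup>2 - 2 * Re (t2 * d\<^sup>2)))))" by (simp add: ew_def)
  then show ?thesis unfolding ew_def expand
    by (auto intro!: derivative_eq_intros)
qed

text \<open>This combination of the two Wirtinger derivatives of the potential is the one in which
  \<open>cnj z\<close> cancels. That a polynomial remains is what makes a raising operator on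
  polynomials possible.\<close>

lemma pot_deriv_center:
  assumes "2 * cmod t2 < 1"
  shows "cnj (pot_deriv t1 t2 z) + cnj (2 * t2) * pot_deriv t1 t2 z
     = of_real (1 - 4 * (cmod t2)\<^sup>2) * (z - ell_center t1 t2)"
proof -
  define D where "D = 1 - 4 * (cmod t2)\<^sup>2"
  have "(2 * cmod t2)\<^sup>2 < 1" using sq_less_one[of "2 * cmod t2"] assms by simp
  then have D: "D \<noteq> 0" by (simp add: D_def power_mult_distrib)
  have tt: "t2 * cnj t2 = of_real ((cmod t2)\<^sup>2)" by (simp add: complex_norm_square del: of_real_power)
  have "of_real D * (z - ell_center t1 t2) = of_real D * z - (cnj t1 + 2 * t1 * cnj t2)"
    unfolding ell_center_def D_def[symmetric] using D by (simp add: field_simps)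
  note a = this
  have b: "complex_of_real D = 1 - 4 * (t2 * cnj t2)" unfolding tt D_def by simp
  show ?thesis unfolding D_def[symmetric] a unfolding b pot_deriv_def
    by (simp add: algebra_simps)
qed

text \<open>The adjoint of differentiation for the weighted inner product, a creation operator.
  Integrating by parts in \<open>cnj z\<close> multiplies \<open>f\<close> by \<open>n\<close> times
  the conjugate of \<open>pot_deriv\<close>; \<open>pot_deriv_center\<close> replaces that by a
  polynomial, at the price of the term with \<open>pderiv f\<close>.\<close>

definition raise_poly :: "nat \<Rightarrow> complex \<Rightarrow> complex \<Rightarrow> complex poly \<Rightarrow> complex poly" where
  "raise_poly n t1 t2 f = Polynomial.smult (of_real (real n * (1 - 4 * (cmod t2)\<^sup>2))) ([:- ell_center t1 t2, 1:] * f)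
     - Polynomial.smult (cnj (2 * t2)) (pderiv f)"

text \<open>The integral of the operator \<open>d/d(cnj z) + c * d/dz\<close> with
  \<open>c = cnj (2 * t2)\<close>, applied to the integrand \<open>cnj g * f * weight\<close>,
  vanishes. With this \<open>c\<close> the derivative of the weight is the weight times a polynomial
  in \<open>z\<close> alone.\<close>

lemma pip_raise:
  assumes n: "n \<ge> 1" and t: "2 * cmod t2 < 1"
  shows "pip n t1 t2 g (raise_poly n t1 t2 f) = pip n t1 t2 (pderiv g) f"
proof -
  let ?w = "\<lambda>z. complex_of_real (ew n t1 t2 z)"
  let ?P = "pot_deriv t1 t2"
  \<comment> \<open>\<open>h d z\<close> times the weight is the derivative of
    \<open>cnj g * f * weight\<close> in the direction \<open>d\<close>.\<close>
  define h where "h d z = cnj (poly (pderiv g) z * d) * poly f z + cnj (poly g z) * (poly (pderiv f) z * d)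
     - of_real (real n) * (d * ?P z + cnj (d * ?P z)) * (cnj (poly g z) * poly f z)" for d z
  have sgP: "subgauss ?P"
  proof -
    have "?P = (\<lambda>z. cnj z + (- t1) + (- 2 * t2) * z)" by (rule ext) (simp add: pot_deriv_def)
    then show ?thesis by (simp only:) (intro subgauss_add subgauss_mult subgauss_const subgauss_id subgauss_cnj)
  qed
  have sgh: "subgauss (h d)" for d
  proof -
    have "h d = (\<lambda>z. cnj (poly (pderiv g) z * d) * poly f z + cnj (poly g z) * (poly (pderiv f) z * d)
     + (- of_real (real n)) * ((d * ?P z + cnj (d * ?P z)) * (cnj (poly g z) * poly f z)))"
      by (rule ext) (simp add: h_def)
    then show ?thesis
      by (simp only:) (intro subgauss_add subgauss_mult subgauss_const subgauss_poly subgauss_cnj sgP)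
  qed
  have int: "integrable lborel (\<lambda>z. h d z * ?w z)" for d
    by (rule integrable_subgauss[OF n t sgh])
  have zero: "(\<integral>z. h d z * ?w z \<partial>lborel) = 0" for d
  proof (rule integral_directional_derivative)
    fix z
    have dp: "((\<lambda>t::real. poly q (z + of_real t * d)) has_vector_derivative poly (pderiv q) z * d) (at 0)" for q
    proof -
      have "(poly q has_field_derivative poly (pderiv q) z) (at (z + of_real 0 * d))" using poly_DERIV by simp
      moreover have "((\<lambda>t::real. z + of_real t * d) has_vector_derivative d) (at 0)"
        by (auto intro!: derivative_eq_intros simp: has_vector_derivative_def scaleR_conv_of_real)
      ultimately have "(poly q \<circ> (\<lambda>t::real. z + of_real t * d) has_vector_derivative d * poly (pderiv q) z) (at 0)"
        by (intro field_vector_diff_chain_at)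
      then show ?thesis by (simp add: o_def mult.commute)
    qed
    have dw: "((\<lambda>t::real. ?w (z + of_real t * d)) has_vector_derivative
        of_real (- (2 * real n * Re (d * ?P z)) * ew n t1 t2 z)) (at 0)"
      using ew_directional_derivative[of n t1 t2 z d]
      by (intro has_vector_derivative_of_real) (simp add: has_real_derivative_iff_has_vector_derivative)
    have "((\<lambda>t::real. (cnj (poly g (z + of_real t * d)) * poly f (z + of_real t * d)) * ?w (z + of_real t * d)) has_vector_derivative
       (cnj (poly g (z + of_real 0 * d)) * poly f (z + of_real 0 * d)) * of_real (- (2 * real n * Re (d * ?P z)) * ew n t1 t2 z)
       + (cnj (poly g (z + of_real 0 * d)) * (poly (pderiv f) z * d) + cnj (poly (pderiv g) z * d) * poly f (z + of_real 0 * d)) * ?w (z + of_real 0 * d)) (at 0)"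
      by (intro has_vector_derivative_mult dp dw has_vector_derivative_cnj)
    moreover have "(cnj (poly g (z + of_real 0 * d)) * poly f (z + of_real 0 * d)) * of_real (- (2 * real n * Re (d * ?P z)) * ew n t1 t2 z)
       + (cnj (poly g (z + of_real 0 * d)) * (poly (pderiv f) z * d) + cnj (poly (pderiv g) z * d) * poly f (z + of_real 0 * d)) * ?w (z + of_real 0 * d)
      = h d z * ?w z"
    proof -
      have "d * ?P z + cnj (d * ?P z) = of_real (2 * Re (d * ?P z))" by (rule complex_add_cnj)
      then have r: "complex_of_real (- (2 * real n * Re (d * ?P z)) * ew n t1 t2 z) = - of_real (real n) * (d * ?P z + cnj (d * ?P z)) * ?w z"
        by simp
      show ?thesis unfolding r h_def by (simp add: algebra_simps)
    qed
    ultimately show "((\<lambda>t::real. cnj (poly g (z + of_real t * d)) * poly f (z + of_real t * d) * ?w (z + of_real t * d)) has_vector_derivative h d z * ?w z) (at 0)"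
      by simp
  next
    show "continuous_on UNIV (\<lambda>z. h d z * ?w z)"
      using sgh continuous_ew unfolding subgauss_def by (auto intro: continuous_intros)
  qed (use pip_integrable[OF n t] int in auto)
  define c where "c = cnj (2 * t2)"
  \<comment> \<open>The left side is \<open>d/d(cnj z) + c * d/dz\<close> expressed by the real
    derivatives in the directions 1 and \<open>\<i>\<close>.\<close>
  have comb: "((1 + c) * (h 1 z * ?w z) + \<i> * (1 - c) * (h \<i> z * ?w z)) / 2
     = cnj (poly (pderiv g) z) * poly f z * ?w z - cnj (poly g z) * poly (raise_poly n t1 t2 f) z * ?w z" for z
  proof -
    have "of_real (real n * (1 - 4 * (cmod t2)\<^sup>2)) * (z - ell_center t1 t2)
        = of_real (real n) * (cnj (?P z) + c * ?P z)"
      using pot_deriv_center[OF t, of t1 z] by (simp add: c_def mult.assoc)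
    moreover have "poly (raise_poly n t1 t2 f) z = of_real (real n * (1 - 4 * (cmod t2)\<^sup>2)) * (z - ell_center t1 t2) * poly f z - c * poly (pderiv f) z"
      unfolding raise_poly_def c_def by (simp add: algebra_simps)
    ultimately have r: "poly (raise_poly n t1 t2 f) z = of_real (real n) * (cnj (?P z) + c * ?P z) * poly f z - c * poly (pderiv f) z"
      by (simp only:)
    show ?thesis unfolding r h_def by (simp add: field_simps)
  qed
  have "pip n t1 t2 (pderiv g) f - pip n t1 t2 g (raise_poly n t1 t2 f)
    = (\<integral>z. ((1 + c) * (h 1 z * ?w z) + \<i> * (1 - c) * (h \<i> z * ?w z)) / 2 \<partial>lborel)"
    unfolding comb pip_def using pip_integrable[OF n t] by simp
  also have "\<dots> = ((1 + c) * (\<integral>z. h 1 z * ?w z \<partial>lborel) + \<i> * (1 - c) * (\<integral>z. h \<i> z * ?w z \<partial>lborel)) / 2"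
    using int by (simp add: mult.assoc)
  also have "\<dots> = 0" by (simp add: zero)
  finally show ?thesis by simp
qed

text \<open>The centre is the critical point of the potential: \<open>pot_deriv_center\<close> says
  there that the derivative and its product with \<open>2 * cnj t2\<close> have equal modulus, which
  for \<open>2 * cmod t2 < 1\<close> forces it to vanish. A quadratic function equals its second
  Taylor polynomial.\<close>

lemma ell_potential_center:
  assumes "2 * cmod t2 < 1"
  shows "ell_potential t1 t2 z = ell_potential t1 t2 (ell_center t1 t2)
     + ((cmod (z - ell_center t1 t2))\<^sup>2 - 2 * Re (t2 * (z - ell_center t1 t2)\<^sup>2))"
proof -
  define v where "v = ell_center t1 t2"
  have c0: "cnj (pot_deriv t1 t2 v) + cnj (2 * t2) * pot_deriv t1 t2 v = 0"
    using pot_deriv_center[OF assms, of t1 v] by (simp add: v_def)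
  have "pot_deriv t1 t2 v = 0"
  proof (rule ccontr)
    assume nz: "pot_deriv t1 t2 v \<noteq> 0"
    have "cmod (pot_deriv t1 t2 v) = cmod (cnj (2 * t2) * pot_deriv t1 t2 v)"
      using c0 by (metis complex_mod_cnj norm_minus_cancel eq_neg_iff_add_eq_0)
    then have "1 = 2 * cmod t2" using nz by (simp add: norm_mult)
    then show False using assms by simp
  qed
  moreover have "ell_potential t1 t2 z = ell_potential t1 t2 v + 2 * Re ((z - v) * pot_deriv t1 t2 v)
     + ((cmod (z - v))\<^sup>2 - 2 * Re (t2 * (z - v)\<^sup>2))"
    unfolding ell_potential_def pot_deriv_def cmod_power2
    by (simp add: power2_eq_square algebra_simps)
  ultimately show ?thesis by (simp add: v_def)
qed

definition ew_mass :: "nat \<Rightarrow> complex \<Rightarrow> complex \<Rightarrow> real" where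
  "ew_mass n t1 t2 = ew n t1 t2 (ell_center t1 t2) * (pi / (real n * sqrt (1 - 4 * (cmod t2)\<^sup>2)))"

lemma ew_mass:
  assumes n: "n \<ge> 1" and t: "2 * cmod t2 < 1"
  shows "pip n t1 t2 1 1 = of_real (ew_mass n t1 t2)"
proof -
  define v where "v = ell_center t1 t2"
  have q: "0 < 1 - 4 * (cmod t2)\<^sup>2"
    using sq_less_one[of "2 * cmod t2"] t by (simp add: power_mult_distrib)
  \<comment> \<open>\<open>A\<close>, \<open>2 * B\<close> and \<open>C\<close> are the coefficients
    of \<open>n * ((cmod z)\<^sup>2 - 2 * Re (t2 * z\<^sup>2))\<close> as a quadratic form in
    \<open>Re z\<close> and \<open>Im z\<close>.\<close>
  define A where "A = real n * (1 - 2 * Re t2)"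
  define B where "B = real n * (2 * Im t2)"
  define C where "C = real n * (1 + 2 * Re t2)"
  have C: "C > 0"
    using abs_Re_le_cmod[of t2] t n unfolding C_def by (intro mult_pos_pos) (auto simp: abs_le_iff)
  have disc: "A * C - B\<^sup>2 = (real n)\<^sup>2 * (1 - 4 * (cmod t2)\<^sup>2)"
    unfolding A_def B_def C_def cmod_power2 by (simp add: power2_eq_square algebra_simps)
  have disc0: "A * C - B\<^sup>2 > 0" unfolding disc using q n by simp
  have w: "ew n t1 t2 (z + v) = ew n t1 t2 v * exp (- (A * (Re z)\<^sup>2 + 2 * B * (Re z * Im z) + C * (Im z)\<^sup>2))" for z
  proof -
    have "real n * ell_potential t1 t2 (z + v) = real n * ell_potential t1 t2 v + (A * (Re z)\<^sup>2 + 2 * B * (Re z * Im z) + C * (Im z)\<^sup>2)"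
      unfolding ell_potential_center[OF t, of t1 "z + v", folded v_def] A_def B_def C_def cmod_power2
      by (simp add: power2_eq_square algebra_simps)
    then show ?thesis unfolding ew_def exp_add[symmetric] by simp
  qed
  have "integrable lborel (\<lambda>z. complex_of_real (ew n t1 t2 z))"
    using pip_integrable[OF n t, of 1 1] by simp
  then have int': "integrable lborel (ew n t1 t2)" by (simp only: complex_of_real_integrable_eq)
  have "has_bochner_integral lborel (\<lambda>z. exp (- (A * (Re z)\<^sup>2 + 2 * B * (Re z * Im z) + C * (Im z)\<^sup>2))) (pi / sqrt (A * C - B\<^sup>2))"
    by (rule has_bochner_integral_nn_integral)
      (use nn_integral_gauss_complex[OF C disc0] disc0 in auto)
  then have "(\<integral>z. ew n t1 t2 (z + v) \<partial>lborel) = ew n t1 t2 v * (pi / sqrt (A * C - B\<^sup>2))"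
    unfolding w by (simp add: has_bochner_integral_iff)
  also have "(\<integral>z. ew n t1 t2 (z + v) \<partial>lborel) = (\<integral>z. ew n t1 t2 z \<partial>lborel)"
    by (rule lborel_translate(2)[OF int'])
  also have "sqrt (A * C - B\<^sup>2) = real n * sqrt (1 - 4 * (cmod t2)\<^sup>2)"
    unfolding disc by (simp add: real_sqrt_mult)
  finally have "(\<integral>z. ew n t1 t2 z \<partial>lborel) = ew_mass n t1 t2"
    by (simp add: ew_mass_def v_def)
  then show ?thesis by (simp add: pip_def)
qed

section \<open>The orthonormal polynomials and the kernel\<close>

fun ell_poly :: "nat \<Rightarrow> complex \<Rightarrow> complex \<Rightarrow> nat \<Rightarrow> complex poly" where
  "ell_poly n t1 t2 0 = 1"
| "ell_poly n t1 t2 (Suc k) = raise_poly n t1 t2 (ell_poly n t1 t2 k)"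

text \<open>Differentiation and raising commute up to the scalar \<kappa> =
  \<open>n * (1 - 4 * (cmod t2)\<^sup>2)\<close>, as for the harmonic oscillator; an Appell sequence
  results by induction.\<close>

lemma pderiv_ell_poly:
  "pderiv (ell_poly n t1 t2 k)
     = Polynomial.smult (of_nat k * of_real (real n * (1 - 4 * (cmod t2)\<^sup>2))) (ell_poly n t1 t2 (k - 1))"
proof (induction k)
  case 0
  then show ?case by (simp add: pderiv_1)
next
  case (Suc k)
  define \<kappa> where "\<kappa> = complex_of_real (real n * (1 - 4 * (cmod t2)\<^sup>2))"
  define L where "L = [:- ell_center t1 t2, 1:]"
  define c where "c = cnj (2 * t2)"
  let ?q = "ell_poly n t1 t2"
  have L': "pderiv L = 1" by (simp add: L_def pderiv_pCons)
  have IH: "pderiv (?q k) = Polynomial.smult (of_nat k * \<kappa>) (?q (k - 1))"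
    using Suc by (simp add: \<kappa>_def)
  have rp: "raise_poly n t1 t2 f = Polynomial.smult \<kappa> (L * f) - Polynomial.smult c (pderiv f)" for f
    by (simp add: raise_poly_def \<kappa>_def L_def c_def)
  have "pderiv (?q (Suc k)) = Polynomial.smult \<kappa> (L * pderiv (?q k)) - Polynomial.smult c (pderiv (pderiv (?q k))) + Polynomial.smult \<kappa> (?q k)"
    by (simp add: rp pderiv_smult pderiv_diff pderiv_mult L' smult_add_right)
  also have "Polynomial.smult \<kappa> (L * pderiv (?q k)) - Polynomial.smult c (pderiv (pderiv (?q k))) = raise_poly n t1 t2 (pderiv (?q k))"
    by (simp add: rp)
  also have "raise_poly n t1 t2 (pderiv (?q k)) = Polynomial.smult (of_nat k * \<kappa>) (raise_poly n t1 t2 (?q (k - 1)))"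
    unfolding IH rp by (simp add: pderiv_smult smult_diff_right mult.commute)
  also have "\<dots> = Polynomial.smult (of_nat k * \<kappa>) (?q k)"
    by (cases k) auto
  also have "Polynomial.smult (of_nat k * \<kappa>) (?q k) + Polynomial.smult \<kappa> (?q k) = Polynomial.smult (of_nat (Suc k) * \<kappa>) (?q k)"
    by (simp add: smult_add_left[symmetric] algebra_simps)
  finally show ?case unfolding \<kappa>_def[symmetric] by simp
qed

text \<open>Each raising multiplies the leading coefficient by the positive number \<kappa>, the
  derivative term being of lower degree.\<close>

lemma ell_poly_lead:
  assumes "n \<ge> 1" "2 * cmod t2 < 1"
  shows "degree (ell_poly n t1 t2 k) = k
    \<and> lead_coeff (ell_poly n t1 t2 k) = of_real ((real n * (1 - 4 * (cmod t2)\<^sup>2)) ^ k)"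
proof (induction k)
  case 0
  then show ?case by simp
next
  case (Suc k)
  define \<kappa> where "\<kappa> = real n * (1 - 4 * (cmod t2)\<^sup>2)"
  have \<kappa>: "\<kappa> > 0"
    using sq_less_one[of "2 * cmod t2"] assms by (auto simp: power_mult_distrib \<kappa>_def)
  let ?q = "ell_poly n t1 t2 k"
  let ?A = "Polynomial.smult (of_real \<kappa>) ([:- ell_center t1 t2, 1:] * ?q)"
  let ?B = "Polynomial.smult (cnj (2 * t2)) (pderiv ?q)"
  have dq: "degree ?q = k" using Suc by simp
  have lq: "coeff ?q k = of_real (\<kappa> ^ k)" using conjunct2[OF Suc] unfolding dq \<kappa>_def .
  have q0: "?q \<noteq> 0" using Suc \<kappa> unfolding \<kappa>_def[symmetric] by auto
  have dA: "degree ?A = Suc k" using q0 Suc \<kappa> by (simp add: degree_mult_eq del: mult_pCons_left)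
  have lA: "lead_coeff ?A = of_real (\<kappa> ^ Suc k)"
    using lq by (simp add: lead_coeff_smult lead_coeff_mult dq del: mult_pCons_left)
  have "degree ?B \<le> degree (pderiv ?q)" by (rule degree_smult_le)
  also have "\<dots> \<le> k" using Suc by (simp add: degree_pderiv)
  finally have dB: "degree ?B < degree ?A" using dA by simp
  have r: "ell_poly n t1 t2 (Suc k) = ?A + - ?B" by (simp add: raise_poly_def \<kappa>_def)
  have d: "degree (?A + - ?B) = degree ?A" using dB by (intro degree_add_eq_left) simp
  have "lead_coeff (?A + - ?B) = lead_coeff ?A"
    unfolding d coeff_add coeff_minus coeff_eq_0[OF dB] by simp
  then have l: "lead_coeff (?A + - ?B) = of_real (\<kappa> ^ Suc k)" unfolding lA .
  show ?case unfolding r \<kappa>_def[symmetric]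
  proof
    show "degree (?A + - ?B) = Suc k" unfolding d dA ..
  qed (rule l)
qed

lemma pip_smult_left:
  assumes "n \<ge> 1" "2 * cmod t2 < 1"
  shows "pip n t1 t2 (Polynomial.smult c f) g = cnj c * pip n t1 t2 f g"
  unfolding pip_def using pip_integrable[OF assms] by (simp add: mult.assoc)

lemma pip_smult_right:
  assumes "n \<ge> 1" "2 * cmod t2 < 1"
  shows "pip n t1 t2 f (Polynomial.smult c g) = c * pip n t1 t2 f g"
proof -
  have "pip n t1 t2 f (Polynomial.smult c g) = (\<integral>z. c * (cnj (poly f z) * poly g z * of_real (ew n t1 t2 z)) \<partial>lborel)"
    unfolding pip_def by (intro Bochner_Integration.integral_cong) (auto simp: mult_ac)
  then show ?thesis unfolding pip_def using pip_integrable[OF assms] by simp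
qed

lemma pip_cnj: "pip n t1 t2 g f = cnj (pip n t1 t2 f g)"
proof -
  have "cnj (pip n t1 t2 f g) = (\<integral>z. cnj (cnj (poly f z) * poly g z * of_real (ew n t1 t2 z)) \<partial>lborel)"
    unfolding pip_def by (rule Bochner_Integration.integral_cnj[symmetric])
  then show ?thesis unfolding pip_def by (simp add: mult.commute)
qed

text \<open>A ladder argument: raising in the right argument becomes a derivative in the left one,
  which lowers both indices by one and contributes a factor \<open>Suc k * \<kappa>\<close>. Once an
  index has reached 0, the derivative of the constant 1 gives orthogonality.\<close>

lemma pip_ell_poly:
  assumes nt: "n \<ge> 1" "2 * cmod t2 < 1"
  shows "pip n t1 t2 (ell_poly n t1 t2 k) (ell_poly n t1 t2 l)
    = (if k = l then of_real (fact k * (real n * (1 - 4 * (cmod t2)\<^sup>2)) ^ k * ew_mass n t1 t2) else 0)"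
proof (induction k arbitrary: l)
  case 0
  show ?case
  proof (cases l)
    case 0
    then show ?thesis using ew_mass[OF nt] by simp
  next
    case (Suc j)
    have "pip n t1 t2 (ell_poly n t1 t2 0) (ell_poly n t1 t2 l) = pip n t1 t2 (pderiv 1) (ell_poly n t1 t2 j)"
      unfolding Suc ell_poly.simps by (rule pip_raise[OF nt])
    also have "\<dots> = 0" by (simp add: pderiv_1 pip_def)
    finally show ?thesis using Suc by simp
  qed
next
  case (Suc k)
  have low: "pip n t1 t2 f (raise_poly n t1 t2 g) = pip n t1 t2 (pderiv f) g" for f g
    by (rule pip_raise[OF nt])
  show ?case
  proof (cases l)
    case 0
    have "pip n t1 t2 (ell_poly n t1 t2 l) (ell_poly n t1 t2 (Suc k)) = pip n t1 t2 (pderiv 1) (ell_poly n t1 t2 k)"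
      unfolding 0 ell_poly.simps by (rule low)
    also have "\<dots> = 0" by (simp add: pderiv_1 pip_def)
    finally show ?thesis using pip_cnj[of n t1 t2 "ell_poly n t1 t2 (Suc k)" "ell_poly n t1 t2 l"] 0 by simp
  next
    case (Suc j)
    have "pip n t1 t2 (ell_poly n t1 t2 (Suc k)) (ell_poly n t1 t2 l)
       = pip n t1 t2 (pderiv (ell_poly n t1 t2 (Suc k))) (ell_poly n t1 t2 j)"
      unfolding Suc ell_poly.simps(2)[of n t1 t2 j] by (rule low)
    also have "\<dots> = of_nat (Suc k) * of_real (real n * (1 - 4 * (cmod t2)\<^sup>2)) * pip n t1 t2 (ell_poly n t1 t2 k) (ell_poly n t1 t2 j)"
      unfolding pderiv_ell_poly pip_smult_left[OF nt] by simp
    finally show ?thesis unfolding Suc.IH \<open>l = Suc j\<close> by simp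
  qed
qed

section \<open>Uniqueness and explicit form of the orthonormal polynomials\<close>

lemma orthonormal_span:
  assumes p: "\<And>k. degree (p k) = k" "\<And>k. p k \<noteq> (0 :: complex poly)"
  shows "degree f \<le> d \<Longrightarrow> \<exists>c. f = (\<Sum>j\<le>d. Polynomial.smult (c j) (p j))"
proof (induction d arbitrary: f)
  case 0
  obtain a where a: "p 0 = [:a:]" using p(1)[of 0] by (metis degree_eq_zeroE)
  obtain b where b: "f = [:b:]" using 0 by (metis degree_eq_zeroE le_zero_eq)
  have "a \<noteq> 0" using p(2)[of 0] a by auto
  then show ?case by (intro exI[of _ "\<lambda>_. b / a"]) (simp add: a b)
next
  case (Suc d)
  define l where "l = lead_coeff (p (Suc d))"
  have l: "l \<noteq> 0" unfolding l_def by (rule leading_coeff_neq_0[OF p(2)])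
  define c where "c = coeff f (Suc d) / l"
  define g where "g = f - Polynomial.smult c (p (Suc d))"
  have "degree g \<le> Suc d" unfolding g_def
    using Suc.prems p(1)[of "Suc d"] by (intro degree_diff_le) (auto intro: order_trans[OF degree_smult_le])
  moreover have "coeff g (Suc d) = 0" using l p(1)[of "Suc d"] by (simp add: g_def c_def l_def)
  ultimately have "degree g \<le> d"
    by (metis eq_zero_or_degree_less le_degree degree_0 leading_coeff_0_iff le_SucE le0)
  then obtain b where b: "g = (\<Sum>j\<le>d. Polynomial.smult (b j) (p j))" using Suc.IH by blast
  have "f = (\<Sum>j\<le>Suc d. Polynomial.smult ((b(Suc d := c)) j) (p j))"
  proof -
    have "(\<Sum>j\<le>d. Polynomial.smult ((b(Suc d := c)) j) (p j)) = g" unfolding b by (intro sum.cong) auto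
    then show ?thesis by (simp add: g_def)
  qed
  then show ?case by blast
qed

lemma orthonormal_expansion:
  assumes p: "is_orthonormal_polys V n p" and "i \<le> d"
  shows "has_bochner_integral lborel
     (\<lambda>z. cnj (poly (p i) z) * poly (\<Sum>j\<le>d. Polynomial.smult (c j) (p j)) z * of_real (exp (- (real n * V z)))) (c i)"
proof -
  have "has_bochner_integral lborel
     (\<lambda>z. \<Sum>j\<le>d. c j * (cnj (poly (p i) z) * poly (p j) z * of_real (exp (- (real n * V z)))))
     (\<Sum>j\<le>d. c j * (if i = j then 1 else 0))"
    using p unfolding is_orthonormal_polys_def
    by (intro has_bochner_integral_sum has_bochner_integral_mult_right) blast+
  moreover have "(\<Sum>j\<le>d. c j * (if i = j then 1 else 0)) = c i"
  proof -
    have "(\<Sum>j\<le>d. c j * (if i = j then 1 else 0)) = (\<Sum>j\<le>d. if i = j then c j else 0)"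
      by (intro sum.cong) auto
    then show ?thesis using assms(2) by simp
  qed
  ultimately show ?thesis
    by (simp add: poly_sum sum_distrib_left sum_distrib_right mult_ac)
qed

text \<open>Expand \<open>q k\<close> in the family \<open>p\<close>. The coefficients below
  \<open>k\<close> vanish, because \<open>p i\<close> lies in the span of
  \<open>q 0, ..., q i\<close> and hence is orthogonal to \<open>q k\<close>. The last coefficient
  is positive by the sign convention and has modulus 1 by normalisation.\<close>

lemma orthonormal_polys_unique:
  assumes p: "is_orthonormal_polys V n p" and q: "is_orthonormal_polys V n q"
  shows "p = q"
proof
  fix k
  let ?w = "\<lambda>z. complex_of_real (exp (- (real n * V z)))"
  have nz: "r j \<noteq> 0" "degree (r j) = j" if "is_orthonormal_polys V n r" for r j
  proof -
    have "degree (r j) = j \<and> (\<exists>c::real. c > 0 \<and> lead_coeff (r j) = of_real c)"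
      using conjunct1[OF that[unfolded is_orthonormal_polys_def]] by (rule spec)
    then show "r j \<noteq> 0" "degree (r j) = j" by auto
  qed
  obtain c where c: "q k = (\<Sum>j\<le>k. Polynomial.smult (c j) (p j))"
    using orthonormal_span[of p "q k" k] nz[OF p] nz[OF q] by auto
  have cz: "c i = 0" if i: "i < k" for i
  proof -
    obtain d where d: "p i = (\<Sum>j\<le>i. Polynomial.smult (d j) (q j))"
      using orthonormal_span[of q "p i" i] nz[OF p] nz[OF q] by auto
    \<comment> \<open>Padding the coefficients with zeros up to index \<open>k\<close> lets
      \<open>orthonormal_expansion\<close> for \<open>q\<close> read off the coefficient at
      \<open>k\<close>, which is 0 since \<open>i < k\<close>.\<close>
    have d': "p i = (\<Sum>j\<le>k. Polynomial.smult (if j \<le> i then d j else 0) (q j))"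
      unfolding d using i by (intro sum.mono_neutral_cong_left) auto
    have "has_bochner_integral lborel (\<lambda>z. cnj (poly (q k) z) * poly (p i) z * ?w z) 0"
      using orthonormal_expansion[OF q order_refl, of k "\<lambda>j. if j \<le> i then d j else 0"] i
      unfolding d'[symmetric] by simp
    from has_bochner_integral_cnj[OF this]
    have "has_bochner_integral lborel (\<lambda>z. cnj (poly (p i) z) * poly (q k) z * ?w z) 0"
      by (simp add: mult_ac)
    moreover have "has_bochner_integral lborel (\<lambda>z. cnj (poly (p i) z) * poly (q k) z * ?w z) (c i)"
      unfolding c using i by (intro orthonormal_expansion[OF p]) simp
    ultimately show ?thesis using has_bochner_integral_eq by blast
  qed
  have "(\<Sum>j\<le>k. Polynomial.smult (c j) (p j)) = (\<Sum>j\<in>{k}. Polynomial.smult (c j) (p j))"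
    using cz by (intro sum.mono_neutral_right) auto
  then have qk: "q k = Polynomial.smult (c k) (p k)" unfolding c by simp
  obtain a b :: real where ab: "a > 0" "b > 0" "lead_coeff (p k) = of_real a" "lead_coeff (q k) = of_real b"
    using spec[OF conjunct1[OF p[unfolded is_orthonormal_polys_def]], of k]
      spec[OF conjunct1[OF q[unfolded is_orthonormal_polys_def]], of k] by auto
  have "c k * of_real a = of_real b"
    using lead_coeff_smult[of "c k" "p k"] unfolding qk[symmetric] ab(3) ab(4) by simp
  then have ck: "c k = of_real (b / a)" using ab by (simp add: field_simps)
  have "has_bochner_integral lborel (\<lambda>z. cnj (poly (q k) z) * poly (q k) z * ?w z) 1"
    using conjunct2[OF q[unfolded is_orthonormal_polys_def], rule_format, of k k] by simp
  moreover have "has_bochner_integral lborel (\<lambda>z. cnj (poly (p k) z) * poly (p k) z * ?w z) 1"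
    using conjunct2[OF p[unfolded is_orthonormal_polys_def], rule_format, of k k] by simp
  then have "has_bochner_integral lborel (\<lambda>z. (cnj (c k) * c k) * (cnj (poly (p k) z) * poly (p k) z * ?w z)) ((cnj (c k) * c k) * 1)"
    by (intro has_bochner_integral_mult_right) auto
  then have "has_bochner_integral lborel (\<lambda>z. cnj (poly (q k) z) * poly (q k) z * ?w z) (cnj (c k) * c k)"
    unfolding qk by (simp add: mult_ac)
  ultimately have "cnj (c k) * c k = 1" using has_bochner_integral_eq by blast
  then have "complex_of_real ((b / a) * (b / a)) = of_real 1" unfolding ck by (simp flip: of_real_mult)
  then have "(b / a) * (b / a) = 1" by (simp only: of_real_eq_iff)
  then have "(b / a)\<^sup>2 = 1\<^sup>2" by (simp only: power2_eq_square mult_1_left)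
  then have "b / a = 1" using ab by (subst (asm) power2_eq_iff_nonneg) auto
  then show "p k = q k" using qk ck by simp
qed

text \<open>With uniqueness this evaluates the definite description in
  \<open>orthonormal_polys\<close>; the radicand is the squared norm found in
  \<open>pip_ell_poly\<close>.\<close>

lemma orthonormal_ell:
  assumes nt: "n \<ge> 1" "2 * cmod t2 < 1"
  shows "orthonormal_polys (ell_potential t1 t2) n
    = (\<lambda>k. Polynomial.smult (of_real (1 / sqrt (fact k * (real n * (1 - 4 * (cmod t2)\<^sup>2)) ^ k * ew_mass n t1 t2))) (ell_poly n t1 t2 k))"
    (is "_ = ?p")
proof -
  define \<kappa> where "\<kappa> = real n * (1 - 4 * (cmod t2)\<^sup>2)"
  have sq: "1 - 4 * (cmod t2)\<^sup>2 > 0"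
    using sq_less_one[of "2 * cmod t2"] nt by (auto simp: power_mult_distrib)
  then have \<kappa>: "\<kappa> > 0" using nt by (simp add: \<kappa>_def)
  have Z: "ew_mass n t1 t2 > 0" unfolding ew_mass_def ew_def using sq nt by simp
  define r where "r k = sqrt (fact k * \<kappa> ^ k * ew_mass n t1 t2)" for k
  have r: "r k > 0" "r k * r k = fact k * \<kappa> ^ k * ew_mass n t1 t2" for k
    using \<kappa> Z by (auto simp: r_def)
  have p: "?p = (\<lambda>k. Polynomial.smult (of_real (1 / r k)) (ell_poly n t1 t2 k))"
    by (simp add: r_def \<kappa>_def)
  have "is_orthonormal_polys (ell_potential t1 t2) n ?p"
    unfolding is_orthonormal_polys_def p
  proof (intro conjI allI)
    fix k l
    show "degree (Polynomial.smult (of_real (1 / r k)) (ell_poly n t1 t2 k)) = k"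
      using ell_poly_lead[OF nt] r(1)[of k] by simp
    have lk: "lead_coeff (ell_poly n t1 t2 k) = of_real (\<kappa> ^ k)"
      using ell_poly_lead[OF nt, of t1 k] unfolding \<kappa>_def by blast+
    show "\<exists>c>0. lead_coeff (Polynomial.smult (of_real (1 / r k)) (ell_poly n t1 t2 k)) = complex_of_real c"
      unfolding lead_coeff_smult lk using r(1)[of k] \<kappa>
      by (intro exI[of _ "1 / r k * \<kappa> ^ k"]) simp
    have "pip n t1 t2 (Polynomial.smult (of_real (1 / r k)) (ell_poly n t1 t2 k)) (Polynomial.smult (of_real (1 / r l)) (ell_poly n t1 t2 l))
       = (if k = l then 1 else 0)"
    proof -
      have "pip n t1 t2 (Polynomial.smult (of_real (1 / r k)) (ell_poly n t1 t2 k)) (Polynomial.smult (of_real (1 / r l)) (ell_poly n t1 t2 l))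
        = of_real (1 / r k) * (of_real (1 / r l) * pip n t1 t2 (ell_poly n t1 t2 k) (ell_poly n t1 t2 l))"
        unfolding pip_smult_left[OF nt] pip_smult_right[OF nt] by simp
      also have "\<dots> = (if k = l then of_real (1 / r k * (1 / r k) * (r k * r k)) else 0)"
        unfolding pip_ell_poly[OF nt] \<kappa>_def[symmetric] r(2)[symmetric] using r(1)[of l] by auto
      also have "\<dots> = (if k = l then 1 else 0)" using r(1)[of l] by auto
      finally show ?thesis .
    qed
    then show "has_bochner_integral lborel
         (\<lambda>z. cnj (poly (Polynomial.smult (of_real (1 / r k)) (ell_poly n t1 t2 k)) z) *
              poly (Polynomial.smult (of_real (1 / r l)) (ell_poly n t1 t2 l)) z *
              complex_of_real (exp (- (real n * ell_potential t1 t2 z))))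
         (if k = l then 1 else 0)"
      using pip_integrable[OF nt] unfolding has_bochner_integral_iff pip_def ew_def by blast
  qed
  then show ?thesis unfolding orthonormal_polys_def
    using orthonormal_polys_unique by (intro the_equality) blast+
qed

text \<open>The rotation that aligns the axes of the ellipse with the coordinate axes. The value 1
  at \<open>t2 = 0\<close> is a convention under which the disc is an ellipse like the
  others.\<close>

definition ell_rot :: "complex \<Rightarrow> complex" where
  "ell_rot t2 = (if t2 = 0 then 1 else csqrt (t2 / of_real (cmod t2)))"

lemma ell_rot: "cmod (ell_rot t2) = 1" "of_real (cmod t2) * (ell_rot t2)\<^sup>2 = t2"
  unfolding ell_rot_def
proof -
  have "(cmod (csqrt (t2 / of_real (cmod t2))))\<^sup>2 = 1" if "t2 \<noteq> 0"
    using that by (simp add: norm_divide flip: norm_power)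
  then show "cmod (if t2 = 0 then 1 else csqrt (t2 / of_real (cmod t2))) = 1"
    by (auto simp: power2_eq_1_iff)
qed auto

text \<open>The factor \<open>sqrt (n * (1 - \<tau>\<^sup>2))\<close> with \<tau> =
  \<open>2 * cmod t2\<close> is what matches the raising recurrence with that of
  \<open>herm\<close>. It gives the image of the limiting ellipse the semi-axes
  \<open>sqrt n * (1 + \<tau>)\<close> and \<open>sqrt n * (1 - \<tau>)\<close>.\<close>

definition ell_coord :: "nat \<Rightarrow> complex \<Rightarrow> complex \<Rightarrow> complex \<Rightarrow> complex" where
  "ell_coord n t1 t2 z = of_real (sqrt (real n * (1 - (2 * cmod t2)\<^sup>2))) * ell_rot t2 * (z - ell_center t1 t2)"

text \<open>By \<open>pderiv_ell_poly\<close> the raising step is a three-term recurrence. One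
  factor \<open>cnj (ell_rot t2)\<close> per degree absorbs the argument of \<open>t2\<close>, and
  the recurrence of \<open>herm\<close> with real parameter remains.\<close>

lemma poly_ell_poly:
  assumes nt: "n \<ge> 1" "2 * cmod t2 < 1"
  shows "poly (ell_poly n t1 t2 k) z = (of_real (sqrt (real n * (1 - (2 * cmod t2)\<^sup>2))) * cnj (ell_rot t2)) ^ k
     * herm (2 * cmod t2) k (ell_coord n t1 t2 z)"
proof (induction k rule: less_induct)
  case (less k)
  define \<kappa> where "\<kappa> = real n * (1 - (2 * cmod t2)\<^sup>2)"
  have \<kappa>: "\<kappa> > 0"
    using sq_less_one[of "2 * cmod t2"] nt by (auto simp: \<kappa>_def)
  have \<kappa>': "real n * (1 - 4 * (cmod t2)\<^sup>2) = \<kappa>" by (simp add: \<kappa>_def power_mult_distrib)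
  define s where "s = complex_of_real (sqrt \<kappa>)"
  have ss: "s * s = of_real \<kappa>" using \<kappa> unfolding s_def of_real_mult[symmetric] by simp
  define \<omega> where "\<omega> = ell_rot t2"
  have \<omega>1: "cnj \<omega> * \<omega> = 1" using ell_rot(1)[of t2] complex_norm_square[of \<omega>] by (simp add: \<omega>_def mult.commute)
  have t2: "cnj t2 = of_real (cmod t2) * (cnj \<omega> * cnj \<omega>)"
    using arg_cong[OF ell_rot(2)[of t2], of cnj] by (simp add: \<omega>_def power2_eq_square)
  define X where "X = ell_coord n t1 t2 z"
  have X: "X = s * \<omega> * (z - ell_center t1 t2)" by (simp add: X_def ell_coord_def s_def \<kappa>_def \<omega>_def)
  have zX: "of_real \<kappa> * (z - ell_center t1 t2) = s * cnj \<omega> * X"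
    unfolding X ss[symmetric] using \<omega>1 by (metis (no_types, opaque_lifting) mult.assoc mult.left_commute mult.right_neutral)
  show ?case
  proof (cases k)
    case 0
    then show ?thesis by simp
  next
    case (Suc j)
    have IH: "poly (ell_poly n t1 t2 i) z = (s * cnj \<omega>) ^ i * herm (2 * cmod t2) i X" if "i \<le> j" for i
      using less[of i] that Suc by (simp add: s_def \<kappa>_def \<omega>_def X_def)
    have "poly (ell_poly n t1 t2 k) z = of_real \<kappa> * (z - ell_center t1 t2) * poly (ell_poly n t1 t2 j) z
       - cnj (2 * t2) * (of_nat j * of_real \<kappa> * poly (ell_poly n t1 t2 (j - 1)) z)"
      unfolding Suc ell_poly.simps raise_poly_def pderiv_ell_poly \<kappa>' by (simp add: algebra_simps)
    also have "\<dots> = (s * cnj \<omega>) ^ k * herm (2 * cmod t2) k X"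
    proof (cases j)
      case 0
      then show ?thesis unfolding zX using IH[of j] Suc by simp
    next
      case (Suc i)
      have 1: "of_real \<kappa> * (z - ell_center t1 t2) * poly (ell_poly n t1 t2 j) z = (s * cnj \<omega>) ^ k * (X * herm (2 * cmod t2) j X)"
        unfolding zX IH[OF order_refl] \<open>k = Suc j\<close> by simp
      have IHi: "poly (ell_poly n t1 t2 i) z = (s * cnj \<omega>) ^ i * herm (2 * cmod t2) i X"
        using IH[of i] Suc by simp
      have 2: "cnj (2 * t2) * (of_nat j * of_real \<kappa> * poly (ell_poly n t1 t2 (j - 1)) z)
         = (s * cnj \<omega>) ^ k * (of_real (2 * cmod t2 * real j) * herm (2 * cmod t2) (j - 1) X)"
        unfolding \<open>k = Suc j\<close> Suc complex_cnj_mult t2 ss[symmetric] using IHi by simp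
      show ?thesis unfolding 1 2 \<open>k = Suc j\<close> herm_Suc by (simp add: right_diff_distrib)
    qed
    finally show ?thesis by (simp add: s_def \<kappa>_def \<omega>_def X_def)
  qed
qed

text \<open>The imaginary part of Mehler's exponent, in terms of the original coordinates relative
  to the centre.\<close>

definition ell_phase :: "nat \<Rightarrow> complex \<Rightarrow> complex \<Rightarrow> complex \<Rightarrow> real" where
  "ell_phase n t2 x y = real n * (Im (cnj x * y) - Im (t2 * (y\<^sup>2 - x\<^sup>2)))"

text \<open>The normalised polynomials produce the Mehler sum at \<open>s = 1\<close>. Factoring out
  its closed form leaves \<open>nkern\<close>, and the closed form combines with the two weights to
  a Gaussian in \<open>w - z\<close> and a phase.\<close>

lemma repr_kernel_nkern:
  assumes nt: "n \<ge> 1" "2 * cmod t2 < 1"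
  shows "repr_kernel (ell_potential t1 t2) n w z
    = of_real (real n / pi) * exp (\<i> * of_real (ell_phase n t2 (w - ell_center t1 t2) (z - ell_center t1 t2)))
      * of_real (exp (- (real n * (cmod (w - z))\<^sup>2 / 2)))
      * nkern (2 * cmod t2) n (cnj (ell_coord n t1 t2 w)) (ell_coord n t1 t2 z)"
proof -
  define \<tau> where "\<tau> = 2 * cmod t2"
  define D where "D = 1 - \<tau>\<^sup>2"
  define \<kappa> where "\<kappa> = real n * D"
  have D: "D > 0" using sq_less_one[of \<tau>] nt by (auto simp: D_def \<tau>_def)
  have \<kappa>: "\<kappa> > 0" using D nt by (simp add: \<kappa>_def)
  have \<kappa>': "real n * (1 - 4 * (cmod t2)\<^sup>2) = \<kappa>" by (simp add: \<kappa>_def D_def \<tau>_def power_mult_distrib)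
  define s where "s = complex_of_real (sqrt \<kappa>)"
  define \<omega> where "\<omega> = ell_rot t2"
  define v where "v = ell_center t1 t2"
  define x where "x = w - v"
  define y where "y = z - v"
  define X where "X = ell_coord n t1 t2 w"
  define Y where "Y = ell_coord n t1 t2 z"
  define Z where "Z = ew_mass n t1 t2"
  have XY: "X = s * \<omega> * x" "Y = s * \<omega> * y"
    by (simp_all add: X_def Y_def ell_coord_def s_def \<kappa>_def \<omega>_def x_def y_def v_def D_def \<tau>_def)
  have \<omega>1: "cnj \<omega> * \<omega> = 1" using ell_rot(1)[of t2] complex_norm_square[of \<omega>] by (simp add: \<omega>_def mult.commute)
  have ss: "s * s = of_real \<kappa>" "cnj s = s" using \<kappa> unfolding s_def of_real_mult[symmetric] by auto
  have Z: "Z > 0" "Z = ew n t1 t2 v * (pi / (real n * sqrt D))"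
    unfolding Z_def ew_mass_def ew_def v_def using D nt by (auto simp: D_def \<tau>_def power_mult_distrib)
  have summand: "cnj (poly (orthonormal_polys (ell_potential t1 t2) n k) w) * poly (orthonormal_polys (ell_potential t1 t2) n k) z
     = of_real (1 / Z) * (1 ^ k * herm \<tau> k (cnj X) * herm \<tau> k Y / fact k)" for k
  proof -
    define r where "r = sqrt (fact k * \<kappa> ^ k * Z)"
    have rr: "r * r = fact k * \<kappa> ^ k * Z" using \<kappa> Z(1) by (simp add: r_def)
    have on: "poly (orthonormal_polys (ell_potential t1 t2) n k) u = of_real (1 / r) * ((s * cnj \<omega>) ^ k * herm \<tau> k (ell_coord n t1 t2 u))" for u
      unfolding orthonormal_ell[OF nt] \<kappa>' Z_def[symmetric] r_def[symmetric]
      using poly_ell_poly[OF nt, of t1 k u] by (simp add: s_def \<kappa>_def D_def \<tau>_def \<omega>_def)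
    have "cnj ((s * cnj \<omega>) ^ k) * (s * cnj \<omega>) ^ k = (s * s * (cnj \<omega> * \<omega>)) ^ k"
    proof -
      have "cnj (s * cnj \<omega>) * (s * cnj \<omega>) = s * s * (cnj \<omega> * \<omega>)" by (simp add: ss mult_ac)
      then show ?thesis unfolding complex_cnj_power power_mult_distrib[symmetric] by (simp only:)
    qed
    also have "\<dots> = of_real (\<kappa> ^ k)" by (simp add: ss \<omega>1)
    finally have pk: "cnj ((s * cnj \<omega>) ^ k) * (s * cnj \<omega>) ^ k = of_real (\<kappa> ^ k)" .
    have "cnj (poly (orthonormal_polys (ell_potential t1 t2) n k) w) * poly (orthonormal_polys (ell_potential t1 t2) n k) z
       = of_real (1 / (r * r)) * (cnj ((s * cnj \<omega>) ^ k) * (s * cnj \<omega>) ^ k) * (herm \<tau> k (cnj X) * herm \<tau> k Y)"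
      unfolding on X_def Y_def herm_cnj by simp
    also have "\<dots> = of_real (1 / (r * r) * \<kappa> ^ k) * (herm \<tau> k (cnj X) * herm \<tau> k Y)"
      unfolding pk by simp
    also have "1 / (r * r) * \<kappa> ^ k = 1 / Z * (1 / fact k)"
      unfolding rr using \<kappa> Z by simp
    finally show ?thesis by simp
  qed
  have sum: "(\<Sum>k<n. cnj (poly (orthonormal_polys (ell_potential t1 t2) n k) w) * poly (orthonormal_polys (ell_potential t1 t2) n k) z)
     = of_real (1 / Z) * mehler_sum \<tau> 1 n (cnj X) Y"
    unfolding summand mehler_sum_def by (simp add: sum_distrib_left)
  define P where "P u = (cmod u)\<^sup>2 - 2 * Re (t2 * u\<^sup>2)" for u
  have V: "ell_potential t1 t2 w = ell_potential t1 t2 v + P x" "ell_potential t1 t2 z = ell_potential t1 t2 v + P y"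
    unfolding v_def P_def x_def y_def by (rule ell_potential_center[OF nt(2)])+
  have "exp (- (real n / 2) * (ell_potential t1 t2 w + ell_potential t1 t2 z))
     = ew n t1 t2 v * exp (- (real n / 2) * (P x + P y))"
    unfolding V ew_def exp_add[symmetric] by (simp add: algebra_simps)
  then have pre: "exp (- (real n / 2) * (ell_potential t1 t2 w + ell_potential t1 t2 z)) * (1 / Z)
     = real n / pi * sqrt D * exp (- (real n / 2) * (P x + P y))"
    unfolding Z(2) using D nt by (simp add: ew_def field_simps)
  have mexp: "mehler_exp \<tau> 1 (cnj X) Y = of_real (real n) * (cnj x * y - t2 * y\<^sup>2 - cnj (t2 * x\<^sup>2))"
  proof -
    have tw: "of_real \<tau> * \<omega>\<^sup>2 = 2 * t2" using ell_rot(2)[of t2] by (simp add: \<tau>_def \<omega>_def mult.assoc)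
    have tw': "of_real \<tau> * (cnj \<omega>)\<^sup>2 = 2 * cnj t2" using arg_cong[OF tw, of cnj] by simp
    have a: "cnj X * Y = of_real \<kappa> * (cnj x * y)"
    proof -
      have "cnj X * Y = (s * s) * (cnj \<omega> * \<omega>) * (cnj x * y)" unfolding XY complex_cnj_mult ss(2) by (simp only: mult_ac)
      then show ?thesis unfolding ss \<omega>1 by simp
    qed
    have b: "of_real \<tau> * Y\<^sup>2 = of_real \<kappa> * (2 * t2 * y\<^sup>2)"
    proof -
      have "of_real \<tau> * Y\<^sup>2 = (s * s) * (of_real \<tau> * \<omega>\<^sup>2) * y\<^sup>2" unfolding XY by (simp add: power2_eq_square)
      then show ?thesis unfolding ss tw by simp
    qed
    have c: "of_real \<tau> * (cnj X)\<^sup>2 = of_real \<kappa> * (2 * cnj t2 * (cnj x)\<^sup>2)"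
    proof -
      have "of_real \<tau> * (cnj X)\<^sup>2 = (s * s) * (of_real \<tau> * (cnj \<omega>)\<^sup>2) * (cnj x)\<^sup>2" unfolding XY complex_cnj_mult ss(2) by (simp add: power2_eq_square)
      then show ?thesis unfolding ss tw' by simp
    qed
    have "mehler_exp \<tau> 1 (cnj X) Y = (cnj X * Y - (of_real \<tau> * Y\<^sup>2 + of_real \<tau> * (cnj X)\<^sup>2) / 2) / of_real D"
      by (simp add: mehler_exp_def D_def distrib_left)
    also have "\<dots> = of_real \<kappa> * (cnj x * y - t2 * y\<^sup>2 - cnj (t2 * x\<^sup>2)) / of_real D"
      unfolding a b c by (simp add: algebra_simps)
    also have "\<dots> = of_real (real n) * (cnj x * y - t2 * y\<^sup>2 - cnj (t2 * x\<^sup>2))"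
      using D by (simp add: \<kappa>_def)
    finally show ?thesis .
  qed
  \<comment> \<open>The weights cancel the real part of Mehler's exponent up to
    \<open>- n * (cmod (w - z))\<^sup>2 / 2\<close>; they are real and leave its imaginary part
    alone.\<close>
  have expo: "of_real (- (real n / 2) * (P x + P y)) + mehler_exp \<tau> 1 (cnj X) Y
     = \<i> * of_real (ell_phase n t2 x y) + of_real (- (real n * (cmod (w - z))\<^sup>2 / 2))"
  proof -
    have wz: "w - z = x - y" by (simp add: x_def y_def)
    have "of_real (- (1 / 2) * (P x + P y)) + (cnj x * y - t2 * y\<^sup>2 - cnj (t2 * x\<^sup>2))
      = \<i> * of_real (Im (cnj x * y) - Im (t2 * (y\<^sup>2 - x\<^sup>2))) + of_real (- ((cmod (w - z))\<^sup>2 / 2))"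
      unfolding P_def wz cmod_power2 by (simp add: complex_eq_iff power2_eq_square field_simps)
    from arg_cong[OF this, of "\<lambda>u. of_real (real n) * u"] show ?thesis
      unfolding mexp ell_phase_def by (simp add: algebra_simps)
  qed
  have "repr_kernel (ell_potential t1 t2) n w z = of_real (real n / pi * sqrt D * exp (- (real n / 2) * (P x + P y))) * mehler_sum \<tau> 1 n (cnj X) Y"
    unfolding repr_kernel_def sum pre[symmetric] by simp
  also have "\<dots> = of_real (real n / pi) * (of_real (exp (- (real n / 2) * (P x + P y))) * exp (mehler_exp \<tau> 1 (cnj X) Y)) * nkern \<tau> n (cnj X) Y"
    unfolding nkern_def D_def[symmetric] by (simp add: exp_minus)
  also have "of_real (exp (- (real n / 2) * (P x + P y))) * exp (mehler_exp \<tau> 1 (cnj X) Y)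
     = exp (\<i> * of_real (ell_phase n t2 x y)) * of_real (exp (- (real n * (cmod (w - z))\<^sup>2 / 2)))"
    unfolding exp_of_real[symmetric] exp_add[symmetric] expo ..
  finally show ?thesis by (simp add: \<tau>_def X_def Y_def x_def y_def v_def mult.assoc)
qed

section \<open>Vitali's theorem, the error function and the central limit theorem\<close>

text \<open>If it failed, Montel's theorem would extract a locally uniform limit along a subsequence
  of bad indices. That limit is entire and zero on the real line, hence zero, and uniformity on a
  disc containing all points \<open>w n\<close> gives the contradiction.\<close>

lemma vitali_null_sequence:
  fixes F :: "nat \<Rightarrow> complex \<Rightarrow> complex"
  assumes holo: "\<And>n. F n holomorphic_on UNIV"
    and bd: "\<And>R. \<exists>B. \<forall>n z. cmod z \<le> R \<longrightarrow> cmod (F n z) \<le> B"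
    and real: "\<And>x::real. (\<lambda>n. F n (of_real x)) \<longlonglongrightarrow> 0"
    and w: "\<And>n. cmod (w n) \<le> R"
  shows "(\<lambda>n. F n (w n)) \<longlonglongrightarrow> 0"
proof (rule ccontr)
  assume "\<not> (\<lambda>n. F n (w n)) \<longlonglongrightarrow> 0"
  then obtain e where e: "e > 0" "\<exists>\<^sub>F n in sequentially. \<not> cmod (F n (w n)) < e"
    unfolding tendsto_iff dist_norm by (auto simp: not_eventually)
  then have "infinite {n. \<not> cmod (F n (w n)) < e}"
    by (simp add: frequently_cofinite[symmetric] cofinite_eq_sequentially)
  then obtain r :: "nat \<Rightarrow> nat" where r: "strict_mono r" "\<And>j. r j \<in> {n. \<not> cmod (F n (w n)) < e}"
    using infinite_enumerate by blast
  have bdK: "\<exists>B. \<forall>h\<in>range F. \<forall>z\<in>K. norm (h z) \<le> B" if "compact K" for K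
  proof -
    obtain R where R: "\<forall>z\<in>K. cmod z \<le> R" using compact_imp_bounded[OF \<open>compact K\<close>] unfolding bounded_iff by blast
    obtain B where "\<forall>n z. cmod z \<le> R \<longrightarrow> cmod (F n z) \<le> B" using bd by blast
    then show ?thesis using R by (intro exI[of _ B]) auto
  qed
  have "\<exists>g k. g holomorphic_on UNIV \<and> strict_mono (k :: nat \<Rightarrow> nat) \<and> (\<forall>x. (\<lambda>n. F (r (k n)) x) \<longlonglongrightarrow> g x)
      \<and> (\<forall>K. compact K \<longrightarrow> uniform_limit K ((\<lambda>j. F (r j)) \<circ> k) g sequentially)"
  proof (rule Montel[of UNIV "range F" "\<lambda>j. F (r j)"])
    fix g and k :: "nat \<Rightarrow> nat"
    assume "g holomorphic_on UNIV" "strict_mono k" "\<And>x. x \<in> UNIV \<Longrightarrow> (\<lambda>n. F (r (k n)) x) \<longlonglongrightarrow> g x"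
      "\<And>K. compact K \<Longrightarrow> K \<subseteq> UNIV \<Longrightarrow> uniform_limit K ((\<lambda>j. F (r j)) \<circ> k) g sequentially"
    then show ?thesis by (intro exI[of _ g] exI[of _ k]) auto
  qed (use holo bdK in auto)
  then obtain g k where g: "g holomorphic_on UNIV" and k: "strict_mono (k :: nat \<Rightarrow> nat)"
      and pt: "\<And>x. (\<lambda>n. F (r (k n)) x) \<longlonglongrightarrow> g x"
      and ul: "\<And>K. compact K \<Longrightarrow> uniform_limit K ((\<lambda>j. F (r j)) \<circ> k) g sequentially"
    by blast
  have rk: "strict_mono (\<lambda>n. r (k n))" using r(1) k by (simp add: strict_mono_def)
  have g0: "g (of_real x) = 0" for x
  proof -
    have "(\<lambda>n. F (r (k n)) (of_real x)) \<longlonglongrightarrow> 0"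
      using LIMSEQ_subseq_LIMSEQ[OF real rk] by (simp add: o_def)
    then show ?thesis using pt LIMSEQ_unique by blast
  qed
  have lim: "(0::complex) islimpt (range of_real)"
    unfolding islimpt_approachable
  proof (intro allI impI)
    fix e :: real assume "e > 0"
    then show "\<exists>x'\<in>range of_real. x' \<noteq> 0 \<and> dist x' (0::complex) < e"
      by (intro bexI[OF _ rangeI[of of_real "e / 2"]]) (auto simp: norm_divide)
  qed
  have gz: "g z = 0" for z
    by (rule analytic_continuation[OF g _ _ _ _ lim]) (use g0 in auto)
  have "uniform_limit (cball 0 R) ((\<lambda>j. F (r j)) \<circ> k) g sequentially" by (rule ul) simp
  then have "\<forall>\<^sub>F n in sequentially. \<forall>z\<in>cball 0 R. dist (F (r (k n)) z) (g z) < e"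
    using e(1) by (auto dest: uniform_limitD simp: o_def)
  then obtain n where "\<forall>z\<in>cball 0 R. dist (F (r (k n)) z) (g z) < e"
    by (auto simp: eventually_sequentially)
  then have "cmod (F (r (k n)) (w (r (k n)))) < e" using w by (auto simp: gz)
  then show False using r(2)[of "k n"] by simp
qed

section \<open>The complementary error function on the complex plane\<close>

lemma cmod_exp_gauss:
  "cmod (exp (- (z + complex_of_real x)\<^sup>2)) \<le> exp ((cmod z)\<^sup>2) * exp (- (x\<^sup>2 / 2))"
proof -
  \<comment> \<open>This square is the difference of the two sides of the next inequality.\<close>
  have "0 \<le> 2 * (Re z + x / 2)\<^sup>2" by simp
  then have "- Re ((z + complex_of_real x)\<^sup>2) \<le> (cmod z)\<^sup>2 - x\<^sup>2 / 2"
    unfolding cmod_power2 by (simp add: power2_eq_square algebra_simps)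
  then show ?thesis by (simp add: exp_add[symmetric])
qed

lemma integrable_gauss_half: "integrable lborel (\<lambda>x::real. exp (- (x\<^sup>2 / 2)))"
proof (rule integrableI_nonneg)
  show "(\<integral>\<^sup>+x. ennreal (exp (- (x\<^sup>2 / 2))) \<partial>lborel) < \<infinity>"
    using nn_integral_gauss[of "1/2" 0] by (simp add: mult.commute)
qed auto

lemma integrable_erfc_integrand: "integrable lborel (\<lambda>x. indicator S x *\<^sub>R exp (- (z + complex_of_real x)\<^sup>2))"
  if [measurable]: "S \<in> sets borel"
proof (rule Bochner_Integration.integrable_bound)
  show "integrable lborel (\<lambda>x::real. exp ((cmod z)\<^sup>2) * exp (- (x\<^sup>2 / 2)))"
    using integrable_gauss_half by simp
  have [measurable]: "(\<lambda>x::real. exp (- (z + complex_of_real x)\<^sup>2)) \<in> borel_measurable borel"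
    by (intro borel_measurable_continuous_onI continuous_intros)
  show "(\<lambda>x. indicator S x *\<^sub>R exp (- (z + complex_of_real x)\<^sup>2)) \<in> borel_measurable lborel"
    by simp
  show "AE x in lborel. norm (indicator S x *\<^sub>R exp (- (z + complex_of_real x)\<^sup>2)) \<le> norm (exp ((cmod z)\<^sup>2) * exp (- (x\<^sup>2 / 2)))"
    using cmod_exp_gauss[of z] by (auto simp: indicator_def)
qed

text \<open>The integral over \<open>[0, N]\<close> equals \<open>f (z + N) - f z\<close> for an
  entire primitive \<open>f\<close> of \<open>exp (- z\<^sup>2)\<close>, so it is entire without
  differentiating under the integral. The tails vanish locally uniformly by
  \<open>cmod_exp_gauss\<close>.\<close>

lemma holomorphic_erfc: "erfc holomorphic_on UNIV"
proof -
  have "(\<lambda>z::complex. exp (- z\<^sup>2)) holomorphic_on UNIV" by (intro holomorphic_intros)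
  then have "\<exists>f. \<forall>z::complex. (f has_field_derivative exp (- z\<^sup>2)) (at z)"
  proof (rule holomorphic_convex_primitive'[OF convex_UNIV open_UNIV])
    fix g assume "\<And>x::complex. x \<in> UNIV \<Longrightarrow> (g has_field_derivative exp (- x\<^sup>2)) (at x)"
    then show ?thesis by auto
  qed
  then obtain f where f: "\<And>z::complex. (f has_field_derivative exp (- z\<^sup>2)) (at z)" by blast
  define E where "E z = (LBINT x:{0..}. exp (- (z + complex_of_real x)\<^sup>2))" for z
  define EN where "EN N z = f (z + of_nat N) - f z" for N z
  define tl where "tl N = (\<integral>x. indicator {real N..} x *\<^sub>R exp (- (x\<^sup>2 / 2)) \<partial>lborel)" for N
  have EN: "EN N z = (\<integral>x. indicator {0..real N} x *\<^sub>R exp (- (z + complex_of_real x)\<^sup>2) \<partial>lborel)" for N z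
  proof -
    have der: "((\<lambda>x. f (z + complex_of_real x)) has_vector_derivative exp (- (z + complex_of_real x)\<^sup>2)) (at x within T)" for x T
    proof -
      have "((\<lambda>x::real. z + of_real x) has_vector_derivative 1) (at x)"
        by (auto intro!: derivative_eq_intros simp: has_vector_derivative_def scaleR_conv_of_real)
      then have "(f \<circ> (\<lambda>x. z + complex_of_real x) has_vector_derivative 1 * exp (- (z + complex_of_real x)\<^sup>2)) (at x)"
        by (rule field_vector_diff_chain_at) (rule f)
      then show ?thesis by (simp add: o_def has_vector_derivative_at_within)
    qed
    show ?thesis
      by (subst integral_FTC_atLeastAtMost[OF _ der]) (auto simp: EN_def intro!: continuous_intros)
  qed
  have tl: "tl \<longlonglongrightarrow> 0"
  proof -
    have "(\<lambda>N. \<integral>x. indicator {real N..} x *\<^sub>R exp (- (x\<^sup>2 / 2)) \<partial>lborel) \<longlonglongrightarrow> (\<integral>x. (0::real) \<partial>(lborel::real measure))"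
    proof (rule integral_dominated_convergence)
      show "AE x in lborel. (\<lambda>N. indicator {real N..} x *\<^sub>R exp (- (x\<^sup>2 / 2))) \<longlonglongrightarrow> 0"
      proof (rule AE_I2)
        fix x :: real
        obtain N where "x < real N" using reals_Archimedean2 by blast
        then have "\<forall>\<^sub>F n in sequentially. indicator {real n..} x *\<^sub>R exp (- (x\<^sup>2 / 2)) = 0"
          unfolding eventually_sequentially by (intro exI[of _ N]) (auto simp: indicator_def)
        then show "(\<lambda>N. indicator {real N..} x *\<^sub>R exp (- (x\<^sup>2 / 2))) \<longlonglongrightarrow> 0"
          by (rule tendsto_eventually)
      qed
      show "AE x in lborel. norm (indicator {real N..} x *\<^sub>R exp (- (x\<^sup>2 / 2))) \<le> exp (- (x\<^sup>2 / 2))" for N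
        by (auto simp: indicator_def)
    qed (use integrable_gauss_half in auto)
    then show ?thesis unfolding tl_def by simp
  qed
  have diff: "cmod (EN N z - E z) \<le> exp ((cmod z)\<^sup>2) * tl N" for N z
  proof -
    have "E z - EN N z = (\<integral>x. indicator {0..} x *\<^sub>R exp (- (z + complex_of_real x)\<^sup>2) - indicator {0..real N} x *\<^sub>R exp (- (z + complex_of_real x)\<^sup>2) \<partial>lborel)"
      unfolding EN E_def set_lebesgue_integral_def
      by (intro Bochner_Integration.integral_diff[symmetric] integrable_erfc_integrand) auto
    also have "cmod \<dots> \<le> (\<integral>x. exp ((cmod z)\<^sup>2) * (indicator {real N..} x *\<^sub>R exp (- (x\<^sup>2 / 2))) \<partial>lborel)"
    proof (rule Bochner_Integration.integral_norm_bound_integral)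
      show "integrable lborel (\<lambda>x. exp ((cmod z)\<^sup>2) * (indicator {real N..} x *\<^sub>R exp (- (x\<^sup>2 / 2))))"
        by (intro integrable_mult_right integrable_mult_indicator integrable_gauss_half) auto
      fix x :: real
      show "norm (indicator {0..} x *\<^sub>R exp (- (z + complex_of_real x)\<^sup>2) - indicator {0..real N} x *\<^sub>R exp (- (z + complex_of_real x)\<^sup>2))
         \<le> exp ((cmod z)\<^sup>2) * (indicator {real N..} x *\<^sub>R exp (- (x\<^sup>2 / 2)))"
        using cmod_exp_gauss[of z x] by (auto simp: indicator_def)
    qed (intro Bochner_Integration.integrable_diff integrable_erfc_integrand; simp)
    also have "\<dots> = exp ((cmod z)\<^sup>2) * tl N" by (simp add: tl_def)
    finally show ?thesis by (simp add: norm_minus_commute)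
  qed
  have "E holomorphic_on UNIV"
  proof (rule holomorphic_uniform_sequence[OF open_UNIV])
    have "f holomorphic_on UNIV" using f by (auto simp: holomorphic_on_def field_differentiable_def)
    from holomorphic_on_compose_gen[OF _ this]
    have fg: "(\<lambda>z. f (g z)) holomorphic_on UNIV" if "g holomorphic_on UNIV" for g
      using that by (auto simp: o_def)
    have "(\<lambda>z. f (z + of_nat N)) holomorphic_on UNIV" for N
      by (intro fg holomorphic_intros)
    then show "EN N holomorphic_on UNIV" for N
      unfolding EN_def[abs_def] using \<open>f holomorphic_on UNIV\<close> by (rule holomorphic_on_diff)
    fix x :: complex
    have "uniform_limit (cball x 1) EN E sequentially"
      unfolding uniform_limit_iff
    proof (intro allI impI)
      fix e :: real assume e: "e > 0"
      define B where "B = exp ((cmod x + 1)\<^sup>2)"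
      have "(\<lambda>N. B * tl N) \<longlonglongrightarrow> B * 0" by (intro tendsto_intros tl)
      then have "\<forall>\<^sub>F N in sequentially. B * tl N < e" using e by (auto dest: order_tendstoD)
      then show "\<forall>\<^sub>F N in sequentially. \<forall>z\<in>cball x 1. dist (EN N z) (E z) < e"
      proof eventually_elim
        case (elim N)
        show ?case
        proof
          fix z assume "z \<in> cball x 1"
          then have "cmod z \<le> cmod x + 1"
            by (metis dist_norm mem_cball norm_minus_commute norm_triangle_le_diff norm_triangle_sub add.commute add_left_mono order_trans)
          then have "exp ((cmod z)\<^sup>2) \<le> B" unfolding B_def by (simp add: power_mono)
          moreover have "0 \<le> tl N" unfolding tl_def by (intro Bochner_Integration.integral_nonneg) auto
          ultimately have "exp ((cmod z)\<^sup>2) * tl N \<le> B * tl N" by (intro mult_right_mono)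
          then show "dist (EN N z) (E z) < e" using diff[of N z] elim by (simp add: dist_norm)
        qed
      qed
    qed
    then show "\<exists>d>0. cball x d \<subseteq> UNIV \<and> uniform_limit (cball x d) EN E sequentially"
      by (intro exI[of _ 1]) auto
  qed
  then have "(\<lambda>z. of_real (2 / sqrt pi) * E z) holomorphic_on UNIV" by (intro holomorphic_intros)
  then show ?thesis unfolding erfc_def[abs_def] E_def .
qed

text \<open>The substitution \<open>y = - u - sqrt 2 * x\<close> maps the ray
  \<open>x \<ge> 0\<close> onto the lower tail of the normal distribution up to
  \<open>- u\<close>.\<close>

lemma erfc_std_normal:
  "erfc (of_real (u / sqrt 2)) = of_real (2 * cdf std_normal_distribution (- u))"
proof -
  interpret real_distribution std_normal_distribution by (rule real_dist_normal_dist)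
  have "cdf std_normal_distribution (- u) = (\<integral>y. indicator {..- u} y \<partial>std_normal_distribution)"
    by (simp add: cdf_def)
  also have "\<dots> = (\<integral>y. std_normal_density y * indicator {..- u} y \<partial>lborel)"
    by (subst integral_density) auto
  also have "\<dots> = \<bar>- sqrt 2\<bar> *\<^sub>R (\<integral>x. std_normal_density (- u + - sqrt 2 * x) * indicator {..- u} (- u + - sqrt 2 * x) \<partial>lborel)"
    by (rule lborel_integral_real_affine) simp
  also have "(\<lambda>x. std_normal_density (- u + - sqrt 2 * x) * indicator {..- u} (- u + - sqrt 2 * x))
     = (\<lambda>x. 1 / sqrt (2 * pi) * (indicator {0..} x *\<^sub>R exp (- (u / sqrt 2 + x)\<^sup>2)))"
  proof
    fix x :: real
    have "- (- u + - sqrt 2 * x)\<^sup>2 / 2 = - (u / sqrt 2 + x)\<^sup>2"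
      by (simp add: power2_eq_square field_simps)
    moreover have "indicator {..- u} (- u + - sqrt 2 * x) = (indicator {0..} x :: real)"
      by (simp add: indicator_def zero_le_mult_iff)
    ultimately show "std_normal_density (- u + - sqrt 2 * x) * indicator {..- u} (- u + - sqrt 2 * x)
       = 1 / sqrt (2 * pi) * (indicator {0..} x *\<^sub>R exp (- (u / sqrt 2 + x)\<^sup>2))"
      unfolding std_normal_density_def by simp
  qed
  also have "\<bar>- sqrt 2\<bar> *\<^sub>R (\<integral>x. 1 / sqrt (2 * pi) * (indicator {0..} x *\<^sub>R exp (- (u / sqrt 2 + x)\<^sup>2)) \<partial>lborel)
     = 1 / sqrt pi * (\<integral>x. indicator {0..} x *\<^sub>R exp (- (u / sqrt 2 + x)\<^sup>2) \<partial>lborel)"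
    by (subst integral_mult_right_zero) (simp add: real_sqrt_mult)
  finally have c: "2 * cdf std_normal_distribution (- u) = 2 / sqrt pi * (\<integral>x. indicator {0..} x *\<^sub>R exp (- (u / sqrt 2 + x)\<^sup>2) \<partial>lborel)"
    by simp
  have "(LBINT x:{0..}. exp (- (complex_of_real (u / sqrt 2) + complex_of_real x)\<^sup>2))
      = (\<integral>x. complex_of_real (indicator {0..} x *\<^sub>R exp (- (u / sqrt 2 + x)\<^sup>2)) \<partial>lborel)"
    unfolding set_lebesgue_integral_def
  proof (intro Bochner_Integration.integral_cong refl)
    fix x :: real
    have "exp (- (complex_of_real (u / sqrt 2) + complex_of_real x)\<^sup>2) = complex_of_real (exp (- (u / sqrt 2 + x)\<^sup>2))"
      unfolding exp_of_real[symmetric] by (simp only: of_real_add of_real_minus of_real_power)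
    then show "indicat_real {0..} x *\<^sub>R exp (- (complex_of_real (u / sqrt 2) + complex_of_real x)\<^sup>2)
      = complex_of_real (indicat_real {0..} x *\<^sub>R exp (- (u / sqrt 2 + x)\<^sup>2))"
      by (simp add: scaleR_conv_of_real)
  qed
  also have "\<dots> = of_real (\<integral>x. indicator {0..} x *\<^sub>R exp (- (u / sqrt 2 + x)\<^sup>2) \<partial>lborel)"
    by (rule integral_complex_of_real)
  finally show ?thesis unfolding erfc_def c of_real_mult by (simp only:)
qed

section \<open>Convergence to the normal distribution\<close>

lemma isCont_cdf_std_normal: "isCont (cdf std_normal_distribution) x"
proof -
  interpret real_distribution std_normal_distribution by (rule real_dist_normal_dist)
  have "emeasure std_normal_distribution {x} = (\<integral>\<^sup>+y. ennreal (std_normal_density y) * indicator {x} y \<partial>lborel)"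
    by (rule emeasure_density) auto
  also have "\<dots> = (\<integral>\<^sup>+y. 0 \<partial>(lborel::real measure))"
  proof (rule nn_integral_cong_AE)
    have "AE y in lborel. y \<noteq> x" by (rule AE_lborel_singleton)
    then show "AE y in lborel. ennreal (std_normal_density y) * indicator {x} y = 0"
      by eventually_elim (auto simp: indicator_def)
  qed
  finally have "measure std_normal_distribution {x} = 0" by (simp add: measure_def)
  then show ?thesis by (simp add: isCont_cdf)
qed

text \<open>Levy's continuity theorem speaks of measures on the real line. This turns a weight on
  the naturals, placed at the points \<open>\<phi> k\<close>, into such a measure and keeps the two
  functions that matter as series.\<close>

lemma discrete_real_distribution:
  fixes P :: "nat \<Rightarrow> real" and \<phi> :: "nat \<Rightarrow> real"
  assumes P0: "\<And>k. 0 \<le> P k" and P1: "P sums 1"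
  obtains M where "real_distribution M"
    "\<And>t. (\<lambda>k. of_real (P k) * iexp (t * \<phi> k)) sums char M t"
    "\<And>y. (\<lambda>k. if \<phi> k \<le> y then P k else 0) sums cdf M y"
proof -
  let ?D = "density (count_space UNIV) (\<lambda>k. ennreal (P k))"
  have sm: "summable P" using P1 by (rule sums_summable)
  have "emeasure ?D (space ?D) = (\<integral>\<^sup>+k. ennreal (P k) \<partial>count_space UNIV)"
    by (simp add: emeasure_density)
  also have "\<dots> = ennreal (\<Sum>k. P k)"
    by (simp add: nn_integral_count_space_nat suminf_ennreal_eq[OF P0 P1] sums_unique[OF P1])
  finally have "emeasure ?D (space ?D) = 1" using sums_unique[OF P1] by simp
  then interpret D: prob_space ?D by (rule prob_spaceI)
  let ?M = "distr ?D borel \<phi>"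
  have [measurable]: "\<phi> \<in> borel_measurable ?D" by simp
  have rd: "real_distribution ?M" by (rule D.real_distribution_distr) simp
  have ic: "integrable (count_space UNIV) (\<lambda>k. P k *\<^sub>R f k)" if "\<And>k. norm (f k) \<le> 1" for f :: "nat \<Rightarrow> 'b::{banach,second_countable_topology}"
    unfolding integrable_count_space_nat_iff
  proof (rule summable_comparison_test[OF _ sm])
    show "\<exists>N. \<forall>n\<ge>N. norm (norm (P n *\<^sub>R f n)) \<le> P n"
      using that P0 by (auto intro: mult_left_le)
  qed
  have "(\<lambda>k. of_real (P k) * iexp (t * \<phi> k)) sums char ?M t" for t
  proof -
    have "char ?M t = (\<integral>k. iexp (t * \<phi> k) \<partial>?D)"
      unfolding char_def by (subst integral_distr) auto
    also have "\<dots> = (\<integral>k. P k *\<^sub>R iexp (t * \<phi> k) \<partial>count_space UNIV)"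
      by (subst integral_density) (use P0 in auto)
    finally show ?thesis
      using sums_integral_count_space_nat[OF ic[of "\<lambda>k. iexp (t * \<phi> k)"]]
      by (simp add: scaleR_conv_of_real norm_exp_i_times del: of_real_mult)
  qed
  moreover have "(\<lambda>k. if \<phi> k \<le> y then P k else 0) sums cdf ?M y" for y
  proof -
    have "cdf ?M y = measure ?D {k. \<phi> k \<le> y}"
      unfolding cdf_def by (subst measure_distr) (auto simp: vimage_def)
    also have "\<dots> = (\<integral>k. indicator {k. \<phi> k \<le> y} k \<partial>?D)" by simp
    also have "\<dots> = (\<integral>k. P k *\<^sub>R indicator {k. \<phi> k \<le> y} k \<partial>count_space UNIV)"
      by (subst integral_density) (use P0 in auto)
    finally have "(\<lambda>k. P k *\<^sub>R indicator {k. \<phi> k \<le> y} k) sums cdf ?M y"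
      using sums_integral_count_space_nat[OF ic[of "indicator {k. \<phi> k \<le> y} :: nat \<Rightarrow> real"]]
      by (simp add: indicator_def)
    moreover have "P k *\<^sub>R indicator {k. \<phi> k \<le> y} k = (if \<phi> k \<le> y then P k else 0)" for k
      by (simp add: indicator_def)
    ultimately show ?thesis by simp
  qed
  ultimately show ?thesis using that rd by blast
qed

text \<open>Levy's continuity theorem gives convergence of distribution functions at fixed points,
  while the threshold here moves with \<open>n\<close>. Fixed points on both sides of
  \<open>l\<close> enclose it eventually, and continuity of the normal distribution function closes
  the gap. The characteristic functions enter as arbitrary sums \<open>c\<close>, to be identified
  where the series is known in closed form.\<close>

lemma std_normal_limit:
  fixes P :: "nat \<Rightarrow> nat \<Rightarrow> real" and m s :: "nat \<Rightarrow> real"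
  assumes P0: "\<And>n k. 0 \<le> P n k" and P1: "\<And>n. P n sums 1"
    and s: "\<forall>\<^sub>F n in sequentially. 0 < s n"
    and char: "\<And>t c. (\<And>n. (\<lambda>k. of_real (P n k) * iexp (t * ((real k - m n) / s n))) sums c n)
        \<Longrightarrow> c \<longlonglongrightarrow> of_real (exp (- (t\<^sup>2 / 2)))"
    and lim: "(\<lambda>n. (real n - m n) / s n) \<longlonglongrightarrow> l"
  shows "(\<lambda>n. \<Sum>k<n. P n k) \<longlonglongrightarrow> cdf std_normal_distribution l"
proof -
  let ?\<phi> = "\<lambda>n k. (real k - m n) / s n"
  have "\<exists>M. real_distribution M \<and> (\<forall>t. (\<lambda>k. of_real (P n k) * iexp (t * ?\<phi> n k)) sums char M t) \<and>
     (\<forall>y. (\<lambda>k. if ?\<phi> n k \<le> y then P n k else 0) sums cdf M y)" for n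
  proof (rule discrete_real_distribution[OF P0[of n] P1, where \<phi> = "?\<phi> n"])
    fix M assume "real_distribution M"
      "\<And>t. (\<lambda>k. of_real (P n k) * iexp (t * ?\<phi> n k)) sums char M t"
      "\<And>y. (\<lambda>k. if ?\<phi> n k \<le> y then P n k else 0) sums cdf M y"
    then show ?thesis by (intro exI[of _ M] conjI allI)
  qed
  then have "\<exists>M. \<forall>n. real_distribution (M n) \<and> (\<forall>t. (\<lambda>k. of_real (P n k) * iexp (t * ?\<phi> n k)) sums char (M n) t) \<and>
     (\<forall>y. (\<lambda>k. if ?\<phi> n k \<le> y then P n k else 0) sums cdf (M n) y)"
    by (intro choice allI)
  then obtain M where M': "\<forall>n. real_distribution (M n) \<and> (\<forall>t. (\<lambda>k. of_real (P n k) * iexp (t * ?\<phi> n k)) sums char (M n) t) \<and>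
     (\<forall>y. (\<lambda>k. if ?\<phi> n k \<le> y then P n k else 0) sums cdf (M n) y)" ..
  have M: "real_distribution (M n)"
    "(\<lambda>k. of_real (P n k) * iexp (t * ?\<phi> n k)) sums char (M n) t"
    "(\<lambda>k. if ?\<phi> n k \<le> y then P n k else 0) sums cdf (M n) y" for n t y
    using spec[OF M', of n] by (elim conjE, simp only:)+
  have "weak_conv_m M std_normal_distribution"
  proof (rule levy_continuity[OF M(1) real_dist_normal_dist])
    fix t
    show "(\<lambda>n. char (M n) t) \<longlonglongrightarrow> char std_normal_distribution t"
      using char[of t "\<lambda>n. char (M n) t"] M(2) by (simp add: char_std_normal_distribution)
  qed
  then have conv: "(\<lambda>n. cdf (M n) y) \<longlonglongrightarrow> cdf std_normal_distribution y" for y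
    unfolding weak_conv_m_def weak_conv_def using isCont_cdf_std_normal by blast
  \<comment> \<open>The sum runs over \<open>k < n\<close>, whereas \<open>cdf\<close> counts with
    \<open>\<le>\<close>; a strict inequality between \<open>y\<close> and the threshold makes the
    two comparable on either side.\<close>
  have lower: "cdf (M n) y \<le> (\<Sum>k<n. P n k)" if "0 < s n" "y < ?\<phi> n n" for n y
  proof (rule sums_le[OF _ M(3)[of n y] sums_If_finite_set[of "{..<n}" "P n"]])
    fix k
    have "k < n" if "?\<phi> n k \<le> y"
    proof -
      have "?\<phi> n k < ?\<phi> n n" using that \<open>y < ?\<phi> n n\<close> by linarith
      then show ?thesis using \<open>0 < s n\<close> by (simp add: divide_less_cancel)
    qed
    then show "(if ?\<phi> n k \<le> y then P n k else 0) \<le> (if k \<in> {..<n} then P n k else 0)" using P0 by auto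
  qed auto
  have upper: "(\<Sum>k<n. P n k) \<le> cdf (M n) y" if "0 < s n" "?\<phi> n n < y" for n y
  proof (rule sums_le[OF _ sums_If_finite_set[of "{..<n}" "P n"] M(3)[of n y]])
    fix k
    have "?\<phi> n k \<le> y" if "k < n"
    proof -
      have "?\<phi> n k \<le> ?\<phi> n n" using that \<open>0 < s n\<close> by (intro divide_right_mono) auto
      then show ?thesis using \<open>?\<phi> n n < y\<close> by linarith
    qed
    then show "(if k \<in> {..<n} then P n k else 0) \<le> (if ?\<phi> n k \<le> y then P n k else 0)" using P0 by auto
  qed auto
  have cont: "(cdf std_normal_distribution \<longlongrightarrow> cdf std_normal_distribution l) (at l)"
    using isCont_cdf_std_normal by (simp add: isCont_def)
  show ?thesis
  proof (rule order_tendstoI)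
    fix a assume a: "a < cdf std_normal_distribution l"
    have "\<forall>\<^sub>F y in at l. a < cdf std_normal_distribution y" using order_tendstoD(1)[OF cont a] .
    then have "\<forall>\<^sub>F y in at_left l. a < cdf std_normal_distribution y" by (simp add: eventually_at_split)
    then obtain y where y: "y < l" "a < cdf std_normal_distribution y"
      unfolding eventually_at_left_field by (metis dense)
    have "\<forall>\<^sub>F n in sequentially. y < ?\<phi> n n" by (rule order_tendstoD(1)[OF lim y(1)])
    moreover have "\<forall>\<^sub>F n in sequentially. a < cdf (M n) y" by (rule order_tendstoD(1)[OF conv y(2)])
    ultimately show "\<forall>\<^sub>F n in sequentially. a < (\<Sum>k<n. P n k)" using s
      by eventually_elim (use lower in force)
  next
    fix a assume a: "cdf std_normal_distribution l < a"
    have "\<forall>\<^sub>F y in at l. cdf std_normal_distribution y < a" using order_tendstoD(2)[OF cont a] .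
    then have "\<forall>\<^sub>F y in at_right l. cdf std_normal_distribution y < a" by (simp add: eventually_at_split)
    then obtain y where y: "l < y" "cdf std_normal_distribution y < a"
      unfolding eventually_at_right_field by (metis dense)
    have "\<forall>\<^sub>F n in sequentially. ?\<phi> n n < y" by (rule order_tendstoD(2)[OF lim y(1)])
    moreover have "\<forall>\<^sub>F n in sequentially. cdf (M n) y < a" by (rule order_tendstoD(2)[OF conv y(2)])
    ultimately show "\<forall>\<^sub>F n in sequentially. (\<Sum>k<n. P n k) < a" using s
      by eventually_elim (use upper in force)
  qed
qed

section \<open>The central limit theorem for the density\<close>

lemma iexp_estimates:
  shows "cmod (iexp \<theta> - 1) \<le> \<bar>\<theta>\<bar>"
    and "cmod (iexp \<theta> - 1 - \<i> * \<theta> + \<theta>\<^sup>2 / 2) \<le> \<bar>\<theta>\<bar> ^ 3"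
    and "cmod ((iexp \<theta> - 1)\<^sup>2 + \<theta>\<^sup>2) \<le> \<bar>\<theta>\<bar> ^ 3"
proof -
  let ?w = "iexp \<theta> - 1"
  show 1: "cmod ?w \<le> \<bar>\<theta>\<bar>" using iexp_approx1[of \<theta> 0] by simp
  have 2: "cmod (?w - \<i> * \<theta>) \<le> \<theta>\<^sup>2 / 2"
    using iexp_approx1[of \<theta> 1] by (simp add: algebra_simps power2_eq_square)
  have "cmod (?w - \<i> * \<theta> + \<theta>\<^sup>2 / 2) \<le> \<bar>\<theta>\<bar> ^ 3 / 6"
    using iexp_approx1[of \<theta> 2]
    by (simp add: algebra_simps power2_eq_square eval_nat_numeral)
  also have "\<dots> \<le> \<bar>\<theta>\<bar> ^ 3" by simp
  finally show "cmod (?w - \<i> * \<theta> + \<theta>\<^sup>2 / 2) \<le> \<bar>\<theta>\<bar> ^ 3" .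
  have "?w\<^sup>2 + \<theta>\<^sup>2 = (?w - \<i> * \<theta>) * (?w + \<i> * \<theta>)" by (simp add: power2_eq_square algebra_simps)
  then have "cmod (?w\<^sup>2 + \<theta>\<^sup>2) = cmod (?w - \<i> * \<theta>) * cmod (?w + \<i> * \<theta>)" by (simp only: norm_mult)
  also have "\<dots> \<le> (\<theta>\<^sup>2 / 2) * (2 * \<bar>\<theta>\<bar>)"
  proof (intro mult_mono 2)
    show "cmod (?w + \<i> * \<theta>) \<le> 2 * \<bar>\<theta>\<bar>"
      using norm_triangle_ineq[of ?w "\<i> * \<theta>"] 1 by (simp add: norm_mult)
  qed auto
  also have "\<dots> = \<bar>\<theta>\<bar> ^ 3" by (simp add: power2_eq_square power3_eq_cube abs_mult_self_eq)
  finally show "cmod (?w\<^sup>2 + \<theta>\<^sup>2) \<le> \<bar>\<theta>\<bar> ^ 3" .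
qed

text \<open>Second-order expansion of a cumulant generating function. Since \<open>w\<close> is
  close to \<open>\<i> * \<theta> - \<theta>\<^sup>2 / 2\<close> and \<open>w\<^sup>2\<close> to
  \<open>- \<theta>\<^sup>2\<close>, the geometric series yields the mean \<open>A + B\<close> and
  the variance \<open>A * (1 - 2 * p) + B * (1 + 2 * q)\<close>. The cubic error has a constant that
  depends only on the bounds \<open>K\<close> and \<open>Q\<close>.\<close>

lemma cumulant_estimate:
  fixes A B p q \<theta> K Q :: real and w :: complex
  assumes "\<bar>A\<bar> \<le> K" "\<bar>B\<bar> \<le> K" "\<bar>p\<bar> \<le> Q" "\<bar>q\<bar> \<le> Q" "\<bar>\<theta>\<bar> * Q \<le> 1 / 2"
  defines "w \<equiv> iexp \<theta> - 1"
  shows "cmod (w * (A / (1 + w * p) + B / (1 - w * q)) - \<i> * \<theta> * (A + B)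
      + \<theta>\<^sup>2 / 2 * (A * (1 - 2 * p) + B * (1 + 2 * q)))
    \<le> (2 * K + 2 * K * Q + 4 * K * Q\<^sup>2) * \<bar>\<theta>\<bar> ^ 3"
proof -
  have w: "cmod w \<le> \<bar>\<theta>\<bar>" unfolding w_def by (rule iexp_estimates)
  have half: "cmod (w * r) \<le> 1 / 2" if "\<bar>r\<bar> \<le> Q" for r :: real
  proof -
    have "cmod (w * r) \<le> \<bar>\<theta>\<bar> * Q" unfolding norm_mult using w that by (intro mult_mono) auto
    then show ?thesis using assms by linarith
  qed
  have ge: "1 / 2 \<le> cmod (1 + w * p)" "1 / 2 \<le> cmod (1 - w * q)"
    using half[of p] half[of q] assms norm_triangle_ineq2[of 1 "- (w * p)"] norm_triangle_ineq2[of 1 "w * q"] by auto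
  then have nz: "1 + w * p \<noteq> 0" "1 - w * q \<noteq> 0" by force+
  have KQ: "0 \<le> K" "0 \<le> Q" using assms by linarith+
  \<comment> \<open>Geometric series cut after the second order, with exact remainder; the
    denominators have modulus at least \<open>1 / 2\<close>.\<close>
  have q1: "w * (a / (1 + w * p)) = w * a - w\<^sup>2 * (a * p) + w ^ 3 * (a * p\<^sup>2 / (1 + w * p))" for a :: complex
    using nz by (simp add: field_simps power2_eq_square power3_eq_cube)
  have q2: "w * (a / (1 - w * q)) = w * a + w\<^sup>2 * (a * q) + w ^ 3 * (a * q\<^sup>2 / (1 - w * q))" for a :: complex
    using nz by (simp add: field_simps power2_eq_square power3_eq_cube)
  have "w * (A / (1 + w * p) + B / (1 - w * q)) - \<i> * \<theta> * (A + B)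
      + \<theta>\<^sup>2 / 2 * (A * (1 - 2 * p) + B * (1 + 2 * q))
    = (A + B) * (w - \<i> * \<theta> + \<theta>\<^sup>2 / 2) + (B * q - A * p) * (w\<^sup>2 + \<theta>\<^sup>2)
      + w ^ 3 * (A * p\<^sup>2 / (1 + w * p) + B * q\<^sup>2 / (1 - w * q))"
    unfolding distrib_left[of w] q1 q2 by (simp add: field_simps)
  also have "cmod \<dots> \<le> (2 * K) * \<bar>\<theta>\<bar> ^ 3 + (2 * K * Q) * \<bar>\<theta>\<bar> ^ 3 + \<bar>\<theta>\<bar> ^ 3 * (4 * K * Q\<^sup>2)"
  proof (intro order_trans[OF norm_triangle_ineq] add_mono)
    show "cmod ((A + B) * (w - \<i> * \<theta> + \<theta>\<^sup>2 / 2)) \<le> (2 * K) * \<bar>\<theta>\<bar> ^ 3"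
      unfolding norm_mult
    proof (intro mult_mono)
      show "cmod (complex_of_real (A + B)) \<le> 2 * K"
        unfolding norm_of_real using assms by linarith
      show "cmod (w - \<i> * \<theta> + \<theta>\<^sup>2 / 2) \<le> \<bar>\<theta>\<bar> ^ 3" unfolding w_def by (rule iexp_estimates)
    qed (use KQ in auto)
    have "\<bar>B * q\<bar> \<le> K * Q" "\<bar>A * p\<bar> \<le> K * Q" unfolding abs_mult using assms by (intro mult_mono; auto)+
    then have "\<bar>B * q - A * p\<bar> \<le> 2 * K * Q" by linarith
    moreover have "cmod (B * q - A * p) = \<bar>B * q - A * p\<bar>"
      by (rule norm_of_real)
    ultimately show "cmod ((B * q - A * p) * (w\<^sup>2 + \<theta>\<^sup>2)) \<le> (2 * K * Q) * \<bar>\<theta>\<bar> ^ 3"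
      unfolding norm_mult using iexp_estimates(3)[of \<theta>] KQ by (intro mult_mono) (auto simp: w_def)
    have b: "cmod (a * r\<^sup>2 / v) \<le> 2 * K * Q\<^sup>2" if "\<bar>a\<bar> \<le> K" "\<bar>r\<bar> \<le> Q" "1 / 2 \<le> cmod v" for a r :: real and v :: complex
    proof -
      have "\<bar>r\<bar>\<^sup>2 \<le> Q\<^sup>2" using that by (intro power_mono) auto
      then have "\<bar>a * r\<^sup>2\<bar> \<le> K * Q\<^sup>2"
        unfolding abs_mult using that KQ by (intro mult_mono) auto
      then have "cmod (a * r\<^sup>2 / v) \<le> (K * Q\<^sup>2) / (1 / 2)"
        unfolding norm_divide norm_of_real using that KQ by (intro frac_le) auto
      then show ?thesis by simp
    qed
    have "cmod (w ^ 3) \<le> \<bar>\<theta>\<bar> ^ 3" unfolding norm_power using w by (intro power_mono) auto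
    moreover have "cmod (A * p\<^sup>2 / (1 + w * p) + B * q\<^sup>2 / (1 - w * q)) \<le> 4 * K * Q\<^sup>2"
      using norm_triangle_ineq[of "A * p\<^sup>2 / (1 + w * p)" "B * q\<^sup>2 / (1 - w * q)"]
        b[OF assms(1,3) ge(1)] b[OF assms(2,4) ge(2)] by simp
    ultimately show "cmod (w ^ 3 * (A * p\<^sup>2 / (1 + w * p) + B * q\<^sup>2 / (1 - w * q))) \<le> \<bar>\<theta>\<bar> ^ 3 * (4 * K * Q\<^sup>2)"
      unfolding norm_mult by (intro mult_mono) auto
  qed
  also have "\<dots> = (2 * K + 2 * K * Q + 4 * K * Q\<^sup>2) * \<bar>\<theta>\<bar> ^ 3" by (simp add: algebra_simps)
  finally show ?thesis .
qed

text \<open>Written in \<open>z - 1\<close>, the exponent separates along the axes, with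
  denominators governed by \<open>\<tau> / (1 + \<tau>)\<close> and
  \<open>\<tau> / (1 - \<tau>)\<close>. These are the \<open>p\<close> and \<open>q\<close> to which
  \<open>cumulant_estimate\<close> is applied.\<close>

lemma mehler_exp_diff:
  fixes z X :: complex
  assumes \<tau>: "0 \<le> \<tau>" "\<tau> < 1" and z: "cmod z = 1"
  shows "mehler_exp \<tau> z (cnj X) X - ell_weight \<tau> X =
    (z - 1) * (((Re X)\<^sup>2 / (1 + \<tau>)\<^sup>2) / (1 + (z - 1) * of_real (\<tau> / (1 + \<tau>)))
       + ((Im X)\<^sup>2 / (1 - \<tau>)\<^sup>2) / (1 - (z - 1) * of_real (\<tau> / (1 - \<tau>))))"
proof -
  define x where "x = complex_of_real (Re X)"
  define y where "y = complex_of_real (Im X)"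
  define t where "t = complex_of_real \<tau>"
  have X: "X = x + \<i> * y" "cnj X = x - \<i> * y" by (simp_all add: x_def y_def complex_eq_iff)
  have nzt: "1 + t \<noteq> 0" "1 - t \<noteq> 0" using \<tau> unfolding t_def by (auto simp: complex_eq_iff)
  have ct: "cmod (z * t) < 1" using \<tau> z by (simp add: t_def norm_mult)
  have nzz: "1 + z * t \<noteq> 0" "1 - z * t \<noteq> 0"
  proof -
    show "1 + z * t \<noteq> 0" using ct by (metis add_eq_0_iff norm_minus_cancel norm_one order_less_irrefl)
    show "1 - z * t \<noteq> 0" using ct by auto
  qed
  have sq: "1 - (z * t)\<^sup>2 = (1 + z * t) * (1 - z * t)" by (simp add: power2_eq_square algebra_simps)
  have "z * cnj X * X - z\<^sup>2 * t * (X\<^sup>2 + (cnj X)\<^sup>2) / 2 = z * x\<^sup>2 * (1 - z * t) + z * y\<^sup>2 * (1 + z * t)"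
    unfolding X(2) unfolding X(1) by (simp add: power2_eq_square field_simps)
  then have "mehler_exp \<tau> z (cnj X) X = (z * x\<^sup>2 * (1 - z * t) + z * y\<^sup>2 * (1 + z * t)) / ((1 + z * t) * (1 - z * t))"
    unfolding mehler_exp_def t_def[symmetric] sq by simp
  also have "\<dots> = z * x\<^sup>2 / (1 + z * t) + z * y\<^sup>2 / (1 - z * t)" using nzz by (simp add: add_divide_distrib)
  finally have 1: "mehler_exp \<tau> z (cnj X) X = \<dots>" .
  have 2: "complex_of_real (ell_weight \<tau> X) = x\<^sup>2 / (1 + t) + y\<^sup>2 / (1 - t)"
    unfolding ell_gen_1[OF \<tau>, symmetric] ell_gen_def by (simp add: x_def y_def t_def)
  have 3: "1 + (z - 1) * (t / (1 + t)) = (1 + z * t) / (1 + t)" "1 - (z - 1) * (t / (1 - t)) = (1 - z * t) / (1 - t)"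
    using nzt by (simp_all add: field_simps)
  have 4: "z * a / (1 + z * t) - a / (1 + t) = (z - 1) * ((a / (1 + t)\<^sup>2) / ((1 + z * t) / (1 + t)))" for a
    using nzt nzz by (simp add: divide_simps power2_eq_square) (simp add: algebra_simps)
  have 5: "z * a / (1 - z * t) - a / (1 - t) = (z - 1) * ((a / (1 - t)\<^sup>2) / ((1 - z * t) / (1 - t)))" for a
    using nzt nzz by (simp add: divide_simps power2_eq_square) (simp add: algebra_simps)
  have "mehler_exp \<tau> z (cnj X) X - ell_weight \<tau> X
    = (z - 1) * ((x\<^sup>2 / (1 + t)\<^sup>2) / (1 + (z - 1) * (t / (1 + t))) + (y\<^sup>2 / (1 - t)\<^sup>2) / (1 - (z - 1) * (t / (1 - t))))"
    unfolding 1 2 3 using 4[of "x\<^sup>2"] 5[of "y\<^sup>2"] by (simp add: distrib_left algebra_simps)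
  then show ?thesis by (simp add: x_def y_def t_def)
qed

text \<open>As \<open>\<tau> n\<close> need not converge, continuity at a single point is not
  enough; the argument rests on uniform continuity of \<open>(1 - u) powr (- 1 / 2)\<close> on the
  disc of radius \<open>(1 - \<delta>)\<^sup>2\<close>, which stays away from the branch
  point.\<close>

lemma mehler_prefactor_limit:
  fixes \<tau> :: "nat \<Rightarrow> real" and z :: "nat \<Rightarrow> complex"
  assumes \<delta>: "0 < \<delta>" and \<tau>: "\<And>n. 0 \<le> \<tau> n" "\<And>n. \<tau> n \<le> 1 - \<delta>" and z: "\<And>n. cmod (z n) = 1" "z \<longlonglongrightarrow> 1"
  shows "(\<lambda>n. of_real (sqrt (1 - (\<tau> n)\<^sup>2)) * (1 - (z n * of_real (\<tau> n))\<^sup>2) powr (- 1 / 2)) \<longlonglongrightarrow> 1"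
proof -
  define g :: "complex \<Rightarrow> complex" where "g u = (1 - u) powr (- 1 / 2)" for u
  let ?S = "cball (0::complex) ((1 - \<delta>)\<^sup>2)"
  have d1: "\<delta> \<le> 1" using \<tau>[of 0] by linarith
  have "(1 - \<delta>)\<^sup>2 < 1" using sq_less_one(1)[of "1 - \<delta>"] \<delta> d1 by simp
  then have Re1: "Re u < 1" if "cmod u \<le> (1 - \<delta>)\<^sup>2" for u
    using that complex_Re_le_cmod[of u] by linarith
  have ne: "1 - u \<noteq> 0" if "cmod u \<le> (1 - \<delta>)\<^sup>2" for u using Re1[OF that] by auto
  have "continuous_on ?S g" unfolding g_def[abs_def]
    by (intro continuous_on_powr_complex continuous_intros) (use Re1 ne in \<open>force+\<close>)
  then have uc: "uniformly_continuous_on ?S g" by (rule compact_uniformly_continuous) simp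
  have le: "(\<tau> n)\<^sup>2 \<le> (1 - \<delta>)\<^sup>2" for n using \<tau> by (intro power_mono) auto
  have in1: "(z n * of_real (\<tau> n))\<^sup>2 \<in> ?S" "(of_real (\<tau> n))\<^sup>2 \<in> ?S" for n
    using le[of n] z(1)[of n] by (auto simp: norm_mult norm_power)
  have "(\<lambda>n. (z n)\<^sup>2 - 1) \<longlonglongrightarrow> 1\<^sup>2 - 1" by (intro tendsto_intros z)
  then have z2: "(\<lambda>n. (z n)\<^sup>2 - 1) \<longlonglongrightarrow> 0" by simp
  have "(\<lambda>n. dist ((z n * of_real (\<tau> n))\<^sup>2) ((of_real (\<tau> n))\<^sup>2)) \<longlonglongrightarrow> 0"
  proof (rule tendsto_0_le[OF z2, of _ 1], intro always_eventually allI)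
    fix n
    have "(z n * of_real (\<tau> n))\<^sup>2 - (of_real (\<tau> n))\<^sup>2 = ((z n)\<^sup>2 - 1) * of_real ((\<tau> n)\<^sup>2)"
      by (simp add: power_mult_distrib algebra_simps)
    then have "dist ((z n * of_real (\<tau> n))\<^sup>2) ((of_real (\<tau> n))\<^sup>2) = cmod ((z n)\<^sup>2 - 1) * (\<tau> n)\<^sup>2"
      by (simp add: dist_norm norm_mult norm_power)
    also have "\<dots> \<le> cmod ((z n)\<^sup>2 - 1) * 1"
      using le[of n] \<open>(1 - \<delta>)\<^sup>2 < 1\<close> by (intro mult_left_mono) auto
    finally show "norm (dist ((z n * of_real (\<tau> n))\<^sup>2) ((of_real (\<tau> n))\<^sup>2)) \<le> norm ((z n)\<^sup>2 - 1) * 1" by simp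
  qed
  then have lim: "(\<lambda>n. dist (g ((z n * of_real (\<tau> n))\<^sup>2)) (g ((of_real (\<tau> n))\<^sup>2))) \<longlonglongrightarrow> 0"
    using in1 by (intro uc[unfolded uniformly_continuous_on_sequentially, rule_format] conjI allI)
  have g1: "of_real (sqrt (1 - (\<tau> n)\<^sup>2)) * g ((of_real (\<tau> n))\<^sup>2) = 1" for n
  proof -
    have "0 < 1 - (\<tau> n)\<^sup>2" using le[of n] \<open>(1 - \<delta>)\<^sup>2 < 1\<close> by linarith
    moreover from this have "g ((of_real (\<tau> n))\<^sup>2) = of_real (inverse (sqrt (1 - (\<tau> n)\<^sup>2)))"
      unfolding g_def using powr_of_real[of "1 - (\<tau> n)\<^sup>2" "- 1 / 2"] powr_minus[of "1 - (\<tau> n)\<^sup>2" "1/2"]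
      by (simp add: powr_half_sqrt)
    ultimately show ?thesis by simp
  qed
  have "(\<lambda>n. of_real (sqrt (1 - (\<tau> n)\<^sup>2)) * g ((z n * of_real (\<tau> n))\<^sup>2) - 1) \<longlonglongrightarrow> 0"
  proof (rule tendsto_0_le[OF lim, of _ 1], intro always_eventually allI)
    fix n
    have "of_real (sqrt (1 - (\<tau> n)\<^sup>2)) * g ((z n * of_real (\<tau> n))\<^sup>2) - 1
       = of_real (sqrt (1 - (\<tau> n)\<^sup>2)) * (g ((z n * of_real (\<tau> n))\<^sup>2) - g ((of_real (\<tau> n))\<^sup>2))"
      unfolding right_diff_distrib g1 ..
    then have "norm (of_real (sqrt (1 - (\<tau> n)\<^sup>2)) * g ((z n * of_real (\<tau> n))\<^sup>2) - 1)
        = \<bar>sqrt (1 - (\<tau> n)\<^sup>2)\<bar> * dist (g ((z n * of_real (\<tau> n))\<^sup>2)) (g ((of_real (\<tau> n))\<^sup>2))"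
      by (simp add: norm_mult dist_norm)
    also have "\<dots> \<le> 1 * dist (g ((z n * of_real (\<tau> n))\<^sup>2)) (g ((of_real (\<tau> n))\<^sup>2))"
    proof (intro mult_right_mono)
      have "(\<tau> n)\<^sup>2 < 1" using le[of n] \<open>(1 - \<delta>)\<^sup>2 < 1\<close> by linarith
      then show "\<bar>sqrt (1 - (\<tau> n)\<^sup>2)\<bar> \<le> 1" by simp
    qed auto
    finally show "norm (of_real (sqrt (1 - (\<tau> n)\<^sup>2)) * g ((z n * of_real (\<tau> n))\<^sup>2) - 1)
       \<le> norm (dist (g ((z n * of_real (\<tau> n))\<^sup>2)) (g ((of_real (\<tau> n))\<^sup>2))) * 1" by simp
  qed
  then show ?thesis unfolding g_def by (simp add: LIM_zero_iff)
qed

text \<open>The characteristic function of \<open>N\<close> is Mehler's formula at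
  \<open>s = iexp \<theta>\<close>. Up to bounded contributions of the square-root prefactor,
  \<open>n * (A n + B n)\<close> is the mean and \<open>n * v n\<close> the variance of
  \<open>N\<close>. The lower bound on \<open>v\<close> makes the relevant \<theta> of order
  \<open>1 / sqrt n\<close>.\<close>

lemma ndens_clt:
  fixes \<tau> :: "nat \<Rightarrow> real" and X :: "nat \<Rightarrow> complex" and K c l :: real
  defines "A \<equiv> \<lambda>n. (Re (X n))\<^sup>2 / (1 + \<tau> n)\<^sup>2 / real n"
    and "B \<equiv> \<lambda>n. (Im (X n))\<^sup>2 / (1 - \<tau> n)\<^sup>2 / real n"
  defines "v \<equiv> \<lambda>n. A n * ((1 - \<tau> n) / (1 + \<tau> n)) + B n * ((1 + \<tau> n) / (1 - \<tau> n))"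
  assumes \<delta>: "0 < \<delta>" and \<tau>: "\<And>n. 0 \<le> \<tau> n" "\<And>n. \<tau> n \<le> 1 - \<delta>"
    and AB: "\<forall>\<^sub>F n in sequentially. A n + B n \<le> K"
    and c: "0 < c" "\<forall>\<^sub>F n in sequentially. c \<le> v n"
    and lim: "(\<lambda>n. sqrt (real n) * (1 - (A n + B n)) / sqrt (v n)) \<longlonglongrightarrow> l"
  shows "(\<lambda>n. ndens (\<tau> n) n (X n)) \<longlonglongrightarrow> cdf std_normal_distribution l"
proof -
  define P where "P n k = sqrt (1 - (\<tau> n)\<^sup>2) * exp (- ell_weight (\<tau> n) (X n)) * ((cmod (herm (\<tau> n) k (X n)))\<^sup>2 / fact k)" for n k
  define m where "m n = real n * (A n + B n)" for n
  define s where "s n = sqrt (real n) * sqrt (v n)" for n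
  have \<tau>1: "\<tau> n < 1" for n using \<tau>[of n] \<delta> by linarith
  have d1: "\<delta> \<le> 1" using \<tau>[of 0] by linarith
  have A0: "0 \<le> A n" and B0: "0 \<le> B n" for n unfolding A_def B_def by auto
  have pos: "0 < 1 - (\<tau> n)\<^sup>2" for n using sq_less_one(2)[OF \<tau>(1) \<tau>1] .
  have "(\<lambda>n. \<Sum>k<n. P n k) \<longlonglongrightarrow> cdf std_normal_distribution l"
  proof (rule std_normal_limit)
    show "0 \<le> P n k" for n k unfolding P_def using pos[of n] by auto
    show "P n sums 1" for n
      using sums_mult[OF gen_sums_1[OF \<tau>(1) \<tau>1], of "sqrt (1 - (\<tau> n)\<^sup>2) * exp (- ell_weight (\<tau> n) (X n))" n "X n"] pos[of n]
      unfolding P_def by (simp add: exp_minus)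
    have ev: "\<forall>\<^sub>F n in sequentially. c \<le> v n \<and> A n + B n \<le> K \<and> 1 \<le> n"
      using c(2) AB eventually_ge_at_top[of 1] by eventually_elim auto
    then show "\<forall>\<^sub>F n in sequentially. 0 < s n"
      by eventually_elim (use c(1) in \<open>auto simp: s_def\<close>)
    have "\<forall>\<^sub>F n in sequentially. (real n - m n) / s n = sqrt (real n) * (1 - (A n + B n)) / sqrt (v n)"
      using ev
    proof eventually_elim
      case (elim n)
      then have "real n - m n = sqrt (real n) * (sqrt (real n) * (1 - (A n + B n)))"
        by (simp add: m_def algebra_simps mult.assoc[symmetric])
      then show ?case using elim by (simp add: s_def)
    qed
    with lim show "(\<lambda>n. (real n - m n) / s n) \<longlonglongrightarrow> l"
      by (simp add: tendsto_cong)
    fix t :: real and ch :: "nat \<Rightarrow> complex"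
    assume ch: "\<And>n. (\<lambda>k. of_real (P n k) * iexp (t * ((real k - m n) / s n))) sums ch n"
    define \<theta> where "\<theta> n = t / s n" for n
    define ex where "ex n = mehler_exp (\<tau> n) (iexp (\<theta> n)) (cnj (X n)) (X n) - ell_weight (\<tau> n) (X n) - \<i> * of_real (\<theta> n * m n)" for n
    define pre where "pre n = of_real (sqrt (1 - (\<tau> n)\<^sup>2)) * (1 - (iexp (\<theta> n) * of_real (\<tau> n))\<^sup>2) powr (- 1 / 2)" for n
    have ch_eq: "ch n = pre n * exp (ex n)" for n
    proof -
      \<comment> \<open>Normalisation and centring: \<open>C\<close> times Mehler's series is the
        characteristic function of the centred and scaled \<open>N\<close>.\<close>
      define C where "C = of_real (sqrt (1 - (\<tau> n)\<^sup>2)) * exp (- of_real (ell_weight (\<tau> n) (X n))) * iexp (- (\<theta> n * m n))"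
      have "(\<lambda>k. C * (iexp (\<theta> n) ^ k * herm (\<tau> n) k (cnj (X n)) * herm (\<tau> n) k (X n) / fact k)) sums
         (C * ((1 - (iexp (\<theta> n) * of_real (\<tau> n))\<^sup>2) powr (- 1 / 2) * exp (mehler_exp (\<tau> n) (iexp (\<theta> n)) (cnj (X n)) (X n))))"
        by (intro sums_mult mehler) (use \<tau>(1) \<tau>1 in auto)
      moreover have "C * (iexp (\<theta> n) ^ k * herm (\<tau> n) k (cnj (X n)) * herm (\<tau> n) k (X n) / fact k)
          = of_real (P n k) * iexp (t * ((real k - m n) / s n))" for k
      proof -
        have "t * ((real k - m n) / s n) = - (\<theta> n * m n) + real k * \<theta> n"
          by (simp add: \<theta>_def diff_divide_distrib algebra_simps)
        then have "iexp (t * ((real k - m n) / s n)) = iexp (- (\<theta> n * m n) + real k * \<theta> n)" by (simp only:)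
        also have "\<dots> = exp (\<i> * of_real (- (\<theta> n * m n)) + of_nat k * (\<i> * of_real (\<theta> n)))"
          by (simp add: algebra_simps)
        also have "\<dots> = iexp (- (\<theta> n * m n)) * iexp (\<theta> n) ^ k" by (simp only: exp_add exp_of_nat_mult)
        finally have e: "iexp (t * ((real k - m n) / s n)) = \<dots>" .
        have h: "iexp (\<theta> n) ^ k * herm (\<tau> n) k (cnj (X n)) * herm (\<tau> n) k (X n) / fact k
           = iexp (\<theta> n) ^ k * of_real ((cmod (herm (\<tau> n) k (X n)))\<^sup>2 / fact k)"
          unfolding mult.assoc cmod_herm_sq by simp
        show ?thesis unfolding e h C_def P_def by (simp add: exp_of_real[symmetric] mult_ac)
      qed
      ultimately have "ch n = C * ((1 - (iexp (\<theta> n) * of_real (\<tau> n))\<^sup>2) powr (- 1 / 2) * exp (mehler_exp (\<tau> n) (iexp (\<theta> n)) (cnj (X n)) (X n)))"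
        using ch sums_unique2 by (simp only:) blast
      also have "\<dots> = pre n * (exp (- of_real (ell_weight (\<tau> n) (X n))) * iexp (- (\<theta> n * m n)) * exp (mehler_exp (\<tau> n) (iexp (\<theta> n)) (cnj (X n)) (X n)))"
        unfolding C_def pre_def by (simp only: mult_ac)
      also have "exp (- of_real (ell_weight (\<tau> n) (X n))) * iexp (- (\<theta> n * m n)) * exp (mehler_exp (\<tau> n) (iexp (\<theta> n)) (cnj (X n)) (X n)) = exp (ex n)"
        unfolding ex_def exp_add[symmetric] by (simp add: algebra_simps)
      finally show ?thesis .
    qed
    have th_small: "\<forall>\<^sub>F n in sequentially. \<bar>\<theta> n\<bar> \<le> (\<bar>t\<bar> / sqrt c) * (1 / sqrt (real n))"
      using ev
    proof eventually_elim
      case (elim n)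
      then have "\<bar>\<theta> n\<bar> = \<bar>t\<bar> / (sqrt (v n) * sqrt (real n))" using c(1) by (simp add: \<theta>_def s_def abs_mult mult.commute)
      also have "\<dots> \<le> \<bar>t\<bar> / (sqrt c * sqrt (real n))"
        using elim c(1) by (intro divide_left_mono mult_right_mono mult_pos_pos) auto
      finally show ?case by simp
    qed
    have isq: "(\<lambda>n. 1 / sqrt (real n)) \<longlonglongrightarrow> 0"
      by (rule real_tendsto_divide_at_top[OF tendsto_const])
         (intro filterlim_compose[OF sqrt_at_top] filterlim_real_sequentially)
    have th0: "\<theta> \<longlonglongrightarrow> 0"
      by (rule tendsto_0_le[OF isq, of _ "\<bar>t\<bar> / sqrt c"])
        (use th_small in \<open>eventually_elim, simp add: mult.commute\<close>)
    have z1: "(\<lambda>n. iexp (\<theta> n)) \<longlonglongrightarrow> 1"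
    proof -
      have "(\<lambda>n. iexp (\<theta> n)) \<longlonglongrightarrow> iexp 0" by (intro tendsto_intros th0)
      then show ?thesis by simp
    qed
    have pre1: "pre \<longlonglongrightarrow> 1" unfolding pre_def[abs_def]
      by (rule mehler_prefactor_limit[OF \<delta> \<tau> _ z1]) simp
    \<comment> \<open>A common bound for \<open>\<tau> / (1 + \<tau>)\<close> and
      \<open>\<tau> / (1 - \<tau>)\<close> over all \<tau> \<le> 1 - \<delta>.\<close>
    define Q where "Q = 1 / \<delta>"
    define K' where "K' = 2 * \<bar>K\<bar> + 2 * \<bar>K\<bar> * Q + 4 * \<bar>K\<bar> * Q\<^sup>2"
    have "(\<lambda>n. \<bar>\<theta> n\<bar> * Q) \<longlonglongrightarrow> \<bar>0\<bar> * Q" by (intro tendsto_intros th0)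
    then have thQ: "\<forall>\<^sub>F n in sequentially. \<bar>\<theta> n\<bar> * Q < 1 / 2" by (rule order_tendstoD) simp
    \<comment> \<open>The cubic error of \<open>cumulant_estimate\<close> is multiplied by
      \<open>n\<close>, and \<open>n * \<bar>\<theta> n\<bar> ^ 3\<close> is of order
      \<open>1 / sqrt n\<close>.\<close>
    have "(\<lambda>n. ex n + of_real (t\<^sup>2 / 2)) \<longlonglongrightarrow> 0"
    proof (rule tendsto_0_le[OF isq, of _ "K' * (\<bar>t\<bar> / sqrt c) ^ 3"])
      show "\<forall>\<^sub>F n in sequentially. cmod (ex n + of_real (t\<^sup>2 / 2)) \<le> norm (1 / sqrt (real n)) * (K' * (\<bar>t\<bar> / sqrt c) ^ 3)"
        using ev th_small thQ
      proof eventually_elim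
        case (elim n)
        have n: "n \<ge> 1" and vn: "v n > 0" using elim c(1) by auto
        define p where "p = \<tau> n / (1 + \<tau> n)"
        define q where "q = \<tau> n / (1 - \<tau> n)"
        have pq: "\<bar>p\<bar> \<le> Q" "\<bar>q\<bar> \<le> Q"
        proof -
          have "\<bar>p\<bar> \<le> 1" using \<tau>(1)[of n] by (simp add: p_def)
          also have "1 \<le> Q" using \<delta> d1 by (simp add: Q_def)
          finally show "\<bar>p\<bar> \<le> Q" .
          have "\<tau> n / (1 - \<tau> n) \<le> 1 / \<delta>" using \<tau>[of n] \<tau>1[of n] \<delta> by (intro frac_le) auto
          then show "\<bar>q\<bar> \<le> Q" using \<tau>(1)[of n] \<tau>1[of n] by (simp add: q_def Q_def)
        qed
        have ABK: "\<bar>A n\<bar> \<le> \<bar>K\<bar>" "\<bar>B n\<bar> \<le> \<bar>K\<bar>" using elim A0[of n] B0[of n] by linarith+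
        have vq: "A n * (1 - 2 * p) + B n * (1 + 2 * q) = v n"
          using \<tau>(1)[of n] \<tau>1[of n] by (simp add: v_def p_def q_def field_simps)
        define w where "w = iexp (\<theta> n) - 1"
        have reA: "(Re (X n))\<^sup>2 / (1 + \<tau> n)\<^sup>2 = real n * A n" "(Im (X n))\<^sup>2 / (1 - \<tau> n)\<^sup>2 = real n * B n"
          using n by (simp_all add: A_def B_def)
        have md: "mehler_exp (\<tau> n) (iexp (\<theta> n)) (cnj (X n)) (X n) - ell_weight (\<tau> n) (X n)
           = real n * (w * (A n / (1 + w * p) + B n / (1 - w * q)))"
          unfolding mehler_exp_diff[OF \<tau>(1) \<tau>1 norm_exp_i_times] p_def[symmetric] q_def[symmetric] w_def[symmetric]
          unfolding reA by (simp add: algebra_simps)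
        have t2: "t\<^sup>2 / 2 = real n * ((\<theta> n)\<^sup>2 / 2 * v n)"
          using n vn by (simp add: \<theta>_def s_def power_divide power_mult_distrib)
        have "ex n + of_real (t\<^sup>2 / 2) = real n * (w * (A n / (1 + w * p) + B n / (1 - w * q)) - \<i> * \<theta> n * (A n + B n)
            + (\<theta> n)\<^sup>2 / 2 * (A n * (1 - 2 * p) + B n * (1 + 2 * q)))"
          unfolding ex_def md t2 m_def vq[symmetric] by (simp add: algebra_simps)
        then have "cmod (ex n + of_real (t\<^sup>2 / 2)) = real n * cmod (w * (A n / (1 + w * p) + B n / (1 - w * q)) - \<i> * \<theta> n * (A n + B n)
            + (\<theta> n)\<^sup>2 / 2 * (A n * (1 - 2 * p) + B n * (1 + 2 * q)))"
          by (simp only: norm_mult norm_of_nat of_real_of_nat_eq)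
        also have "\<dots> \<le> real n * (K' * \<bar>\<theta> n\<bar> ^ 3)"
          unfolding w_def K'_def using ABK pq elim by (intro mult_left_mono cumulant_estimate) auto
        also have "\<dots> \<le> real n * (K' * ((\<bar>t\<bar> / sqrt c) * (1 / sqrt (real n))) ^ 3)"
          using elim \<delta> by (intro mult_left_mono power_mono) (auto simp: K'_def Q_def)
        also have "\<dots> = K' * (\<bar>t\<bar> / sqrt c) ^ 3 * (real n * (1 / sqrt (real n)) ^ 3)"
          unfolding power_mult_distrib by (simp only: mult_ac)
        also have "real n * (1 / sqrt (real n)) ^ 3 = 1 / sqrt (real n)"
          using n by (simp add: power3_eq_cube field_simps)
        finally show ?case using n by (simp add: mult.commute)
      qed
    qed
    then have "(\<lambda>n. ex n + of_real (t\<^sup>2 / 2) - of_real (t\<^sup>2 / 2)) \<longlonglongrightarrow> 0 - of_real (t\<^sup>2 / 2)"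
      by (intro tendsto_intros)
    then have "(\<lambda>n. pre n * exp (ex n)) \<longlonglongrightarrow> 1 * exp (- of_real (t\<^sup>2 / 2))"
      by (intro tendsto_intros pre1) simp
    then show "ch \<longlonglongrightarrow> of_real (exp (- (t\<^sup>2 / 2)))"
      unfolding ch_eq[abs_def] by (simp add: exp_of_real[symmetric])
  qed
  then show ?thesis unfolding P_def ndens_def sum_distrib_left .
qed

section \<open>The boundary limit of the kernel\<close>

text \<open>The length of a positive multiple of the gradient of \<open>ellq\<close> at the point
  with parameter \<phi> on the ellipse with semi-axes \<open>1 + \<tau>\<close> and
  \<open>1 - \<tau>\<close>. Hence \<open>bnd_normal\<close> is the outer unit normal there.\<close>

definition bnd_norm :: "real \<Rightarrow> real \<Rightarrow> real" where
  "bnd_norm \<tau> \<phi> = cmod (Complex ((1 - \<tau>) * cos \<phi>) ((1 + \<tau>) * sin \<phi>))"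

definition bnd_normal :: "real \<Rightarrow> real \<Rightarrow> complex" where
  "bnd_normal \<tau> \<phi> = Complex ((1 - \<tau>) * cos \<phi>) ((1 + \<tau>) * sin \<phi>) / of_real (bnd_norm \<tau> \<phi>)"

text \<open>The rescaled boundary point with angle \<open>\<phi>\<close>, displaced by \<open>b\<close> in the frame of the outer normal.\<close>

definition bnd_coord :: "nat \<Rightarrow> real \<Rightarrow> real \<Rightarrow> complex \<Rightarrow> complex" where
  "bnd_coord n \<tau> \<phi> b = of_real (sqrt (real n)) * Complex ((1 + \<tau>) * cos \<phi>) ((1 - \<tau>) * sin \<phi>)
     + of_real (sqrt (1 - \<tau>\<^sup>2)) * bnd_normal \<tau> \<phi> * b"

lemma bnd_norm_sq:
  "(bnd_norm \<tau> \<phi>)\<^sup>2 = (1 - \<tau>)\<^sup>2 * (cos \<phi>)\<^sup>2 + (1 + \<tau>)\<^sup>2 * (sin \<phi>)\<^sup>2"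
  by (simp add: bnd_norm_def cmod_power2 power_mult_distrib)

lemma bnd_norm_ge:
  assumes "0 \<le> \<tau>" "\<tau> < 1"
  shows "1 - \<tau> \<le> bnd_norm \<tau> \<phi>"
proof (rule power2_le_imp_le)
  have "(1 - \<tau>)\<^sup>2 * (sin \<phi>)\<^sup>2 \<le> (1 + \<tau>)\<^sup>2 * (sin \<phi>)\<^sup>2"
    using assms by (intro mult_right_mono power_mono) auto
  then have "(1 - \<tau>)\<^sup>2 * ((cos \<phi>)\<^sup>2 + (sin \<phi>)\<^sup>2) \<le> (bnd_norm \<tau> \<phi>)\<^sup>2"
    unfolding bnd_norm_sq distrib_left by simp
  then show "(1 - \<tau>)\<^sup>2 \<le> (bnd_norm \<tau> \<phi>)\<^sup>2" by simp
qed (simp add: bnd_norm_def)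

lemma cmod_bnd_normal:
  assumes "0 \<le> \<tau>" "\<tau> < 1"
  shows "cmod (bnd_normal \<tau> \<phi>) = 1"
proof -
  have "0 < bnd_norm \<tau> \<phi>" using bnd_norm_ge[OF assms, of \<phi>] assms by linarith
  then show ?thesis by (simp add: bnd_normal_def norm_divide bnd_norm_def)
qed

text \<open>A displacement \<open>b\<close> in the frame of the normal changes \<open>ellq\<close>
  by \<open>2 * sqrt n * s * Re b\<close> to leading order, and the standard deviation of
  \<open>N\<close> is asymptotically \<open>sqrt n * s\<close> with the same
  \<open>s = bnd_norm / sqrt (1 - \<tau>\<^sup>2)\<close>. In the quotient \<tau> and \<phi> drop
  out; the tangential part \<open>Im b\<close> enters only at second order.\<close>

lemma ndens_boundary:
  fixes \<tau> \<phi> :: "nat \<Rightarrow> real" and b :: "nat \<Rightarrow> complex"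
  assumes \<delta>: "0 < \<delta>" and \<tau>: "\<And>n. 0 \<le> \<tau> n" "\<And>n. \<tau> n \<le> 1 - \<delta>"
    and b: "\<And>n. Re (b n) = x" "\<And>n. cmod (b n) \<le> R"
  shows "(\<lambda>n. ndens (\<tau> n) n (bnd_coord n (\<tau> n) (\<phi> n) (b n))) \<longlonglongrightarrow> cdf std_normal_distribution (- (2 * x))"
proof -
  define X where "X n = bnd_coord n (\<tau> n) (\<phi> n) (b n)" for n
  define \<epsilon> where "\<epsilon> n = 1 / sqrt (real n)" for n
  define Nb where "Nb n = bnd_normal (\<tau> n) (\<phi> n) * b n" for n
  define r where "r n = sqrt (1 - (\<tau> n)\<^sup>2)" for n
  define \<alpha> where "\<alpha> n = r n * Re (Nb n) / (1 + \<tau> n)" for n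
  define \<beta> where "\<beta> n = r n * Im (Nb n) / (1 - \<tau> n)" for n
  define A where "A n = (Re (X n))\<^sup>2 / (1 + \<tau> n)\<^sup>2 / real n" for n
  define B where "B n = (Im (X n))\<^sup>2 / (1 - \<tau> n)\<^sup>2 / real n" for n
  define ca where "ca n = (1 - \<tau> n) / (1 + \<tau> n)" for n
  define cb where "cb n = (1 + \<tau> n) / (1 - \<tau> n)" for n
  define v where "v n = A n * ca n + B n * cb n" for n
  \<comment> \<open>The limiting standard deviation divided by \<open>sqrt n\<close>;
    \<open>v n\<close> differs from its square by at most a multiple of
    \<open>1 / sqrt n\<close>.\<close>
  define s where "s n = bnd_norm (\<tau> n) (\<phi> n) / r n" for n
  define S where "S = 1 / \<delta>"
  have \<tau>1: "\<tau> n < 1" for n using \<tau>[of n] \<delta> by linarith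
  have d1: "\<delta> \<le> 1" using \<tau>[of 0] by linarith
  have S1: "1 \<le> S" using \<delta> d1 by (simp add: S_def)
  have R0: "0 \<le> R" using b(2)[of 0] norm_ge_zero order_trans by blast
  have r: "0 < r n" "r n \<le> 1" "(r n)\<^sup>2 = (1 + \<tau> n) * (1 - \<tau> n)" for n
    using sq_less_one[OF \<tau>(1) \<tau>1, of n] by (auto simp: r_def power2_eq_square algebra_simps)
  have Nb: "cmod (Nb n) \<le> R" for n
    using b(2)[of n] cmod_bnd_normal[OF \<tau>(1) \<tau>1] by (simp add: Nb_def norm_mult)
  have \<alpha>: "\<bar>\<alpha> n\<bar> \<le> R * S" for n
  proof -
    have "\<bar>\<alpha> n\<bar> = r n * \<bar>Re (Nb n)\<bar> / (1 + \<tau> n)" using r(1)[of n] \<tau>(1)[of n] by (simp add: \<alpha>_def abs_mult)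
    also have "\<dots> \<le> (1 * R) / 1"
      using r[of n] \<tau>(1)[of n] Nb[of n] abs_Re_le_cmod[of "Nb n"] R0 by (intro frac_le mult_mono) auto
    also have "\<dots> \<le> R * S" using mult_left_mono[OF S1 R0] by simp
    finally show ?thesis .
  qed
  have \<beta>: "\<bar>\<beta> n\<bar> \<le> R * S" for n
  proof -
    have "\<bar>\<beta> n\<bar> = r n * \<bar>Im (Nb n)\<bar> / (1 - \<tau> n)" using r(1)[of n] \<tau>1[of n] by (simp add: \<beta>_def abs_mult)
    also have "\<dots> \<le> (1 * R) / \<delta>"
      using r[of n] \<tau>(2)[of n] \<delta> Nb[of n] abs_Im_le_cmod[of "Nb n"] R0 by (intro frac_le mult_mono) auto
    finally show ?thesis by (simp add: S_def)
  qed
  have isq: "\<epsilon> \<longlonglongrightarrow> 0" unfolding \<epsilon>_def[abs_def]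
    by (rule real_tendsto_divide_at_top[OF tendsto_const])
      (intro filterlim_compose[OF sqrt_at_top] filterlim_real_sequentially)
  have Aeq: "A n = (cos (\<phi> n) + \<epsilon> n * \<alpha> n)\<^sup>2" and Beq: "B n = (sin (\<phi> n) + \<epsilon> n * \<beta> n)\<^sup>2" if "n \<ge> 1" for n
  proof -
    have n: "sqrt (real n) \<noteq> 0" "sqrt (real n) * sqrt (real n) = real n" using that by auto
    have t: "1 + \<tau> n \<noteq> 0" "1 - \<tau> n \<noteq> 0" using \<tau>(1)[of n] \<tau>1[of n] by linarith+
    have scale: "(q * (u * c) + w) / u / q = c + 1 / q * (w / u)" if "q \<noteq> 0" "u \<noteq> 0" for q u c w :: real
      using that by (simp add: field_simps)
    have "Re (X n) = sqrt (real n) * ((1 + \<tau> n) * cos (\<phi> n)) + r n * Re (Nb n)"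
      "Im (X n) = sqrt (real n) * ((1 - \<tau> n) * sin (\<phi> n)) + r n * Im (Nb n)"
      unfolding X_def bnd_coord_def mult.assoc Nb_def[symmetric] r_def[symmetric] by simp_all
    note ReIm = this
    have "Re (X n) / (1 + \<tau> n) / sqrt (real n) = cos (\<phi> n) + \<epsilon> n * \<alpha> n"
      unfolding ReIm \<alpha>_def \<epsilon>_def by (rule scale[OF n(1) t(1)])
    then have "(Re (X n) / (1 + \<tau> n) / sqrt (real n))\<^sup>2 = (cos (\<phi> n) + \<epsilon> n * \<alpha> n)\<^sup>2" by simp
    then show "A n = (cos (\<phi> n) + \<epsilon> n * \<alpha> n)\<^sup>2" by (simp add: A_def power_divide power_mult_distrib)
    have "Im (X n) / (1 - \<tau> n) / sqrt (real n) = sin (\<phi> n) + \<epsilon> n * \<beta> n"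
      unfolding ReIm \<beta>_def \<epsilon>_def by (rule scale[OF n(1) t(2)])
    then have "(Im (X n) / (1 - \<tau> n) / sqrt (real n))\<^sup>2 = (sin (\<phi> n) + \<epsilon> n * \<beta> n)\<^sup>2" by simp
    then show "B n = (sin (\<phi> n) + \<epsilon> n * \<beta> n)\<^sup>2" by (simp add: B_def power_divide power_mult_distrib)
  qed
  have ev: "\<forall>\<^sub>F n in sequentially. 1 \<le> n \<and> 0 \<le> \<epsilon> n \<and> \<epsilon> n \<le> 1"
    using eventually_ge_at_top[of 1]
  proof eventually_elim
    case (elim n)
    then have "1 \<le> sqrt (real n)" by simp
    then show ?case using elim by (simp add: \<epsilon>_def)
  qed
  have sqb: "(y + e * a)\<^sup>2 - y\<^sup>2 \<le> e * (2 * (R * S) + (R * S)\<^sup>2)" "y\<^sup>2 - (y + e * a)\<^sup>2 \<le> e * (2 * (R * S) + (R * S)\<^sup>2)"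
    if "\<bar>y\<bar> \<le> 1" "0 \<le> e" "e \<le> 1" "\<bar>a\<bar> \<le> R * S" for y e a :: real
  proof -
    have "\<bar>(y + e * a)\<^sup>2 - y\<^sup>2\<bar> = \<bar>e\<bar> * \<bar>2 * y * a + e * a\<^sup>2\<bar>"
      unfolding abs_mult[symmetric] by (simp add: power2_eq_square algebra_simps)
    also have "\<dots> \<le> \<bar>e\<bar> * (2 * (R * S) + (R * S)\<^sup>2)"
    proof (intro mult_left_mono)
      have "\<bar>y * a\<bar> \<le> 1 * (R * S)" unfolding abs_mult using that by (intro mult_mono) auto
      moreover have "\<bar>a\<bar>\<^sup>2 \<le> (R * S)\<^sup>2" using that by (intro power_mono) auto
      then have "e * a\<^sup>2 \<le> 1 * (R * S)\<^sup>2" using that by (intro mult_mono) auto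
      moreover have "0 \<le> e * a\<^sup>2" using that by auto
      ultimately show "\<bar>2 * y * a + e * a\<^sup>2\<bar> \<le> 2 * (R * S) + (R * S)\<^sup>2" by linarith
    qed auto
    finally show "(y + e * a)\<^sup>2 - y\<^sup>2 \<le> e * (2 * (R * S) + (R * S)\<^sup>2)" "y\<^sup>2 - (y + e * a)\<^sup>2 \<le> e * (2 * (R * S) + (R * S)\<^sup>2)"
      using that by auto
  qed
  define L where "L = 2 * (R * S) + (R * S)\<^sup>2"
  have L0: "0 \<le> L" using R0 S1 by (simp add: L_def)
  have cab: "0 \<le> ca n" "ca n \<le> 2 * S" "0 \<le> cb n" "cb n \<le> 2 * S" "\<delta> / 2 \<le> ca n" for n
  proof -
    show "0 \<le> ca n" "0 \<le> cb n" using \<tau>(1)[of n] \<tau>1[of n] by (auto simp: ca_def cb_def)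
    have "ca n \<le> 1" using \<tau>(1)[of n] by (simp add: ca_def)
    then show "ca n \<le> 2 * S" using S1 by linarith
    have "cb n \<le> 2 / \<delta>" unfolding cb_def using \<tau>[of n] \<tau>1[of n] \<delta> by (intro frac_le) auto
    then show "cb n \<le> 2 * S" by (simp add: S_def)
    show "\<delta> / 2 \<le> ca n" unfolding ca_def using \<tau>[of n] \<tau>1[of n] \<delta> by (intro frac_le) auto
  qed
  have ss: "(s n)\<^sup>2 = (cos (\<phi> n))\<^sup>2 * ca n + (sin (\<phi> n))\<^sup>2 * cb n" for n
  proof -
    have t: "1 + \<tau> n \<noteq> 0" "1 - \<tau> n \<noteq> 0" using \<tau>(1)[of n] \<tau>1[of n] by linarith+
    have "(s n)\<^sup>2 = ((1 - \<tau> n)\<^sup>2 * (cos (\<phi> n))\<^sup>2 + (1 + \<tau> n)\<^sup>2 * (sin (\<phi> n))\<^sup>2) / ((1 + \<tau> n) * (1 - \<tau> n))"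
      by (simp add: s_def power_divide bnd_norm_sq r(3))
    also have "\<dots> = (cos (\<phi> n))\<^sup>2 * ca n + (sin (\<phi> n))\<^sup>2 * cb n"
      unfolding ca_def cb_def using t by (simp add: field_simps power2_eq_square)
    finally show ?thesis .
  qed
  have s0: "0 < s n" "\<delta> / 2 \<le> (s n)\<^sup>2" for n
  proof -
    have "0 < bnd_norm (\<tau> n) (\<phi> n)" using bnd_norm_ge[OF \<tau>(1) \<tau>1, of n "\<phi> n"] \<tau>1[of n] by linarith
    then show "0 < s n" using r(1)[of n] by (simp add: s_def)
    have "ca n \<le> cb n" unfolding ca_def cb_def using \<tau>(1)[of n] \<tau>1[of n] by (intro frac_le) auto
    then have "(sin (\<phi> n))\<^sup>2 * ca n \<le> (sin (\<phi> n))\<^sup>2 * cb n" by (intro mult_left_mono) auto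
    then have "((cos (\<phi> n))\<^sup>2 + (sin (\<phi> n))\<^sup>2) * ca n \<le> (s n)\<^sup>2" unfolding ss distrib_right by simp
    then show "\<delta> / 2 \<le> (s n)\<^sup>2" using cab(5)[of n] by simp
  qed
  have vs: "\<forall>\<^sub>F n in sequentially. \<bar>v n - (s n)\<^sup>2\<bar> \<le> \<epsilon> n * (4 * L * S)"
    using ev
  proof eventually_elim
    case (elim n)
    have "\<bar>A n - (cos (\<phi> n))\<^sup>2\<bar> \<le> \<epsilon> n * L" "\<bar>B n - (sin (\<phi> n))\<^sup>2\<bar> \<le> \<epsilon> n * L"
      using sqb[of "cos (\<phi> n)" "\<epsilon> n" "\<alpha> n"] sqb[of "sin (\<phi> n)" "\<epsilon> n" "\<beta> n"] elim \<alpha>[of n] \<beta>[of n] Aeq[of n] Beq[of n]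
      by (auto simp: L_def abs_le_iff)
    then have "\<bar>(A n - (cos (\<phi> n))\<^sup>2) * ca n\<bar> \<le> (\<epsilon> n * L) * (2 * S)" "\<bar>(B n - (sin (\<phi> n))\<^sup>2) * cb n\<bar> \<le> (\<epsilon> n * L) * (2 * S)"
      unfolding abs_mult using cab[of n] elim L0 by (intro mult_mono; auto)+
    moreover have "v n - (s n)\<^sup>2 = (A n - (cos (\<phi> n))\<^sup>2) * ca n + (B n - (sin (\<phi> n))\<^sup>2) * cb n"
      unfolding v_def ss by (simp add: algebra_simps)
    ultimately show ?case by (simp add: algebra_simps abs_le_iff)
  qed
  have v0: "(\<lambda>n. v n - (s n)\<^sup>2) \<longlonglongrightarrow> 0"
    by (rule tendsto_0_le[OF isq, of _ "4 * L * S"]) (use vs ev in \<open>eventually_elim, simp\<close>)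
  have vc: "\<forall>\<^sub>F n in sequentially. \<delta> / 4 \<le> v n"
  proof -
    have "\<forall>\<^sub>F n in sequentially. - (\<delta> / 4) < v n - (s n)\<^sup>2" using \<delta> by (intro order_tendstoD(1)[OF v0]) auto
    then show ?thesis
    proof eventually_elim
      case (elim n)
      then show ?case using s0(2)[of n] by linarith
    qed
  qed
  have ratio: "(\<lambda>n. s n / sqrt (v n)) \<longlonglongrightarrow> 1"
  proof -
    have "(\<lambda>n. (s n)\<^sup>2 / v n - 1) \<longlonglongrightarrow> 0"
    proof (rule tendsto_0_le[OF v0, of _ "4 / \<delta>"])
      show "\<forall>\<^sub>F n in sequentially. norm ((s n)\<^sup>2 / v n - 1) \<le> norm (v n - (s n)\<^sup>2) * (4 / \<delta>)"
        using vc
      proof eventually_elim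
        case (elim n)
        then have vp: "0 < v n" using \<delta> by linarith
        then have "(s n)\<^sup>2 / v n - 1 = ((s n)\<^sup>2 - v n) / v n" by (simp add: field_simps)
        then have "norm ((s n)\<^sup>2 / v n - 1) = \<bar>v n - (s n)\<^sup>2\<bar> / v n" using vp by (simp add: abs_minus_commute)
        also have "\<dots> \<le> \<bar>v n - (s n)\<^sup>2\<bar> / (\<delta> / 4)" using elim \<delta> by (intro divide_left_mono) auto
        finally show ?case by (simp add: field_simps)
      qed
    qed
    then have "(\<lambda>n. (s n)\<^sup>2 / v n) \<longlonglongrightarrow> 1" by (simp add: LIM_zero_iff)
    then have "(\<lambda>n. sqrt ((s n)\<^sup>2 / v n)) \<longlonglongrightarrow> sqrt 1" by (rule tendsto_real_sqrt)
    then show ?thesis using s0(1) by (simp add: real_sqrt_divide less_imp_le abs_of_nonneg)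
  qed
  have "(\<lambda>n. ndens (\<tau> n) n (X n)) \<longlonglongrightarrow> cdf std_normal_distribution (- (2 * x))"
    using \<delta> \<tau>
  proof (rule ndens_clt[where \<tau> = \<tau> and \<delta> = \<delta> and X = X and K = "2 + 2 * L" and c = "\<delta> / 4", folded A_def B_def ca_def cb_def, folded v_def])
    show "\<forall>\<^sub>F n in sequentially. A n + B n \<le> 2 + 2 * L"
      using ev
    proof eventually_elim
      case (elim n)
      have "A n \<le> (cos (\<phi> n))\<^sup>2 + \<epsilon> n * L" "B n \<le> (sin (\<phi> n))\<^sup>2 + \<epsilon> n * L"
        using sqb(1)[of "cos (\<phi> n)" "\<epsilon> n" "\<alpha> n"] sqb(1)[of "sin (\<phi> n)" "\<epsilon> n" "\<beta> n"] elim \<alpha>[of n] \<beta>[of n] Aeq[of n] Beq[of n]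
        by (auto simp: L_def)
      moreover have "\<epsilon> n * L \<le> 1 * L" using elim L0 by (intro mult_right_mono) auto
      moreover have "(sin (\<phi> n))\<^sup>2 + (cos (\<phi> n))\<^sup>2 = 1" by simp
      ultimately show ?case by linarith
    qed
    show "0 < \<delta> / 4" using \<delta> by simp
    show "\<forall>\<^sub>F n in sequentially. \<delta> / 4 \<le> v n" by (rule vc)
    have main: "\<forall>\<^sub>F n in sequentially. sqrt (real n) * (1 - (A n + B n)) / sqrt (v n)
        = - (2 * x) * (s n / sqrt (v n)) - \<epsilon> n * ((\<alpha> n)\<^sup>2 + (\<beta> n)\<^sup>2) / sqrt (v n)"
      using ev
    proof eventually_elim
      case (elim n)
      then have n: "n \<ge> 1" by simp
      have t: "1 + \<tau> n \<noteq> 0" "1 - \<tau> n \<noteq> 0" using \<tau>(1)[of n] \<tau>1[of n] by linarith+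
      have se: "sqrt (real n) * \<epsilon> n = 1" using n by (simp add: \<epsilon>_def)
      define D where "D = bnd_norm (\<tau> n) (\<phi> n)"
      have D: "0 < D" using bnd_norm_ge[OF \<tau>(1) \<tau>1, of n "\<phi> n"] \<tau>1[of n] by (simp add: D_def)
      \<comment> \<open>The displacement paired with half the gradient of the quadratic form: the
        gradient points along the normal, so only the normal component \<open>x\<close>
        survives.\<close>
      have cross: "\<alpha> n * cos (\<phi> n) + \<beta> n * sin (\<phi> n) = s n * x"
      proof -
        define N where "N = bnd_normal (\<tau> n) (\<phi> n)"
        have c: "(1 - \<tau> n) * cos (\<phi> n) = D * Re N" "(1 + \<tau> n) * sin (\<phi> n) = D * Im N"
          using D by (simp_all add: N_def bnd_normal_def D_def)
        have N1: "(Re N)\<^sup>2 + (Im N)\<^sup>2 = 1"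
          using cmod_bnd_normal[OF \<tau>(1) \<tau>1, of n "\<phi> n"] by (simp add: N_def cmod_def)
        have "\<alpha> n * cos (\<phi> n) + \<beta> n * sin (\<phi> n)
           = r n * (Re (Nb n) * ((1 - \<tau> n) * cos (\<phi> n)) + Im (Nb n) * ((1 + \<tau> n) * sin (\<phi> n))) / ((1 + \<tau> n) * (1 - \<tau> n))"
          unfolding \<alpha>_def \<beta>_def using t by (simp add: field_simps)
        also have "Re (Nb n) * ((1 - \<tau> n) * cos (\<phi> n)) + Im (Nb n) * ((1 + \<tau> n) * sin (\<phi> n)) = D * (((Re N)\<^sup>2 + (Im N)\<^sup>2) * x)"
          unfolding c Nb_def N_def[symmetric] using b(1)[of n] by (simp add: power2_eq_square algebra_simps)
        also have "r n * (D * (((Re N)\<^sup>2 + (Im N)\<^sup>2) * x)) / ((1 + \<tau> n) * (1 - \<tau> n)) = s n * x"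
          unfolding r(3)[symmetric] N1 using r(1)[of n] by (simp add: s_def D_def power2_eq_square)
        finally show ?thesis .
      qed
      have one: "(sin (\<phi> n))\<^sup>2 + (cos (\<phi> n))\<^sup>2 = 1" by simp
      have quad: "1 - (A n + B n) = - (2 * \<epsilon> n * (\<alpha> n * cos (\<phi> n) + \<beta> n * sin (\<phi> n))) - \<epsilon> n * \<epsilon> n * ((\<alpha> n)\<^sup>2 + (\<beta> n)\<^sup>2)"
        unfolding Aeq[OF n] Beq[OF n] one[symmetric] by (simp add: power2_eq_square algebra_simps)
      have "sqrt (real n) * (1 - (A n + B n)) = (sqrt (real n) * \<epsilon> n) * (- (2 * (s n * x)) - \<epsilon> n * ((\<alpha> n)\<^sup>2 + (\<beta> n)\<^sup>2))"
        unfolding quad cross by (simp add: algebra_simps)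
      then have num: "sqrt (real n) * (1 - (A n + B n)) = - (2 * x) * s n - \<epsilon> n * ((\<alpha> n)\<^sup>2 + (\<beta> n)\<^sup>2)"
        unfolding se by simp
      show ?case unfolding num diff_divide_distrib times_divide_eq_right ..
    qed
    have "(\<lambda>n. \<epsilon> n * ((\<alpha> n)\<^sup>2 + (\<beta> n)\<^sup>2) / sqrt (v n)) \<longlonglongrightarrow> 0"
    proof (rule tendsto_0_le[OF isq, of _ "2 * (R * S)\<^sup>2 / sqrt (\<delta> / 4)"])
      show "\<forall>\<^sub>F n in sequentially. norm (\<epsilon> n * ((\<alpha> n)\<^sup>2 + (\<beta> n)\<^sup>2) / sqrt (v n)) \<le> norm (\<epsilon> n) * (2 * (R * S)\<^sup>2 / sqrt (\<delta> / 4))"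
        using vc ev
      proof eventually_elim
        case (elim n)
        have "\<bar>\<alpha> n\<bar>\<^sup>2 \<le> (R * S)\<^sup>2" "\<bar>\<beta> n\<bar>\<^sup>2 \<le> (R * S)\<^sup>2" using \<alpha>[of n] \<beta>[of n] by (intro power_mono; simp)+
        then have "((\<alpha> n)\<^sup>2 + (\<beta> n)\<^sup>2) / sqrt (v n) \<le> 2 * (R * S)\<^sup>2 / sqrt (\<delta> / 4)"
          using elim \<delta> by (intro frac_le) auto
        then have "\<epsilon> n * (((\<alpha> n)\<^sup>2 + (\<beta> n)\<^sup>2) / sqrt (v n)) \<le> \<epsilon> n * (2 * (R * S)\<^sup>2 / sqrt (\<delta> / 4))"
          using elim by (intro mult_left_mono) auto
        moreover have "0 \<le> \<epsilon> n * ((\<alpha> n)\<^sup>2 + (\<beta> n)\<^sup>2) / sqrt (v n)" using elim \<delta> by simp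
        ultimately show ?case using elim by (simp only: real_norm_def abs_of_nonneg times_divide_eq_right)
      qed
    qed
    then have "(\<lambda>n. - (2 * x) * (s n / sqrt (v n)) - \<epsilon> n * ((\<alpha> n)\<^sup>2 + (\<beta> n)\<^sup>2) / sqrt (v n)) \<longlonglongrightarrow> - (2 * x) * 1 - 0"
      by (intro tendsto_intros ratio)
    then show "(\<lambda>n. sqrt (real n) * (1 - (A n + B n)) / sqrt (v n)) \<longlonglongrightarrow> - (2 * x)"
      using main by (simp add: tendsto_cong)
  qed
  then show ?thesis unfolding X_def .
qed

text \<open>Vitali's theorem is applied to one variable at a time. The local bounds come from
  \<open>nkern_bound\<close>, where both densities are at most 1 and the Gaussian loss depends only
  on the two displacements.\<close>

theorem nkern_boundary:
  fixes \<tau> \<phi> :: "nat \<Rightarrow> real" and a b :: "nat \<Rightarrow> complex"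
  assumes \<delta>: "0 < \<delta>" and \<tau>: "\<And>n. 0 \<le> \<tau> n" "\<And>n. \<tau> n \<le> 1 - \<delta>"
    and ab: "\<And>n. cmod (a n) \<le> R" "\<And>n. cmod (b n) \<le> R"
  shows "(\<lambda>n. nkern (\<tau> n) n (cnj (bnd_coord n (\<tau> n) (\<phi> n) (a n))) (bnd_coord n (\<tau> n) (\<phi> n) (b n))
      - erfc ((cnj (a n) + b n) / of_real (sqrt 2)) / 2) \<longlonglongrightarrow> 0"
proof -
  have \<tau>1: "\<tau> n < 1" for n using \<tau>[of n] \<delta> by linarith
  \<comment> \<open>The first argument is passed as \<open>\<alpha> = cnj a\<close>; the outer
    conjugation undoes the inner one, so \<open>G\<close> is holomorphic in both variables.\<close>
  define G where "G n \<alpha> \<beta> = nkern (\<tau> n) n (cnj (bnd_coord n (\<tau> n) (\<phi> n) (cnj \<alpha>))) (bnd_coord n (\<tau> n) (\<phi> n) \<beta>)" for n \<alpha> \<beta>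
  define H where "H n x y = G n (x - \<i> * y) (x + \<i> * y) - erfc (of_real (sqrt 2) * x) / 2" for n x y
  have cnj_coord: "cnj (bnd_coord n t p (cnj \<alpha>)) = cnj (bnd_coord n t p 0) + of_real (sqrt (1 - t\<^sup>2)) * cnj (bnd_normal t p) * \<alpha>" for n t p \<alpha>
    by (simp add: bnd_coord_def)
  have holoG: "(\<lambda>x. G n (f x) (g x)) holomorphic_on UNIV" if "f holomorphic_on UNIV" "g holomorphic_on UNIV" for n f g
    unfolding G_def cnj_coord unfolding bnd_coord_def by (intro holomorphic_intros \<tau>(1) \<tau>1 that)
  have holoE: "(\<lambda>x. erfc (g x)) holomorphic_on UNIV" if "g holomorphic_on UNIV" for g
    using holomorphic_on_compose_gen[OF that holomorphic_erfc] by (simp add: o_def)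
  \<comment> \<open>Displacements carry the factor \<open>sqrt (1 - \<tau>\<^sup>2)\<close>, which
    cancels the \<open>1 - \<tau>\<^sup>2\<close> in \<open>nkern_bound\<close>; the result is free
    of \<open>n\<close>, \<tau> and \<phi>.\<close>
  have Gb: "cmod (G n \<alpha> \<beta>) \<le> exp ((cmod \<alpha> + cmod \<beta>)\<^sup>2 / 2)" for n \<alpha> \<beta>
  proof -
    let ?X = "bnd_coord n (\<tau> n) (\<phi> n)"
    define D where "D = 1 - (\<tau> n)\<^sup>2"
    have D: "0 < D" using sq_less_one[OF \<tau>(1) \<tau>1] by (simp add: D_def)
    have "?X \<beta> - ?X (cnj \<alpha>) = of_real (sqrt D) * bnd_normal (\<tau> n) (\<phi> n) * (\<beta> - cnj \<alpha>)"
      by (simp add: bnd_coord_def D_def algebra_simps)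
    then have "cmod (?X \<beta> - ?X (cnj \<alpha>)) = sqrt D * cmod (\<beta> - cnj \<alpha>)"
      using D cmod_bnd_normal[OF \<tau>(1) \<tau>1] by (simp add: norm_mult)
    then have e: "(cmod (?X \<beta> - ?X (cnj \<alpha>)))\<^sup>2 / (2 * D) = (cmod (\<beta> - cnj \<alpha>))\<^sup>2 / 2"
      using D by (simp add: power_mult_distrib)
    have "exp (- (cmod (?X \<beta> - ?X (cnj \<alpha>)))\<^sup>2 / (2 * D)) * cmod (G n \<alpha> \<beta>)
        \<le> sqrt (ndens (\<tau> n) n (?X (cnj \<alpha>)) * ndens (\<tau> n) n (?X \<beta>))"
      unfolding G_def D_def by (rule nkern_bound[OF \<tau>(1) \<tau>1])
    also have "\<dots> \<le> sqrt (1 * 1)"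
      by (intro real_sqrt_le_mono mult_mono ndens_range \<tau>(1) \<tau>1) auto
    finally have "exp (- ((cmod (\<beta> - cnj \<alpha>))\<^sup>2 / 2)) * cmod (G n \<alpha> \<beta>) \<le> 1" using e by simp
    then have "cmod (G n \<alpha> \<beta>) \<le> exp ((cmod (\<beta> - cnj \<alpha>))\<^sup>2 / 2)" by (simp add: exp_minus field_simps)
    also have "cmod (\<beta> - cnj \<alpha>) \<le> cmod \<alpha> + cmod \<beta>" using norm_triangle_ineq4[of \<beta> "cnj \<alpha>"] by simp
    then have "exp ((cmod (\<beta> - cnj \<alpha>))\<^sup>2 / 2) \<le> exp ((cmod \<alpha> + cmod \<beta>)\<^sup>2 / 2)" by (simp add: power_mono)
    finally show ?thesis .
  qed
  have Eb: "\<exists>B. \<forall>z. cmod z \<le> M \<longrightarrow> cmod (erfc z) \<le> B" for M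
  proof -
    have "continuous_on (cball 0 M) erfc"
      using holomorphic_on_imp_continuous_on[OF holomorphic_erfc] continuous_on_subset by blast
    then have "bounded (erfc ` cball 0 M)" by (intro compact_imp_bounded compact_continuous_image) auto
    then obtain B where "\<forall>x\<in>erfc ` cball 0 M. cmod x \<le> B" unfolding bounded_iff by blast
    then show ?thesis by (intro exI[of _ B]) auto
  qed
  have Hb: "\<exists>B. \<forall>n x y. cmod x \<le> M \<and> cmod y \<le> M \<longrightarrow> cmod (H n x y) \<le> B" for M
  proof -
    obtain B where B: "\<forall>z. cmod z \<le> sqrt 2 * \<bar>M\<bar> \<longrightarrow> cmod (erfc z) \<le> B" using Eb by blast
    have "cmod (H n x y) \<le> exp ((4 * \<bar>M\<bar>)\<^sup>2 / 2) + B / 2" if "cmod x \<le> M" "cmod y \<le> M" for n x y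
    proof -
      have "cmod (x - \<i> * y) \<le> 2 * \<bar>M\<bar>" "cmod (x + \<i> * y) \<le> 2 * \<bar>M\<bar>"
        using norm_triangle_ineq4[of x "\<i> * y"] norm_triangle_ineq[of x "\<i> * y"] that by (auto simp: norm_mult)
      then have "(cmod (x - \<i> * y) + cmod (x + \<i> * y))\<^sup>2 \<le> (4 * \<bar>M\<bar>)\<^sup>2" by (intro power_mono) auto
      then have 1: "cmod (G n (x - \<i> * y) (x + \<i> * y)) \<le> exp ((4 * \<bar>M\<bar>)\<^sup>2 / 2)"
        using Gb[of n "x - \<i> * y" "x + \<i> * y"] by (auto intro: order_trans)
      have "cmod (of_real (sqrt 2) * x) \<le> sqrt 2 * \<bar>M\<bar>" using that by (simp add: norm_mult)
      then have 2: "cmod (erfc (of_real (sqrt 2) * x) / 2) \<le> B / 2" using B by (simp add: norm_divide)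
      show ?thesis unfolding H_def using 1 2 by (intro order_trans[OF norm_triangle_ineq4] add_mono)
    qed
    then show ?thesis by blast
  qed
  \<comment> \<open>For real arguments the kernel sits on the diagonal, at the displacement
    \<open>x + \<i> * y\<close>, and is a density.\<close>
  have step1: "(\<lambda>n. H n (of_real x) (of_real (y n))) \<longlonglongrightarrow> 0" if y: "\<And>n. \<bar>y n\<bar> \<le> M" for x M and y :: "nat \<Rightarrow> real"
  proof -
    define bb where "bb n = Complex x (y n)" for n
    have bb: "of_real x + \<i> * of_real (y n) = bb n" "of_real x - \<i> * of_real (y n) = cnj (bb n)" for n
      by (simp_all add: bb_def complex_eq_iff)
    have "(\<lambda>n. ndens (\<tau> n) n (bnd_coord n (\<tau> n) (\<phi> n) (bb n))) \<longlonglongrightarrow> cdf std_normal_distribution (- (2 * x))"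
    proof (rule ndens_boundary[OF \<delta> \<tau>, of bb x "\<bar>x\<bar> + M"])
      show "cmod (bb n) \<le> \<bar>x\<bar> + M" for n
        using cmod_le[of "bb n"] y[of n] by (simp add: bb_def)
    qed (simp add: bb_def)
    then have "(\<lambda>n. complex_of_real (ndens (\<tau> n) n (bnd_coord n (\<tau> n) (\<phi> n) (bb n))) - of_real (cdf std_normal_distribution (- (2 * x))))
        \<longlonglongrightarrow> of_real (cdf std_normal_distribution (- (2 * x))) - of_real (cdf std_normal_distribution (- (2 * x)))"
      by (intro tendsto_intros)
    moreover have "H n (of_real x) (of_real (y n)) = complex_of_real (ndens (\<tau> n) n (bnd_coord n (\<tau> n) (\<phi> n) (bb n))) - of_real (cdf std_normal_distribution (- (2 * x)))" for n
    proof -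
      have E: "of_real (sqrt 2) * complex_of_real x = of_real (2 * x / sqrt 2)"
      proof -
        have "sqrt 2 * x = 2 * x / sqrt 2" by (simp add: field_simps)
        then show ?thesis by (simp only: of_real_mult[symmetric])
      qed
      have "erfc (of_real (sqrt 2) * of_real x) / 2 = of_real (cdf std_normal_distribution (- (2 * x)))"
        unfolding E erfc_std_normal by simp
      then show ?thesis unfolding H_def bb G_def
        by (simp add: nkern_diag[OF \<tau>(1) \<tau>1])
    qed
    ultimately show ?thesis by simp
  qed
  \<comment> \<open>Vitali in the first variable, for a fixed real second one.\<close>
  have step2: "(\<lambda>n. H n (x n) (of_real y)) \<longlonglongrightarrow> 0" if x: "\<And>n. cmod (x n) \<le> M" for M y and x :: "nat \<Rightarrow> complex"
  proof (rule vitali_null_sequence[where F = "\<lambda>n z. H n z (of_real y)" and R = M])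
    show "(\<lambda>z. H n z (of_real y)) holomorphic_on UNIV" for n
      unfolding H_def by (intro holomorphic_intros holoG holoE)  auto
    show "\<exists>B. \<forall>n z. cmod z \<le> R \<longrightarrow> cmod (H n z (of_real y)) \<le> B" for R
    proof -
      obtain B where "\<forall>n u z. cmod u \<le> max R \<bar>y\<bar> \<and> cmod z \<le> max R \<bar>y\<bar> \<longrightarrow> cmod (H n u z) \<le> B" using Hb by blast
      then show ?thesis by (intro exI[of _ B]) (auto simp: le_max_iff_disj)
    qed
    show "(\<lambda>n. H n (of_real z) (of_real y)) \<longlonglongrightarrow> 0" for z
      by (rule step1[of "\<lambda>_. y" "\<bar>y\<bar>"]) simp
  qed (rule x)
  \<comment> \<open>Vitali in the second variable; the moving complex points \<open>x n\<close> are
    built into the sequence of functions.\<close>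
  have step3: "(\<lambda>n. H n (x n) (y n)) \<longlonglongrightarrow> 0" if x: "\<And>n. cmod (x n) \<le> M" and y: "\<And>n. cmod (y n) \<le> M" for M and x y :: "nat \<Rightarrow> complex"
  proof (rule vitali_null_sequence[where F = "\<lambda>n z. H n (x n) z" and R = M])
    show "(\<lambda>z. H n (x n) z) holomorphic_on UNIV" for n
      unfolding H_def by (intro holomorphic_intros holoG) auto
    show "\<exists>B. \<forall>n z. cmod z \<le> R \<longrightarrow> cmod (H n (x n) z) \<le> B" for R
    proof -
      obtain B where "\<forall>n u z. cmod u \<le> max R M \<and> cmod z \<le> max R M \<longrightarrow> cmod (H n u z) \<le> B" using Hb by blast
      then show ?thesis using x by (intro exI[of _ B]) (auto simp: le_max_iff_disj)
    qed
    show "(\<lambda>n. H n (x n) (of_real z)) \<longlonglongrightarrow> 0" for z by (rule step2[OF x])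
  qed (rule y)
  define x where "x n = (cnj (a n) + b n) / 2" for n
  define y where "y n = (b n - cnj (a n)) / (2 * \<i>)" for n
  have xy: "x n - \<i> * y n = cnj (a n)" "x n + \<i> * y n = b n" for n
    by (simp_all add: x_def y_def field_simps)
  have "(\<lambda>n. H n (x n) (y n)) \<longlonglongrightarrow> 0"
  proof (rule step3[of _ R])
    show "cmod (x n) \<le> R" for n
      using norm_triangle_ineq[of "cnj (a n)" "b n"] ab[of n] by (simp add: x_def norm_divide)
    show "cmod (y n) \<le> R" for n
      using norm_triangle_ineq4[of "b n" "cnj (a n)"] ab[of n] by (simp add: y_def norm_divide norm_mult)
  qed
  moreover have "of_real (sqrt 2) * x n = (cnj (a n) + b n) / of_real (sqrt 2)" for n
  proof -
    have "complex_of_real (sqrt 2) * of_real (sqrt 2) = 2" by (simp flip: of_real_mult)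
    then show ?thesis by (simp add: x_def field_simps)
  qed
  ultimately show ?thesis unfolding H_def xy G_def by simp
qed

section \<open>Geometry of the ellipse\<close>

lemma ell_axes:
  assumes "2 * cmod t2 < 1"
  shows "1 \<le> ell_a t2" "0 < ell_b t2" "ell_b t2 \<le> 1"
    "(ell_a t2)\<^sup>2 = (1 + 2 * cmod t2) / (1 - 2 * cmod t2)" "(ell_b t2)\<^sup>2 = (1 - 2 * cmod t2) / (1 + 2 * cmod t2)"
    "sqrt (1 - (2 * cmod t2)\<^sup>2) * ell_a t2 = 1 + 2 * cmod t2"
    "sqrt (1 - (2 * cmod t2)\<^sup>2) * ell_b t2 = 1 - 2 * cmod t2"
proof -
  define t where "t = 2 * cmod t2"
  have t: "0 \<le> t" "t < 1" using assms by (auto simp: t_def)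
  have f: "1 - t\<^sup>2 = (1 + t) * (1 - t)" by (simp add: power2_eq_square algebra_simps)
  show "1 \<le> ell_a t2" "0 < ell_b t2" "ell_b t2 \<le> 1"
    "(ell_a t2)\<^sup>2 = (1 + 2 * cmod t2) / (1 - 2 * cmod t2)" "(ell_b t2)\<^sup>2 = (1 - 2 * cmod t2) / (1 + 2 * cmod t2)"
    using t unfolding ell_a_def ell_b_def t_def[symmetric] by auto
  show "sqrt (1 - (2 * cmod t2)\<^sup>2) * ell_a t2 = 1 + 2 * cmod t2"
    unfolding ell_a_def t_def[symmetric] real_sqrt_mult[symmetric] f
    using t by (simp add: real_sqrt_unique power2_eq_square)
  show "sqrt (1 - (2 * cmod t2)\<^sup>2) * ell_b t2 = 1 - 2 * cmod t2"
    unfolding ell_b_def t_def[symmetric] real_sqrt_mult[symmetric] f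
    using t by (simp add: real_sqrt_unique power2_eq_square)
qed

lemma csqrt_ell_rot:
  assumes "t2 \<noteq> 0"
  shows "csqrt t2 = of_real (sqrt (cmod t2)) * ell_rot t2"
proof (rule csqrt_unique)
  have "(of_real (sqrt (cmod t2)) * ell_rot t2)\<^sup>2 = of_real ((sqrt (cmod t2))\<^sup>2) * (ell_rot t2)\<^sup>2"
    by (simp only: power_mult_distrib of_real_power)
  then show "(of_real (sqrt (cmod t2)) * ell_rot t2)\<^sup>2 = t2" using ell_rot(2)[of t2] by simp
  have q: "0 < sqrt (cmod t2)" using assms by simp
  have parts: "Re (of_real r * w) = r * Re w" "Im (of_real r * w) = r * Im w" for r w by simp_all
  show "0 < Re (of_real (sqrt (cmod t2)) * ell_rot t2) \<or>
      Re (of_real (sqrt (cmod t2)) * ell_rot t2) = 0 \<and> 0 \<le> Im (of_real (sqrt (cmod t2)) * ell_rot t2)"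
    using csqrt_principal[of "t2 / of_real (cmod t2)"] assms q
    unfolding parts by (simp add: ell_rot_def zero_less_mult_iff zero_le_mult_iff del: csqrt.sel)
qed

lemma csqrt_scaled_parts:
  assumes "t2 \<noteq> 0"
  shows "(Re (csqrt t2 * u))\<^sup>2 = cmod t2 * (Re (ell_rot t2 * u))\<^sup>2" "(Im (csqrt t2 * u))\<^sup>2 = cmod t2 * (Im (ell_rot t2 * u))\<^sup>2"
  unfolding csqrt_ell_rot[OF assms] mult.assoc by (simp_all add: power_mult_distrib)

text \<open>Dividing by \<open>cmod t2\<close> turns \<open>csqrt t2\<close> into the rotation
  \<open>ell_rot\<close>, after which disc and ellipse have one common description.\<close>

lemma ell_shifted_iff:
  assumes t: "2 * cmod t2 < 1" and s: "0 < ell_b t2 + s"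
  shows "z \<in> ell_shifted t1 t2 s \<longleftrightarrow>
    (Re (ell_rot t2 * (z - ell_center t1 t2)))\<^sup>2 / (ell_a t2 + s)\<^sup>2 + (Im (ell_rot t2 * (z - ell_center t1 t2)))\<^sup>2 / (ell_b t2 + s)\<^sup>2 < 1"
proof (cases "t2 = 0")
  case True
  define u where "u = z - ell_center t1 0"
  have "0 < (1 + s)\<^sup>2" using s True by (simp add: ell_b_def)
  then have "(Re u)\<^sup>2 / (1 + s)\<^sup>2 + (Im u)\<^sup>2 / (1 + s)\<^sup>2 < 1 \<longleftrightarrow> (Re u)\<^sup>2 + (Im u)\<^sup>2 < (1 + s)\<^sup>2"
    by (simp add: add_divide_distrib[symmetric])
  then show ?thesis unfolding True ell_shifted_def
    by (simp add: ell_rot_def ell_a_def ell_b_def cmod_power2 u_def)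
next
  case False
  define u where "u = z - ell_center t1 t2"
  have "cmod t2 > 0" using False by simp
  then show ?thesis unfolding ell_shifted_def u_def[symmetric] using False
    by (simp add: csqrt_scaled_parts[OF False] u_def[symmetric] distrib_left[symmetric] times_divide_eq_right[symmetric]
        del: times_divide_eq_right times_complex.sel)
qed

lemma ell_boundary_iff:
  assumes t: "2 * cmod t2 < 1"
  shows "z \<in> ell_boundary t1 t2 \<longleftrightarrow>
    (Re (ell_rot t2 * (z - ell_center t1 t2)))\<^sup>2 / (ell_a t2)\<^sup>2 + (Im (ell_rot t2 * (z - ell_center t1 t2)))\<^sup>2 / (ell_b t2)\<^sup>2 = 1"
proof (cases "t2 = 0")
  case True
  define u where "u = z - ell_center t1 0"
  have "cmod u = 1 \<longleftrightarrow> (cmod u)\<^sup>2 = 1"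
    by (metis norm_ge_zero power2_eq_iff_nonneg power_one zero_le_one)
  then show ?thesis unfolding True ell_boundary_def
    by (simp add: ell_rot_def ell_a_def ell_b_def cmod_power2 u_def)
next
  case False
  define u where "u = z - ell_center t1 t2"
  have "cmod t2 > 0" using False by simp
  then show ?thesis unfolding ell_boundary_def u_def[symmetric] using False
    by (simp add: csqrt_scaled_parts[OF False] u_def[symmetric] distrib_left[symmetric] times_divide_eq_right[symmetric]
        del: times_divide_eq_right times_complex.sel)
qed

lemma unit_circle_unique_angle:
  assumes "x\<^sup>2 + y\<^sup>2 = (1::real)"
  shows "\<exists>!\<phi>. - pi < \<phi> \<and> \<phi> \<le> pi \<and> x = cos \<phi> \<and> y = sin \<phi>"
proof -
  define z where "z = Complex x y"
  have z: "cmod z = 1" using assms by (simp add: z_def cmod_def)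
  have "z \<noteq> 0" using z by auto
  then have c: "cis (Arg z) = z" using z by (simp add: cis_Arg sgn_div_norm)
  have iff: "x = cos \<phi> \<and> y = sin \<phi> \<longleftrightarrow> z = cis \<phi>" for \<phi> by (auto simp: z_def complex_eq_iff)
  show ?thesis unfolding iff
  proof (rule ex1I[of _ "Arg z"])
    show "- pi < Arg z \<and> Arg z \<le> pi \<and> z = cis (Arg z)" using c Arg_bounded[of z] by simp
    fix \<phi> assume "- pi < \<phi> \<and> \<phi> \<le> pi \<and> z = cis \<phi>"
    then show "\<phi> = Arg z" by (simp add: Arg_cis)
  qed
qed

text \<open>Dividing by the semi-axes maps the ellipse to the unit circle, where the angle in the
  half-open interval is unique. So the definite description denotes, for \<open>t2 = 0\<close> as
  well.\<close>

lemma ell_phi: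
  assumes t: "2 * cmod t2 < 1" and z: "z \<in> ell_boundary t1 t2"
  shows "- pi < ell_phi t1 t2 z" "ell_phi t1 t2 z \<le> pi"
    "ell_rot t2 * (z - ell_center t1 t2) = Complex (ell_a t2 * cos (ell_phi t1 t2 z)) (ell_b t2 * sin (ell_phi t1 t2 z))"
proof -
  define W where "W = ell_rot t2 * (z - ell_center t1 t2)"
  have ab: "ell_a t2 \<noteq> 0" "ell_b t2 \<noteq> 0" using ell_axes[OF t] by auto
  have "(Re W / ell_a t2)\<^sup>2 + (Im W / ell_b t2)\<^sup>2 = 1"
    using z unfolding ell_boundary_iff[OF t] W_def power_divide .
  then have ex: "\<exists>!\<phi>. - pi < \<phi> \<and> \<phi> \<le> pi \<and> Re W / ell_a t2 = cos \<phi> \<and> Im W / ell_b t2 = sin \<phi>"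
    by (rule unit_circle_unique_angle)
  have iff: "Re W / ell_a t2 = cos \<phi> \<and> Im W / ell_b t2 = sin \<phi> \<longleftrightarrow> W = Complex (ell_a t2 * cos \<phi>) (ell_b t2 * sin \<phi>)" for \<phi>
    using ab by (auto simp: complex_eq_iff field_simps)
  have ex': "\<exists>!\<phi>. - pi < \<phi> \<and> \<phi> \<le> pi \<and> W = Complex (ell_a t2 * cos \<phi>) (ell_b t2 * sin \<phi>)"
    using ex unfolding iff .
  have "ell_phi t1 t2 z = (THE \<phi>. - pi < \<phi> \<and> \<phi> \<le> pi \<and> W = Complex (ell_a t2 * cos \<phi>) (ell_b t2 * sin \<phi>))"
  proof (cases "t2 = 0")
    case True
    then show ?thesis unfolding ell_phi_def W_def
      by (simp add: ell_rot_def ell_a_def ell_b_def cis.code)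
  next
    case False
    have "of_real (ell_a t2 * cos \<phi>) + \<i> * of_real (ell_b t2 * sin \<phi>) = Complex (ell_a t2 * cos \<phi>) (ell_b t2 * sin \<phi>)" for \<phi>
      by (simp add: complex_eq_iff)
    then show ?thesis unfolding ell_phi_def W_def ell_rot_def using False by (simp only: if_False)
  qed
  then show "- pi < ell_phi t1 t2 z" "ell_phi t1 t2 z \<le> pi"
    "ell_rot t2 * (z - ell_center t1 t2) = Complex (ell_a t2 * cos (ell_phi t1 t2 z)) (ell_b t2 * sin (ell_phi t1 t2 z))"
    using theI'[OF ex'] unfolding W_def by auto
qed

text \<open>\<open>Arg t2 / 2\<close> lies above \<open>- pi / 2\<close> and is at most
  \<open>pi / 2\<close>, the range of arguments of the principal root; at the endpoint
  \<open>Arg t2 = pi\<close> the root is \<open>\<i>\<close>.\<close>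

lemma ell_rot_cis:
  assumes "t2 \<noteq> 0"
  shows "ell_rot t2 = cis (Arg t2 / 2)"
proof -
  have "csqrt (t2 / of_real (cmod t2)) = cis (Arg t2 / 2)"
  proof (rule csqrt_unique)
    have "(cis (Arg t2 / 2))\<^sup>2 = cis (Arg t2)" by (simp add: power2_eq_square cis_mult)
    then show "(cis (Arg t2 / 2))\<^sup>2 = t2 / of_real (cmod t2)"
      using assms by (simp add: cis_Arg sgn_eq)
    show "0 < Re (cis (Arg t2 / 2)) \<or> Re (cis (Arg t2 / 2)) = 0 \<and> 0 \<le> Im (cis (Arg t2 / 2))"
    proof (cases "Arg t2 = pi")
      case False
      then have "0 < cos (Arg t2 / 2)" using Arg_bounded[of t2] by (intro cos_gt_zero_pi) auto
      then show ?thesis by simp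
    qed simp
  qed
  then show ?thesis using assms by (simp add: ell_rot_def)
qed

text \<open>\<open>arctan\<close> always yields a direction in the right half-plane, whereas the
  real part of the normal has the sign of \<open>cos \<phi>\<close>. The factor
  \<open>sgn (cos \<phi>)\<close> makes up for this and is the origin of the summand
  \<open>sgn \<phi> * pi\<close> in \<open>ell_psi\<close>.\<close>

lemma cis_arctan_scaled:
  assumes "0 \<le> \<tau>" "\<tau> < 1" "cos \<phi> \<noteq> 0"
  shows "cis (arctan ((1 + \<tau>) / (1 - \<tau>) * tan \<phi>)) = of_real (sgn (cos \<phi>)) * bnd_normal \<tau> \<phi>"
proof -
  define D where "D = bnd_norm \<tau> \<phi>"
  define x where "x = (1 + \<tau>) / (1 - \<tau>) * tan \<phi>"
  have D: "0 < D" using bnd_norm_ge[OF assms(1,2), of \<phi>] assms by (simp add: D_def)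
  have c: "0 < (1 - \<tau>) * \<bar>cos \<phi>\<bar>" using assms by simp
  have "1 + x\<^sup>2 = (D / ((1 - \<tau>) * \<bar>cos \<phi>\<bar>))\<^sup>2"
  proof -
    have quot: "1 + (p / q * (s / c))\<^sup>2 = (q\<^sup>2 * c\<^sup>2 + p\<^sup>2 * s\<^sup>2) / (q\<^sup>2 * c\<^sup>2)" if "q \<noteq> 0" "c \<noteq> 0" for p q s c :: real
      using that by (simp add: power_mult_distrib power_divide add_divide_distrib)
    show ?thesis unfolding x_def tan_def D_def power_divide[of "bnd_norm \<tau> \<phi>"] bnd_norm_sq power_mult_distrib[of "1 - \<tau>"] power2_abs
      using assms by (intro quot) auto
  qed
  then have sq: "sqrt (1 + x\<^sup>2) = D / ((1 - \<tau>) * \<bar>cos \<phi>\<bar>)" using D c by simp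
  have ab: "\<bar>cos \<phi>\<bar> = sgn (cos \<phi>) * cos \<phi>" by (simp add: abs_sgn mult.commute)
  have co: "cos (arctan x) = sgn (cos \<phi>) * ((1 - \<tau>) * cos \<phi> / D)"
    unfolding cos_arctan sq ab by simp
  have "x * \<bar>cos \<phi>\<bar> * (1 - \<tau>) = sgn (cos \<phi>) * ((1 + \<tau>) * sin \<phi>)"
    unfolding x_def tan_def ab using assms by simp
  then have si: "sin (arctan x) = sgn (cos \<phi>) * ((1 + \<tau>) * sin \<phi> / D)"
    unfolding sin_arctan sq by (simp add: mult_ac)
  show ?thesis unfolding x_def[symmetric] bnd_normal_def D_def[symmetric]
    by (simp add: complex_eq_iff co si)
qed

text \<open>Gives the explicit angle its meaning: in the coordinates rotated by
  \<open>ell_rot\<close> it is the direction of the outer normal. Where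
  \<open>cos \<phi> < 0\<close>, adding \<open>sgn \<phi> * pi\<close> reverses the direction found
  by \<open>arctan\<close>.\<close>

lemma ell_psi:
  assumes t: "2 * cmod t2 < 1" and z: "z \<in> ell_boundary t1 t2"
  shows "ell_rot t2 * exp (\<i> * of_real (ell_psi t1 t2 z)) = bnd_normal (2 * cmod t2) (ell_phi t1 t2 z)"
proof -
  define \<tau> where "\<tau> = 2 * cmod t2"
  have \<tau>: "0 \<le> \<tau>" "\<tau> < 1" using t by (auto simp: \<tau>_def)
  define \<phi> where "\<phi> = ell_phi t1 t2 z"
  have \<phi>: "- pi < \<phi>" "\<phi> \<le> pi" using ell_phi[OF t z] by (auto simp: \<phi>_def)
  define \<alpha> where "\<alpha> = arctan ((1 + \<tau>) / (1 - \<tau>) * tan \<phi>)"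
  have exp_cis: "exp (\<i> * of_real y) = cis y" for y by (simp add: cis_conv_exp)
  show ?thesis
  proof (cases "t2 = 0")
    case True
    have "bnd_normal 0 \<phi> = cis \<phi>" by (simp add: bnd_normal_def bnd_norm_def complex_eq_iff cmod_def)
    then show ?thesis using True unfolding exp_cis \<phi>_def
      by (simp add: ell_psi_def ell_rot_def)
  next
    case False
    have psi: "ell_psi t1 t2 z = - (Arg t2 / 2) + (if - (pi / 2) < \<phi> \<and> \<phi> < pi / 2 then \<alpha>
        else if \<phi> < - (pi / 2) \<or> pi / 2 < \<phi> then \<alpha> + sgn \<phi> * pi else \<phi>)"
      using False unfolding ell_psi_def Let_def \<phi>_def[symmetric] \<tau>_def[symmetric] \<alpha>_def[symmetric] by simp
    have red: "ell_rot t2 * exp (\<i> * of_real (ell_psi t1 t2 z)) = cis (if - (pi / 2) < \<phi> \<and> \<phi> < pi / 2 then \<alpha>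
        else if \<phi> < - (pi / 2) \<or> pi / 2 < \<phi> then \<alpha> + sgn \<phi> * pi else \<phi>)"
      unfolding exp_cis ell_rot_cis[OF False] cis_mult psi by simp
    consider (mid) "- (pi / 2) < \<phi>" "\<phi> < pi / 2" | (left) "\<phi> < - (pi / 2)" | (right) "pi / 2 < \<phi>" | (edge) "\<phi> = pi / 2 \<or> \<phi> = - (pi / 2)"
      by linarith
    then have "cis (if - (pi / 2) < \<phi> \<and> \<phi> < pi / 2 then \<alpha>
        else if \<phi> < - (pi / 2) \<or> pi / 2 < \<phi> then \<alpha> + sgn \<phi> * pi else \<phi>) = bnd_normal \<tau> \<phi>"
    proof cases
      case mid
      then have "0 < cos \<phi>" by (rule cos_gt_zero_pi)
      then show ?thesis using mid cis_arctan_scaled[OF \<tau>, of \<phi>] by (simp add: \<alpha>_def)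
    next
      case left
      have "0 < cos (\<phi> + pi)" using left \<phi> by (intro cos_gt_zero_pi) auto
      then have "cos \<phi> < 0" by simp
      moreover have "\<phi> < 0" using left pi_gt_zero by linarith
      then have "sgn \<phi> = - 1" by simp
      moreover have "cis (\<alpha> - pi) = - cis \<alpha>" by (simp add: complex_eq_iff)
      ultimately show ?thesis using left cis_arctan_scaled[OF \<tau>, of \<phi>] by (simp add: \<alpha>_def)
    next
      case right
      have "0 < cos (\<phi> - pi)" using right \<phi> by (intro cos_gt_zero_pi) auto
      then have "cos \<phi> < 0" by simp
      moreover have "0 < \<phi>" using right pi_gt_zero by linarith
      then have "sgn \<phi> = 1" by simp
      moreover have "cis (\<alpha> + pi) = - cis \<alpha>" by (simp add: complex_eq_iff)
      ultimately show ?thesis using right cis_arctan_scaled[OF \<tau>, of \<phi>] by (simp add: \<alpha>_def)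
    next
      \<comment> \<open>At the endpoints of the minor axis the normal is \<open>\<i>\<close> or
        \<open>- \<i>\<close>, which is \<open>cis \<phi>\<close> itself.\<close>
      case edge
      then have "cos \<phi> = 0 \<and> \<bar>sin \<phi>\<bar> = 1"
        by (elim disjE) (simp_all only: cos_minus sin_minus cos_pi_half sin_pi_half abs_minus_cancel abs_one simp_thms)
      then have c: "cos \<phi> = 0" and s: "\<bar>sin \<phi>\<bar> = 1" by auto
      have "(bnd_norm \<tau> \<phi>)\<^sup>2 = (1 + \<tau>)\<^sup>2"
        unfolding bnd_norm_sq using c s by (simp add: power2_abs[symmetric, of "sin \<phi>"] del: power2_abs)
      then have "bnd_norm \<tau> \<phi> = 1 + \<tau>" using \<tau> by (simp add: bnd_norm_def)
      then have "bnd_normal \<tau> \<phi> = cis \<phi>" using c \<tau> by (simp add: bnd_normal_def complex_eq_iff)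
      moreover have "\<not> (- (pi / 2) < \<phi> \<and> \<phi> < pi / 2)" "\<not> (\<phi> < - (pi / 2) \<or> pi / 2 < \<phi>)"
        using edge pi_gt_zero by (elim disjE; linarith)+
      ultimately show ?thesis by (simp only: if_False)
    qed
    then show ?thesis unfolding red \<tau>_def \<phi>_def .
  qed
qed

lemma ell_coord_boundary:
  assumes n: "n \<ge> 1" and t: "2 * cmod t2 < 1" and z: "z \<in> ell_boundary t1 t2"
  shows "ell_coord n t1 t2 (z + a * exp (\<i> * of_real (ell_psi t1 t2 z)) / of_real (sqrt (real n)))
     = bnd_coord n (2 * cmod t2) (ell_phi t1 t2 z) a"
proof -
  define e where "e = exp (\<i> * of_real (ell_psi t1 t2 z))"
  define D where "D = 1 - (2 * cmod t2)\<^sup>2"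
  define s where "s = complex_of_real (sqrt (real n))"
  have s: "s \<noteq> 0" using n by (simp add: s_def)
  have "ell_coord n t1 t2 (z + a * e / s) = s * (of_real (sqrt D) * (ell_rot t2 * (z - ell_center t1 t2))) + of_real (sqrt D) * (ell_rot t2 * e) * a"
    unfolding ell_coord_def D_def[symmetric] real_sqrt_mult of_real_mult s_def[symmetric]
    using s by (simp add: field_simps)
  also have "ell_rot t2 * e = bnd_normal (2 * cmod t2) (ell_phi t1 t2 z)"
    unfolding e_def by (rule ell_psi[OF t z])
  also have "of_real (sqrt D) * (ell_rot t2 * (z - ell_center t1 t2))
     = Complex ((1 + 2 * cmod t2) * cos (ell_phi t1 t2 z)) ((1 - 2 * cmod t2) * sin (ell_phi t1 t2 z))"
    unfolding ell_phi(3)[OF t z] using ell_axes(6,7)[OF t] by (simp add: complex_eq_iff D_def mult.assoc[symmetric])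
  finally show ?thesis by (simp add: bnd_coord_def e_def s_def D_def)
qed

text \<open>The linear map that turns the ellipse into a circle. As \<open>ellq\<close> is the
  squared norm of the image, perturbing a point costs no more than a triangle inequality.\<close>

definition sqz :: "real \<Rightarrow> complex \<Rightarrow> complex" where
  "sqz \<tau> X = Complex (Re X / (1 + \<tau>)) (Im X / (1 - \<tau>))"

lemma ellq_sqz: "ellq \<tau> X = (cmod (sqz \<tau> X))\<^sup>2"
  by (simp add: ellq_def sqz_def cmod_power2 power_divide)

lemma sqz_add: "sqz \<tau> (X + Y) = sqz \<tau> X + sqz \<tau> Y"
  by (simp add: sqz_def complex_eq_iff add_divide_distrib)

lemma sqz_real: "sqz \<tau> (of_real r * X) = of_real r * sqz \<tau> X"
  by (simp add: sqz_def complex_eq_iff)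

lemma cmod_sqz_le:
  assumes "0 \<le> \<tau>" "\<tau> < 1"
  shows "cmod (sqz \<tau> X) \<le> cmod X / (1 - \<tau>)"
proof (rule power2_le_imp_le)
  have "(Re X)\<^sup>2 / (1 + \<tau>)\<^sup>2 \<le> (Re X)\<^sup>2 / (1 - \<tau>)\<^sup>2"
    using assms by (intro divide_left_mono power_mono mult_pos_pos) auto
  then show "(cmod (sqz \<tau> X))\<^sup>2 \<le> (cmod X / (1 - \<tau>))\<^sup>2"
    unfolding ellq_sqz[symmetric] ellq_def power_divide cmod_power2[of X] add_divide_distrib by simp
qed (use assms in auto)

text \<open>Moving \<open>z\<close> by \<open>a / sqrt n\<close> moves the rescaled point by at most
  \<open>cmod a\<close>, and its \<open>sqz\<close> image by at most
  \<open>cmod a / (1 - 2 * cmod t2)\<close>; the elliptic distance \<open>q\<close> of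
  \<open>z\<close> from the centre is magnified by \<open>sqrt n\<close>.\<close>

lemma cmod_sqz_coord:
  fixes t1 t2 z a :: complex
  assumes n: "n \<ge> 1" and t: "2 * cmod t2 < 1"
  defines "u \<equiv> ell_rot t2 * (z - ell_center t1 t2)"
  defines "q \<equiv> sqrt ((Re u)\<^sup>2 / (ell_a t2)\<^sup>2 + (Im u)\<^sup>2 / (ell_b t2)\<^sup>2)"
  shows "cmod (sqz (2 * cmod t2) (ell_coord n t1 t2 (z + a / of_real (sqrt (real n))))) \<le> sqrt (real n) * q + cmod a / (1 - 2 * cmod t2)"
    and "sqrt (real n) * q - cmod a / (1 - 2 * cmod t2) \<le> cmod (sqz (2 * cmod t2) (ell_coord n t1 t2 (z + a / of_real (sqrt (real n)))))"
proof -
  define \<tau> where "\<tau> = 2 * cmod t2"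
  have \<tau>: "0 \<le> \<tau>" "\<tau> < 1" using t by (auto simp: \<tau>_def)
  define r where "r = sqrt (1 - \<tau>\<^sup>2)"
  have r: "0 < r" "r \<le> 1" using sq_less_one[OF \<tau>] by (auto simp: r_def)
  define s where "s = complex_of_real (sqrt (real n))"
  have s: "s \<noteq> 0" using n by (simp add: s_def)
  have co: "ell_coord n t1 t2 (z + a / s) = s * (of_real r * u) + of_real r * ell_rot t2 * a"
    unfolding ell_coord_def \<tau>_def[symmetric] real_sqrt_mult of_real_mult s_def[symmetric] r_def[symmetric] u_def
    using s by (simp add: field_simps)
  have ru: "cmod (sqz \<tau> (of_real r * u)) = q"
  proof -
    have ab: "0 < ell_a t2" "0 < ell_b t2" using ell_axes(1,2)[OF t] by auto
    have "r * ell_a t2 = 1 + \<tau>" "r * ell_b t2 = 1 - \<tau>" using ell_axes(6,7)[OF t] by (auto simp: r_def \<tau>_def)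
    then have "r / (1 + \<tau>) = 1 / ell_a t2" "r / (1 - \<tau>) = 1 / ell_b t2"
      using ab r by (metis less_irrefl nonzero_divide_mult_cancel_left)+
    then have "sqz \<tau> (of_real r * u) = Complex (Re u / ell_a t2) (Im u / ell_b t2)"
      unfolding sqz_def by (simp add: complex_eq_iff) (metis mult.commute times_divide_eq_right mult.right_neutral)
    then show ?thesis by (simp add: cmod_def q_def power_divide)
  qed
  have ca: "cmod (sqz \<tau> (of_real r * ell_rot t2 * a)) \<le> cmod a / (1 - \<tau>)"
  proof -
    have "cmod (sqz \<tau> (of_real r * ell_rot t2 * a)) \<le> cmod (of_real r * ell_rot t2 * a) / (1 - \<tau>)" by (rule cmod_sqz_le[OF \<tau>])
    also have "cmod (of_real r * ell_rot t2 * a) = r * cmod a" using r ell_rot(1)[of t2] by (simp add: norm_mult)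
    also have "r * cmod a / (1 - \<tau>) \<le> cmod a / (1 - \<tau>)"
      using r \<tau> by (intro divide_right_mono mult_left_le_one_le) auto
    finally show ?thesis .
  qed
  have m: "cmod (sqz \<tau> (s * (of_real r * u))) = sqrt (real n) * q"
    unfolding s_def sqz_real[of \<tau> "sqrt (real n)"] norm_mult ru by simp
  show "cmod (sqz (2 * cmod t2) (ell_coord n t1 t2 (z + a / of_real (sqrt (real n))))) \<le> sqrt (real n) * q + cmod a / (1 - 2 * cmod t2)"
    unfolding s_def[symmetric] co \<tau>_def[symmetric] sqz_add
    using norm_triangle_ineq[of "sqz \<tau> (s * (of_real r * u))" "sqz \<tau> (of_real r * ell_rot t2 * a)"] m ca by linarith
  show "sqrt (real n) * q - cmod a / (1 - 2 * cmod t2) \<le> cmod (sqz (2 * cmod t2) (ell_coord n t1 t2 (z + a / of_real (sqrt (real n)))))"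
    unfolding s_def[symmetric] co \<tau>_def[symmetric] sqz_add
    using norm_diff_ineq[of "sqz \<tau> (s * (of_real r * u))" "sqz \<tau> (of_real r * ell_rot t2 * a)"] m ca by linarith
qed

section \<open>Limits of the scaled kernel\<close>

text \<open>For each \<open>n\<close> a violating parameter is chosen if there is one, and a fixed
  element of \<open>D\<close> otherwise. Convergence along this one sequence rules out violations
  for all large \<open>n\<close>.\<close>

lemma eventually_ball_of_sequences:
  fixes f :: "nat \<Rightarrow> 'p \<Rightarrow> real"
  assumes seq: "\<And>p. (\<And>n. p n \<in> D) \<Longrightarrow> (\<lambda>n. f n (p n)) \<longlonglongrightarrow> 0" and "0 < \<epsilon>"
  shows "\<forall>\<^sub>F n in sequentially. \<forall>p\<in>D. f n p < \<epsilon>"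
proof (cases "D = {}")
  case False
  then obtain p0 where p0: "p0 \<in> D" by blast
  define p where "p n = (if \<exists>q\<in>D. \<not> f n q < \<epsilon> then (SOME q. q \<in> D \<and> \<not> f n q < \<epsilon>) else p0)" for n
  have p: "p n \<in> D \<and> ((\<exists>q\<in>D. \<not> f n q < \<epsilon>) \<longrightarrow> \<not> f n (p n) < \<epsilon>)" for n
  proof (cases "\<exists>q\<in>D. \<not> f n q < \<epsilon>")
    case True
    then have "\<exists>q. q \<in> D \<and> \<not> f n q < \<epsilon>" by blast
    from someI_ex[OF this] show ?thesis using True by (simp add: p_def)
  qed (simp add: p_def p0)
  have "(\<lambda>n. f n (p n)) \<longlonglongrightarrow> 0" using p by (intro seq) blast
  then have "\<forall>\<^sub>F n in sequentially. f n (p n) < \<epsilon>" using \<open>0 < \<epsilon>\<close> by (rule order_tendstoD)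
  then show ?thesis by eventually_elim (use p in blast)
qed simp

lemma tendsto_ennreal_0I:
  fixes F :: "nat \<Rightarrow> ennreal"
  assumes "\<And>\<epsilon>. 0 < \<epsilon> \<Longrightarrow> \<forall>\<^sub>F n in sequentially. F n \<le> ennreal \<epsilon>"
  shows "F \<longlonglongrightarrow> 0"
proof (rule order_tendstoI)
  fix a :: ennreal assume "0 < a"
  then obtain x where x: "0 < x" "x < a" using dense by blast
  obtain r where r: "x = ennreal r" "0 \<le> r" using x by (cases x) auto
  then have "0 < r" using x by (simp add: ennreal_less_zero_iff)
  from assms[OF this] show "\<forall>\<^sub>F n in sequentially. F n < a"
    by eventually_elim (use x r in \<open>auto intro: le_less_trans\<close>)
qed simp

section \<open>Determinants under scaling and perturbation of the entries\<close>

lemma det_mat: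
  "Determinant.det (Matrix.mat m m (\<lambda>(i, j). f i j))
    = (\<Sum>p\<in>{p. p permutes {0..<m}}. signof p * (\<Prod>i = 0..<m. f i (p i)))"
proof -
  have "Matrix.mat m m (\<lambda>(i, j). f i j) \<in> carrier_mat m m" by simp
  from det_def'[OF this] have "Determinant.det (Matrix.mat m m (\<lambda>(i, j). f i j))
     = (\<Sum>p\<in>{p. p permutes {0..<m}}. signof p * (\<Prod>i = 0..<m. Matrix.mat m m (\<lambda>(i, j). f i j) $$ (i, p i)))" .
  also have "\<dots> = (\<Sum>p\<in>{p. p permutes {0..<m}}. signof p * (\<Prod>i = 0..<m. f i (p i)))"
  proof (intro sum.cong arg_cong2[where f = "(*)"] prod.cong refl)
    fix p i assume "p \<in> {p. p permutes {0..<m}}" "i \<in> {0..<m}"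
    then have "p i < m" using permutes_in_image[of p "{0..<m}" i] by auto
    then show "Matrix.mat m m (\<lambda>(i, j). f i j) $$ (i, p i) = f i (p i)" using \<open>i \<in> {0..<m}\<close> by simp
  qed
  finally show ?thesis .
qed

text \<open>Every index occurs once as a row and once as a column in each product of the Leibniz
  formula, so the factors pair up to \<open>c\<close>. This serves both for extracting powers of
  \<open>n\<close> and for removing phases.\<close>

lemma det_mat_scale:
  fixes f :: "nat \<Rightarrow> nat \<Rightarrow> 'a::comm_ring_1"
  assumes "\<And>i. i < m \<Longrightarrow> u i * v i = c"
  shows "Determinant.det (Matrix.mat m m (\<lambda>(i, j). u i * f i j * v j)) = c ^ m * Determinant.det (Matrix.mat m m (\<lambda>(i, j). f i j))"
proof -
  have "(\<Prod>i = 0..<m. u i * f i (p i) * v (p i)) = c ^ m * (\<Prod>i = 0..<m. f i (p i))" if "p permutes {0..<m}" for p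
  proof -
    have "(\<Prod>i = 0..<m. v (p i)) = (\<Prod>i = 0..<m. v i)"
      using prod.permute[OF that, of v] by (simp add: o_def)
    then have "(\<Prod>i = 0..<m. u i * f i (p i) * v (p i)) = (\<Prod>i = 0..<m. u i * v i) * (\<Prod>i = 0..<m. f i (p i))"
      by (simp add: prod.distrib mult_ac)
    also have "(\<Prod>i = 0..<m. u i * v i) = c ^ m" using assms by simp
    finally show ?thesis .
  qed
  then show ?thesis unfolding det_mat sum_distrib_left
    by (intro sum.cong) (auto simp: mult_ac)
qed

text \<open>Only the comparison family \<open>G\<close> is bounded a priori. Writing each factor as
  \<open>G\<close> plus a difference leaves three terms, each containing a factor that tends to
  0.\<close>

lemma prod_diff_tendsto_0:
  fixes F G :: "nat \<Rightarrow> 'i \<Rightarrow> complex"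
  assumes "finite I" "\<And>i. i \<in> I \<Longrightarrow> (\<lambda>n. F n i - G n i) \<longlonglongrightarrow> 0" "\<And>n i. i \<in> I \<Longrightarrow> cmod (G n i) \<le> B"
  shows "(\<lambda>n. (\<Prod>i\<in>I. F n i) - (\<Prod>i\<in>I. G n i)) \<longlonglongrightarrow> 0"
  using assms
proof (induction I rule: finite_induct)
  case (insert j I)
  have IH: "(\<lambda>n. (\<Prod>i\<in>I. F n i) - (\<Prod>i\<in>I. G n i)) \<longlonglongrightarrow> 0" using insert by auto
  have d: "(\<lambda>n. F n j - G n j) \<longlonglongrightarrow> 0" using insert by auto
  have Pb: "cmod (\<Prod>i\<in>I. G n i) \<le> B ^ card I" for n
    unfolding prod_norm[symmetric] using prod_mono[of I "\<lambda>i. cmod (G n i)" "\<lambda>_. B"] insert.prems(2) by auto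
  have t1: "(\<lambda>n. (F n j - G n j) * ((\<Prod>i\<in>I. F n i) - (\<Prod>i\<in>I. G n i))) \<longlonglongrightarrow> 0"
    using tendsto_mult[OF d IH] by simp
  have t2: "(\<lambda>n. (F n j - G n j) * (\<Prod>i\<in>I. G n i)) \<longlonglongrightarrow> 0"
    by (rule tendsto_0_le[OF d, of _ "B ^ card I"])
      (intro always_eventually allI, unfold norm_mult, intro mult_left_mono Pb norm_ge_zero)
  have t3: "(\<lambda>n. G n j * ((\<Prod>i\<in>I. F n i) - (\<Prod>i\<in>I. G n i))) \<longlonglongrightarrow> 0"
    by (rule tendsto_0_le[OF IH, of _ B])
      (intro always_eventually allI, unfold norm_mult mult.commute[of _ B], intro mult_right_mono norm_ge_zero insert.prems(2) insertI1)
  have "(\<lambda>n. (F n j - G n j) * ((\<Prod>i\<in>I. F n i) - (\<Prod>i\<in>I. G n i)) + (F n j - G n j) * (\<Prod>i\<in>I. G n i)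
      + G n j * ((\<Prod>i\<in>I. F n i) - (\<Prod>i\<in>I. G n i))) \<longlonglongrightarrow> 0 + 0 + 0"
    by (intro tendsto_add t1 t2 t3)
  then show ?case using insert.hyps by (simp add: algebra_simps)
qed simp

lemma det_diff_tendsto_0:
  fixes F G :: "nat \<Rightarrow> nat \<Rightarrow> nat \<Rightarrow> complex"
  assumes "\<And>k l. k < m \<Longrightarrow> l < m \<Longrightarrow> (\<lambda>n. F n k l - G n k l) \<longlonglongrightarrow> 0"
    and "\<And>n k l. k < m \<Longrightarrow> l < m \<Longrightarrow> cmod (G n k l) \<le> B"
  shows "(\<lambda>n. Determinant.det (Matrix.mat m m (\<lambda>(k, l). F n k l)) - Determinant.det (Matrix.mat m m (\<lambda>(k, l). G n k l))) \<longlonglongrightarrow> 0"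
proof -
  have "(\<lambda>n. \<Sum>p\<in>{p. p permutes {0..<m}}. signof p * ((\<Prod>i = 0..<m. F n i (p i)) - (\<Prod>i = 0..<m. G n i (p i)))) \<longlonglongrightarrow>
      (\<Sum>p\<in>{p. p permutes {0..<m}}. signof p * 0)"
  proof (intro tendsto_sum tendsto_mult_left)
    fix p assume "p \<in> {p. p permutes {0..<m}}"
    then have p: "i < m \<Longrightarrow> p i < m" for i using permutes_in_image[of p "{0..<m}" i] by auto
    show "(\<lambda>n. (\<Prod>i = 0..<m. F n i (p i)) - (\<Prod>i = 0..<m. G n i (p i))) \<longlonglongrightarrow> 0"
      by (rule prod_diff_tendsto_0[of _ _ _ B]) (use assms p in auto)
  qed
  then show ?thesis unfolding det_mat by (simp add: right_diff_distrib sum_subtractf)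
qed

section \<open>The kernel on the microscopic scale\<close>

definition skern :: "complex \<Rightarrow> complex \<Rightarrow> nat \<Rightarrow> complex \<Rightarrow> complex \<Rightarrow> complex \<Rightarrow> complex" where
  "skern t1 t2 n z a b = nkern (2 * cmod t2) n
     (cnj (ell_coord n t1 t2 (z + a / of_real (sqrt (real n))))) (ell_coord n t1 t2 (z + b / of_real (sqrt (real n))))"

text \<open>All exponents are quadratic, so scaling by \<open>1 / sqrt n\<close> is exact: for every
  \<open>n \<ge> 1\<close> the phase is \<open>theta\<close> and the Gaussian that of
  \<open>a - b\<close>. The asymptotics lie entirely in \<open>skern\<close>.\<close>

lemma scaled_repr_kernel:
  assumes n: "n \<ge> 1" and t: "2 * cmod t2 < 1"
  shows "1 / of_nat n * repr_kernel (ell_potential t1 t2) n (z + a / of_real (sqrt (real n))) (z + b / of_real (sqrt (real n)))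
    = of_real (1 / pi) * exp (\<i> * of_real (theta n t2 (z - ell_center t1 t2) a b))
      * of_real (exp (- (cmod (a - b))\<^sup>2 / 2)) * skern t1 t2 n z a b"
proof -
  define s where "s = sqrt (real n)"
  have s: "s \<noteq> 0" "s * s = real n" using n by (auto simp: s_def)
  define u where "u = z - ell_center t1 t2"
  have e1: "real n * (cmod ((z + a / of_real s) - (z + b / of_real s)))\<^sup>2 / 2 = (cmod (a - b))\<^sup>2 / 2"
  proof -
    have "(z + a / of_real s) - (z + b / of_real s) = (a - b) / of_real s" by (simp add: diff_divide_distrib)
    then have "cmod ((z + a / of_real s) - (z + b / of_real s)) = cmod (a - b) / s" by (simp add: norm_divide s_def)
    then show ?thesis using s n by (simp add: power_divide power2_eq_square[of s])
  qed
  have phase: "ell_phase n t2 (u + a / of_real s) (u + b / of_real s) = theta n t2 u a b"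
  proof -
    have a1: "Im (cnj (u + a / of_real s) * (u + b / of_real s))
      = (Im (cnj u * b + cnj a * u)) / s + Im (cnj a * b) / (s * s)"
      using s(1) by (simp add: field_simps)
    have a2: "t2 * ((u + b / of_real s)\<^sup>2 - (u + a / of_real s)\<^sup>2) = (2 * t2 * u * (b - a)) / of_real s + t2 * (b\<^sup>2 - a\<^sup>2) / of_real (s * s)"
      using s(1) by (simp add: field_simps power2_eq_square)
    have "ell_phase n t2 (u + a / of_real s) (u + b / of_real s)
      = (s * s) * ((Im (cnj u * b + cnj a * u)) / s + Im (cnj a * b) / (s * s) - (Im (2 * t2 * u * (b - a)) / s + Im (t2 * (b\<^sup>2 - a\<^sup>2)) / (s * s)))"
      unfolding ell_phase_def a1 a2 s(2)[symmetric] plus_complex.sel Im_divide_of_real ..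
    also have "\<dots> = s * (Im (cnj u * b + cnj a * u) - Im (2 * t2 * u * (b - a))) + Im (cnj a * b) - Im (t2 * (b\<^sup>2 - a\<^sup>2))"
      using s(1) by (simp only: right_diff_distrib distrib_left) (simp add: field_simps)
    also have "Im (cnj u * b + cnj a * u) - Im (2 * t2 * u * (b - a)) = Im ((cnj a - cnj b) * (u - 2 * cnj t2 * cnj u))"
      by (simp add: algebra_simps)
    finally show ?thesis unfolding theta_def s_def[symmetric] by (simp add: algebra_simps)
  qed
  have sh: "z + c / of_real s - ell_center t1 t2 = u + c / of_real s" for c by (simp add: u_def)
  have "1 / of_nat n * repr_kernel (ell_potential t1 t2) n (z + a / of_real s) (z + b / of_real s)
    = (1 / of_nat n * of_real (real n / pi)) * exp (\<i> * of_real (theta n t2 u a b)) * of_real (exp (- ((cmod (a - b))\<^sup>2 / 2))) * skern t1 t2 n z a b"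
    unfolding repr_kernel_nkern[OF n t] sh phase e1 skern_def s_def[symmetric] by (simp only: mult.assoc)
  also have "1 / of_nat n * complex_of_real (real n / pi) = of_real (1 / pi)" using n by simp
  finally show ?thesis unfolding u_def s_def by simp
qed

lemma theta_cocycle:
  "theta n t2 u x y = (sqrt (real n) * Im (cnj x * (u - 2 * cnj t2 * cnj u)) + Im (t2 * x\<^sup>2))
     - (sqrt (real n) * Im (cnj y * (u - 2 * cnj t2 * cnj u)) + Im (t2 * y\<^sup>2)) + Im (cnj x * y)"
  unfolding theta_def by (simp add: algebra_simps)

text \<open>The phases \<open>theta\<close> are a coboundary plus \<open>Im (cnj x * y)\<close>, so they drop out of determinants.\<close>

lemma scaled_corr_fun:
  assumes n: "n \<ge> 1" and t: "2 * cmod t2 < 1"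
  shows "1 / of_nat n ^ m * corr_fun (ell_potential t1 t2) n m (\<lambda>j. z + x j / of_real (sqrt (real n)))
    = Determinant.det (Matrix.mat m m (\<lambda>(k, l). of_real (1 / pi) * exp (- of_real ((cmod (x k - x l))\<^sup>2 / 2) + \<i> * of_real (Im (cnj (x k) * x l)))
        * skern t1 t2 n z (x k) (x l)))"
    (is "_ = Determinant.det (Matrix.mat m m (\<lambda>(k, l). ?T k l))")
proof -
  define u where "u = z - ell_center t1 t2"
  define f where "f y = sqrt (real n) * Im (cnj y * (u - 2 * cnj t2 * cnj u)) + Im (t2 * y\<^sup>2)" for y
  let ?K = "\<lambda>k l. repr_kernel (ell_potential t1 t2) n (z + x k / of_real (sqrt (real n))) (z + x l / of_real (sqrt (real n)))"
  have K: "1 / of_nat n * ?K k l * 1 = exp (\<i> * of_real (f (x k))) * ?T k l * exp (- (\<i> * of_real (f (x l))))" for k l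
  proof -
    have "exp (\<i> * of_real (theta n t2 u (x k) (x l))) * of_real (exp (- (cmod (x k - x l))\<^sup>2 / 2))
       = exp (\<i> * of_real (f (x k))) * exp (- of_real ((cmod (x k - x l))\<^sup>2 / 2) + \<i> * of_real (Im (cnj (x k) * x l))) * exp (- (\<i> * of_real (f (x l))))"
      unfolding theta_cocycle f_def[symmetric] exp_of_real[symmetric] exp_add[symmetric] by (simp add: algebra_simps)
    then have "of_real (1 / pi) * (exp (\<i> * of_real (theta n t2 u (x k) (x l))) * of_real (exp (- (cmod (x k - x l))\<^sup>2 / 2))) * skern t1 t2 n z (x k) (x l)
       = exp (\<i> * of_real (f (x k))) * ?T k l * exp (- (\<i> * of_real (f (x l))))"
      by (simp only: mult_ac)
    then show ?thesis unfolding scaled_repr_kernel[OF n t] u_def by (simp only: mult.assoc mult_1_right)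
  qed
  have "1 / of_nat n ^ m * corr_fun (ell_potential t1 t2) n m (\<lambda>j. z + x j / of_real (sqrt (real n)))
    = (1 / of_nat n) ^ m * Determinant.det (Matrix.mat m m (\<lambda>(k, l). ?K k l))"
    by (simp add: corr_fun_def power_one_over)
  also have "\<dots> = Determinant.det (Matrix.mat m m (\<lambda>(k, l). 1 / of_nat n * ?K k l * 1))"
    by (rule det_mat_scale[symmetric]) simp
  also have "\<dots> = Determinant.det (Matrix.mat m m (\<lambda>(k, l). exp (\<i> * of_real (f (x k))) * ?T k l * exp (- (\<i> * of_real (f (x l))))))"
    unfolding K ..
  also have "\<dots> = 1 ^ m * Determinant.det (Matrix.mat m m (\<lambda>(k, l). ?T k l))"
    by (rule det_mat_scale) (simp add: exp_minus)
  finally show ?thesis by simp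
qed

text \<open>The coordinate stretches by \<open>sqrt (n * (1 - \<tau>\<^sup>2))\<close> with \<tau> =
  \<open>2 * cmod t2\<close>, so the Gaussian loss in the kernel bounds depends on
  \<open>b - a\<close> alone.\<close>

lemma skern_norm_factor:
  assumes n: "n \<ge> 1" and t: "2 * cmod t2 < 1"
  shows "(cmod (ell_coord n t1 t2 (z + b / of_real (sqrt (real n))) - ell_coord n t1 t2 (z + a / of_real (sqrt (real n)))))\<^sup>2
     / (2 * (1 - (2 * cmod t2)\<^sup>2)) = (cmod (b - a))\<^sup>2 / 2"
proof -
  define D where "D = 1 - (2 * cmod t2)\<^sup>2"
  have D: "0 < D" using sq_less_one(2)[of "2 * cmod t2"] t by (simp add: D_def)
  have "ell_coord n t1 t2 (z + b / of_real (sqrt (real n))) - ell_coord n t1 t2 (z + a / of_real (sqrt (real n)))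
      = of_real (sqrt D) * ell_rot t2 * (b - a)"
    unfolding ell_coord_def D_def[symmetric] real_sqrt_mult of_real_mult using n by (simp add: field_simps)
  then have "cmod (ell_coord n t1 t2 (z + b / of_real (sqrt (real n))) - ell_coord n t1 t2 (z + a / of_real (sqrt (real n)))) = sqrt D * cmod (b - a)"
    using D ell_rot(1)[of t2] by (simp add: norm_mult)
  then show ?thesis unfolding D_def[symmetric] using D by (simp add: power_mult_distrib)
qed

text \<open>\<open>sqrt (\<delta>0 / (2 - \<delta>0))\<close> is the value of \<open>ell_b\<close>
  at the extreme \<open>2 * cmod t2 = 1 - \<delta>0\<close>, hence its minimum. The semi-axes are
  reciprocal to each other, so the same number controls \<open>ell_a\<close> from above.\<close>

lemma ell_a_le:
  assumes "0 < \<delta>0" "2 * cmod t2 \<le> 1 - \<delta>0"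
  shows "sqrt (\<delta>0 / (2 - \<delta>0)) * ell_a t2 \<le> 1" "sqrt (\<delta>0 / (2 - \<delta>0)) \<le> ell_b t2"
proof -
  have t: "0 \<le> cmod t2" "0 < 1 - 2 * cmod t2" "0 < 2 - \<delta>0" using assms norm_ge_zero[of t2] by linarith+
  have le: "\<delta>0 / (2 - \<delta>0) \<le> (1 - 2 * cmod t2) / (1 + 2 * cmod t2)"
    using assms t by (intro frac_le) (auto intro: add_pos_nonneg)
  then show b: "sqrt (\<delta>0 / (2 - \<delta>0)) \<le> ell_b t2" unfolding ell_b_def by simp
  have "sqrt (\<delta>0 / (2 - \<delta>0)) * ell_a t2 \<le> ell_b t2 * ell_a t2"
    using b t by (intro mult_right_mono) (auto simp: ell_a_def intro!: divide_nonneg_pos add_nonneg_nonneg)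
  also have "ell_b t2 * ell_a t2 = 1"
  proof -
    have "1 + 2 * cmod t2 \<noteq> 0" "1 - 2 * cmod t2 \<noteq> 0" using t by linarith+
    then show ?thesis unfolding ell_a_def ell_b_def real_sqrt_mult[symmetric] by simp
  qed
  finally show "sqrt (\<delta>0 / (2 - \<delta>0)) * ell_a t2 \<le> 1" .
qed

lemma eventually_small_shift:
  assumes "0 < c" "0 \<le> K"
  obtains N where "1 \<le> N" "\<And>n. n \<ge> N \<Longrightarrow> K \<le> sqrt (real n) * c"
proof -
  obtain N where N: "real N \<ge> (K / c)\<^sup>2" using real_arch_simple by blast
  have "K \<le> sqrt (real n) * c" if "n \<ge> max 1 N" for n
  proof -
    have "(K / c)\<^sup>2 \<le> real n" using N that by (auto intro: order_trans)
    then have "K / c \<le> sqrt (real n)" by (rule real_le_rsqrt)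
    then show ?thesis using assms by (simp add: field_simps)
  qed
  then show ?thesis using that[of "max 1 N"] by simp
qed

text \<open>Lowering a semi-axis \<open>x \<le> 1 / \<beta>\<close> by \<delta> shrinks it by the
  relative amount \<open>\<delta> / x \<ge> \<delta> * \<beta> = c\<close>. The point thus has
  elliptic norm at most \<open>1 - c\<close> uniformly in the parameters, and half of this margin is
  spent on the displacement \<open>a / sqrt n\<close>.\<close>

lemma ndens_interior_point:
  assumes \<delta>0: "0 < \<delta>0" "\<delta>0 < 1" and \<delta>: "0 < \<delta>" "\<delta> < sqrt (\<delta>0 / (2 - \<delta>0))" and A: "0 \<le> A"
  obtains C r N where "0 < C" "0 < r" "r < 1" "1 \<le> N"
    "\<And>n t1 t2 z a. n \<ge> N \<Longrightarrow> 2 * cmod t2 \<le> 1 - \<delta>0 \<Longrightarrow> z \<in> ell_shifted t1 t2 (- \<delta>) \<Longrightarrow> cmod a \<le> A \<Longrightarrow>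
       1 - ndens (2 * cmod t2) n (ell_coord n t1 t2 (z + a / of_real (sqrt (real n)))) \<le> C * r ^ n"
proof -
  define \<beta> where "\<beta> = sqrt (\<delta>0 / (2 - \<delta>0))"
  have \<beta>: "0 < \<beta>" "\<beta> \<le> 1" using \<delta>0 by (auto simp: \<beta>_def)
  define c where "c = \<delta> * \<beta>"
  have c: "0 < c" using \<delta> \<beta> by (simp add: c_def)
  have c1: "c < 1"
  proof -
    have "\<delta> * \<beta> \<le> \<delta> * 1" using \<delta> \<beta> by (intro mult_left_mono) auto
    then show ?thesis using \<delta>(2) \<beta>(2) unfolding c_def \<beta>_def by linarith
  qed
  obtain C r where Cr: "0 < C" "0 < r" "r < 1"
    "\<And>\<tau> n X. 0 \<le> \<tau> \<Longrightarrow> \<tau> \<le> 1 - \<delta>0 \<Longrightarrow> ellq \<tau> X \<le> real n * (1 - c / 2)\<^sup>2 \<Longrightarrow> 1 - ndens \<tau> n X \<le> C * r ^ n"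
  proof (rule ndens_interior[of \<delta>0 "(1 - c / 2)\<^sup>2"])
    show "(1 - c / 2)\<^sup>2 < 1" using c c1 by (simp add: power_less_one_iff)
  qed (use \<delta>0 in auto)
  obtain N where N: "1 \<le> N" "\<And>n. n \<ge> N \<Longrightarrow> A / \<delta>0 \<le> sqrt (real n) * (c / 2)"
    using eventually_small_shift[of "c / 2" "A / \<delta>0"] c A \<delta>0 by auto
  have main: "1 - ndens (2 * cmod t2) n (ell_coord n t1 t2 (z + a / of_real (sqrt (real n)))) \<le> C * r ^ n"
    if n: "n \<ge> N" and t: "2 * cmod t2 \<le> 1 - \<delta>0" and z: "z \<in> ell_shifted t1 t2 (- \<delta>)" and a: "cmod a \<le> A" for n t1 t2 z a
  proof -
    have t1: "2 * cmod t2 < 1" and n1: "n \<ge> 1" using t \<delta>0 n N by linarith+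
    note ab = ell_axes[OF t1]
    have \<delta>b: "\<delta> < ell_b t2" using \<delta>(2) ell_a_le(2)[OF \<delta>0(1) t] by linarith
    have \<delta>a: "\<delta> < ell_a t2" using \<delta>b ab by linarith
    define u where "u = ell_rot t2 * (z - ell_center t1 t2)"
    have in1: "(Re u)\<^sup>2 / (ell_a t2 - \<delta>)\<^sup>2 + (Im u)\<^sup>2 / (ell_b t2 - \<delta>)\<^sup>2 < 1"
      using z ell_shifted_iff[OF t1, of "- \<delta>" z t1] \<delta>b by (simp add: u_def)
    have scale: "y / x\<^sup>2 \<le> y / (x - \<delta>)\<^sup>2 * (1 - c)\<^sup>2" if "\<delta> < x" "\<beta> * x \<le> 1" "0 \<le> y" for x y
    proof -
      have "c * x \<le> \<delta>" using mult_left_mono[OF that(2), of \<delta>] \<delta> by (simp add: c_def mult.assoc)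
      then have "x - \<delta> \<le> (1 - c) * x" by (simp add: algebra_simps)
      then have "(x - \<delta>)\<^sup>2 \<le> ((1 - c) * x)\<^sup>2" using that by (intro power_mono) auto
      then have "y * (x - \<delta>)\<^sup>2 \<le> y * ((1 - c) * x)\<^sup>2" using that by (intro mult_left_mono)
      moreover have "y / p \<le> y / q * k" if "y * q \<le> y * (k * p)" "0 < p" "0 < q" for p q k :: real
        using that by (simp add: divide_simps mult_ac)
      ultimately show ?thesis using that \<delta> by (simp add: power_mult_distrib)
    qed
    have "\<beta> * ell_a t2 \<le> 1" unfolding \<beta>_def by (rule ell_a_le[OF \<delta>0(1) t])
    moreover from this have "\<beta> * ell_b t2 \<le> 1"
      using ab \<beta> mult_left_mono[of "ell_b t2" "ell_a t2" \<beta>] by linarith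
    ultimately have "(Re u)\<^sup>2 / (ell_a t2)\<^sup>2 + (Im u)\<^sup>2 / (ell_b t2)\<^sup>2
       \<le> (Re u)\<^sup>2 / (ell_a t2 - \<delta>)\<^sup>2 * (1 - c)\<^sup>2 + (Im u)\<^sup>2 / (ell_b t2 - \<delta>)\<^sup>2 * (1 - c)\<^sup>2"
      using \<delta>a \<delta>b by (intro add_mono scale) auto
    also have "\<dots> = ((Re u)\<^sup>2 / (ell_a t2 - \<delta>)\<^sup>2 + (Im u)\<^sup>2 / (ell_b t2 - \<delta>)\<^sup>2) * (1 - c)\<^sup>2" by (simp add: distrib_right)
    also have "\<dots> \<le> 1 * (1 - c)\<^sup>2" using in1 by (intro mult_right_mono) auto
    finally have q: "sqrt ((Re u)\<^sup>2 / (ell_a t2)\<^sup>2 + (Im u)\<^sup>2 / (ell_b t2)\<^sup>2) \<le> 1 - c"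
      using c1 by (intro real_le_lsqrt) auto
    define X where "X = ell_coord n t1 t2 (z + a / of_real (sqrt (real n)))"
    have "cmod a / (1 - 2 * cmod t2) \<le> A / \<delta>0" using a t \<delta>0 A by (intro frac_le) auto
    also have "\<dots> \<le> sqrt (real n) * (c / 2)" by (rule N(2)[OF n])
    finally have "cmod (sqz (2 * cmod t2) X) \<le> sqrt (real n) * (1 - c) + sqrt (real n) * (c / 2)"
      using cmod_sqz_coord(1)[OF n1 t1, where ?t1.0 = t1 and z = z and a = a] mult_left_mono[OF q real_sqrt_ge_zero[OF of_nat_0_le_iff[of n]]]
      unfolding u_def X_def by linarith
    also have "\<dots> = sqrt (real n) * (1 - c / 2)" by (simp add: algebra_simps)
    finally have "(cmod (sqz (2 * cmod t2) X))\<^sup>2 \<le> (sqrt (real n) * (1 - c / 2))\<^sup>2" by (intro power_mono) auto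
    then have "ellq (2 * cmod t2) X \<le> real n * (1 - c / 2)\<^sup>2" unfolding ellq_sqz by (simp add: power_mult_distrib)
    then show ?thesis unfolding X_def[symmetric] using t by (intro Cr(4)) auto
  qed
  show ?thesis using that[OF Cr(1-3) N(1)] main by blast
qed

text \<open>Raising a semi-axis by \<delta> enlarges it by a factor of at least
  \<open>1 + c\<close>; again half of the margin pays for the displacement
  \<open>a / sqrt n\<close>.\<close>

lemma ndens_exterior_point:
  assumes \<delta>0: "0 < \<delta>0" "\<delta>0 < 1" and \<delta>: "0 < \<delta>" and A: "0 \<le> A"
  obtains r N where "0 < r" "r < 1" "1 \<le> N"
    "\<And>n t1 t2 z a. n \<ge> N \<Longrightarrow> 2 * cmod t2 \<le> 1 - \<delta>0 \<Longrightarrow> z \<notin> ell_shifted t1 t2 \<delta> \<Longrightarrow> cmod a \<le> A \<Longrightarrow>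
       ndens (2 * cmod t2) n (ell_coord n t1 t2 (z + a / of_real (sqrt (real n)))) \<le> r ^ n"
proof -
  define \<beta> where "\<beta> = sqrt (\<delta>0 / (2 - \<delta>0))"
  have \<beta>: "0 < \<beta>" using \<delta>0 by (auto simp: \<beta>_def)
  define c where "c = \<delta> * \<beta>"
  have c: "0 < c" using \<delta> \<beta> by (simp add: c_def)
  obtain r where r: "0 < r" "r < 1"
    "\<And>\<tau> n X. 0 \<le> \<tau> \<Longrightarrow> \<tau> \<le> 1 - \<delta>0 \<Longrightarrow> real n * (1 + c / 2)\<^sup>2 \<le> ellq \<tau> X \<Longrightarrow> ndens \<tau> n X \<le> r ^ n"
  proof (rule ndens_exterior[of \<delta>0 "(1 + c / 2)\<^sup>2"])
    show "1 < (1 + c / 2)\<^sup>2" using c by (simp add: one_less_power)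
  qed (use \<delta>0 in auto)
  obtain N where N: "1 \<le> N" "\<And>n. n \<ge> N \<Longrightarrow> A / \<delta>0 \<le> sqrt (real n) * (c / 2)"
    using eventually_small_shift[of "c / 2" "A / \<delta>0"] c A \<delta>0 by auto
  have main: "ndens (2 * cmod t2) n (ell_coord n t1 t2 (z + a / of_real (sqrt (real n)))) \<le> r ^ n"
    if n: "n \<ge> N" and t: "2 * cmod t2 \<le> 1 - \<delta>0" and z: "z \<notin> ell_shifted t1 t2 \<delta>" and a: "cmod a \<le> A" for n t1 t2 z a
  proof -
    have t1: "2 * cmod t2 < 1" and n1: "n \<ge> 1" using t \<delta>0 n N by linarith+
    note ab = ell_axes[OF t1]
    define u where "u = ell_rot t2 * (z - ell_center t1 t2)"
    have out1: "1 \<le> (Re u)\<^sup>2 / (ell_a t2 + \<delta>)\<^sup>2 + (Im u)\<^sup>2 / (ell_b t2 + \<delta>)\<^sup>2"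
      using z ell_shifted_iff[OF t1, of \<delta> z t1] \<delta> ab by (simp add: u_def)
    have scale: "y / (x + \<delta>)\<^sup>2 * (1 + c)\<^sup>2 \<le> y / x\<^sup>2" if "0 < x" "\<beta> * x \<le> 1" "0 \<le> y" for x y
    proof -
      have "c * x \<le> \<delta>" using mult_left_mono[OF that(2), of \<delta>] \<delta> by (simp add: c_def mult.assoc)
      then have "(1 + c) * x \<le> x + \<delta>" by (simp add: algebra_simps)
      then have "((1 + c) * x)\<^sup>2 \<le> (x + \<delta>)\<^sup>2" using that c by (intro power_mono) auto
      then have "y * ((1 + c) * x)\<^sup>2 \<le> y * (x + \<delta>)\<^sup>2" using that by (intro mult_left_mono)
      then show ?thesis using that \<delta> by (simp add: divide_simps power_mult_distrib mult_ac)
    qed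
    have "\<beta> * ell_a t2 \<le> 1" unfolding \<beta>_def by (rule ell_a_le[OF \<delta>0(1) t])
    moreover from this have "\<beta> * ell_b t2 \<le> 1"
      using ab \<beta> mult_left_mono[of "ell_b t2" "ell_a t2" \<beta>] by linarith
    ultimately have le: "(Re u)\<^sup>2 / (ell_a t2 + \<delta>)\<^sup>2 * (1 + c)\<^sup>2 + (Im u)\<^sup>2 / (ell_b t2 + \<delta>)\<^sup>2 * (1 + c)\<^sup>2
       \<le> (Re u)\<^sup>2 / (ell_a t2)\<^sup>2 + (Im u)\<^sup>2 / (ell_b t2)\<^sup>2"
      using ab by (intro add_mono scale) auto
    have "1 * (1 + c)\<^sup>2 \<le> ((Re u)\<^sup>2 / (ell_a t2 + \<delta>)\<^sup>2 + (Im u)\<^sup>2 / (ell_b t2 + \<delta>)\<^sup>2) * (1 + c)\<^sup>2"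
      using out1 by (intro mult_right_mono) auto
    also have "\<dots> \<le> (Re u)\<^sup>2 / (ell_a t2)\<^sup>2 + (Im u)\<^sup>2 / (ell_b t2)\<^sup>2" using le by (simp add: distrib_right)
    finally have q: "1 + c \<le> sqrt ((Re u)\<^sup>2 / (ell_a t2)\<^sup>2 + (Im u)\<^sup>2 / (ell_b t2)\<^sup>2)"
      by (intro real_le_rsqrt) simp
    define X where "X = ell_coord n t1 t2 (z + a / of_real (sqrt (real n)))"
    have "cmod a / (1 - 2 * cmod t2) \<le> A / \<delta>0" using a t \<delta>0 A by (intro frac_le) auto
    also have "\<dots> \<le> sqrt (real n) * (c / 2)" by (rule N(2)[OF n])
    finally have "sqrt (real n) * (1 + c) - sqrt (real n) * (c / 2) \<le> cmod (sqz (2 * cmod t2) X)"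
      using cmod_sqz_coord(2)[OF n1 t1, where ?t1.0 = t1 and z = z and a = a] mult_left_mono[OF q real_sqrt_ge_zero[OF of_nat_0_le_iff[of n]]]
      unfolding u_def X_def by linarith
    then have "sqrt (real n) * (1 + c / 2) \<le> cmod (sqz (2 * cmod t2) X)" by (simp add: algebra_simps)
    then have "(sqrt (real n) * (1 + c / 2))\<^sup>2 \<le> (cmod (sqz (2 * cmod t2) X))\<^sup>2" using c by (intro power_mono) auto
    then have "real n * (1 + c / 2)\<^sup>2 \<le> ellq (2 * cmod t2) X" unfolding ellq_sqz by (simp add: power_mult_distrib)
    then show ?thesis unfolding X_def[symmetric] using t by (intro r(3)) auto
  qed
  show ?thesis using that[OF r(1,2) N(1)] main by blast
qed

lemma cmod_diff_sq_le:
  assumes "cmod a \<le> A" "cmod b \<le> A"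
  shows "(cmod (b - a))\<^sup>2 / 2 \<le> 2 * A\<^sup>2"
proof -
  have "cmod (b - a) \<le> 2 * A" using norm_triangle_ineq4[of b a] assms by linarith
  then have "(cmod (b - a))\<^sup>2 \<le> (2 * A)\<^sup>2" by (intro power_mono) auto
  then show ?thesis by (simp add: power_mult_distrib)
qed

text \<open>The geometric mean of two exponentially small tails is exponentially small. Undoing the
  Gaussian loss costs at most \<open>exp (2 * A\<^sup>2)\<close>, because
  \<open>cmod (b - a) \<le> 2 * A\<close>.\<close>

lemma skern_interior:
  assumes \<delta>0: "0 < \<delta>0" "\<delta>0 < 1" and \<delta>: "0 < \<delta>" "\<delta> < sqrt (\<delta>0 / (2 - \<delta>0))" and A: "0 \<le> A"
    and t: "\<And>n. 2 * cmod (t2 n) \<le> 1 - \<delta>0" and z: "\<And>n. z n \<in> ell_shifted (t1 n) (t2 n) (- \<delta>)"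
    and ab: "\<And>n. cmod (a n) \<le> A" "\<And>n. cmod (b n) \<le> A"
  shows "(\<lambda>n. skern (t1 n) (t2 n) n (z n) (a n) (b n) - 1) \<longlonglongrightarrow> 0"
proof -
  obtain C r N where C: "0 < C" "0 < r" "r < 1" "1 \<le> N"
    "\<And>n t1 t2 z a. n \<ge> N \<Longrightarrow> 2 * cmod t2 \<le> 1 - \<delta>0 \<Longrightarrow> z \<in> ell_shifted t1 t2 (- \<delta>) \<Longrightarrow> cmod a \<le> A \<Longrightarrow>
       1 - ndens (2 * cmod t2) n (ell_coord n t1 t2 (z + a / of_real (sqrt (real n)))) \<le> C * r ^ n"
    using ndens_interior_point[OF \<delta>0 \<delta> A] by blast
  have "(\<lambda>n. r ^ n) \<longlonglongrightarrow> 0" using C by (intro LIMSEQ_power_zero) auto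
  then show ?thesis
  proof (rule tendsto_0_le[where K = "exp (2 * A\<^sup>2) * C"])
    show "\<forall>\<^sub>F n in sequentially. cmod (skern (t1 n) (t2 n) n (z n) (a n) (b n) - 1) \<le> norm (r ^ n) * (exp (2 * A\<^sup>2) * C)"
      using eventually_ge_at_top[of N]
    proof eventually_elim
      case (elim n)
      have n1: "n \<ge> 1" and t1: "2 * cmod (t2 n) < 1" using elim C t[of n] \<delta>0 by linarith+
      define X where "X c = ell_coord n (t1 n) (t2 n) (z n + c / of_real (sqrt (real n)))" for c
      have d: "1 - ndens (2 * cmod (t2 n)) n (X c) \<le> C * r ^ n" if "cmod c \<le> A" for c
        unfolding X_def by (rule C(5)[OF elim t z that])
      have d0: "0 \<le> 1 - ndens (2 * cmod (t2 n)) n (X c)" for c using ndens_range(2)[OF _ t1, of n "X c"] by simp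
      have ef: "- (cmod (X (b n) - X (a n)))\<^sup>2 / (2 * (1 - (2 * cmod (t2 n))\<^sup>2)) = - ((cmod (b n - a n))\<^sup>2 / 2)"
        unfolding minus_divide_left[symmetric] X_def skern_norm_factor[OF n1 t1] ..
      have "exp (- (cmod (X (b n) - X (a n)))\<^sup>2 / (2 * (1 - (2 * cmod (t2 n))\<^sup>2))) * cmod (skern (t1 n) (t2 n) n (z n) (a n) (b n) - 1)
         \<le> sqrt ((1 - ndens (2 * cmod (t2 n)) n (X (a n))) * (1 - ndens (2 * cmod (t2 n)) n (X (b n))))"
        unfolding skern_def X_def by (rule one_minus_nkern_bound[OF _ t1]) simp
      also have "\<dots> \<le> sqrt ((C * r ^ n) * (C * r ^ n))"
        using d[OF ab(1)] d[OF ab(2)] d0 C by (intro real_sqrt_le_mono mult_mono) auto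
      also have "\<dots> = C * r ^ n" using C by simp
      finally have "exp (- ((cmod (b n - a n))\<^sup>2 / 2)) * cmod (skern (t1 n) (t2 n) n (z n) (a n) (b n) - 1) \<le> C * r ^ n" unfolding ef .
      then have "cmod (skern (t1 n) (t2 n) n (z n) (a n) (b n) - 1) \<le> exp ((cmod (b n - a n))\<^sup>2 / 2) * (C * r ^ n)"
        by (simp add: exp_minus field_simps)
      also have "\<dots> \<le> exp (2 * A\<^sup>2) * (C * r ^ n)"
        using cmod_diff_sq_le[OF ab] C by (intro mult_right_mono) auto
      finally show ?case using C by (simp add: mult_ac)
    qed
  qed
qed

lemma skern_exterior:
  assumes \<delta>0: "0 < \<delta>0" "\<delta>0 < 1" and \<delta>: "0 < \<delta>" and A: "0 \<le> A"
    and t: "\<And>n. 2 * cmod (t2 n) \<le> 1 - \<delta>0" and z: "\<And>n. z n \<notin> ell_shifted (t1 n) (t2 n) \<delta>"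
    and ab: "\<And>n. cmod (a n) \<le> A" "\<And>n. cmod (b n) \<le> A"
  shows "(\<lambda>n. skern (t1 n) (t2 n) n (z n) (a n) (b n)) \<longlonglongrightarrow> 0"
proof -
  obtain r N where C: "0 < r" "r < 1" "1 \<le> N"
    "\<And>n t1 t2 z a. n \<ge> N \<Longrightarrow> 2 * cmod t2 \<le> 1 - \<delta>0 \<Longrightarrow> z \<notin> ell_shifted t1 t2 \<delta> \<Longrightarrow> cmod a \<le> A \<Longrightarrow>
       ndens (2 * cmod t2) n (ell_coord n t1 t2 (z + a / of_real (sqrt (real n)))) \<le> r ^ n"
    using ndens_exterior_point[OF \<delta>0 \<delta> A] by blast
  have "(\<lambda>n. r ^ n) \<longlonglongrightarrow> 0" using C by (intro LIMSEQ_power_zero) auto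
  then show ?thesis
  proof (rule tendsto_0_le[where K = "exp (2 * A\<^sup>2)"])
    show "\<forall>\<^sub>F n in sequentially. cmod (skern (t1 n) (t2 n) n (z n) (a n) (b n)) \<le> norm (r ^ n) * exp (2 * A\<^sup>2)"
      using eventually_ge_at_top[of N]
    proof eventually_elim
      case (elim n)
      have n1: "n \<ge> 1" and t1: "2 * cmod (t2 n) < 1" using elim C t[of n] \<delta>0 by linarith+
      define X where "X c = ell_coord n (t1 n) (t2 n) (z n + c / of_real (sqrt (real n)))" for c
      have d: "ndens (2 * cmod (t2 n)) n (X c) \<le> r ^ n" if "cmod c \<le> A" for c
        unfolding X_def by (rule C(4)[OF elim t z that])
      have d0: "0 \<le> ndens (2 * cmod (t2 n)) n (X c)" for c using ndens_range(1)[OF _ t1, of n "X c"] by simp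
      have ef: "- (cmod (X (b n) - X (a n)))\<^sup>2 / (2 * (1 - (2 * cmod (t2 n))\<^sup>2)) = - ((cmod (b n - a n))\<^sup>2 / 2)"
        unfolding minus_divide_left[symmetric] X_def skern_norm_factor[OF n1 t1] ..
      have "exp (- (cmod (X (b n) - X (a n)))\<^sup>2 / (2 * (1 - (2 * cmod (t2 n))\<^sup>2))) * cmod (skern (t1 n) (t2 n) n (z n) (a n) (b n))
         \<le> sqrt (ndens (2 * cmod (t2 n)) n (X (a n)) * ndens (2 * cmod (t2 n)) n (X (b n)))"
        unfolding skern_def X_def by (rule nkern_bound[OF _ t1]) simp
      also have "\<dots> \<le> sqrt (r ^ n * r ^ n)"
        using d[OF ab(1)] d[OF ab(2)] d0 C by (intro real_sqrt_le_mono mult_mono) auto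
      also have "\<dots> = r ^ n" using C by simp
      finally have "exp (- ((cmod (b n - a n))\<^sup>2 / 2)) * cmod (skern (t1 n) (t2 n) n (z n) (a n) (b n)) \<le> r ^ n" unfolding ef .
      then have "cmod (skern (t1 n) (t2 n) n (z n) (a n) (b n)) \<le> exp ((cmod (b n - a n))\<^sup>2 / 2) * r ^ n"
        by (simp add: exp_minus field_simps)
      also have "\<dots> \<le> exp (2 * A\<^sup>2) * r ^ n"
        using cmod_diff_sq_le[OF ab] C by (intro mult_right_mono) auto
      finally show ?case using C by (simp add: mult_ac)
    qed
  qed
qed

lemma skern_boundary:
  fixes t1 t2 z a b :: "nat \<Rightarrow> complex"
  defines "e \<equiv> \<lambda>n. exp (\<i> * of_real (ell_psi (t1 n) (t2 n) (z n)))"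
  assumes \<delta>0: "0 < \<delta>0"
    and t: "\<And>n. 2 * cmod (t2 n) \<le> 1 - \<delta>0" and z: "\<And>n. z n \<in> ell_boundary (t1 n) (t2 n)"
    and ab: "\<And>n. cmod (a n) \<le> A" "\<And>n. cmod (b n) \<le> A"
  shows "(\<lambda>n. skern (t1 n) (t2 n) n (z n) (a n * e n) (b n * e n) - erfc ((cnj (a n) + b n) / of_real (sqrt 2)) / 2) \<longlonglongrightarrow> 0"
proof -
  have "(\<lambda>n. nkern (2 * cmod (t2 n)) n (cnj (bnd_coord n (2 * cmod (t2 n)) (ell_phi (t1 n) (t2 n) (z n)) (a n)))
      (bnd_coord n (2 * cmod (t2 n)) (ell_phi (t1 n) (t2 n) (z n)) (b n)) - erfc ((cnj (a n) + b n) / of_real (sqrt 2)) / 2) \<longlonglongrightarrow> 0"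
    by (rule nkern_boundary[OF \<delta>0 _ t ab]) simp
  \<comment> \<open>The identification of the coordinates divides by \<open>sqrt n\<close>, hence an
    equality for \<open>n \<ge> 1\<close> only.\<close>
  moreover have "\<forall>\<^sub>F n in sequentially. nkern (2 * cmod (t2 n)) n (cnj (bnd_coord n (2 * cmod (t2 n)) (ell_phi (t1 n) (t2 n) (z n)) (a n)))
      (bnd_coord n (2 * cmod (t2 n)) (ell_phi (t1 n) (t2 n) (z n)) (b n)) - erfc ((cnj (a n) + b n) / of_real (sqrt 2)) / 2
     = skern (t1 n) (t2 n) n (z n) (a n * e n) (b n * e n) - erfc ((cnj (a n) + b n) / of_real (sqrt 2)) / 2"
    using eventually_ge_at_top[of 1]
  proof eventually_elim
    case (elim n)
    have "2 * cmod (t2 n) < 1" using t[of n] \<delta>0 by linarith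
    then show ?case unfolding skern_def e_def using ell_coord_boundary[OF elim _ z] by simp
  qed
  ultimately show ?thesis by (rule Lim_transform_eventually)
qed

text \<open>One argument for the three regimes: \<open>e\<close> is the frame (1 or the normal
  direction) and \<open>L\<close> the limit of \<open>skern\<close>. The factor in front of
  \<open>skern\<close> has modulus at most 1, and a unimodular frame preserves
  \<open>cmod (a - b)\<close>, so the convergence carries over without loss.\<close>

lemma kernel_uniform_limit:
  fixes D :: "(complex \<times> complex \<times> complex) set" and L :: "complex \<Rightarrow> complex \<Rightarrow> complex"
    and e :: "complex \<Rightarrow> complex \<Rightarrow> complex \<Rightarrow> complex"
  assumes D: "\<And>t1 t2 z. (t1, t2, z) \<in> D \<Longrightarrow> 2 * cmod t2 < 1"
    and e: "\<And>t1 t2 z. cmod (e t1 t2 z) = 1"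
    and core: "\<And>t1 t2 z a b. (\<And>n. (t1 n, t2 n, z n) \<in> D) \<Longrightarrow> (\<And>n. cmod (a n) \<le> A) \<Longrightarrow> (\<And>n. cmod (b n) \<le> A) \<Longrightarrow>
      (\<lambda>n. skern (t1 n) (t2 n) n (z n) (a n * e (t1 n) (t2 n) (z n)) (b n * e (t1 n) (t2 n) (z n)) - L (a n) (b n)) \<longlonglongrightarrow> 0"
    and "0 < \<epsilon>"
  shows "\<forall>\<^sub>F n in sequentially. \<forall>t1 t2 z a b. (t1, t2, z) \<in> D \<longrightarrow> cmod a \<le> A \<longrightarrow> cmod b \<le> A \<longrightarrow>
    cmod (1 / of_nat n * repr_kernel (ell_potential t1 t2) n
         (z + a * e t1 t2 z / of_real (sqrt (real n))) (z + b * e t1 t2 z / of_real (sqrt (real n)))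
       - of_real (1 / pi) * exp (\<i> * of_real (theta n t2 (z - ell_center t1 t2) (a * e t1 t2 z) (b * e t1 t2 z)))
           * of_real (exp (- (cmod (a - b))\<^sup>2 / 2)) * L a b) \<le> \<epsilon>"
proof -
  let ?S = "{(t1, t2, z, a, b). (t1, t2, z) \<in> D \<and> cmod a \<le> A \<and> cmod b \<le> A}"
  have "\<forall>\<^sub>F n in sequentially. \<forall>p\<in>?S. (\<lambda>(t1, t2, z, a, b). cmod (skern t1 t2 n z (a * e t1 t2 z) (b * e t1 t2 z) - L a b)) p < \<epsilon>"
  proof (rule eventually_ball_of_sequences[OF _ \<open>0 < \<epsilon>\<close>])
    fix p :: "nat \<Rightarrow> complex \<times> complex \<times> complex \<times> complex \<times> complex"
    assume p: "\<And>n. p n \<in> ?S"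
    define t1 where "t1 n = fst (p n)" for n
    define t2 where "t2 n = fst (snd (p n))" for n
    define z where "z n = fst (snd (snd (p n)))" for n
    define a where "a n = fst (snd (snd (snd (p n))))" for n
    define b where "b n = snd (snd (snd (snd (p n))))" for n
    have pn: "p n = (t1 n, t2 n, z n, a n, b n)" for n by (simp add: t1_def t2_def z_def a_def b_def)
    have "(\<lambda>n. skern (t1 n) (t2 n) n (z n) (a n * e (t1 n) (t2 n) (z n)) (b n * e (t1 n) (t2 n) (z n)) - L (a n) (b n)) \<longlonglongrightarrow> 0"
      by (rule core) (use p in \<open>auto simp: pn\<close>)
    then show "(\<lambda>n. case p n of (t1, t2, z, a, b) \<Rightarrow> cmod (skern t1 t2 n z (a * e t1 t2 z) (b * e t1 t2 z) - L a b)) \<longlonglongrightarrow> 0"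
      unfolding pn by (simp add: tendsto_norm_zero)
  qed
  then show ?thesis using eventually_ge_at_top[of 1]
  proof eventually_elim
    case (elim n)
    show ?case
    proof (intro allI impI)
      fix t1 t2 z a b
      assume tz: "(t1, t2, z) \<in> D" and ab: "cmod a \<le> A" "cmod b \<le> A"
      let ?e = "e t1 t2 z"
      define E where "E = of_real (1 / pi) * exp (\<i> * of_real (theta n t2 (z - ell_center t1 t2) (a * ?e) (b * ?e)))
           * of_real (exp (- (cmod (a - b))\<^sup>2 / 2))"
      have lt: "cmod (skern t1 t2 n z (a * ?e) (b * ?e) - L a b) < \<epsilon>" using elim(1) tz ab by auto
      have ae: "cmod (a * ?e - b * ?e) = cmod (a - b)"
        using e[of t1 t2 z] by (simp add: left_diff_distrib[symmetric] norm_mult)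
      have "cmod E = 1 / pi * exp (- (cmod (a - b))\<^sup>2 / 2)" unfolding E_def norm_mult norm_exp_eq_Re norm_of_real by simp
      also have "\<dots> \<le> 1 * 1" using pi_gt3 by (intro mult_mono) auto
      finally have E: "cmod E \<le> 1" by simp
      have "cmod (E * skern t1 t2 n z (a * ?e) (b * ?e) - E * L a b) = cmod E * cmod (skern t1 t2 n z (a * ?e) (b * ?e) - L a b)"
        by (simp add: right_diff_distrib[symmetric] norm_mult)
      also have "\<dots> \<le> 1 * \<epsilon>" using E lt by (intro mult_mono) auto
      finally show "cmod (1 / of_nat n * repr_kernel (ell_potential t1 t2) n
         (z + a * ?e / of_real (sqrt (real n))) (z + b * ?e / of_real (sqrt (real n)))
       - of_real (1 / pi) * exp (\<i> * of_real (theta n t2 (z - ell_center t1 t2) (a * ?e) (b * ?e)))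
           * of_real (exp (- (cmod (a - b))\<^sup>2 / 2)) * L a b) \<le> \<epsilon>"
        unfolding scaled_repr_kernel[OF elim(2) D[OF tz]] ae E_def by simp
    qed
  qed
qed

text \<open>Unlike for the kernel, products of entries are compared here, which calls for the a
  priori bound \<open>B\<close> on the limit.\<close>

lemma corr_fun_uniform_limit:
  fixes D :: "(complex \<times> complex \<times> complex) set" and L :: "complex \<Rightarrow> complex \<Rightarrow> complex"
    and e :: "complex \<Rightarrow> complex \<Rightarrow> complex \<Rightarrow> complex"
  assumes D: "\<And>t1 t2 z. (t1, t2, z) \<in> D \<Longrightarrow> 2 * cmod t2 < 1"
    and e: "\<And>t1 t2 z. cmod (e t1 t2 z) = 1"
    and core: "\<And>t1 t2 z a b. (\<And>n. (t1 n, t2 n, z n) \<in> D) \<Longrightarrow> (\<And>n. cmod (a n) \<le> A) \<Longrightarrow> (\<And>n. cmod (b n) \<le> A) \<Longrightarrow>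
      (\<lambda>n. skern (t1 n) (t2 n) n (z n) (a n * e (t1 n) (t2 n) (z n)) (b n * e (t1 n) (t2 n) (z n)) - L (a n) (b n)) \<longlonglongrightarrow> 0"
    and L: "\<And>a b. cmod a \<le> A \<Longrightarrow> cmod b \<le> A \<Longrightarrow> cmod (L a b) \<le> B"
    and "0 < \<epsilon>"
  shows "\<forall>\<^sub>F n in sequentially. \<forall>t1 t2 z a. (t1, t2, z) \<in> D \<longrightarrow> a \<in> {..<m} \<rightarrow> cball 0 A \<longrightarrow>
    cmod (1 / of_nat n ^ m * corr_fun (ell_potential t1 t2) n m (\<lambda>j. z + a j * e t1 t2 z / of_real (sqrt (real n)))
       - Determinant.det (Matrix.mat m m (\<lambda>(k, l). of_real (1 / pi) * exp (- of_real ((cmod (a k - a l))\<^sup>2 / 2) + \<i> * of_real (Im (cnj (a k) * a l)))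
           * L (a k) (a l)))) \<le> \<epsilon>"
proof -
  let ?S = "{(t1, t2, z, a). (t1, t2, z) \<in> D \<and> a \<in> {..<m} \<rightarrow> cball 0 A}"
  define G where "G x y = of_real (1 / pi) * exp (- of_real ((cmod (x - y))\<^sup>2 / 2) + \<i> * of_real (Im (cnj x * y)))" for x y
  have G1: "cmod (G x y) \<le> 1" for x y
  proof -
    have "cmod (G x y) = 1 / pi * exp (- ((cmod (x - y))\<^sup>2 / 2))" unfolding G_def norm_mult norm_exp_eq_Re norm_of_real by simp
    also have "\<dots> \<le> 1 * 1" using pi_gt3 by (intro mult_mono) auto
    finally show ?thesis by simp
  qed
  have "\<forall>\<^sub>F n in sequentially. \<forall>p\<in>?S. (\<lambda>(t1, t2, z, a). cmod (
      Determinant.det (Matrix.mat m m (\<lambda>(k, l). G (a k) (a l) * skern t1 t2 n z (a k * e t1 t2 z) (a l * e t1 t2 z)))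
      - Determinant.det (Matrix.mat m m (\<lambda>(k, l). G (a k) (a l) * L (a k) (a l))))) p < \<epsilon>"
  proof (rule eventually_ball_of_sequences[OF _ \<open>0 < \<epsilon>\<close>])
    fix p :: "nat \<Rightarrow> complex \<times> complex \<times> complex \<times> (nat \<Rightarrow> complex)"
    assume p: "\<And>n. p n \<in> ?S"
    define t1 where "t1 n = fst (p n)" for n
    define t2 where "t2 n = fst (snd (p n))" for n
    define z where "z n = fst (snd (snd (p n)))" for n
    define a where "a n = snd (snd (snd (p n)))" for n
    have pn: "p n = (t1 n, t2 n, z n, a n)" for n by (simp add: t1_def t2_def z_def a_def)
    have tz: "(t1 n, t2 n, z n) \<in> D" for n using p[of n] by (simp add: pn)
    have a: "cmod (a n k) \<le> A" if "k < m" for n k using p[of n] that by (auto simp: pn Pi_iff)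
    have "(\<lambda>n. Determinant.det (Matrix.mat m m (\<lambda>(k, l). G (a n k) (a n l) * skern (t1 n) (t2 n) n (z n) (a n k * e (t1 n) (t2 n) (z n)) (a n l * e (t1 n) (t2 n) (z n))))
      - Determinant.det (Matrix.mat m m (\<lambda>(k, l). G (a n k) (a n l) * L (a n k) (a n l)))) \<longlonglongrightarrow> 0"
    proof (rule det_diff_tendsto_0)
      fix k l assume kl: "k < m" "l < m"
      have lim: "(\<lambda>n. skern (t1 n) (t2 n) n (z n) (a n k * e (t1 n) (t2 n) (z n)) (a n l * e (t1 n) (t2 n) (z n)) - L (a n k) (a n l)) \<longlonglongrightarrow> 0"
        by (rule core[OF tz a[OF kl(1)] a[OF kl(2)]])
      show "(\<lambda>n. G (a n k) (a n l) * skern (t1 n) (t2 n) n (z n) (a n k * e (t1 n) (t2 n) (z n)) (a n l * e (t1 n) (t2 n) (z n))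
          - G (a n k) (a n l) * L (a n k) (a n l)) \<longlonglongrightarrow> 0"
      proof (rule tendsto_0_le[OF lim, of _ 1], intro always_eventually allI)
        fix n
        show "cmod (G (a n k) (a n l) * skern (t1 n) (t2 n) n (z n) (a n k * e (t1 n) (t2 n) (z n)) (a n l * e (t1 n) (t2 n) (z n))
          - G (a n k) (a n l) * L (a n k) (a n l))
          \<le> cmod (skern (t1 n) (t2 n) n (z n) (a n k * e (t1 n) (t2 n) (z n)) (a n l * e (t1 n) (t2 n) (z n)) - L (a n k) (a n l)) * 1"
          unfolding right_diff_distrib[symmetric] norm_mult
          using mult_right_mono[OF G1 norm_ge_zero] by simp
      qed
      fix n
      have "cmod (G (a n k) (a n l)) * cmod (L (a n k) (a n l)) \<le> 1 * B"
        using G1 L[OF a[OF kl(1)] a[OF kl(2)]] by (intro mult_mono) auto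
      then show "cmod (G (a n k) (a n l) * L (a n k) (a n l)) \<le> B" by (simp add: norm_mult)
    qed
    then show "(\<lambda>n. case p n of (t1, t2, z, a) \<Rightarrow> cmod (
      Determinant.det (Matrix.mat m m (\<lambda>(k, l). G (a k) (a l) * skern t1 t2 n z (a k * e t1 t2 z) (a l * e t1 t2 z)))
      - Determinant.det (Matrix.mat m m (\<lambda>(k, l). G (a k) (a l) * L (a k) (a l))))) \<longlonglongrightarrow> 0"
      unfolding pn by (simp only: prod.case tendsto_norm_zero)
  qed
  then show ?thesis using eventually_ge_at_top[of 1]
  proof eventually_elim
    case (elim n)
    show ?case
    proof (intro allI impI)
      fix t1 t2 z and a :: "nat \<Rightarrow> complex"
      assume tz: "(t1, t2, z) \<in> D" and a: "a \<in> {..<m} \<rightarrow> cball 0 A"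
      let ?e = "e t1 t2 z"
      \<comment> \<open>A common unimodular factor cancels in \<open>cnj x * y\<close> and in
        \<open>cmod (x - y)\<close>, so the frame disappears from the limiting determinant.\<close>
      have G': "of_real (1 / pi) * exp (- of_real ((cmod (x * ?e - y * ?e))\<^sup>2 / 2) + \<i> * of_real (Im (cnj (x * ?e) * (y * ?e)))) = G x y" for x y
      proof -
        have "cmod (x * ?e - y * ?e) = cmod (x - y)"
          using e[of t1 t2 z] by (simp add: left_diff_distrib[symmetric] norm_mult)
        moreover have "cnj (x * ?e) * (y * ?e) = cnj x * y * (?e * cnj ?e)" by simp
        then have "cnj (x * ?e) * (y * ?e) = cnj x * y" unfolding complex_norm_square[symmetric] e by simp
        ultimately show ?thesis unfolding G_def by (simp only:)
      qed
      have "cmod (Determinant.det (Matrix.mat m m (\<lambda>(k, l). G (a k) (a l) * skern t1 t2 n z (a k * ?e) (a l * ?e)))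
         - Determinant.det (Matrix.mat m m (\<lambda>(k, l). G (a k) (a l) * L (a k) (a l)))) < \<epsilon>"
        using elim(1) tz a by auto
      then show "cmod (1 / of_nat n ^ m * corr_fun (ell_potential t1 t2) n m (\<lambda>j. z + a j * ?e / of_real (sqrt (real n)))
       - Determinant.det (Matrix.mat m m (\<lambda>(k, l). of_real (1 / pi) * exp (- of_real ((cmod (a k - a l))\<^sup>2 / 2) + \<i> * of_real (Im (cnj (a k) * a l)))
           * L (a k) (a l)))) \<le> \<epsilon>"
        unfolding scaled_corr_fun[OF elim(2) D[OF tz], of m t1 z "\<lambda>j. a j * ?e"] G' unfolding G_def[symmetric] by (rule less_imp_le)
    qed
  qed
qed

section \<open>Uniform limits\<close>

text \<open>In \<open>ennreal\<close> suprema exist without any proof of boundedness, so an eventual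
  bound valid for all parameters suffices.\<close>

lemma SUP_kernel_null:
  fixes f :: "nat \<Rightarrow> complex \<Rightarrow> complex \<Rightarrow> complex \<Rightarrow> complex \<Rightarrow> complex \<Rightarrow> real"
  assumes "\<And>\<epsilon>. 0 < \<epsilon> \<Longrightarrow> \<forall>\<^sub>F n in sequentially. \<forall>t1 t2 z a b. (t1, t2) \<in> T \<longrightarrow> z \<in> E t1 t2 \<longrightarrow> cmod a \<le> A \<longrightarrow> cmod b \<le> A \<longrightarrow> f n t1 t2 z a b \<le> \<epsilon>"
  shows "(\<lambda>n. SUP (t1, t2) \<in> T. SUP z \<in> E t1 t2. SUP a \<in> cball 0 A. SUP b \<in> cball 0 A. ennreal (f n t1 t2 z a b)) \<longlonglongrightarrow> 0"
proof (rule tendsto_ennreal_0I)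
  fix \<epsilon> :: real assume "0 < \<epsilon>"
  from assms[OF this]
  show "\<forall>\<^sub>F n in sequentially. (SUP (t1, t2) \<in> T. SUP z \<in> E t1 t2. SUP a \<in> cball 0 A. SUP b \<in> cball 0 A. ennreal (f n t1 t2 z a b)) \<le> ennreal \<epsilon>"
    by eventually_elim (auto intro!: SUP_least ennreal_leI)
qed

lemma SUP_corr_null:
  fixes f :: "nat \<Rightarrow> complex \<Rightarrow> complex \<Rightarrow> complex \<Rightarrow> (nat \<Rightarrow> complex) \<Rightarrow> real"
  assumes "\<And>\<epsilon>. 0 < \<epsilon> \<Longrightarrow> \<forall>\<^sub>F n in sequentially. \<forall>t1 t2 z a. (t1, t2) \<in> T \<longrightarrow> z \<in> E t1 t2 \<longrightarrow> a \<in> S \<longrightarrow> f n t1 t2 z a \<le> \<epsilon>"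
  shows "(\<lambda>n. SUP (t1, t2) \<in> T. SUP z \<in> E t1 t2. SUP a \<in> S. ennreal (f n t1 t2 z a)) \<longlonglongrightarrow> 0"
proof (rule tendsto_ennreal_0I)
  fix \<epsilon> :: real assume "0 < \<epsilon>"
  from assms[OF this]
  show "\<forall>\<^sub>F n in sequentially. (SUP (t1, t2) \<in> T. SUP z \<in> E t1 t2. SUP a \<in> S. ennreal (f n t1 t2 z a)) \<le> ennreal \<epsilon>"
    by eventually_elim (auto intro!: SUP_least ennreal_leI)
qed

theorem theorem10p7:
  fixes m :: nat and \<delta>0 A \<delta> :: real
  assumes "m \<ge> 1" and "0 < \<delta>0" and "\<delta>0 < 1" and "A > 0"
    and "0 < \<delta>" and "\<delta> < sqrt (\<delta>0 / (2 - \<delta>0))"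
  shows
    "((\<lambda>n. SUP (t1, t2) \<in> admissible \<delta>0.
        SUP z0 \<in> ell_shifted t1 t2 (- \<delta>). SUP a \<in> cball 0 A. SUP b \<in> cball 0 A.
          ennreal (cmod (1 / of_nat n *
              repr_kernel (ell_potential t1 t2) n
                (z0 + a / of_real (sqrt (real n))) (z0 + b / of_real (sqrt (real n)))
            - of_real (1 / pi) * exp (\<i> * of_real (theta n t2 (z0 - ell_center t1 t2) a b))
                * of_real (exp (- (cmod (a - b))\<^sup>2 / 2)))))
      \<longlonglongrightarrow> 0) \<and>
     ((\<lambda>n. SUP (t1, t2) \<in> admissible \<delta>0.
        SUP z0 \<in> UNIV - ell_shifted t1 t2 \<delta>. SUP a \<in> cball 0 A. SUP b \<in> cball 0 A.
          ennreal (cmod (1 / of_nat n *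
              repr_kernel (ell_potential t1 t2) n
                (z0 + a / of_real (sqrt (real n))) (z0 + b / of_real (sqrt (real n))))))
      \<longlonglongrightarrow> 0) \<and>
     ((\<lambda>n. SUP (t1, t2) \<in> admissible \<delta>0.
        SUP z0 \<in> ell_boundary t1 t2. SUP a \<in> cball 0 A. SUP b \<in> cball 0 A.
          ennreal (let e = exp (\<i> * of_real (ell_psi t1 t2 z0)) in
            cmod (1 / of_nat n *
              repr_kernel (ell_potential t1 t2) n
                (z0 + a * e / of_real (sqrt (real n))) (z0 + b * e / of_real (sqrt (real n)))
            - exp (\<i> * of_real (theta n t2 (z0 - ell_center t1 t2) (a * e) (b * e)))
                * of_real (exp (- (cmod (a - b))\<^sup>2 / 2))
                * (of_real (1 / (2 * pi)) * erfc ((cnj a + b) / of_real (sqrt 2))))))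
      \<longlonglongrightarrow> 0) \<and>
     ((\<lambda>n. SUP (t1, t2) \<in> admissible \<delta>0.
        SUP z0 \<in> ell_shifted t1 t2 (- \<delta>). SUP a \<in> {..<m} \<rightarrow> cball 0 A.
          ennreal (cmod (1 / of_nat n ^ m *
              corr_fun (ell_potential t1 t2) n m (\<lambda>j. z0 + a j / of_real (sqrt (real n)))
            - Determinant.det (Matrix.mat m m (\<lambda>(k, l).
                of_real (1 / pi) * exp (- of_real ((cmod (a k - a l))\<^sup>2 / 2)
                  + \<i> * of_real (Im (cnj (a k) * a l))))))))
      \<longlonglongrightarrow> 0) \<and>
     ((\<lambda>n. SUP (t1, t2) \<in> admissible \<delta>0.
        SUP z0 \<in> UNIV - ell_shifted t1 t2 \<delta>. SUP a \<in> {..<m} \<rightarrow> cball 0 A.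
          ennreal (cmod (1 / of_nat n ^ m *
              corr_fun (ell_potential t1 t2) n m (\<lambda>j. z0 + a j / of_real (sqrt (real n))))))
      \<longlonglongrightarrow> 0) \<and>
     ((\<lambda>n. SUP (t1, t2) \<in> admissible \<delta>0.
        SUP z0 \<in> ell_boundary t1 t2. SUP a \<in> {..<m} \<rightarrow> cball 0 A.
          ennreal (let e = exp (\<i> * of_real (ell_psi t1 t2 z0)) in
            cmod (1 / of_nat n ^ m *
              corr_fun (ell_potential t1 t2) n m (\<lambda>j. z0 + a j * e / of_real (sqrt (real n)))
            - Determinant.det (Matrix.mat m m (\<lambda>(k, l).
                of_real (1 / (2 * pi)) * erfc ((cnj (a k) + a l) / of_real (sqrt 2))
                  * exp (- of_real ((cmod (a k - a l))\<^sup>2 / 2)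
                      + \<i> * of_real (Im (cnj (a k) * a l))))))))
      \<longlonglongrightarrow> 0)"
proof -
  define Din where "Din = {(t1, t2, z). (t1, t2) \<in> admissible \<delta>0 \<and> z \<in> ell_shifted t1 t2 (- \<delta>)}"
  define Dout where "Dout = {(t1, t2, z). (t1, t2) \<in> admissible \<delta>0 \<and> z \<in> UNIV - ell_shifted t1 t2 \<delta>}"
  define Dbd where "Dbd = {(t1, t2, z). (t1, t2) \<in> admissible \<delta>0 \<and> z \<in> ell_boundary t1 t2}"
  define psi where "psi t1 t2 z = exp (\<i> * complex_of_real (ell_psi t1 t2 z))" for t1 t2 z
  \<comment> \<open>Half of \<open>erfc\<close>: together with the factor \<open>1 / pi\<close> of
    the scaled kernel it yields the \<open>1 / (2 * pi)\<close> of the limit.\<close>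
  define Lbd where "Lbd a b = erfc ((cnj a + b) / of_real (sqrt 2)) / 2" for a b
  have A: "0 \<le> A" using assms by simp
  have adm: "2 * cmod t2 \<le> 1 - \<delta>0" if "(t1, t2) \<in> admissible \<delta>0" for t1 t2
    using that by (simp add: admissible_def)
  have adm1: "2 * cmod t2 < 1" if "(t1, t2) \<in> admissible \<delta>0" for t1 t2
    using adm[OF that] assms by linarith
  have psi1: "cmod (psi t1 t2 z) = 1" for t1 t2 z by (simp add: psi_def)
  have core_in: "(\<lambda>n. skern (t1 n) (t2 n) n (z n) (a n * 1) (b n * 1) - 1) \<longlonglongrightarrow> 0"
    if "\<And>n. (t1 n, t2 n, z n) \<in> Din" "\<And>n. cmod (a n) \<le> A" "\<And>n. cmod (b n) \<le> A" for t1 t2 z a b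
    unfolding mult_1_right
    by (rule skern_interior[OF assms(2,3,5,6) A]) (use that in \<open>auto simp: Din_def admissible_def\<close>)
  have core_out: "(\<lambda>n. skern (t1 n) (t2 n) n (z n) (a n * 1) (b n * 1) - 0) \<longlonglongrightarrow> 0"
    if "\<And>n. (t1 n, t2 n, z n) \<in> Dout" "\<And>n. cmod (a n) \<le> A" "\<And>n. cmod (b n) \<le> A" for t1 t2 z a b
    unfolding mult_1_right diff_0_right
    by (rule skern_exterior[OF assms(2,3,5) A]) (use that in \<open>auto simp: Dout_def admissible_def\<close>)
  have core_bd: "(\<lambda>n. skern (t1 n) (t2 n) n (z n) (a n * psi (t1 n) (t2 n) (z n)) (b n * psi (t1 n) (t2 n) (z n)) - Lbd (a n) (b n)) \<longlonglongrightarrow> 0"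
    if "\<And>n. (t1 n, t2 n, z n) \<in> Dbd" "\<And>n. cmod (a n) \<le> A" "\<And>n. cmod (b n) \<le> A" for t1 t2 z a b
    unfolding psi_def Lbd_def
    by (rule skern_boundary[OF assms(2) _ _ that(2,3)]) (use that in \<open>auto simp: Dbd_def admissible_def\<close>)
  \<comment> \<open>The bound on the limit entries that the determinants require:
    \<open>erfc\<close> is continuous, and its arguments stay in the disc of radius
    \<open>2 * A\<close>.\<close>
  obtain Bd where Bd: "\<And>a b. cmod a \<le> A \<Longrightarrow> cmod b \<le> A \<Longrightarrow> cmod (Lbd a b) \<le> Bd"
  proof -
    have "continuous_on (cball 0 (2 * A)) erfc"
      using holomorphic_on_imp_continuous_on[OF holomorphic_erfc] continuous_on_subset by blast
    then have "bounded (erfc ` cball 0 (2 * A))" by (intro compact_imp_bounded compact_continuous_image) auto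
    then obtain B where B: "\<forall>x\<in>erfc ` cball 0 (2 * A). cmod x \<le> B" unfolding bounded_iff by blast
    have "cmod (Lbd a b) \<le> B / 2" if "cmod a \<le> A" "cmod b \<le> A" for a b
    proof -
      have "cmod (cnj a + b) \<le> 2 * A" using norm_triangle_ineq[of "cnj a" b] that by simp
      then have "cmod (cnj a + b) / sqrt 2 \<le> 2 * A / 1" using A by (intro frac_le) auto
      then have "(cnj a + b) / of_real (sqrt 2) \<in> cball 0 (2 * A)" by (simp add: norm_divide)
      then show ?thesis using B by (simp add: Lbd_def norm_divide)
    qed
    then show ?thesis using that by blast
  qed
  have Din1: "2 * cmod t2 < 1" if "(t1, t2, z) \<in> Din" for t1 t2 z using that adm1 by (auto simp: Din_def)
  have Dout1: "2 * cmod t2 < 1" if "(t1, t2, z) \<in> Dout" for t1 t2 z using that adm1 by (auto simp: Dout_def)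
  have Dbd1: "2 * cmod t2 < 1" if "(t1, t2, z) \<in> Dbd" for t1 t2 z using that adm1 by (auto simp: Dbd_def)
  \<comment> \<open>Here \<open>m \<ge> 1\<close> enters, as the empty determinant is 1.\<close>
  have zero_det: "Determinant.det (Matrix.mat m m (\<lambda>(k, l). (0::complex))) = 0"
    using assms(1) by (simp add: det_mat power_0_left)
  show ?thesis
  proof ((intro conjI; (rule SUP_kernel_null | rule SUP_corr_null)), goal_cases)
    case (1 \<epsilon>)
    show ?case
      by (rule eventually_mono[OF kernel_uniform_limit[where D = Din and e = "\<lambda>_ _ _. 1" and L = "\<lambda>_ _. 1" and A = A and \<epsilon> = \<epsilon>]],
          (fact Din1 norm_one core_in \<open>0 < \<epsilon>\<close>)+)
        (simp add: Din_def)
  next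
    case (2 \<epsilon>)
    show ?case
      by (rule eventually_mono[OF kernel_uniform_limit[where D = Dout and e = "\<lambda>_ _ _. 1" and L = "\<lambda>_ _. 0" and A = A and \<epsilon> = \<epsilon>]],
          (fact Dout1 norm_one core_out \<open>0 < \<epsilon>\<close>)+)
        (simp add: Dout_def)
  next
    case (3 \<epsilon>)
    show ?case
      by (rule eventually_mono[OF kernel_uniform_limit[where D = Dbd and e = "psi" and L = "Lbd" and A = A and \<epsilon> = \<epsilon>]],
          (fact Dbd1 psi1 core_bd \<open>0 < \<epsilon>\<close>)+)
        (simp add: Dbd_def psi_def Lbd_def Let_def mult_ac)
  next
    case (4 \<epsilon>)
    note eps = this
    show ?case
    proof (rule eventually_mono[OF corr_fun_uniform_limit[where D = Din and e = "\<lambda>_ _ _. 1" and L = "\<lambda>_ _. 1" and A = A and \<epsilon> = \<epsilon> and m = m and B = 1]], goal_cases)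
      case 1 then show ?case by (rule Din1)
    next
      case 3 then show ?case by (rule core_in)
    next
      case 5 show ?case by (rule eps)
    qed (simp_all add: Din_def)
  next
    case (5 \<epsilon>)
    note eps = this
    show ?case
    proof (rule eventually_mono[OF corr_fun_uniform_limit[where D = Dout and e = "\<lambda>_ _ _. 1" and L = "\<lambda>_ _. 0" and A = A and \<epsilon> = \<epsilon> and m = m and B = 0]], goal_cases)
      case 1 then show ?case by (rule Dout1)
    next
      case 3 then show ?case by (rule core_out)
    next
      case 5 show ?case by (rule eps)
    qed (simp_all add: Dout_def zero_det)
  next
    case (6 \<epsilon>)
    note eps = this
    show ?case
    proof (rule eventually_mono[OF corr_fun_uniform_limit[where D = Dbd and e = "psi" and L = "Lbd" and A = A and \<epsilon> = \<epsilon> and m = m and B = Bd]], goal_cases)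
      case 1 then show ?case by (rule Dbd1)
    next
      case 2 show ?case by (rule psi1)
    next
      case 3 then show ?case by (rule core_bd)
    next
      case 4 then show ?case by (rule Bd)
    next
      case 5 show ?case by (rule eps)
    qed (simp add: Dbd_def psi_def Lbd_def Let_def mult_ac)
  qed
qed

end
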